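(* Let $k\geq 1$ be an integer, let $\chi$ be a primitive nonprincipal Dirichlet character modulo $k$, and let $N(T,\chi)$ denote the number of zeroes $\rho=\beta+i\gamma$ of $L(s,\chi)$ (counted with multiplicity) with $0<\beta<1$ and $|\gamma|\leq T$. Then for all $T\geq 1$, \[ \left|N(T,\chi)-\frac{T}{\pi}\log\frac{kT}{2\pi e}\right|\leq 0.317\log kT+6.401 . \] More generally, for every row $(\eta, C_1, C_2, C_2')$ of the following list, one has $\left|N(T,\chi)-\frac{T}{\pi}\log\frac{kT}{2\pi e}\right|\leq C_1\log kT + C_2$ for all $T\geq 1$, and $\left|N(T,\chi)-\frac{T}{\pi}\log\frac{kT}{2\pi e}\right|\leq C_1\log kT + C_2'$ for all $T\geq 10$: $(0.05,\ 0.248,\ 9.339,\ 8.666)$; $(0.10,\ 0.265,\ 8.015,\ 7.311)$; $(0.15,\ 0.282,\ 7.280,\ 6.549)$; $(0.20,\ 0.300,\ 6.778,\ 6.021)$; $(0.25,\ 0.317,\ 6.401,\ 5.616)$; $(0.30,\ 0.334,\ 6.101,\ 5.288)$; $(0.35,\ 0.351,\ 5.852,\ 5.011)$; $(0.40,\ 0.369,\ 5.640,\ 4.770)$; $(0.45,\ 0.386,\ 5.456,\ 4.556)$; $(0.50,\ 0.403,\ 5.294,\ 4.363)$.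
   Context: $L(s,\chi)=\sum_{n\geq1}\chi(n)n^{-s}$ is the Dirichlet $L$-function, extended to an entire function (as $\chi$ is nonprincipal). The parameter $\eta$ is merely an index labelling the admissible pairs of constants. Logarithms are natural. *)

theory Defs
  imports "HOL-Complex_Analysis.Complex_Analysis"
begin

definition dirichlet_char :: "nat \<Rightarrow> (nat \<Rightarrow> complex) \<Rightarrow> bool" where
  "dirichlet_char k chi \<longleftrightarrow> k > 0 \<and>
     (\<forall>m n. chi (m * n) = chi m * chi n) \<and>
     (\<forall>n. chi (n + k) = chi n) \<and>
     (\<forall>n. chi n \<noteq> 0 \<longleftrightarrow> coprime n k)"

definition principal_char :: "nat \<Rightarrow> (nat \<Rightarrow> complex) \<Rightarrow> bool" where
  "principal_char k chi \<longleftrightarrow> (\<forall>n. coprime n k \<longrightarrow> chi n = 1)"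

definition induced_modulus :: "nat \<Rightarrow> (nat \<Rightarrow> complex) \<Rightarrow> nat \<Rightarrow> bool" where
  "induced_modulus k chi d \<longleftrightarrow> d dvd k \<and>
     (\<forall>n. coprime n k \<and> n mod d = 1 mod d \<longrightarrow> chi n = 1)"

definition primitive_char :: "nat \<Rightarrow> (nat \<Rightarrow> complex) \<Rightarrow> bool" where
  "primitive_char k chi \<longleftrightarrow> dirichlet_char k chi \<and>
     (\<forall>d. d < k \<longrightarrow> \<not> induced_modulus k chi d)"

definition dirichlet_L :: "(nat \<Rightarrow> complex) \<Rightarrow> complex \<Rightarrow> complex" where
  "dirichlet_L chi = (SOME f. f holomorphic_on UNIV \<and>
     (\<forall>s. Re s > 1 \<longrightarrow>
        (\<lambda>n. chi (Suc n) / of_nat (Suc n) powr s) sums f s))"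

definition N_zeros :: "real \<Rightarrow> (nat \<Rightarrow> complex) \<Rightarrow> real" where
  "N_zeros T chi = (\<Sum>\<rho>\<in>{\<rho>. dirichlet_L chi \<rho> = 0 \<and> 0 < Re \<rho> \<and> Re \<rho> < 1 \<and> \<bar>Im \<rho>\<bar> \<le> T}.
                     real_of_int (zorder (dirichlet_L chi) \<rho>))"

text \<open>Rows (eta, C1, C2, C2').\<close>
definition zero_count_table :: "(real \<times> real \<times> real \<times> real) list" where
  "zero_count_table =
    [(0.05, 0.248, 9.339, 8.666), (0.10, 0.265, 8.015, 7.311),
     (0.15, 0.282, 7.280, 6.549), (0.20, 0.300, 6.778, 6.021),
     (0.25, 0.317, 6.401, 5.616), (0.30, 0.334, 6.101, 5.288),
     (0.35, 0.351, 5.852, 5.011), (0.40, 0.369, 5.640, 4.770),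
     (0.45, 0.386, 5.456, 4.556), (0.50, 0.403, 5.294, 4.363)]"

end

theory Submission
  imports Defs "HOL-Number_Theory.Number_Theory"
begin

text \<open>
  Write \<open>\<gamma>\<close> for the path from \<open>1/2 - iT\<close> through \<open>c - iT\<close> and \<open>c + iT\<close> to \<open>1/2 + iT\<close>, with \<open>c > 1\<close> close to \<open>1\<close>.
  The argument principle and the reflection \<open>s \<mapsto> 1 - cnj s\<close> of the functional equation give
  \<open>2 * pi * N(T, \<chi>) = Im (2 * \<integral>\<^sub>\<gamma> L'/L) + (variation of the argument of the Gamma factor)\<close>,
  and Stirling's formula turns the last term into the main term.  The vertical part of the integral is a difference of values
  of \<open>log L\<close>, which is bounded by \<open>log \<zeta>(c)\<close>.  On a horizontal part, an argument variation of size \<open>\<Theta>\<close> produces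
  (Backlund) about \<open>N * \<Theta> / pi\<close> zeros of the real part of a rotation of \<open>L(z + iT) ^ N\<close> to the right of \<open>1/2\<close>, and by the
  functional equation as many again to the left.  Jensen's inequality, here in the strip
  \<open>- 1/5 \<le> Re z \<le> B\<close> instead of a disc, bounds their number in terms of the growth of \<open>L\<close> on the two edges
  and of \<open>log \<bar>L(c + iT)\<bar>\<close>; the latter is played off against the vertical contribution by Cauchy--Schwarz.
  Using a strip makes crude estimates of the zeta values sufficient for every row of the table.
\<close>

section \<open>Jensen and Backlund in a strip\<close>

text \<open>\<open>dirichlet_L\<close> is chosen among entire functions, so continuation, functional
  equation and nonvanishing on the line of real part 1 all have to be established before any zero
  can be counted. On the left edge of the strip \<open>L (z + i * T)\<close> has size
  \<open>exp A\<close> only near the real axis; away from it the Gamma factor grows like a power of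
  \<open>Im z\<close>. The three lines theorem therefore uses a majorant quadratic in
  \<open>Im z\<close>, at the price of the term \<open>(c + d) * (B - c) / (4 * T)\<close>. Blaschke
  factors are taken in pairs: a zero \<open>x\<close> right of 1/2 with one between
  \<open>1 - x\<close> and 1/2. Such a pair costs at least a factor \<open>exp (- G)\<close>
  wherever it lies, the worst place being 1/2. The coefficient of \<open>ln (k * T)\<close> becomes
  \<open>2 * (1 / 2 + d) * w / G\<close>. Here \<open>w = (B - c) / (B + d)\<close> is the weight of
  the left edge in the interpolation at \<open>c\<close>, \<open>1 / 2 + d\<close> the exponent of
  \<open>k * T\<close> on that edge, and 2 counts the two horizontal sides. Moving \<open>B\<close>
  towards \<open>c\<close> lowers \<open>w\<close> and raises the bound for zeta at
  \<open>B\<close>; the rows of the table trace this trade-off.\<close>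

lemma frontier_cbox_complex:
  assumes "z \<in> frontier (cbox a b :: complex set)"
  shows "z \<in> cbox a b \<and> (Re z = Re a \<or> Re z = Re b \<or> Im z = Im a \<or> Im z = Im b)"
  using assms by (auto simp: frontier_def in_cbox_complex_iff in_box_complex_iff)

text \<open>Phragmen--Lindelof with the harmonic majorant \<open>Re (H 0 z)\<close>: a linear
  interpolation plus \<open>q\<close> times the real part of \<open>(w - a) * (b - w)\<close>, which
  equals the square of \<open>Im w\<close> on both edges. Replacing \<open>q\<close> by
  \<open>q + e\<close> adds Gaussian decay along the strip, which beats the assumed exponential
  growth; afterwards \<open>e\<close> tends to 0.\<close>

lemma three_lines_quadratic:
  fixes f :: "complex \<Rightarrow> complex" and a b A A' q C :: real
  assumes ab: "a < b" and q: "q \<ge> 0"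
    and hol: "f holomorphic_on {z. a < Re z \<and> Re z < b}"
    and cont: "continuous_on {z. a \<le> Re z \<and> Re z \<le> b} f"
    and growth: "\<And>z. a \<le> Re z \<Longrightarrow> Re z \<le> b \<Longrightarrow> norm (f z) \<le> C * exp (C * \<bar>Im z\<bar>)"
    and left: "\<And>z. Re z = a \<Longrightarrow> norm (f z) \<le> exp (A + q * (Im z)\<^sup>2)"
    and right: "\<And>z. Re z = b \<Longrightarrow> norm (f z) \<le> exp (A' + q * (Im z)\<^sup>2)"
    and z: "a \<le> Re z" "Re z \<le> b"
  shows "norm (f z) \<le> exp ((A * (b - Re z) + A' * (Re z - a)) / (b - a) + q * ((Im z)\<^sup>2 + (Re z - a) * (b - Re z)))"
proof -
  define H :: "real \<Rightarrow> complex \<Rightarrow> complex" where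
    "H = (\<lambda>e w. (of_real A * (of_real b - w) + of_real A' * (w - of_real a)) / of_real (b - a)
            + of_real (q + e) * ((w - of_real a) * (of_real b - w)))"
  have ReH: "Re (H e w) = (A * (b - Re w) + A' * (Re w - a)) / (b - a) + (q + e) * ((Im w)\<^sup>2 + (Re w - a) * (b - Re w))" for e w
    unfolding H_def plus_complex.sel Re_divide_of_real by (simp add: power2_eq_square algebra_simps)
  have key: "norm (f z) \<le> exp (Re (H e z))" if e: "e > 0" for e
  proof -
    define g where "g = (\<lambda>w. f w * exp (- H e w))"
    define M where "M = \<bar>A\<bar> + \<bar>A'\<bar>"
    have lin: "- M \<le> (A * (b - x) + A' * (x - a)) / (b - a)" if "a \<le> x" "x \<le> b" for x
    proof -
      have "- \<bar>A\<bar> * (b - a) \<le> A * (b - x)"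
        using that mult_mono[of "\<bar>A\<bar>" "\<bar>A\<bar>" "b - x" "b - a"] abs_ge_minus_self[of "A * (b - x)"] by (auto simp: abs_mult)
      moreover have "- \<bar>A'\<bar> * (b - a) \<le> A' * (x - a)"
        using that mult_mono[of "\<bar>A'\<bar>" "\<bar>A'\<bar>" "x - a" "b - a"] abs_ge_minus_self[of "A' * (x - a)"] by (auto simp: abs_mult)
      ultimately show ?thesis using ab by (simp add: M_def field_simps)
    qed
    have gn: "norm (g w) \<le> C * exp (C * \<bar>Im w\<bar>) * exp (M - e * (Im w)\<^sup>2)" if "a \<le> Re w" "Re w \<le> b" for w
    proof -
      have "- Re (H e w) \<le> M - e * (Im w)\<^sup>2"
      proof -
        have "0 \<le> (Re w - a) * (b - Re w)" using that by simp
        hence "e * (Im w)\<^sup>2 \<le> (q + e) * ((Im w)\<^sup>2 + (Re w - a) * (b - Re w))"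
          using q e by (intro mult_mono) auto
        thus ?thesis using lin[OF that] by (subst ReH) auto
      qed
      moreover have "norm (g w) = norm (f w) * exp (- Re (H e w))"
        by (simp add: g_def norm_mult)
      ultimately show ?thesis
        using growth[OF that] order_trans[OF norm_ge_zero growth[OF that]]
        by (simp only:) (intro mult_mono; simp)
    qed
    \<comment> \<open>Finds a height from which the Gaussian factor outweighs the growth bound; the
      strip is cut there to a rectangle.\<close>
    have "filterlim (\<lambda>y. C * y + (M - e * y\<^sup>2)) at_bot at_top"
      using e by real_asymp
    hence "filterlim (\<lambda>y. exp (C * y + (M - e * y\<^sup>2))) (nhds 0) at_top"
      by (rule filterlim_compose[OF exp_at_bot])
    hence "filterlim (\<lambda>y. C * exp (C * y + (M - e * y\<^sup>2))) (nhds 0) at_top"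
      by (rule tendsto_mult_right_zero)
    hence "filterlim (\<lambda>y. C * exp (C * y) * exp (M - e * y\<^sup>2)) (nhds 0) at_top"
      by (simp add: exp_add mult.assoc)
    hence "eventually (\<lambda>y. C * exp (C * y) * exp (M - e * y\<^sup>2) < 1) at_top"
      by (rule order_tendstoD) simp
    hence "eventually (\<lambda>y. C * exp (C * y) * exp (M - e * y\<^sup>2) < 1 \<and> y > \<bar>Im z\<bar>) at_top"
      using eventually_gt_at_top by (rule eventually_conj)
    then obtain Y where Y: "C * exp (C * Y) * exp (M - e * Y\<^sup>2) < 1" "Y > \<bar>Im z\<bar>"
      by (auto simp: eventually_at_top_linorder)
    define S where "S = cbox (Complex a (-Y)) (Complex b Y)"
    have Sdef: "w \<in> S \<longleftrightarrow> a \<le> Re w \<and> Re w \<le> b \<and> -Y \<le> Im w \<and> Im w \<le> Y" for w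
      by (auto simp: S_def in_cbox_complex_iff)
    have "norm (g z) \<le> 1"
    proof (rule maximum_modulus_frontier[of g S 1 z])
      show "g holomorphic_on interior S"
        unfolding g_def H_def using ab
        by (intro holomorphic_intros holomorphic_on_subset[OF hol])
           (auto simp: S_def interior_cbox in_box_complex_iff)
      show "continuous_on (closure S) g"
        unfolding g_def H_def using ab
        by (intro continuous_intros continuous_on_subset[OF cont])
           (auto simp: S_def in_cbox_complex_iff)
      show "bounded S" by (simp add: S_def)
      show "z \<in> S" using z Y by (auto simp: Sdef)
      show "norm (g w) \<le> 1" if w: "w \<in> frontier S" for w
      proof -
        have ws: "a \<le> Re w" "Re w \<le> b"
          using frontier_cbox_complex[OF w[unfolded S_def]] Sdef[of w] by (auto simp: S_def)
        have gnorm: "norm (g w) = norm (f w) * exp (- Re (H e w))"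
          by (simp add: g_def norm_mult)
        consider "Re w = a" | "Re w = b" | "\<bar>Im w\<bar> = Y"
          using frontier_cbox_complex[OF w[unfolded S_def]] Y by auto
        thus ?thesis
        proof cases
          case 1
          have "norm (g w) \<le> exp (A + q * (Im w)\<^sup>2) * exp (- Re (H e w))"
            unfolding gnorm by (intro mult_right_mono left 1) auto
          also have "\<dots> = exp (- e * (Im w)\<^sup>2)"
          proof -
            have "(A * (b - a) + A' * (a - a)) / (b - a) = A" using ab by simp
            thus ?thesis unfolding exp_add[symmetric] ReH 1 by (simp add: distrib_right)
          qed
          also have "\<dots> \<le> 1" using e by simp
          finally show ?thesis .
        next
          case 2
          have "norm (g w) \<le> exp (A' + q * (Im w)\<^sup>2) * exp (- Re (H e w))"
            unfolding gnorm by (intro mult_right_mono right 2) auto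
          also have "\<dots> = exp (- e * (Im w)\<^sup>2)"
          proof -
            have "(A * (b - b) + A' * (b - a)) / (b - a) = A'" using ab by simp
            thus ?thesis unfolding exp_add[symmetric] ReH 2 by (simp add: distrib_right)
          qed
          also have "\<dots> \<le> 1" using e by simp
          finally show ?thesis .
        next
          case 3
          have "(Im w)\<^sup>2 = Y\<^sup>2" using 3 by (metis power2_abs)
          thus ?thesis using gn[OF ws] Y 3 by simp
        qed
      qed
    qed
    moreover have "norm (g z) = norm (f z) / exp (Re (H e z))"
      by (simp add: g_def norm_mult norm_divide exp_minus divide_inverse[symmetric])
    ultimately show ?thesis by (simp add: field_simps)
  qed
  have "((\<lambda>e. exp (Re (H e z))) \<longlongrightarrow> exp (Re (H 0 z))) (at_right 0)"
    unfolding H_def by (intro tendsto_intros tendsto_eq_rhs[OF tendsto_ident_at]) auto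
  moreover have "eventually (\<lambda>e. norm (f z) \<le> exp (Re (H e z))) (at_right (0::real))"
    using key by (auto simp: eventually_at_right_field intro: exI[of _ 1])
  ultimately have "norm (f z) \<le> exp (Re (H 0 z))"
    by (intro tendsto_lowerbound) auto
  thus ?thesis by (subst (asm) ReH) auto
qed


lemma norm_sin_squared_alt: "(norm (sin z))\<^sup>2 = (sin (Re z))\<^sup>2 + (sinh (Im z))\<^sup>2"
proof -
  have "(norm (sin z))\<^sup>2 = (exp (2 * Im z) + inverse (exp (2 * Im z)) - 2 * cos (2 * Re z)) / 4"
    by (rule norm_sin_squared)
  also have "cos (2 * Re z) = 1 - 2 * (sin (Re z))\<^sup>2"
    by (rule cos_double_sin)
  also have "(exp (2 * Im z) + inverse (exp (2 * Im z)) - 2 * (1 - 2 * (sin (Re z))\<^sup>2)) / 4 = (sin (Re z))\<^sup>2 + (sinh (Im z))\<^sup>2"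
    by (simp add: sinh_def exp_minus power2_eq_square field_simps flip: exp_add)
  finally show ?thesis .
qed

text \<open>Dividing both functions by \<open>z - a\<close> leaves removable singularities, and the
  quotient obtained from \<open>s\<close> has no zero because the zero of \<open>s\<close> is
  simple; \<open>G\<close> is the quotient of the two.\<close>

lemma holomorphic_factor_simple_zero:
  assumes V: "open V" and F: "F holomorphic_on V" and S: "s holomorphic_on V"
    and a: "a \<in> V" "F a = 0" "s a = 0" "deriv s a \<noteq> 0"
    and nz: "\<And>z. z \<in> V \<Longrightarrow> z \<noteq> a \<Longrightarrow> s z \<noteq> 0"
  obtains G where "G holomorphic_on V" "\<And>z. z \<in> V \<Longrightarrow> F z = s z * G z"
proof -
  define F1 where "F1 = (\<lambda>z. if z = a then deriv F a else F z / (z - a))"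
  define s1 where "s1 = (\<lambda>z. if z = a then deriv s a else s z / (z - a))"
  have F1: "F1 holomorphic_on V" by (rule pole_theorem_open_0[OF F V, of a]) (auto simp: F1_def a)
  have s1: "s1 holomorphic_on V" by (rule pole_theorem_open_0[OF S V, of a]) (auto simp: s1_def a)
  have "s1 z \<noteq> 0" if "z \<in> V" for z using nz[OF that] a by (auto simp: s1_def)
  hence "(\<lambda>z. F1 z / s1 z) holomorphic_on V" by (intro holomorphic_intros F1 s1)
  moreover have "F z = s z * (F1 z / s1 z)" if "z \<in> V" for z
    using nz[OF that] a by (auto simp: F1_def s1_def)
  ultimately show thesis by (rule that)
qed

text \<open>With \<open>al = pi / (2 * W)\<close> the zeros of \<open>sin (al * z)\<close> are the
  multiples of \<open>2 * W\<close>.\<close>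

lemma sin_factor_nonzero:
  fixes z :: complex and al W :: real
  assumes al: "al = pi / (2 * W)" "W > 0" and z: "\<bar>Re z\<bar> < 2 * W" "z \<noteq> 0"
  shows "sin (of_real al * z) \<noteq> 0"
proof
  assume "sin (of_real al * z) = 0"
  then obtain n :: int where n: "of_real al * z = of_real (of_int n * pi)"
    by (auto simp: sin_eq_0)
  have "z = of_real (2 * W * of_int n)"
  proof -
    have "al \<noteq> 0" using al by simp
      hence "z = of_real (of_int n * pi) / of_real al" using n by (simp add: eq_divide_eq mult.commute)
    also have "\<dots> = of_real (of_int n * pi / al)" by (simp del: of_real_mult)
    also have "of_int n * pi / al = 2 * W * of_int n" using al by simp
    finally show ?thesis .
  qed
  hence "\<bar>2 * W * of_int n\<bar> < 2 * W" "n \<noteq> 0" using z by auto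
  hence "2 * W * \<bar>of_int n\<bar> < 2 * W * 1" using al by (simp add: abs_mult)
  hence "\<bar>real_of_int n\<bar> < 1" using al by simp
  with \<open>n \<noteq> 0\<close> show False by linarith
qed

text \<open>The zeros are removed one at a time: at \<open>r\<close> the other sines do not vanish,
  so the remaining factor does. \<open>V\<close> exceeds the strip by \<open>W / 2\<close> on either
  side, which gives an open set around the closed strip in which each sine still has only its one
  zero.\<close>

lemma factor_sin_zeros:
  fixes F :: "complex \<Rightarrow> complex" and al W d B :: real
  assumes al: "al = pi / (2 * W)" and W: "W = B + d" "W > 0"
    and V: "V = {z. - d - W / 2 < Re z \<and> Re z < B + W / 2}"
    and F: "F holomorphic_on V"
    and Z: "finite Z" "\<And>r. r \<in> Z \<Longrightarrow> - d < r \<and> r < B \<and> F (of_real r) = 0"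
  shows "\<exists>G. G holomorphic_on V \<and> (\<forall>z\<in>V. F z = (\<Prod>r\<in>Z. sin (of_real al * (z - of_real r))) * G z)"
  using Z
proof (induction Z rule: finite_induct)
  case empty
  thus ?case using F by (intro exI[of _ F]) auto
next
  case (insert r Z)
  have openV: "open V"
    unfolding V by (simp add: open_halfspace_Re_gt open_halfspace_Re_lt open_Collect_conj)
  obtain G where G: "G holomorphic_on V" "\<And>z. z \<in> V \<Longrightarrow> F z = (\<Prod>r\<in>Z. sin (of_real al * (z - of_real r))) * G z"
    using insert.IH insert.prems by blast
  have V': "\<bar>Re (z - of_real x)\<bar> < 2 * W" if "z \<in> V" "- d < x" "x < B" for z x
    using that W by (auto simp: V field_simps abs_less_iff)
  have r: "- d < r" "r < B" "F (of_real r) = 0" using insert.prems[of r] by auto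
  have al0: "al \<noteq> 0" using al W(2) by simp
  have rV: "of_real r \<in> V" using r W(2) by (simp add: V)
  have "sin (of_real al * (of_real r - of_real x)) \<noteq> (0::complex)" if "x \<in> Z" for x
  proof (rule sin_factor_nonzero[OF al W(2)])
    show "\<bar>Re (complex_of_real r - complex_of_real x)\<bar> < 2 * W"
      using V'[OF rV] insert.prems[of x] that by auto
    show "complex_of_real r - complex_of_real x \<noteq> 0" using that insert.hyps by auto
  qed
  hence "(\<Prod>x\<in>Z. sin (of_real al * (of_real r - of_real x :: complex))) \<noteq> 0"
    using insert.hyps by (auto simp: prod_zero_iff)
  hence Gr: "G (of_real r) = 0" using G(2)[OF rV] r by simp
  have D: "((\<lambda>z. sin (of_real al * (z - of_real r))) has_field_derivative of_real al) (at (of_real r :: complex))"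
    by (auto intro!: derivative_eq_intros)
  obtain G' where G': "G' holomorphic_on V" "\<And>z. z \<in> V \<Longrightarrow> G z = sin (of_real al * (z - of_real r)) * G' z"
  proof (rule holomorphic_factor_simple_zero[OF openV G(1) _ rV Gr, of "\<lambda>z. sin (of_real al * (z - of_real r))"])
    show "(\<lambda>z. sin (complex_of_real al * (z - complex_of_real r))) holomorphic_on V"
      by (intro holomorphic_intros)
    show "deriv (\<lambda>z. sin (complex_of_real al * (z - complex_of_real r))) (complex_of_real r) \<noteq> 0"
      using DERIV_imp_deriv[OF D] al0 by simp
    show "sin (complex_of_real al * (z - complex_of_real r)) \<noteq> 0" if "z \<in> V" "z \<noteq> complex_of_real r" for z
      using that V'[of z r] r by (intro sin_factor_nonzero[OF al W(2)]) auto
  qed auto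
  show ?case
    using G'(1) G(2) G'(2) insert.hyps by (intro exI[of _ G']) (auto simp: mult_ac)
qed

text \<open>The point \<open>- r - 2 * d\<close> is the mirror image of \<open>r\<close> in the line
  \<open>Re z = - d\<close>. On that line the two arguments have opposite real parts, on
  \<open>Re z = B\<close> their real parts add up to \<open>pi\<close>, and the norm of a sine
  depends on the real part only through the square of its sine. So the quotient of the two sines, a
  Blaschke factor of the strip, has modulus 1 on both edges.\<close>

lemma blaschke_edge:
  fixes z :: complex and al W d B r :: real
  assumes al: "al = pi / (2 * W)" and W: "W = B + d" "W > 0" and z: "Re z = - d \<or> Re z = B"
  shows "norm (sin (of_real al * (z + of_real (r + 2 * d)))) = norm (sin (of_real al * (z - of_real r)))"
proof -
  have "(sin (al * (Re z + (r + 2 * d))))\<^sup>2 = (sin (al * (Re z - r)))\<^sup>2"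
    using z
  proof
    assume "Re z = - d"
    hence "al * (Re z + (r + 2 * d)) = - (al * (Re z - r))" by (simp add: algebra_simps)
    thus ?thesis by simp
  next
    assume "Re z = B"
    hence "al * (Re z + (r + 2 * d)) = pi - al * (Re z - r)"
      using al W by (simp add: field_simps)
    thus ?thesis by simp
  qed
  hence "(norm (sin (of_real al * (z + of_real (r + 2 * d)))))\<^sup>2 = (norm (sin (of_real al * (z - of_real r))))\<^sup>2"
    unfolding norm_sin_squared_alt by simp
  thus ?thesis by (simp add: power2_eq_iff_nonneg)
qed

lemma norm_sin_le: "norm (sin z) \<le> exp \<bar>Im z\<bar>" for z :: complex
proof -
  have "norm (sin z) \<le> (norm (exp (\<i> * z)) + norm (exp (- (\<i> * z)))) / 2"
    unfolding sin_exp_eq using norm_triangle_ineq4[of "exp (\<i> * z)" "exp (- (\<i> * z))"]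
    by (simp add: norm_divide norm_mult)
  also have "\<dots> = (exp (- Im z) + exp (Im z)) / 2" by simp
  also have "\<dots> \<le> exp \<bar>Im z\<bar>" by (cases "Im z \<ge> 0") auto
  finally show ?thesis .
qed

lemma norm_sin_ge: "\<bar>sinh (Im z)\<bar> \<le> norm (sin z)" for z :: complex
proof (rule power2_le_imp_le)
  show "\<bar>sinh (Im z)\<bar>\<^sup>2 \<le> (norm (sin z))\<^sup>2" unfolding norm_sin_squared_alt by simp
qed simp

text \<open>Jensen's inequality for a strip, with the Blaschke factors of the strip
  \<open>- d \<le> Re z \<le> B\<close> replacing those of a disc.\<close>
lemma strip_jensen:
  fixes F :: "complex \<Rightarrow> complex" and al W d B A A' q C c :: real
  assumes al: "al = pi / (2 * W)" and W: "W = B + d" "W > 0" and q: "q \<ge> 0"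
    and F: "F holomorphic_on UNIV"
    and Z: "finite Z" "\<And>r. r \<in> Z \<Longrightarrow> - d < r \<and> r < B \<and> F (of_real r) = 0"
    and growth: "\<And>z. - d \<le> Re z \<Longrightarrow> Re z \<le> B \<Longrightarrow> norm (F z) \<le> C * exp (C * \<bar>Im z\<bar>)"
    and left: "\<And>z. Re z = - d \<Longrightarrow> norm (F z) \<le> exp (A + q * (Im z)\<^sup>2)"
    and right: "\<And>z. Re z = B \<Longrightarrow> norm (F z) \<le> exp (A' + q * (Im z)\<^sup>2)"
    and c: "- d < c" "c < B"
  shows "norm (F (of_real c)) \<le> (\<Prod>r\<in>Z. \<bar>sin (al * (c - r))\<bar> / \<bar>sin (al * (c + (r + 2 * d)))\<bar>)
           * exp ((A * (B - c) + A' * (c + d)) / W + q * ((c + d) * (B - c)))"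
proof -
  define V where "V = {z. - d - W / 2 < Re z \<and> Re z < B + W / 2}"
  obtain G where G: "G holomorphic_on V" "\<And>z. z \<in> V \<Longrightarrow> F z = (\<Prod>r\<in>Z. sin (of_real al * (z - of_real r))) * G z"
    using factor_sin_zeros[OF al W V_def holomorphic_on_subset[OF F] Z] by auto
  define Q where "Q = (\<lambda>z. \<Prod>r\<in>Z. sin (of_real al * (z + of_real (r + 2 * d))) :: complex)"
  define P where "P = (\<lambda>z. \<Prod>r\<in>Z. sin (of_real al * (z - of_real r)) :: complex)"
  \<comment> \<open>This is \<open>F\<close> divided by its Blaschke product \<open>P / Q\<close>.
    Since \<open>norm Q = norm P\<close> on the edges, the edge bounds of \<open>F\<close> pass to
    \<open>H\<close>.\<close>
  define H where "H = (\<lambda>z. G z * Q z)"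
  have inV: "z \<in> V" if "- d \<le> Re z" "Re z \<le> B" for z using that W(2) by (simp add: V_def)
  have FP: "F z = P z * G z" if "- d \<le> Re z" "Re z \<le> B" for z using G(2)[OF inV[OF that]] by (simp add: P_def)
  have holH: "H holomorphic_on V" unfolding H_def Q_def by (intro holomorphic_intros G(1))
  have al0: "al > 0" using al W by simp
  have edge: "norm (H z) \<le> norm (F z)" if z: "Re z = - d \<or> Re z = B" for z
  proof -
    have "norm (Q z) = norm (P z)"
      unfolding Q_def P_def prod_norm[symmetric] by (intro prod.cong refl blaschke_edge[OF al W z])
    thus ?thesis using FP[of z] z W by (auto simp: H_def norm_mult)
  qed
  define n where "n = card Z"
  \<comment> \<open>When \<open>Im z\<close> has modulus at least 1, every factor of
    \<open>P\<close> has norm at least \<open>sinh al\<close>, so division by \<open>P\<close>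
    preserves exponential growth; closer to the axis compactness suffices.\<close>
  define s where "s = sinh al"
  have s: "s > 0" using al0 by (simp add: s_def)
  define K where "K = cbox (Complex (-d) (-1)) (Complex B 1)"
  have "continuous_on K H"
    using holomorphic_on_imp_continuous_on[OF holH] by (rule continuous_on_subset) (auto simp: K_def in_cbox_complex_iff intro!: inV)
  hence "bounded (H ` K)" by (intro compact_imp_bounded compact_continuous_image) (auto simp: K_def)
  then obtain C1 where C1: "\<And>z. z \<in> K \<Longrightarrow> norm (H z) \<le> C1" "C1 \<ge> 0"
    by (auto simp: bounded_pos intro: less_imp_le)
  define C2 where "C2 = max C1 (max (\<bar>C\<bar> / s ^ n) (\<bar>C\<bar> + al * n))"
  have C2: "norm (H z) \<le> C2 * exp (C2 * \<bar>Im z\<bar>)" if z: "- d \<le> Re z" "Re z \<le> B" for z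
  proof (cases "\<bar>Im z\<bar> \<le> 1")
    case True
    have "norm (H z) \<le> C1 * 1" using True z C1(1)[of z] by (auto simp: K_def in_cbox_complex_iff abs_le_iff)
    also have "\<dots> \<le> C2 * exp (C2 * \<bar>Im z\<bar>)" using C1 by (intro mult_mono) (auto simp: C2_def)
    finally show ?thesis .
  next
    case False
    have P: "s ^ n \<le> norm (P z)"
    proof -
      have "(\<Prod>r\<in>Z. s) \<le> (\<Prod>r\<in>Z. norm (sin (of_real al * (z - of_real r)) :: complex))"
      proof (intro prod_mono conjI)
        fix r assume "r \<in> Z"
        have "s \<le> \<bar>sinh (al * Im z)\<bar>"
        proof (cases "Im z \<ge> 0")
          case True
          thus ?thesis using False al0 by (auto simp: s_def)
        next
          case F: False
          have "s \<le> sinh (al * (- Im z))"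
            unfolding s_def sinh_real_le_iff using F False al0 mult_left_mono[of 1 "- Im z" al] by auto
          thus ?thesis by simp
        qed
        also have "\<dots> \<le> norm (sin (of_real al * (z - of_real r)) :: complex)"
          using norm_sin_ge[of "of_real al * (z - of_real r)"] by simp
        finally show "s \<le> norm (sin (of_real al * (z - of_real r)) :: complex)" .
      qed (use s in auto)
      thus ?thesis by (simp add: P_def n_def prod_norm)
    qed
    have Q: "norm (Q z) \<le> exp (al * n * \<bar>Im z\<bar>)"
    proof -
      have "norm (Q z) \<le> (\<Prod>r\<in>Z. exp (al * \<bar>Im z\<bar>))"
        unfolding Q_def prod_norm[symmetric]
      proof (intro prod_mono conjI)
        fix r
        show "norm (sin (of_real al * (z + of_real (r + 2 * d)))) \<le> exp (al * \<bar>Im z\<bar>)"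
          using norm_sin_le[of "of_real al * (z + of_real (r + 2 * d))"] al0 by (simp add: abs_mult)
      qed auto
      thus ?thesis by (simp add: n_def exp_of_nat_mult[symmetric] mult_ac)
    qed
    have "norm (G z) * s ^ n \<le> norm (G z) * norm (P z)" by (intro mult_left_mono P) auto
    also have "\<dots> = norm (F z)" using FP[OF z] by (simp add: norm_mult)
    also have "\<dots> \<le> \<bar>C\<bar> * exp (\<bar>C\<bar> * \<bar>Im z\<bar>)"
      using growth[OF z] by (rule order_trans) (intro mult_mono; auto intro!: mult_right_mono)
    finally have Gz: "norm (G z) \<le> \<bar>C\<bar> / s ^ n * exp (\<bar>C\<bar> * \<bar>Im z\<bar>)" using s by (simp add: field_simps)
    have "norm (H z) \<le> (\<bar>C\<bar> / s ^ n * exp (\<bar>C\<bar> * \<bar>Im z\<bar>)) * exp (al * n * \<bar>Im z\<bar>)"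
      unfolding H_def norm_mult by (intro mult_mono Gz Q) (use s in auto)
    also have "\<dots> = \<bar>C\<bar> / s ^ n * exp ((\<bar>C\<bar> + al * n) * \<bar>Im z\<bar>)" by (simp flip: exp_add add: algebra_simps)
    also have "\<dots> \<le> C2 * exp (C2 * \<bar>Im z\<bar>)"
      using s C1 by (intro mult_mono) (auto simp: C2_def le_max_iff_disj intro!: mult_right_mono)
    finally show ?thesis .
  qed
  have "norm (H (of_real c)) \<le> exp ((A * (B - Re (of_real c)) + A' * (Re (of_real c) - (-d))) / (B - (-d)) + q * ((Im (of_real c))\<^sup>2 + (Re (of_real c) - (-d)) * (B - Re (of_real c))))"
  proof (rule three_lines_quadratic[of "-d" B q H C2 A A'])
    show "H holomorphic_on {z. - d < Re z \<and> Re z < B}"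
      by (rule holomorphic_on_subset[OF holH]) (auto intro: inV)
    show "continuous_on {z. - d \<le> Re z \<and> Re z \<le> B} H"
      by (rule continuous_on_subset[OF holomorphic_on_imp_continuous_on[OF holH]]) (auto intro: inV)
    show "norm (H z) \<le> exp (A + q * (Im z)\<^sup>2)" if "Re z = - d" for z
      using edge[of z] left[OF that] that by simp
    show "norm (H z) \<le> exp (A' + q * (Im z)\<^sup>2)" if "Re z = B" for z
      using edge[of z] right[OF that] that by simp
  qed (use W q c C2 in auto)
  hence Hc: "norm (H (of_real c)) \<le> exp ((A * (B - c) + A' * (c + d)) / W + q * ((c + d) * (B - c)))"
    using W by simp
  have nz: "sin (al * (c + (r + 2 * d))) \<noteq> 0" if "r \<in> Z" for r
  proof -
    have "sin (complex_of_real al * of_real (c + (r + 2 * d))) \<noteq> 0"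
      using Z(2)[OF that] c W by (intro sin_factor_nonzero[OF al W(2)]) (auto simp: abs_less_iff simp del: of_real_add)
    thus ?thesis by (metis of_real_mult sin_of_real of_real_0)
  qed
  have Qc: "Q (of_real c) = of_real (\<Prod>r\<in>Z. sin (al * (c + (r + 2 * d))))"
    by (simp add: Q_def flip: sin_of_real)
  have Pc: "P (of_real c) = of_real (\<Prod>r\<in>Z. sin (al * (c - r)))"
    by (simp add: P_def flip: sin_of_real)
  have Qnz: "(\<Prod>r\<in>Z. sin (al * (c + (r + 2 * d)))) \<noteq> 0" using nz Z(1) by (simp add: prod_zero_iff)
  hence Qnz': "Q (of_real c) \<noteq> 0" unfolding Qc of_real_eq_0_iff .
  have "norm (F (of_real c)) = norm (P (of_real c)) / norm (Q (of_real c)) * norm (H (of_real c))"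
    using FP[of "of_real c"] c Qnz' by (simp add: H_def norm_mult)
  also have "norm (P (of_real c)) / norm (Q (of_real c)) = (\<Prod>r\<in>Z. \<bar>sin (al * (c - r))\<bar> / \<bar>sin (al * (c + (r + 2 * d)))\<bar>)"
    by (simp add: Pc Qc abs_prod prod_dividef del: of_real_prod)
  also have "\<dots> * norm (H (of_real c)) \<le> \<dots> * exp ((A * (B - c) + A' * (c + d)) / W + q * ((c + d) * (B - c)))"
    by (intro mult_left_mono Hc prod_nonneg) auto
  finally show ?thesis .
qed


text \<open>At \<open>c\<close> a Blaschke factor decreases as its zero moves to the right, so
  \<open>y\<close> may be replaced by \<open>1 - x\<close>. Product formulas for sines then give
  \<open>(C - a) / (C - b)\<close> with \<open>C = cos (al * (2 * x - 1))\<close> and constants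
  \<open>a \<ge> b\<close>. This increases with \<open>C\<close>, hence is largest at
  \<open>x = 1 / 2\<close>, where the hypothesis on \<open>G\<close> bounds it.\<close>

lemma blaschke_pair:
  fixes al W d B c x y G :: real
  assumes al: "al = pi / (2 * W)" and W: "W = B + d" "W > 0"
    and c: "1 / 2 < c" "c < B" "- d < 1 - c" and x: "1 / 2 \<le> x" "x \<le> c" and y: "1 - x \<le> y" "y \<le> 1 / 2"
    and G: "G > 0" "1 - cos (al * (2 * c - 1)) \<le> exp (- G) * (1 - cos (al * (2 * c + 1 + 4 * d)))"
  shows "\<bar>sin (al * (c - x))\<bar> / \<bar>sin (al * (c + (x + 2 * d)))\<bar> * (\<bar>sin (al * (c - y))\<bar> / \<bar>sin (al * (c + (y + 2 * d)))\<bar>) \<le> exp (- G)"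
proof -
  have al0: "al > 0" using al W by simp
  have alW: "al * (2 * W) = pi" using al W by simp
  have pos: "0 \<le> sin (al * u)" if "0 \<le> u" "u \<le> 2 * W" for u
    using that al0 alW by (intro sin_ge_zero) (auto simp flip: alW)
  have pos': "0 < sin (al * u)" if "0 < u" "u < 2 * W" for u
    using that al0 alW by (intro sin_gt_zero) (auto simp flip: alW)
  define y' where "y' = 1 - x"
  have p1: "0 \<le> sin (al * (c - x))" "0 \<le> sin (al * (c - y))" "0 \<le> sin (al * (c - y'))"
    using x y c W by (auto intro!: pos simp: y'_def)
  have p2: "0 < sin (al * (c + (x + 2 * d)))" "0 < sin (al * (c + (y + 2 * d)))" "0 < sin (al * (c + (y' + 2 * d)))"
    using x y c W by (auto intro!: pos' simp: y'_def)
  have "sin (al * (c - y)) * sin (al * (c + (y' + 2 * d))) \<le> sin (al * (c - y')) * sin (al * (c + (y + 2 * d)))"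
  proof -
    have "0 \<le> sin (al * (2 * c + 2 * d)) * sin (al * (y - y'))"
      using x y c W by (intro mult_nonneg_nonneg pos) (auto simp: y'_def)
    also have "\<dots> = sin (al * (c - y')) * sin (al * (c + (y + 2 * d))) - sin (al * (c - y)) * sin (al * (c + (y' + 2 * d)))"
      unfolding sin_times_sin by (simp add: algebra_simps cos_minus[of "al * (y + (y' + 2 * d))", symmetric] add_divide_distrib diff_divide_distrib)
    finally show ?thesis by simp
  qed
  hence mono: "sin (al * (c - y)) / sin (al * (c + (y + 2 * d))) \<le> sin (al * (c - y')) / sin (al * (c + (y' + 2 * d)))"
    using p2 by (simp add: divide_simps mult_ac)
  have "sin (al * (c - x)) * sin (al * (c - y')) = (cos (al * (2 * x - 1)) - cos (al * (2 * c - 1))) / 2"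
    unfolding sin_times_sin y'_def using cos_minus[of "al * (2 * x - 1)"] by (simp add: algebra_simps)
  also have "\<dots> \<le> exp (- G) * ((cos (al * (2 * x - 1)) - cos (al * (2 * c + 1 + 4 * d))) / 2)"
  proof -
    have "(1 - exp (- G)) * (cos (al * (2 * x - 1))) \<le> (1 - exp (- G)) * 1"
      using G by (intro mult_left_mono) auto
    thus ?thesis using G(2) by (simp add: field_simps)
  qed
  also have "(cos (al * (2 * x - 1)) - cos (al * (2 * c + 1 + 4 * d))) / 2 = sin (al * (c + (x + 2 * d))) * sin (al * (c + (y' + 2 * d)))"
    unfolding sin_times_sin y'_def by (simp add: algebra_simps)
  finally have main: "sin (al * (c - x)) / sin (al * (c + (x + 2 * d))) * (sin (al * (c - y')) / sin (al * (c + (y' + 2 * d)))) \<le> exp (- G)"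
    using p2 by (simp add: divide_simps mult_ac)
  have "sin (al * (c - x)) / sin (al * (c + (x + 2 * d))) * (sin (al * (c - y)) / sin (al * (c + (y + 2 * d)))) \<le> sin (al * (c - x)) / sin (al * (c + (x + 2 * d))) * (sin (al * (c - y')) / sin (al * (c + (y' + 2 * d))))"
    using p1 p2 by (intro mult_left_mono mono divide_nonneg_pos) auto
  with main p1 p2 show ?thesis by simp
qed

text \<open>Here \<open>\<beta>\<close> is an argument measured from \<open>c\<close>. Between
  \<open>c\<close> and \<open>1 / 2\<close> it climbs from 0 to \<open>\<Theta>\<close> and meets
  the levels \<open>lx j\<close>. The reflection hypothesis carries it on to about
  \<open>2 * \<Theta> - lx j\<close> at \<open>1 - X j\<close>, so between \<open>1 / 2\<close> and
  that point it meets the level \<open>ly j\<close>. Levels below and above \<open>\<Theta>\<close>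
  keep the two families apart.\<close>

lemma backlund_levels:
  fixes \<beta> :: "real \<Rightarrow> real" and c E \<Theta> :: real and N :: nat
  assumes c: "1 / 2 < c" and N: "N > 0" and cont: "continuous_on {1 - c..c} \<beta>"
    and b: "\<beta> c = 0" "\<beta> (1 / 2) = \<Theta>" "\<Theta> \<ge> 0"
    and E: "\<And>x. x \<in> {1 / 2..c} \<Longrightarrow> \<bar>\<beta> (1 - x) + \<beta> x - 2 * \<Theta>\<bar> \<le> E"
  obtains n :: nat and X Y where "real n \<ge> (\<Theta> - E) * N / pi - 3 / 2"
    "\<And>j. j < n \<Longrightarrow> X j \<in> {1 / 2..c} \<and> Y j \<in> {1 - X j..1 / 2} \<and> cos (N * \<beta> (X j)) = 0 \<and> cos (N * \<beta> (Y j)) = 0"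
    "inj_on X {..<n}" "inj_on Y {..<n}" "X ` {..<n} \<inter> Y ` {..<n} = {}"
proof -
  have E0: "E \<ge> 0" using E[of c] c by force
  \<comment> \<open>The levels satisfy \<open>lx j + ly j = (J + 1) * pi / N\<close>, and
    \<open>J\<close> is the largest index for which this is at most \<open>2 * \<Theta> - E\<close>.
    The 1/2 subtracted in \<open>n\<close> makes up for the rounding in \<open>J\<close>, so that
    \<open>ly j\<close> stays at or above \<open>\<Theta>\<close>.\<close>
  define n where "n = nat \<lfloor>(\<Theta> - E) * N / pi - 1 / 2\<rfloor>"
  define J where "J = \<lfloor>(2 * \<Theta> - E) * N / pi\<rfloor> - 1"
  have n1: "real n \<ge> (\<Theta> - E) * N / pi - 3 / 2" unfolding n_def by linarith
  have jn: "real j + 3 / 2 \<le> (\<Theta> - E) * N / pi" if "j < n" for j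
    using that unfolding n_def by linarith
  define lx where "lx = (\<lambda>j::nat. (real j + 1 / 2) * pi / N)"
  define ly where "ly = (\<lambda>j::nat. (real_of_int (J - int j) + 1 / 2) * pi / N)"
  have lx: "lx j < \<Theta>" "0 \<le> lx j" if "j < n" for j
  proof -
    have "(real j + 1 / 2) * pi / N < (real j + 3 / 2) * pi / N" using N by (intro divide_strict_right_mono mult_strict_right_mono) auto
    also have "\<dots> \<le> ((\<Theta> - E) * N / pi) * pi / N" by (intro divide_right_mono mult_right_mono jn that) auto
    also have "\<dots> = \<Theta> - E" using N by simp
    finally show "lx j < \<Theta>" using E0 by (simp add: lx_def)
  qed (simp add: lx_def)
  have ly: "\<Theta> \<le> ly j" "ly j \<le> 2 * \<Theta> - E - lx j" if "j < n" for j
  proof -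
    have J: "real_of_int J \<ge> (2 * \<Theta> - E) * N / pi - 2" "real_of_int J \<le> (2 * \<Theta> - E) * N / pi - 1" unfolding J_def by linarith+
    have "\<Theta> = (\<Theta> * N / pi) * pi / N" using N by simp
    also have "\<Theta> * N / pi = (2 * \<Theta> - E) * N / pi - (\<Theta> - E) * N / pi" by (simp add: field_simps)
    also have "\<dots> \<le> real_of_int (J - int j) + 1 / 2" using J jn[OF that] by simp
    finally show "\<Theta> \<le> ly j" unfolding ly_def using N by (auto simp: divide_right_mono mult_right_mono)
    have "ly j + lx j = (real_of_int J + 1) * pi / N" using N by (simp add: ly_def lx_def field_simps)
    also have "\<dots> \<le> ((2 * \<Theta> - E) * N / pi) * pi / N" using J by (intro divide_right_mono mult_right_mono) auto
    also have "\<dots> = 2 * \<Theta> - E" using N by simp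
    finally show "ly j \<le> 2 * \<Theta> - E - lx j" by simp
  qed
  have "\<exists>x. x \<in> {1 / 2..c} \<and> \<beta> x = lx j" if "j < n" for j
    using IVT2'[of \<beta> c "lx j" "1 / 2"] lx[OF that] b c continuous_on_subset[OF cont, of "{1 / 2..c}"] by auto
  then obtain X where X: "\<And>j. j < n \<Longrightarrow> X j \<in> {1 / 2..c} \<and> \<beta> (X j) = lx j" by metis
  have "\<exists>y. y \<in> {1 - X j..1 / 2} \<and> \<beta> y = ly j" if "j < n" for j
  proof -
    have "ly j \<le> \<beta> (1 - X j)" using E[of "X j"] X[OF that] ly[OF that] by auto
    thus ?thesis
      using IVT2'[of \<beta> "1 / 2" "ly j" "1 - X j"] ly[OF that] b c X[OF that] continuous_on_subset[OF cont, of "{1 - X j..1 / 2}"] by auto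
  qed
  then obtain Y where Y: "\<And>j. j < n \<Longrightarrow> Y j \<in> {1 - X j..1 / 2} \<and> \<beta> (Y j) = ly j" by metis
  have lxi: "lx i = lx j \<Longrightarrow> i = j" for i j using N by (auto simp: lx_def)
  have lyi: "ly i = ly j \<Longrightarrow> i = j" for i j using N by (auto simp: ly_def)
  show thesis
  proof (rule that[OF n1, of X Y])
    show "inj_on X {..<n}" using X lxi by (metis inj_onI lessThan_iff)
    show "inj_on Y {..<n}" using Y lyi by (metis inj_onI lessThan_iff)
    show "X ` {..<n} \<inter> Y ` {..<n} = {}"
    proof (rule ccontr)
      assume "X ` {..<n} \<inter> Y ` {..<n} \<noteq> {}"
      then obtain i j where ij: "i < n" "j < n" "X i = Y j" by auto
      hence "lx i = ly j" using X Y by metis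
      thus False using lx[OF ij(1)] ly[OF ij(2)] by simp
    qed
    fix j assume j: "j < n"
    have cz: "cos (N * (of_int i * pi / N + pi / 2 / N)) = 0" for i
    proof -
      have "N * (of_int i * pi / N + pi / 2 / N) = pi * of_int i + pi / 2" using N by (simp add: field_simps)
      thus ?thesis by (simp add: cos_add sin_zero_iff_int2 mult.commute)
    qed
    have "lx j = of_int (int j) * pi / N + pi / 2 / N" "ly j = of_int (J - int j) * pi / N + pi / 2 / N"
      using N by (simp_all add: lx_def ly_def field_simps)
    thus "X j \<in> {1 / 2..c} \<and> Y j \<in> {1 - X j..1 / 2} \<and> cos (N * \<beta> (X j)) = 0 \<and> cos (N * \<beta> (Y j)) = 0"
      using X[OF j] Y[OF j] cz by metis
  qed
qed

text \<open>For each \<open>N\<close>, the function \<open>(h z + cnj (h (cnj z))) / 2\<close> with \<open>h z = cis (- N * b c) * f z ^ N\<close> vanishes at the real points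
  where \<open>N * (b x - b c)\<close> is an odd multiple of \<open>pi / 2\<close>.  The hypothesis on \<open>E\<close> pairs such points \<open>x \<ge> 1 / 2\<close> with
  such points \<open>y \<ge> 1 - x\<close>; letting \<open>N\<close> tend to infinity removes the loss from rounding.\<close>
lemma backlund_strip:
  fixes f :: "complex \<Rightarrow> complex" and b :: "real \<Rightarrow> real" and al W d B A A' q C c E G :: real
  assumes al: "al = pi / (2 * W)" and W: "W = B + d" "W > 0" and q: "q \<ge> 0"
    and f: "f holomorphic_on UNIV"
    and growth: "\<And>z. - d \<le> Re z \<Longrightarrow> Re z \<le> B \<Longrightarrow> norm (f z) \<le> C * exp (C * \<bar>Im z\<bar>)"
    and left: "\<And>z. Re z = - d \<Longrightarrow> norm (f z) \<le> exp (A + q * (Im z)\<^sup>2)"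
    and right: "\<And>z. Re z = B \<Longrightarrow> norm (f z) \<le> exp (A' + q * (Im z)\<^sup>2)"
    and c: "1 / 2 < c" "c < B" "- d < 1 - c"
    and b: "continuous_on {1 - c..c} b" "\<And>x. x \<in> {1 - c..c} \<Longrightarrow> f (of_real x) = of_real (norm (f (of_real x))) * cis (b x)"
    and E: "\<And>x. x \<in> {1 / 2..c} \<Longrightarrow> \<bar>b (1 - x) + b x - 2 * b (1 / 2)\<bar> \<le> E"
    and fc: "f (of_real c) \<noteq> 0"
    and G: "G > 0" "1 - cos (al * (2 * c - 1)) \<le> exp (- G) * (1 - cos (al * (2 * c + 1 + 4 * d)))"
  shows "\<bar>b (1 / 2) - b c\<bar> \<le> E + pi / G * ((A * (B - c) + A' * (c + d)) / W + q * ((c + d) * (B - c)) - ln (norm (f (of_real c))))"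
proof -
  \<comment> \<open>With this sign \<open>\<beta>\<close> is 0 at \<open>c\<close> and
    \<open>\<Theta> \<ge> 0\<close> at \<open>1 / 2\<close>.\<close>
  define sg :: real where "sg = (if b (1 / 2) \<ge> b c then 1 else - 1)"
  define \<Theta> where "\<Theta> = \<bar>b (1 / 2) - b c\<bar>"
  define \<beta> where "\<beta> = (\<lambda>x. sg * (b x - b c))"
  define M where "M = (A * (B - c) + A' * (c + d)) / W + q * ((c + d) * (B - c))"
  have sg: "\<bar>sg * x\<bar> = \<bar>x\<bar>" "sg * sg = 1" for x by (auto simp: sg_def)
  have key: "((\<Theta> - E) / pi - 3 / 2 / N) * G \<le> M - ln (norm (f (of_real c)))" if N: "N > 0" for N :: nat
  proof -
    have E': "\<bar>\<beta> (1 - x) + \<beta> x - 2 * \<Theta>\<bar> \<le> E" if "x \<in> {1 / 2..c}" for x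
    proof -
      have "\<beta> (1 - x) + \<beta> x - 2 * \<Theta> = sg * (b (1 - x) + b x - 2 * b (1 / 2))"
        by (auto simp: \<beta>_def \<Theta>_def sg_def algebra_simps)
      thus ?thesis using E[OF that] sg by simp
    qed
    obtain n :: nat and X Y where n: "real n \<ge> (\<Theta> - E) * N / pi - 3 / 2"
      and XY: "\<And>j. j < n \<Longrightarrow> X j \<in> {1 / 2..c} \<and> Y j \<in> {1 - X j..1 / 2} \<and> cos (N * \<beta> (X j)) = 0 \<and> cos (N * \<beta> (Y j)) = 0"
      and inj: "inj_on X {..<n}" "inj_on Y {..<n}" and disj: "X ` {..<n} \<inter> Y ` {..<n} = {}"
    proof (rule backlund_levels[OF c(1) N, of \<beta> \<Theta> E])
      show "continuous_on {1 - c..c} \<beta>" unfolding \<beta>_def by (intro continuous_intros b)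
    qed (use E' in \<open>auto simp: \<beta>_def \<Theta>_def sg_def\<close>)
    define u where "u = cis (- (N * b c))"
    define h where "h = (\<lambda>z. u * f z ^ N)"
    define F where "F = (\<lambda>z. (h z + cnj (h (cnj z))) / 2)"
    have holh: "h holomorphic_on UNIV" unfolding h_def by (intro holomorphic_intros f)
    have "(cnj \<circ> h \<circ> cnj) holomorphic_on UNIV"
      by (rule holomorphic_on_compose_cnj_cnj) (auto intro: holomorphic_on_subset[OF holh])
    hence holF: "F holomorphic_on UNIV" unfolding F_def o_def by (intro holomorphic_intros holh) auto
    have nF: "norm (F z) \<le> R" if "norm (f z) ^ N \<le> R" "norm (f (cnj z)) ^ N \<le> R" for z R
    proof -
      have "norm (F z) \<le> (norm (h z) + norm (h (cnj z))) / 2"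
        unfolding F_def using norm_triangle_ineq[of "h z" "cnj (h (cnj z))"] by (simp add: norm_divide)
      thus ?thesis using that by (simp add: h_def u_def norm_mult norm_power)
    qed
    \<comment> \<open>On the real axis \<open>F\<close> is the real part of \<open>h\<close>. The
      rotation by \<open>u\<close> makes the cosine 1 at \<open>c\<close>, so Jensen's inequality is
      applied at a point where passing to the real part loses nothing.\<close>
    have Fx: "F (of_real x) = of_real (norm (f (of_real x)) ^ N * cos (N * \<beta> x))" if "x \<in> {1 - c..c}" for x
    proof -
      have "h (of_real x) = u * (of_real (norm (f (of_real x))) * cis (b x)) ^ N"
        unfolding h_def using b(2)[OF that] by simp
      also have "\<dots> = of_real (norm (f (of_real x)) ^ N) * (cis (- (N * b c)) * cis (N * b x))"
        unfolding power_mult_distrib Complex.DeMoivre u_def by (simp only: of_real_power mult_ac)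
      also have "cis (- (N * b c)) * cis (N * b x) = cis (N * (b x - b c))"
        unfolding cis_mult by (rule arg_cong[of _ _ cis]) (simp add: algebra_simps)
      finally have "F (of_real x) = of_real (norm (f (of_real x)) ^ N) * of_real (cos (N * (b x - b c)))"
        by (simp add: F_def cis_cnj complex_eq_iff)
      also have "cos (N * (b x - b c)) = cos (N * \<beta> x)"
      proof -
        have "cos (N * (b c - b x)) = cos (N * (b x - b c))"
          using cos_minus[of "N * (b x - b c)"] by (simp add: algebra_simps)
        thus ?thesis by (simp add: \<beta>_def sg_def)
      qed
      finally show ?thesis by simp
    qed
    define Z where "Z = X ` {..<n} \<union> Y ` {..<n}"
    have ZF: "- d < r \<and> r < B \<and> F (of_real r) = 0" if "r \<in> Z" for r
    proof -
      from that have "(\<exists>j<n. r = X j) \<or> (\<exists>j<n. r = Y j)" by (auto simp: Z_def)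
      then obtain j where j: "j < n" "r = X j \<or> r = Y j" by blast
      hence "r \<in> {1 - c..c}" "cos (N * \<beta> r) = 0" using XY[OF j(1)] c by auto
      thus ?thesis using c Fx[of r] by auto
    qed
    have jen: "norm (F (of_real c)) \<le> (\<Prod>r\<in>Z. \<bar>sin (al * (c - r))\<bar> / \<bar>sin (al * (c + (r + 2 * d)))\<bar>)
           * exp ((N * A * (B - c) + N * A' * (c + d)) / W + N * q * ((c + d) * (B - c)))"
    proof (rule strip_jensen[OF al W _ holF, where C = "max (\<bar>C\<bar> ^ N) (N * \<bar>C\<bar>)"])
      show "norm (F z) \<le> max (\<bar>C\<bar> ^ N) (N * \<bar>C\<bar>) * exp (max (\<bar>C\<bar> ^ N) (N * \<bar>C\<bar>) * \<bar>Im z\<bar>)" if "- d \<le> Re z" "Re z \<le> B" for z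
      proof -
        have *: "norm (f w) ^ N \<le> max (\<bar>C\<bar> ^ N) (N * \<bar>C\<bar>) * exp (max (\<bar>C\<bar> ^ N) (N * \<bar>C\<bar>) * \<bar>Im w\<bar>)" if w: "- d \<le> Re w" "Re w \<le> B" for w
        proof -
          have "norm (f w) \<le> \<bar>C\<bar> * exp (\<bar>C\<bar> * \<bar>Im w\<bar>)"
            using growth[OF w] by (rule order_trans) (intro mult_mono; auto intro!: mult_right_mono)
          hence "norm (f w) ^ N \<le> (\<bar>C\<bar> * exp (\<bar>C\<bar> * \<bar>Im w\<bar>)) ^ N" by (intro power_mono) auto
          also have "\<dots> = \<bar>C\<bar> ^ N * exp (N * \<bar>C\<bar> * \<bar>Im w\<bar>)" by (simp add: power_mult_distrib exp_of_nat_mult[symmetric] mult_ac)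
          also have "\<dots> \<le> max (\<bar>C\<bar> ^ N) (N * \<bar>C\<bar>) * exp (max (\<bar>C\<bar> ^ N) (N * \<bar>C\<bar>) * \<bar>Im w\<bar>)"
            by (intro mult_mono) (auto intro!: mult_right_mono simp: le_max_iff_disj)
          finally show ?thesis .
        qed
        show ?thesis using *[of z] *[of "cnj z"] that by (intro nF) auto
      qed
      show "norm (F z) \<le> exp (N * A + N * q * (Im z)\<^sup>2)" if "Re z = - d" for z
      proof -
        have "norm (f w) ^ N \<le> exp (N * A + N * q * (Im w)\<^sup>2)" if "Re w = - d" for w
          using power_mono[OF left[OF that] norm_ge_zero, of N] by (simp add: exp_of_nat_mult[symmetric] algebra_simps)
        from this[of z] this[of "cnj z"] show ?thesis using that by (intro nF) auto
      qed
      show "norm (F z) \<le> exp (N * A' + N * q * (Im z)\<^sup>2)" if "Re z = B" for z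
      proof -
        have "norm (f w) ^ N \<le> exp (N * A' + N * q * (Im w)\<^sup>2)" if "Re w = B" for w
          using power_mono[OF right[OF that] norm_ge_zero, of N] by (simp add: exp_of_nat_mult[symmetric] algebra_simps)
        from this[of z] this[of "cnj z"] show ?thesis using that by (intro nF) auto
      qed
    qed (use q c ZF in \<open>auto simp: Z_def\<close>)
    have "(\<Prod>r\<in>Z. \<bar>sin (al * (c - r))\<bar> / \<bar>sin (al * (c + (r + 2 * d)))\<bar>)
      = (\<Prod>j<n. \<bar>sin (al * (c - X j))\<bar> / \<bar>sin (al * (c + (X j + 2 * d)))\<bar> * (\<bar>sin (al * (c - Y j))\<bar> / \<bar>sin (al * (c + (Y j + 2 * d)))\<bar>))"
      unfolding Z_def prod.distrib by (subst prod.union_disjoint) (use disj inj in \<open>auto simp: prod.reindex\<close>)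
    also have "\<dots> \<le> (\<Prod>j<n. exp (- G))"
    proof (intro prod_mono conjI)
      fix j assume "j \<in> {..<n}"
      thus "\<bar>sin (al * (c - X j))\<bar> / \<bar>sin (al * (c + (X j + 2 * d)))\<bar> * (\<bar>sin (al * (c - Y j))\<bar> / \<bar>sin (al * (c + (Y j + 2 * d)))\<bar>) \<le> exp (- G)"
        using XY[of j] by (intro blaschke_pair[OF al W c _ _ _ _ G]) auto
    qed auto
    also have "\<dots> = exp (- (n * G))" by (simp add: exp_of_nat_mult[symmetric])
    finally have PL: "(\<Prod>r\<in>Z. \<bar>sin (al * (c - r))\<bar> / \<bar>sin (al * (c + (r + 2 * d)))\<bar>) \<le> exp (- (n * G))" .
    have "norm (f (of_real c)) ^ N = norm (F (of_real c))"
      using Fx[of c] c by (simp add: \<beta>_def norm_power)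
    also note jen
    also have "(N * A * (B - c) + N * A' * (c + d)) / W + N * q * ((c + d) * (B - c)) = N * M"
      by (simp add: M_def add_divide_distrib algebra_simps)
    finally have "norm (f (of_real c)) ^ N \<le> (\<Prod>r\<in>Z. \<bar>sin (al * (c - r))\<bar> / \<bar>sin (al * (c + (r + 2 * d)))\<bar>) * exp (N * M)" .
    also have "\<dots> \<le> exp (- (n * G)) * exp (N * M)" by (intro mult_right_mono PL) auto
    finally have "norm (f (of_real c)) ^ N \<le> exp (- (n * G) + N * M)" unfolding exp_add .
    hence "ln (norm (f (of_real c)) ^ N) \<le> ln (exp (- (n * G) + N * M))"
      using fc by (subst ln_le_cancel_iff) auto
    hence "ln (norm (f (of_real c)) ^ N) \<le> - (n * G) + N * M" by simp
    hence "n * G \<le> N * (M - ln (norm (f (of_real c))))"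
      using fc by (simp add: ln_realpow algebra_simps)
    moreover have "((\<Theta> - E) * N / pi - 3 / 2) * G \<le> n * G" using n G by (intro mult_right_mono) auto
    ultimately have "((\<Theta> - E) * N / pi - 3 / 2) * G \<le> N * (M - ln (norm (f (of_real c))))" by simp
    hence "((\<Theta> - E) * N / pi - 3 / 2) * G / N \<le> M - ln (norm (f (of_real c)))" using N by (simp add: field_simps)
    also have "((\<Theta> - E) * N / pi - 3 / 2) * G / N = ((\<Theta> - E) / pi - 3 / 2 / N) * G" using N by (simp add: field_simps)
    finally show ?thesis .
  qed
  have "(\<lambda>N. ((\<Theta> - E) / pi - 3 / 2 / real N) * G) \<longlonglongrightarrow> ((\<Theta> - E) / pi - 0) * G"
    by (intro tendsto_intros)
  hence "((\<Theta> - E) / pi - 0) * G \<le> M - ln (norm (f (of_real c)))"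
    by (rule LIMSEQ_le_const2) (use key in \<open>auto intro!: exI[of _ 1]\<close>)
  hence "\<Theta> \<le> E + pi / G * (M - ln (norm (f (of_real c))))"
    using G by (simp add: field_simps)
  thus ?thesis by (simp add: \<Theta>_def M_def)
qed

section \<open>The Gamma factor on vertical lines\<close>

text \<open>For \<open>u, T > 0\<close> this is \<open>Im (w * Ln w)\<close> with
  \<open>w = u + i * T\<close>, an antiderivative in \<open>u\<close> of
  \<open>arctan (T / u)\<close>. At \<open>u = 0\<close> the convention \<open>T / 0 = 0\<close>
  gives \<open>T * ln T\<close>, which is also the limit from the right.\<close>

definition arctan_prim :: "real \<Rightarrow> real \<Rightarrow> real" where
  "arctan_prim T u = u * arctan (T / u) + T / 2 * ln (u\<^sup>2 + T\<^sup>2)"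

lemma DERIV_arctan_div:
  assumes "T > 0" "u > 0"
  shows "((\<lambda>u. arctan (T / u)) has_real_derivative - T / (u\<^sup>2 + T\<^sup>2)) (at u)"
proof -
  have "u\<^sup>2 + T\<^sup>2 > 0" using assms by (simp add: add_pos_pos)
  thus ?thesis using assms
    by (auto intro!: derivative_eq_intros simp: field_simps power2_eq_square)
qed

lemma DERIV_arctan_prim:
  assumes "T > 0" "u > 0"
  shows "(arctan_prim T has_real_derivative arctan (T / u)) (at u)"
proof -
  have p: "u\<^sup>2 + T\<^sup>2 > 0" using assms by (simp add: add_pos_pos)
  have "((\<lambda>u. u * arctan (T / u) + T / 2 * ln (u\<^sup>2 + T\<^sup>2)) has_real_derivative
      (1 * arctan (T / u) + (- T / (u\<^sup>2 + T\<^sup>2)) * u) + T / 2 * (2 * u / (u\<^sup>2 + T\<^sup>2))) (at u)"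
    using assms p by (intro DERIV_add DERIV_mult DERIV_arctan_div DERIV_ident DERIV_cmult) (auto intro!: derivative_eq_intros)
  also have "(1 * arctan (T / u) + (- T / (u\<^sup>2 + T\<^sup>2)) * u) + T / 2 * (2 * u / (u\<^sup>2 + T\<^sup>2)) = arctan (T / u)"
    by simp
  finally show ?thesis by (simp add: arctan_prim_def[abs_def])
qed

text \<open>The end \<open>u = 0\<close> matters: for \<open>m = 1 / 2\<close> the midpoint
  comparison runs over the interval from 0 to 1.\<close>

lemma continuous_on_arctan_prim:
  assumes "T > 0"
  shows "continuous_on {0..} (arctan_prim T)"
  unfolding continuous_on_eq_continuous_within
proof (rule ballI)
  fix u :: real assume u: "u \<in> {0..}"
  show "continuous (at u within {0..}) (arctan_prim T)"
  proof (cases "u = 0")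
    case False
    hence "isCont (arctan_prim T) u" using u DERIV_arctan_prim[OF assms, of u] DERIV_isCont by auto
    thus ?thesis by (rule continuous_at_imp_continuous_at_within)
  next
    case True
    have "((\<lambda>u. u * arctan (T / u)) \<longlongrightarrow> 0) (at 0 within {0..})"
    proof (rule tendsto_0_le[where K = "pi / 2"])
      show "((\<lambda>u. u) \<longlongrightarrow> 0) (at (0::real) within {0..})" by (rule tendsto_ident_at)
      show "\<forall>\<^sub>F u in at 0 within {0..}. norm (u * arctan (T / u)) \<le> norm u * (pi / 2)"
      proof (intro always_eventually allI)
        fix u
        have "\<bar>arctan (T / u)\<bar> \<le> pi / 2" using arctan_bounded[of "T / u"] by linarith
        thus "norm (u * arctan (T / u)) \<le> norm u * (pi / 2)"
          unfolding real_norm_def abs_mult by (intro mult_left_mono) auto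
      qed
    qed
    moreover have "((\<lambda>u. T / 2 * ln (u\<^sup>2 + T\<^sup>2)) \<longlongrightarrow> T / 2 * ln (0\<^sup>2 + T\<^sup>2)) (at 0 within {0..})"
      using assms by (intro tendsto_intros tendsto_ident_at) auto
    ultimately have "((\<lambda>u. u * arctan (T / u) + T / 2 * ln (u\<^sup>2 + T\<^sup>2)) \<longlongrightarrow> 0 + T / 2 * ln (0\<^sup>2 + T\<^sup>2)) (at 0 within {0..})"
      by (rule tendsto_add)
    thus ?thesis unfolding True continuous_within arctan_prim_def[abs_def] by simp
  qed
qed

lemma convex_arctan_div:
  assumes T: "T > 0" and "x > 0" "y > 0"
  shows "arctan (T / y) \<ge> arctan (T / x) - T / (x\<^sup>2 + T\<^sup>2) * (y - x)"
proof -
  have p: "u\<^sup>2 + T\<^sup>2 > 0" for u using T by (simp add: add_nonneg_pos)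
  have "convex_on {0<..} (\<lambda>u. arctan (T / u))"
  proof (rule f''_ge0_imp_convex)
    show "((\<lambda>u. arctan (T / u)) has_real_derivative - T / (u\<^sup>2 + T\<^sup>2)) (at u)" if "u \<in> {0<..}" for u
      using that T by (intro DERIV_arctan_div) auto
    show "((\<lambda>u. - T / (u\<^sup>2 + T\<^sup>2)) has_real_derivative 2 * T * u / (u\<^sup>2 + T\<^sup>2)\<^sup>2) (at u)" if "u \<in> {0<..}" for u
      using p[of u] by (auto intro!: derivative_eq_intros simp: power2_eq_square)
    show "0 \<le> 2 * T * u / (u\<^sup>2 + T\<^sup>2)\<^sup>2" if "u \<in> {0<..}" for u using that T by simp
  qed auto
  hence "arctan (T / y) - arctan (T / x) \<ge> (- T / (x\<^sup>2 + T\<^sup>2)) * (y - x)"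
    by (rule convex_on_imp_above_tangent)
       (use assms DERIV_arctan_div[OF T, of x] in \<open>auto simp: interior_open intro: has_field_derivative_at_within\<close>)
  thus ?thesis by simp
qed

text \<open>One half of the Hermite--Hadamard inequality: by convexity \<open>G\<close> has a
  nonnegative derivative in the half-width \<open>h\<close>.\<close>

lemma arctan_prim_midpoint:
  assumes T: "T > 0" and m: "m \<ge> 1 / 2"
  shows "arctan (T / m) \<le> arctan_prim T (m + 1 / 2) - arctan_prim T (m - 1 / 2)"
proof -
  define G where "G = (\<lambda>h. arctan_prim T (m + h) - arctan_prim T (m - h) - 2 * h * arctan (T / m))"
  have D: "(G has_real_derivative arctan (T / (m + h)) * 1 - arctan (T / (m - h)) * (- 1) - 2 * arctan (T / m)) (at h)"
    if "0 < h" "h < 1 / 2" for h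
    unfolding G_def using that m
    by (intro DERIV_diff DERIV_chain2[where f = "arctan_prim T"] DERIV_arctan_prim T) (auto intro!: derivative_eq_intros)
  have "continuous_on {0..1 / 2} G" unfolding G_def using m
    by (intro continuous_intros continuous_on_compose2[OF continuous_on_arctan_prim[OF T]]) auto
  then obtain l h where h: "0 < h" "h < 1 / 2" "(G has_real_derivative l) (at h)" "G (1 / 2) - G 0 = (1 / 2 - 0) * l"
    using MVT[of 0 "1 / 2" G] D by (auto simp: real_differentiable_def)
  have "l = arctan (T / (m + h)) * 1 - arctan (T / (m - h)) * (- 1) - 2 * arctan (T / m)"
    by (rule DERIV_unique[OF h(3) D[OF h(1,2)]])
  also have "\<dots> \<ge> 0"
    using convex_arctan_div[OF T, of m "m + h"] convex_arctan_div[OF T, of m "m - h"] h m by simp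
  finally have "G 0 \<le> G (1 / 2)" using h(4) by simp
  thus ?thesis by (simp add: G_def)
qed

text \<open>The other half of Hermite--Hadamard: the derivative of \<open>G\<close> is nonnegative
  because the tangent at \<open>m + h\<close> stays below the convex function at
  \<open>m\<close>.\<close>

lemma arctan_prim_trapezoid:
  assumes T: "T > 0" and m: "m > 0"
  shows "arctan_prim T (m + 1) - arctan_prim T m \<le> (arctan (T / m) + arctan (T / (m + 1))) / 2"
proof -
  define G where "G = (\<lambda>h. h * (arctan (T / m) + arctan (T / (m + h))) / 2 - arctan_prim T (m + h))"
  have "G 0 \<le> G 1"
  proof (rule DERIV_nonneg_imp_nondecreasing[of 0 1 G])
    fix h :: real assume h: "0 \<le> h" "h \<le> 1"
    have "(G has_real_derivative (1 * (arctan (T / m) + arctan (T / (m + h))) + (0 + - T / ((m + h)\<^sup>2 + T\<^sup>2) * 1) * h) / 2 - arctan (T / (m + h)) * 1) (at h)"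
      unfolding G_def using h m
      by (intro DERIV_diff DERIV_cdivide DERIV_mult DERIV_add DERIV_const DERIV_ident DERIV_chain2[where f = "arctan_prim T"] DERIV_chain2[where f = "\<lambda>u. arctan (T / u)"] DERIV_arctan_div DERIV_arctan_prim T) (auto intro!: derivative_eq_intros)
    moreover have "(1 * (arctan (T / m) + arctan (T / (m + h))) + (0 + - T / ((m + h)\<^sup>2 + T\<^sup>2) * 1) * h) / 2 - arctan (T / (m + h)) * 1 \<ge> 0"
      using convex_arctan_div[OF T, of "m + h" m] h m by (simp add: algebra_simps)
    ultimately show "\<exists>y. (G has_real_derivative y) (at h) \<and> 0 \<le> y" by blast
  qed auto
  hence "- arctan_prim T m \<le> (arctan (T / m) + arctan (T / (m + 1))) / 2 - arctan_prim T (m + 1)" by (simp add: G_def)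
  thus ?thesis by linarith
qed

lemma Im_ln_Gamma_series:
  assumes x: "x > 0" and n: "n > 0"
  shows "Im (ln_Gamma_series (Complex x T) n) = T * ln n - (\<Sum>k\<le>n. arctan (T / (x + real k)))"
proof -
  have 1: "Im (Ln z) = arctan (Im z / Re z)" if "Re z > 0" for z
    using that by (metis Arg_eq_Im_Ln arg_conv_arctan order_less_irrefl zero_complex.simps(1))
  have 2: "Im (Ln (Complex x T / of_nat k + 1)) = arctan (T / (x + real k))" if "k \<ge> 1" for k :: nat
  proof -
    have e: "Complex x T / of_nat k + 1 = Complex (x / k + 1) (T / k)" by (simp add: complex_eq_iff)
    have "(T / k) / (x / k + 1) = T / (x + k)" using that x by (simp add: field_simps)
    moreover have "x / k + 1 > 0" using x that by (simp add: add_pos_pos)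
    ultimately show ?thesis unfolding e by (subst 1) auto
  qed
  have "Im (ln_Gamma_series (Complex x T) n) = T * ln n - arctan (T / x) - (\<Sum>k=1..n. arctan (T / (x + real k)))"
    using n x by (simp add: ln_Gamma_series_def 1 2 Im_sum flip: Ln_of_real[of "real n", simplified])
  also have "\<dots> = T * ln n - (\<Sum>k\<le>n. arctan (T / (x + real k)))"
    by (simp add: atMost_atLeast0 sum.atLeast_Suc_atMost[of 0 n])
  finally show ?thesis .
qed

text \<open>Stirling's formula with explicit error. The sum of arctangents in
  \<open>Im_ln_Gamma_series\<close> is bounded above by the midpoint rule and below by the
  trapezoidal rule; what is left at the far end, \<open>T * ln n\<close> minus the primitive, tends
  to \<open>- T\<close>.\<close>

lemma Im_ln_Gamma_bounds:
  assumes x: "x \<ge> 1 / 2" and T: "T > 0"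
  shows "arctan_prim T (x - 1 / 2) - T \<le> Im (ln_Gamma (Complex x T))"
    and "Im (ln_Gamma (Complex x T)) \<le> arctan_prim T x - arctan (T / x) / 2 - T"
proof -
  have "Complex x T \<notin> \<int>\<^sub>\<le>\<^sub>0" using T by (auto simp: nonpos_Ints_def complex_eq_iff)
  hence lim: "(\<lambda>n. Im (ln_Gamma_series (Complex x T) n)) \<longlonglongrightarrow> Im (ln_Gamma (Complex x T))"
    by (intro tendsto_Im ln_Gamma_complex_LIMSEQ)
  have up: "(\<Sum>k\<le>n. arctan (T / (x + real k))) \<le> arctan_prim T (x + real n + 1 / 2) - arctan_prim T (x - 1 / 2)" for n :: nat
  proof (induction n)
    case 0 thus ?case using arctan_prim_midpoint[OF T x] by simp
  next
    case (Suc n)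
    thus ?case using arctan_prim_midpoint[OF T, of "x + Suc n"] x by (simp add: algebra_simps)
  qed
  have lo: "arctan_prim T (x + real n) - arctan_prim T x + (arctan (T / x) + arctan (T / (x + real n))) / 2 \<le> (\<Sum>k\<le>n. arctan (T / (x + real k)))" for n :: nat
  proof (induction n)
    case 0 thus ?case by simp
  next
    case (Suc n)
    thus ?case using arctan_prim_trapezoid[OF T, of "x + n"] x by (simp add: algebra_simps add_divide_distrib)
  qed
  have "(\<lambda>n. T * ln n - (arctan_prim T (x + real n + 1 / 2) - arctan_prim T (x - 1 / 2))) \<longlonglongrightarrow> arctan_prim T (x - 1 / 2) - T"
  proof -
    have "(\<lambda>n. T * ln (real n) - arctan_prim T (x + real n + 1 / 2)) \<longlonglongrightarrow> - T"
      unfolding arctan_prim_def using T by real_asymp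
    from tendsto_add[OF this tendsto_const[of "arctan_prim T (x - 1 / 2)"]] show ?thesis by (simp add: algebra_simps)
  qed
  thus "arctan_prim T (x - 1 / 2) - T \<le> Im (ln_Gamma (Complex x T))"
  proof (rule LIMSEQ_le[OF _ lim], intro exI[of _ 1] allI impI)
    fix n :: nat assume "n \<ge> 1"
    thus "T * ln n - (arctan_prim T (x + real n + 1 / 2) - arctan_prim T (x - 1 / 2)) \<le> Im (ln_Gamma_series (Complex x T) n)"
      using up[of n] x by (subst Im_ln_Gamma_series) auto
  qed
  have "(\<lambda>n. T * ln n - (arctan_prim T (x + real n) - arctan_prim T x + (arctan (T / x) + arctan (T / (x + real n))) / 2)) \<longlonglongrightarrow> arctan_prim T x - arctan (T / x) / 2 - T"
  proof -
    have "(\<lambda>n. T * ln (real n) - arctan_prim T (x + real n) - arctan (T / (x + real n)) / 2) \<longlonglongrightarrow> - T"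
      unfolding arctan_prim_def using T by real_asymp
    from tendsto_add[OF this tendsto_const[of "arctan_prim T x - arctan (T / x) / 2"]] show ?thesis by (simp add: algebra_simps add_divide_distrib)
  qed
  thus "Im (ln_Gamma (Complex x T)) \<le> arctan_prim T x - arctan (T / x) / 2 - T"
  proof (rule LIMSEQ_le[OF lim], intro exI[of _ 1] allI impI)
    fix n :: nat assume "n \<ge> 1"
    thus "Im (ln_Gamma_series (Complex x T) n) \<le> T * ln n - (arctan_prim T (x + real n) - arctan_prim T x + (arctan (T / x) + arctan (T / (x + real n))) / 2)"
      using lo[of n] x by (subst Im_ln_Gamma_series) auto
  qed
qed

lemma ln_add_square_bounds:
  assumes T: "T > (0::real)"
  shows "T / 2 * ln (u\<^sup>2 + T\<^sup>2) \<ge> T * ln T" "T / 2 * ln (u\<^sup>2 + T\<^sup>2) \<le> T * ln T + u\<^sup>2 / (2 * T)"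
proof -
  have p: "1 + (u / T)\<^sup>2 > 0" by (simp add: add_pos_nonneg)
  have "u\<^sup>2 + T\<^sup>2 = T\<^sup>2 * (1 + (u / T)\<^sup>2)" using T by (simp add: field_simps power2_eq_square)
  hence e: "ln (u\<^sup>2 + T\<^sup>2) = 2 * ln T + ln (1 + (u / T)\<^sup>2)" using T p by (simp add: ln_mult ln_realpow)
  have "ln (1 + (u / T)\<^sup>2) \<ge> 0" by simp
  hence "T / 2 * ln (1 + (u / T)\<^sup>2) \<ge> 0" using T by simp
  thus "T / 2 * ln (u\<^sup>2 + T\<^sup>2) \<ge> T * ln T" unfolding e distrib_left by simp
  have "ln (1 + (u / T)\<^sup>2) \<le> (u / T)\<^sup>2" by (rule ln_add_one_self_le_self) simp
  hence "T / 2 * ln (1 + (u / T)\<^sup>2) \<le> T / 2 * (u / T)\<^sup>2" using T by (intro mult_left_mono) auto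
  also have "T / 2 * (u / T)\<^sup>2 = u\<^sup>2 / (2 * T)" using T by (simp add: power2_eq_square)
  finally show "T / 2 * ln (u\<^sup>2 + T\<^sup>2) \<le> T * ln T + u\<^sup>2 / (2 * T)" unfolding e distrib_left by simp
qed

text \<open>At \<open>x = 1 / 2\<close> the lower bound starts from the primitive at 0, and in the
  upper bound the two arctangents cancel; only \<open>ln_add_square_bounds\<close> costs
  something.\<close>

lemma Im_ln_Gamma_half:
  assumes T: "T > 0"
  shows "T * ln T - T \<le> Im (ln_Gamma (Complex (1 / 2) T))"
    "Im (ln_Gamma (Complex (1 / 2) T)) \<le> T * ln T - T + 1 / (8 * T)"
  using Im_ln_Gamma_bounds[OF order.refl T] ln_add_square_bounds[OF T, of 0] ln_add_square_bounds[OF T, of "1 / 2"]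
  by (auto simp: arctan_prim_def power2_eq_square)

text \<open>Along a horizontal line the argument of Gamma grows like \<open>pi / 2 * x\<close>. In
  the functional equation this is cancelled by the dominant exponential of \<open>gcos\<close>, so
  that only the deviation \<open>D\<close>, of order \<open>1 / T\<close>, survives.\<close>

lemma Im_ln_Gamma_horizontal:
  assumes T: "T > 0" and x: "x \<ge> 1 / 2"
  defines "D \<equiv> Im (ln_Gamma (Complex x T)) - Im (ln_Gamma (Complex (1 / 2) T)) - pi / 2 * (x - 1 / 2)"
  shows "D \<ge> - ((x - 1 / 2)\<^sup>2 + 1 / 8) / T" "D \<le> x\<^sup>2 / (2 * T)"
proof -
  define v where "v = x - 1 / 2"
  have v: "v \<ge> 0" using x by (simp add: v_def)
  have "v * arctan (T / v) \<ge> v * (pi / 2) - v\<^sup>2 / T"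
  proof (cases "v = 0")
    case False
    hence "arctan (inverse (v / T)) = pi / 2 - arctan (v / T)" using T v by (intro arctan_inverse) auto
    hence "arctan (T / v) = pi / 2 - arctan (v / T)" by simp
    moreover have "arctan (v / T) \<le> v / T" using T v by (intro arctan_le_self) auto
    ultimately have "v * arctan (T / v) \<ge> v * (pi / 2 - v / T)" using v by (intro mult_left_mono) auto
    thus ?thesis by (simp add: algebra_simps power2_eq_square)
  qed auto
  hence "arctan_prim T v \<ge> v * (pi / 2) - v\<^sup>2 / T + T * ln T"
    using ln_add_square_bounds(1)[OF T, of v] by (simp add: arctan_prim_def)
  moreover have "- ((x - 1 / 2)\<^sup>2 + 1 / 8) / T = - (v\<^sup>2 / T) - 1 / (8 * T)" using T by (simp add: v_def field_simps)
  ultimately show "D \<ge> - ((x - 1 / 2)\<^sup>2 + 1 / 8) / T"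
    using Im_ln_Gamma_bounds(1)[OF x T] Im_ln_Gamma_half(2)[OF T]
    unfolding D_def v_def[symmetric] by (simp add: mult.commute)
  have "arctan_prim T x - arctan (T / x) / 2 = v * arctan (T / x) + T / 2 * ln (x\<^sup>2 + T\<^sup>2)"
    by (simp add: arctan_prim_def v_def algebra_simps)
  also have "\<dots> \<le> v * (pi / 2) + (T * ln T + x\<^sup>2 / (2 * T))"
    using v by (intro add_mono mult_left_mono ln_add_square_bounds T less_imp_le[OF arctan_ubound]) auto
  finally show "D \<le> x\<^sup>2 / (2 * T)"
    using Im_ln_Gamma_bounds(2)[OF x T] Im_ln_Gamma_half(1)[OF T]
    by (simp add: D_def v_def[symmetric] algebra_simps)
qed


section \<open>Modulus of the Gamma factor between the lines of real part 1/2 and 3/2\<close>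

definition gcos :: "complex \<Rightarrow> complex \<Rightarrow> complex" where
  "gcos e s = exp (- (\<i> * pi * s / 2)) + e * exp (\<i> * pi * s / 2)"

text \<open>Up to the power \<open>(2 * pi / k) powr (- s)\<close> and constants this is the factor
  of the functional equation. The division by \<open>sqrt (2 * pi)\<close> gives it modulus exactly
  1 on the critical line.\<close>

definition gfac :: "complex \<Rightarrow> complex \<Rightarrow> complex" where
  "gfac e s = Gamma s * gcos e s / of_real (sqrt (2 * pi))"

text \<open>The function \<open>gcos\<close> is \<open>2 * cos (pi * s / 2)\<close> for
  \<open>e = 1\<close> and \<open>- 2 * i * sin (pi * s / 2)\<close> for \<open>e = - 1\<close>. On
  the critical line \<open>cnj s = 1 - s\<close>, so in either case the square of its modulus is
  \<open>2 * sin (pi * s)\<close>, which the reflection formula of Gamma cancels.\<close>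

lemma norm_gfac_half:
  assumes e: "e = 1 \<or> e = - 1" and s: "Re s = 1 / 2"
  shows "norm (gfac e s) = 1"
proof -
  have cs: "cnj s = 1 - s" using s by (simp add: complex_eq_iff)
  have half: "exp (\<i> * pi / 2) = \<i>" "exp (- (\<i> * pi / 2)) = - \<i>"
    using cis_pi_half[unfolded cis_conv_exp] by (simp_all add: exp_minus)
  have e1: "cnj (exp (- (\<i> * pi * s / 2))) = \<i> * exp (- (\<i> * pi * s / 2))"
  proof -
    have "cnj (exp (- (\<i> * pi * s / 2))) = exp (\<i> * pi / 2 + - (\<i> * pi * s / 2))"
      by (simp add: exp_cnj cs algebra_simps diff_divide_distrib)
    thus ?thesis unfolding exp_add half .
  qed
  have e2: "cnj (exp (\<i> * pi * s / 2)) = - \<i> * exp (\<i> * pi * s / 2)"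
  proof -
    have "cnj (exp (\<i> * pi * s / 2)) = exp (- (\<i> * pi / 2) + \<i> * pi * s / 2)"
      by (simp add: exp_cnj cs algebra_simps diff_divide_distrib)
    thus ?thesis unfolding exp_add half .
  qed
  have ee: "cnj e = e" "e * e = 1" using e by auto
  have "gcos e s * cnj (gcos e s) = \<i> * (exp (- (\<i> * pi * s / 2)) * exp (- (\<i> * pi * s / 2))) - \<i> * (exp (\<i> * pi * s / 2) * exp (\<i> * pi * s / 2))"
  proof -
    have "(x + e * y) * (\<i> * x + e * (- \<i> * y)) = \<i> * (x * x) - (e * e) * (\<i> * (y * y))" for x y
      by (simp add: algebra_simps)
    thus ?thesis unfolding gcos_def complex_cnj_add complex_cnj_mult e1 e2 ee by simp
  qed
  also have "\<dots> = \<i> * exp (- (\<i> * (pi * s))) - \<i> * exp (\<i> * (pi * s))"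
    unfolding exp_add[symmetric] by (simp add: algebra_simps)
  also have "\<dots> = 2 * sin (pi * s)"
    unfolding sin_exp_eq by (simp add: field_simps)
  finally have g: "gcos e s * cnj (gcos e s) = 2 * sin (pi * s)" .
  have nz: "sin (of_real pi * s) \<noteq> 0"
  proof
    assume "sin (of_real pi * s) = 0"
    then obtain n :: int where "of_real pi * s = of_real (of_int n * pi)" by (auto simp: sin_eq_0)
    hence "s = of_int n" by (simp add: mult.commute)
    hence "real_of_int (2 * n) = 1" using s by simp
    hence "2 * n = 1" by (metis of_int_eq_1_iff)
    thus False by presburger
  qed
  have "gfac e s * cnj (gfac e s) = (Gamma s * Gamma (1 - s)) * (gcos e s * cnj (gcos e s)) / (of_real (sqrt (2 * pi)) * of_real (sqrt (2 * pi)))"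
    by (simp add: gfac_def cnj_Gamma cs)
  also have "\<dots> = 1"
    unfolding Gamma_reflection_complex g of_real_mult[symmetric] using nz by simp
  finally have "(norm (gfac e s))\<^sup>2 = 1"
    by (metis complex_norm_square of_real_eq_1_iff)
  thus ?thesis by (smt (verit) norm_ge_zero power2_eq_1_iff)
qed

text \<open>A shift by 1 multiplies Gamma by \<open>w\<close> and turns \<open>gcos e\<close> into
  \<open>gcos (- e)\<close> up to a unit, which is why both signs of \<open>e\<close> are treated
  together.\<close>

lemma norm_gfac_three_halves:
  assumes e: "e = 1 \<or> e = - 1" and s: "Re s = 3 / 2"
  shows "norm (gfac e s) = norm (s - 1)"
proof -
  define w where "w = s - 1"
  have w: "Re w = 1 / 2" "s = w + 1" using s by (auto simp: w_def)
  have "w \<notin> \<int>\<^sub>\<le>\<^sub>0" using w by (auto simp: nonpos_Ints_def)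
  have half: "exp (\<i> * pi / 2) = \<i>" "exp (- (\<i> * pi / 2)) = - \<i>"
    using cis_pi_half[unfolded cis_conv_exp] by (simp_all add: exp_minus)
  have "gcos e s = exp (- (\<i> * pi / 2) + - (\<i> * pi * w / 2)) + e * exp (\<i> * pi / 2 + \<i> * pi * w / 2)"
    by (simp add: gcos_def w(2) algebra_simps add_divide_distrib)
  also have "\<dots> = - \<i> * gcos (- e) w"
    unfolding exp_add half gcos_def by (simp add: algebra_simps)
  finally have "gfac e s = w * (- \<i>) * gfac (- e) w"
    using Gamma_plus1[of w] w \<open>w \<notin> \<int>\<^sub>\<le>\<^sub>0\<close> by (simp add: gfac_def)
  hence "norm (gfac e s) = norm w * norm (gfac (- e) w)" by (simp add: norm_mult)
  also have "norm (gfac (- e) w) = 1" using e w by (intro norm_gfac_half) auto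
  finally show ?thesis by (simp add: w_def)
qed

lemma norm_Gamma_complex_le:
  assumes "Re s > 0"
  shows "norm (Gamma s) \<le> Gamma (Re s)"
proof -
  have "norm (integral {0..} (\<lambda>t. of_real t powr (s - 1) / of_real (exp t))) \<le> integral {0..} (\<lambda>t. t powr (Re s - 1) / exp t)"
    using Gamma_integral_complex[OF assms] Gamma_integral_real[OF assms]
    by (intro integral_norm_bound_integral) (auto simp: norm_divide norm_powr_real_powr has_integral_iff)
  thus ?thesis using Gamma_integral_complex[OF assms] Gamma_integral_real[OF assms] by (simp add: has_integral_iff)
qed

lemma norm_gcos_le:
  assumes "e = 1 \<or> e = - 1"
  shows "norm (gcos e s) \<le> 2 * exp (pi / 2 * \<bar>Im s\<bar>)"
proof -
  have "norm (gcos e s) \<le> exp (pi * Im s / 2) + exp (- (pi * Im s / 2))"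
    unfolding gcos_def using assms norm_triangle_ineq[of "exp (- (\<i> * pi * s / 2))" "e * exp (\<i> * pi * s / 2)"]
    by (auto simp: norm_mult)
  also have "\<dots> \<le> exp (pi / 2 * \<bar>Im s\<bar>) + exp (pi / 2 * \<bar>Im s\<bar>)"
    by (intro add_mono) (auto simp: abs_if)
  finally show ?thesis by simp
qed

text \<open>Interpolates between the two lines on which the modulus is known exactly. This replaces
  Stirling's formula for the modulus; \<open>lam\<close> is a free parameter of the quadratic
  term.\<close>

lemma norm_gfac_le:
  assumes e: "e = 1 \<or> e = - 1" and T: "T > 0" and lam: "lam > 0" and x: "1 / 2 \<le> Re s" "Re s \<le> 3 / 2"
  shows "norm (gfac e s) \<le> exp ((Re s - 1 / 2) * (ln T + (1 / (8 * T) + lam / 2) / T)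
           + ((Im s - T)\<^sup>2 + (Re s - 1 / 2) * (3 / 2 - Re s)) / (2 * lam * T))"
proof -
  define q where "q = 1 / (2 * lam * T)"
  define A' where "A' = ln T + (1 / (8 * T) + lam / 2) / T"
  define f where "f = (\<lambda>z. gfac e (z + \<i> * of_real T))"
  have nonpos: "z \<notin> \<int>\<^sub>\<le>\<^sub>0" if "Re z > 0" for z :: complex using that by (auto simp: nonpos_Ints_def)
  have hol: "f holomorphic_on {z. Re z > 0}"
    unfolding f_def gfac_def gcos_def by (intro holomorphic_intros) (auto intro!: nonpos)
  have "continuous_on {1 / 2..3 / 2} (Gamma :: real \<Rightarrow> real)"
    by (intro continuous_intros) (auto simp: nonpos_Ints_def)
  hence "bounded (Gamma ` {1 / 2..3 / 2 :: real})" by (intro compact_imp_bounded compact_continuous_image) auto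
  then obtain K where "K > 0" "\<forall>y\<in>Gamma ` {1 / 2..3 / 2 :: real}. norm y \<le> K"
    unfolding bounded_pos by blast
  hence K: "\<And>x::real. x \<in> {1 / 2..3 / 2} \<Longrightarrow> norm (Gamma x) \<le> K" "K > 0" by auto
  define C where "C = max (pi / 2) (K * (2 * exp (pi / 2 * T)) / sqrt (2 * pi))"
  have "norm (f (s - \<i> * of_real T)) \<le> exp ((0 * (3 / 2 - Re (s - \<i> * of_real T)) + A' * (Re (s - \<i> * of_real T) - 1 / 2)) / (3 / 2 - 1 / 2)
       + q * ((Im (s - \<i> * of_real T))\<^sup>2 + (Re (s - \<i> * of_real T) - 1 / 2) * (3 / 2 - Re (s - \<i> * of_real T))))"
  proof (rule three_lines_quadratic[where C = C])
    show "q \<ge> 0" using T lam by (simp add: q_def)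
    show "f holomorphic_on {z. 1 / 2 < Re z \<and> Re z < 3 / 2}" by (rule holomorphic_on_subset[OF hol]) auto
    show "continuous_on {z. 1 / 2 \<le> Re z \<and> Re z \<le> 3 / 2} f"
      by (rule continuous_on_subset[OF holomorphic_on_imp_continuous_on[OF hol]]) auto
    show "norm (f z) \<le> C * exp (C * \<bar>Im z\<bar>)" if z: "1 / 2 \<le> Re z" "Re z \<le> 3 / 2" for z
    proof -
      have "norm (Gamma (z + \<i> * of_real T)) \<le> K"
        using norm_Gamma_complex_le[of "z + \<i> * of_real T"] K(1)[of "Re z"] z by auto
      moreover have "norm (gcos e (z + \<i> * of_real T)) \<le> 2 * exp (pi / 2 * T) * exp (pi / 2 * \<bar>Im z\<bar>)"
      proof -
        have "norm (gcos e (z + \<i> * of_real T)) \<le> 2 * exp (pi / 2 * \<bar>Im z + T\<bar>)"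
          using norm_gcos_le[OF e, of "z + \<i> * of_real T"] by simp
        also have "\<dots> \<le> 2 * exp (pi / 2 * T + pi / 2 * \<bar>Im z\<bar>)"
          unfolding distrib_left[symmetric] using T by (intro mult_left_mono) auto
        finally show ?thesis by (simp add: exp_add)
      qed
      ultimately have "norm (f z) \<le> K * (2 * exp (pi / 2 * T) * exp (pi / 2 * \<bar>Im z\<bar>)) / sqrt (2 * pi)"
        unfolding f_def gfac_def norm_divide norm_mult using K
        by (simp del: divide_le_cancel) (intro divide_right_mono mult_mono; simp)
      also have "\<dots> = (K * (2 * exp (pi / 2 * T)) / sqrt (2 * pi)) * exp (pi / 2 * \<bar>Im z\<bar>)" by simp
      also have "\<dots> \<le> C * exp (C * \<bar>Im z\<bar>)"
      proof -
        have c1: "K * (2 * exp (pi / 2 * T)) / sqrt (2 * pi) \<le> C" by (simp add: C_def)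
        moreover have "0 \<le> K * (2 * exp (pi / 2 * T)) / sqrt (2 * pi)" using K by simp
        moreover have "pi / 2 * \<bar>Im z\<bar> \<le> C * \<bar>Im z\<bar>" by (intro mult_right_mono) (auto simp: C_def)
        ultimately show ?thesis by (intro mult_mono) auto
      qed
      finally show ?thesis .
    qed
    show "norm (f z) \<le> exp (0 + q * (Im z)\<^sup>2)" if "Re z = 1 / 2" for z
      using norm_gfac_half[OF e, of "z + \<i> * of_real T"] that T lam by (simp add: f_def q_def)
    show "norm (f z) \<le> exp (A' + q * (Im z)\<^sup>2)" if z: "Re z = 3 / 2" for z
    proof -
      define y where "y = Im z"
      have "norm (f z) = norm (z + \<i> * of_real T - 1)"
        unfolding f_def by (rule norm_gfac_three_halves[OF e]) (use z in auto)
      also have "\<dots> = sqrt (1 / 4 + (T + y)\<^sup>2)"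
        unfolding cmod_def by (simp add: z y_def power2_eq_square add_ac)
      also have "\<dots> \<le> T + \<bar>y\<bar> + 1 / (8 * T)"
      proof (rule real_le_lsqrt)
        have "1 / 4 = 2 * T * (1 / (8 * T))" using T by simp
        also have "\<dots> \<le> 2 * (T + \<bar>y\<bar>) * (1 / (8 * T))" using T by (intro mult_right_mono) auto
        also have "\<dots> \<le> 2 * (T + \<bar>y\<bar>) * (1 / (8 * T)) + (1 / (8 * T))\<^sup>2" by simp
        finally have 1: "1 / 4 \<le> 2 * (T + \<bar>y\<bar>) * (1 / (8 * T)) + (1 / (8 * T))\<^sup>2" .
        have "(T + y)\<^sup>2 \<le> (T + \<bar>y\<bar>)\<^sup>2" using T by (intro power2_le_iff_abs_le[THEN iffD2]) auto
        moreover have "(T + \<bar>y\<bar> + 1 / (8 * T))\<^sup>2 = (T + \<bar>y\<bar>)\<^sup>2 + (2 * (T + \<bar>y\<bar>) * (1 / (8 * T)) + (1 / (8 * T))\<^sup>2)"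
          using power2_sum[of "T + \<bar>y\<bar>" "1 / (8 * T)"] by linarith
        ultimately show "1 / 4 + (T + y)\<^sup>2 \<le> (T + \<bar>y\<bar> + 1 / (8 * T))\<^sup>2" using 1 by linarith
      qed (use T in auto)
      also have "\<dots> = T * (1 + (\<bar>y\<bar> + 1 / (8 * T)) / T)" using T by (simp add: field_simps)
      also have "\<dots> \<le> T * exp ((\<bar>y\<bar> + 1 / (8 * T)) / T)" using T by (intro mult_left_mono exp_ge_add_one_self) auto
      also have "\<dots> = exp (ln T + (\<bar>y\<bar> + 1 / (8 * T)) / T)" using T by (simp add: exp_add)
      \<comment> \<open>The arithmetic-geometric mean inequality turns the growth linear in the
        modulus of \<open>y\<close> into the quadratic form that the three lines lemma
        accepts.\<close>
      also have "\<dots> \<le> exp (A' + q * y\<^sup>2)"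
      proof -
        have "0 \<le> (\<bar>y\<bar> - lam)\<^sup>2" by simp
        hence "2 * lam * \<bar>y\<bar> \<le> y\<^sup>2 + lam\<^sup>2" by (simp add: power2_diff mult_ac)
        hence "\<bar>y\<bar> * (2 * lam) \<le> y\<^sup>2 + lam * lam" by (simp add: mult_ac power2_eq_square)
        hence "\<bar>y\<bar> \<le> (y\<^sup>2 + lam * lam) / (2 * lam)" using lam by (simp add: pos_le_divide_eq)
        also have "\<dots> = y\<^sup>2 / (2 * lam) + lam / 2" using lam by (simp add: add_divide_distrib)
        finally have "\<bar>y\<bar> \<le> y\<^sup>2 / (2 * lam) + lam / 2" .
        hence "\<bar>y\<bar> / T \<le> (y\<^sup>2 / (2 * lam) + lam / 2) / T" using T by (intro divide_right_mono) auto
        thus ?thesis using T lam by (simp add: A'_def q_def add_divide_distrib)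
      qed
      finally show ?thesis by (simp add: y_def)
    qed
  qed (use x in auto)
  thus ?thesis by (simp add: f_def A'_def q_def mult.commute)
qed

section \<open>Dirichlet series with periodic coefficients\<close>

text \<open>A \<open>k\<close>-periodic function whose residue at the integer \<open>n\<close> is \<open>k * c n / (2 * pi * \<i>)\<close>.\<close>
definition per_kernel :: "nat \<Rightarrow> (nat \<Rightarrow> complex) \<Rightarrow> complex \<Rightarrow> complex" where
  "per_kernel k c z = (\<Sum>a=1..k. c a / (exp (2 * of_real pi * \<i> * (z - of_nat a) / of_nat k) - 1))"

lemma exp_unit_eq_1D:
  assumes k: "k > 0" and "exp (2 * of_real pi * \<i> * (z - of_nat a) / of_nat k) = 1"
  obtains n :: int where "z = of_nat a + of_nat k * of_int n"
proof -
  define w where "w = 2 * of_real pi * \<i> * (z - of_nat a) / of_nat k"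
  have "exp w = 1" using assms by (simp add: w_def)
  then obtain n :: int where n: "Re w = 0" "Im w = of_int (2 * n) * pi" by (auto simp: exp_eq_1)
  have "w = \<i> * of_real (of_int (2 * n) * pi)" using n by (simp add: complex_eq_iff)
  hence "2 * of_real pi * \<i> * (z - of_nat a) = 2 * of_real pi * \<i> * (of_nat k * of_int n)"
    using k by (simp add: w_def divide_eq_eq mult_ac)
  hence "z - of_nat a = of_nat k * of_int n" by simp
  hence "z = of_nat a + of_nat k * of_int n" by (simp add: algebra_simps)
  thus thesis by (rule that)
qed

lemma per_kernel_periodic:
  assumes k: "k > 0"
  shows "per_kernel k c (z + of_nat k * of_nat j) = per_kernel k c z"
proof -
  have "exp (2 * of_real pi * \<i> * (z + of_nat k * of_nat j - of_nat a) / of_nat k) = exp (2 * of_real pi * \<i> * (z - of_nat a) / of_nat k)" for a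
  proof -
    have "2 * of_real pi * \<i> * (z + of_nat k * of_nat j - of_nat a) / of_nat k = 2 * of_real pi * \<i> * (z - of_nat a) / of_nat k + of_nat j * (2 * of_real pi * \<i>)"
      using k by (simp add: field_simps)
    also have "exp \<dots> = exp (2 * of_real pi * \<i> * (z - of_nat a) / of_nat k) * (exp (2 * of_real pi * \<i>)) ^ j"
      by (simp only: exp_add exp_of_nat_mult)
    finally show ?thesis by (simp add: exp_two_pi_i)
  qed
  thus ?thesis by (simp add: per_kernel_def)
qed

lemma per_kernel_holomorphic:
  assumes k: "k > 0" and S: "\<And>z n. z \<in> S \<Longrightarrow> z = of_int n \<Longrightarrow> False"
  shows "per_kernel k c holomorphic_on S"
proof -
  have "exp (2 * of_real pi * \<i> * (z - of_nat a) / of_nat k) - 1 \<noteq> 0" if "z \<in> S" for z a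
  proof
    assume "exp (2 * of_real pi * \<i> * (z - of_nat a) / of_nat k) - 1 = 0"
    hence "exp (2 * of_real pi * \<i> * (z - of_nat a) / of_nat k) = 1" by simp
    then obtain n where "z = of_nat a + of_nat k * of_int n" by (rule exp_unit_eq_1D[OF k])
    hence "z = of_int (int a + int k * n)" by simp
    thus False using S[OF that] by blast
  qed
  thus ?thesis unfolding per_kernel_def[abs_def] using k by (intro holomorphic_intros) auto
qed

text \<open>Far below the axis each summand decays by itself. Far above it each tends to
  \<open>- c a\<close>, and only the vanishing sum of the coefficients makes the kernel
  decay.\<close>

lemma norm_per_kernel_far:
  assumes k: "k > 0" and c: "(\<Sum>a=1..k. c a) = 0" and z: "\<bar>Im z\<bar> \<ge> 1"
  shows "norm (per_kernel k c z) \<le> (\<Sum>a=1..k. norm (c a)) / (1 - exp (- (2 * pi / k))) * exp (- (2 * pi / k * \<bar>Im z\<bar>))"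
proof -
  define \<mu> where "\<mu> = 2 * pi / k"
  define Q where "Q = exp (- (\<mu> * \<bar>Im z\<bar>))"
  have \<mu>: "\<mu> > 0" using k by (simp add: \<mu>_def)
  have Q: "0 < Q" "Q \<le> exp (- \<mu>)" "exp (- \<mu>) < 1" using \<mu> z by (auto simp: Q_def)
  have Q1: "Q < 1" using Q by linarith
  define q where "q = (\<lambda>a. exp (2 * of_real pi * \<i> * (z - of_nat a) / of_nat k))"
  have nq: "norm (q a) = exp (- (\<mu> * Im z))" for a
    using k by (simp add: q_def \<mu>_def Re_divide_of_nat)
  have "norm (per_kernel k c z) \<le> (\<Sum>a=1..k. norm (c a) * (Q / (1 - Q)))"
  proof (cases "Im z > 0")
    case True
    hence nq': "norm (q a) = Q" for a by (simp add: nq Q_def)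
    have q1: "q a \<noteq> 1" for a using nq'[of a] Q1 by auto
    have "per_kernel k c z = (\<Sum>a=1..k. c a / (q a - 1)) + (\<Sum>a=1..k. c a)" using c by (simp add: per_kernel_def q_def)
    also have "\<dots> = (\<Sum>a=1..k. c a * (q a / (q a - 1)))"
      unfolding sum.distrib[symmetric] using q1 by (intro sum.cong refl) (simp add: field_simps)
    also have "norm \<dots> \<le> (\<Sum>a=1..k. norm (c a) * (Q / (1 - Q)))"
    proof (rule sum_norm_le)
      fix a
      have "1 - Q \<le> norm (q a - 1)" using norm_triangle_ineq2[of 1 "q a"] nq'[of a] by (simp add: norm_minus_commute)
      hence "norm (q a / (q a - 1)) \<le> Q / (1 - Q)" unfolding norm_divide nq' using Q(1) Q1 by (intro divide_left_mono mult_pos_pos) auto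
      thus "norm (c a * (q a / (q a - 1))) \<le> norm (c a) * (Q / (1 - Q))" unfolding norm_mult by (intro mult_left_mono) auto
    qed
    finally show ?thesis .
  next
    case False
    hence nq': "norm (q a) = 1 / Q" for a using z by (simp add: nq Q_def exp_minus field_simps)
    have "norm (per_kernel k c z) \<le> (\<Sum>a=1..k. norm (c a / (q a - 1)))"
      unfolding per_kernel_def q_def by (rule norm_sum)
    also have "\<dots> \<le> (\<Sum>a=1..k. norm (c a) * (Q / (1 - Q)))"
    proof (rule sum_mono)
      fix a
      have n1: "1 / Q - 1 \<le> norm (q a - 1)" using norm_triangle_ineq2[of "q a" 1] nq'[of a] by simp
      have n2: "1 / Q - 1 > 0" using Q(1) Q1 by (simp add: field_simps)
      have "norm (c a / (q a - 1)) \<le> norm (c a) / (1 / Q - 1)"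
        unfolding norm_divide
        by (intro divide_left_mono mult_pos_pos n1 n2 norm_ge_zero less_le_trans[OF n2 n1])
      also have "\<dots> = norm (c a) * (Q / (1 - Q))" using Q(1) Q1 by (simp add: field_simps)
      finally show "norm (c a / (q a - 1)) \<le> norm (c a) * (Q / (1 - Q))" .
    qed
    finally show ?thesis .
  qed
  also have "\<dots> = (\<Sum>a=1..k. norm (c a)) * Q / (1 - Q)" by (simp add: sum_distrib_right sum_divide_distrib)
  also have "\<dots> \<le> (\<Sum>a=1..k. norm (c a)) * Q / (1 - exp (- \<mu>))"
    by (intro divide_left_mono mult_nonneg_nonneg sum_nonneg mult_pos_pos norm_ge_zero; use Q Q1 in linarith)
  finally show ?thesis by (simp add: Q_def \<mu>_def)
qed

text \<open>The lines of real part \<open>1 / 2 + k * j\<close> avoid all poles, and periodicity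
  reduces them to \<open>j = 0\<close>, so one constant serves all of them.\<close>

lemma per_kernel_bound:
  assumes k: "k > 0" and c: "(\<Sum>a=1..k. c a) = 0"
  obtains C where "C > 0" "\<And>z. \<bar>Im z\<bar> \<ge> 1 \<or> (\<exists>j::nat. Re z = 1 / 2 + real k * real j) \<Longrightarrow> norm (per_kernel k c z) \<le> C * exp (- (2 * pi / k * \<bar>Im z\<bar>))"
proof -
  define \<mu> where "\<mu> = 2 * pi / k"
  have \<mu>: "\<mu> > 0" using k by (simp add: \<mu>_def)
  define K where "K = closed_segment (Complex (1 / 2) (-1)) (Complex (1 / 2) 1)"
  have K: "z \<in> K \<longleftrightarrow> Re z = 1 / 2 \<and> \<bar>Im z\<bar> \<le> 1" for z
    unfolding K_def by (subst closed_segment_same_Re) (auto simp: closed_segment_eq_real_ivl)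
  have "per_kernel k c holomorphic_on K"
  proof (rule per_kernel_holomorphic[OF k])
    fix z n assume "z \<in> K" "z = of_int n"
    hence "real_of_int (2 * n) = 1" by (simp add: K)
    hence "2 * n = 1" by (metis of_int_eq_1_iff)
    thus False by presburger
  qed
  hence "bounded (per_kernel k c ` K)"
    by (intro compact_imp_bounded compact_continuous_image holomorphic_on_imp_continuous_on) (auto simp: K_def)
  then obtain C0 where C0: "C0 > 0" "\<forall>y\<in>per_kernel k c ` K. norm y \<le> C0" unfolding bounded_pos by blast
  define C1 where "C1 = (\<Sum>a=1..k. norm (c a)) / (1 - exp (- \<mu>))"
  define C where "C = max C1 (C0 * exp \<mu>)"
  show thesis
  proof (rule that[of C])
    show "C > 0" using C0 by (simp add: C_def less_max_iff_disj)
    have far: "norm (per_kernel k c z) \<le> C * exp (- (2 * pi / k * \<bar>Im z\<bar>))" if "\<bar>Im z\<bar> \<ge> 1" for z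
    proof -
      have "norm (per_kernel k c z) \<le> C1 * exp (- (2 * pi / k * \<bar>Im z\<bar>))"
        using norm_per_kernel_far[OF k c that] unfolding C1_def \<mu>_def .
      also have "\<dots> \<le> C * exp (- (2 * pi / k * \<bar>Im z\<bar>))" by (intro mult_right_mono) (auto simp: C_def)
      finally show ?thesis .
    qed
    fix z assume "\<bar>Im z\<bar> \<ge> 1 \<or> (\<exists>j::nat. Re z = 1 / 2 + real k * real j)"
    thus "norm (per_kernel k c z) \<le> C * exp (- (2 * pi / k * \<bar>Im z\<bar>))"
    proof
      assume "\<exists>j::nat. Re z = 1 / 2 + real k * real j"
      then obtain j :: nat where j: "Re z = 1 / 2 + real k * real j" ..
      show ?thesis
      proof (cases "\<bar>Im z\<bar> \<ge> 1")
        case False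
        define w where "w = z - of_nat k * of_nat j"
        have w: "w \<in> K" "Im w = Im z" using j False by (auto simp: w_def K)
        have "per_kernel k c z = per_kernel k c w" using per_kernel_periodic[OF k, of c w j] by (simp add: w_def)
        also have "norm \<dots> \<le> C0" using C0 w by auto
        also have "\<dots> \<le> (C0 * exp \<mu>) * exp (- (\<mu> * \<bar>Im z\<bar>))"
          using C0 False \<mu> by (simp add: mult.assoc flip: exp_add)
        also have "\<dots> \<le> C * exp (- (\<mu> * \<bar>Im z\<bar>))" by (intro mult_right_mono) (auto simp: C_def)
        finally show ?thesis by (simp add: \<mu>_def)
      qed (rule far)
    qed (rule far)
  qed
qed

lemma norm_powr_minus_le:
  assumes "Re z \<ge> 0" "z \<noteq> 0"
  shows "norm (z powr (- s)) \<le> norm z powr (- Re s) * exp (pi / 2 * \<bar>Im s\<bar>)"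
proof -
  have "\<bar>Im (Ln z)\<bar> \<le> pi / 2" using Re_Ln_pos_le[of z] assms by simp
  hence "\<bar>Im s * Im (Ln z)\<bar> \<le> \<bar>Im s\<bar> * (pi / 2)" unfolding abs_mult by (intro mult_left_mono) auto
  hence "Im s * Im (Ln z) \<le> pi / 2 * \<bar>Im s\<bar>" by (simp add: mult.commute)
  moreover have "norm (z powr (- s)) = norm z powr (- Re s) * exp (Im s * Im (Ln z))"
    using assms by (simp add: norm_powr_complex Arg_eq_Im_Ln)
  ultimately show ?thesis by (simp add: mult_left_mono)
qed

lemma powr_le_exp:
  assumes "R \<ge> 0" "m > 0"
  obtains K :: real where "K > 0" "\<And>y. y \<ge> 0 \<Longrightarrow> (1 + y) powr R \<le> K * exp (m * y)"
proof -
  define e where "e = m / (R + 1)"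
  have e: "e > 0" "R * e \<le> m" using assms by (auto simp: e_def field_simps)
  show thesis
  proof (rule that[of "exp (R * (e - 1 - ln e))"])
    fix y :: real assume y: "y \<ge> 0"
    have "ln (e * (1 + y)) \<le> e * (1 + y) - 1" using e y by (intro ln_le_minus_one) auto
    moreover have "ln (e * (1 + y)) = ln e + ln (1 + y)" using e y by (subst ln_mult) auto
    ultimately have "ln (1 + y) \<le> (e - 1 - ln e) + e * y" by (simp add: algebra_simps)
    hence "R * ln (1 + y) \<le> R * ((e - 1 - ln e) + e * y)" using assms by (intro mult_left_mono)
    also have "\<dots> = R * (e - 1 - ln e) + (R * e) * y" by (simp add: algebra_simps)
    also have "\<dots> \<le> R * (e - 1 - ln e) + m * y" using e y by (intro add_left_mono mult_right_mono) auto
    finally show "(1 + y) powr R \<le> exp (R * (e - 1 - ln e)) * exp (m * y)"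
      using y by (simp add: powr_def flip: exp_add)
  qed simp
qed

section \<open>Analytic continuation by integrals along vertical lines\<close>

definition line_fun :: "nat \<Rightarrow> (nat \<Rightarrow> complex) \<Rightarrow> complex \<Rightarrow> complex \<Rightarrow> complex" where
  "line_fun k c s z = z powr (- s) * per_kernel k c z"

text \<open>The integration is in the height \<open>y\<close>, so the factor \<open>i\<close> of
  \<open>dz\<close> is missing; it reappears wherever this is compared with a contour
  integral.\<close>

definition line_int :: "nat \<Rightarrow> (nat \<Rightarrow> complex) \<Rightarrow> real \<Rightarrow> nat \<Rightarrow> complex \<Rightarrow> complex" where
  "line_int k c x m s = integral {- real m..real m} (\<lambda>y. line_fun k c s (Complex x y))"

lemma holomorphic_line_fun:
  assumes k: "k > 0" and S: "\<And>z. z \<in> S \<Longrightarrow> Re z > 0" "\<And>z n. z \<in> S \<Longrightarrow> z = of_int n \<Longrightarrow> False"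
  shows "line_fun k c s holomorphic_on S"
  unfolding line_fun_def[abs_def]
  by (intro holomorphic_intros per_kernel_holomorphic k)
     (use S in \<open>force simp: complex_nonpos_Reals_iff\<close>)+

lemma half_not_int: "1 / 2 + real k * real j \<noteq> of_int n"
proof
  assume "1 / 2 + real k * real j = of_int n"
  hence "real_of_int (1 + 2 * (int k * int j)) = real_of_int (2 * n)" by simp
  hence "1 + 2 * (int k * int j) = 2 * n" by (simp only: of_int_eq_iff)
  thus False by presburger
qed

lemma continuous_on_line_fun:
  assumes k: "k > 0"
  shows "continuous_on A (\<lambda>y. line_fun k c s (Complex (1 / 2 + real k * real j) y))"
proof (rule continuous_on_compose2[of "{z. Re z = 1 / 2 + real k * real j}" "line_fun k c s"])
  have pos: "1 / 2 + real k * real j > 0" by (simp add: add_pos_nonneg)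
  show "continuous_on {z. Re z = 1 / 2 + real k * real j} (line_fun k c s)"
    using half_not_int[of k j] half_not_int[of k j, symmetric] pos
    by (intro holomorphic_on_imp_continuous_on holomorphic_line_fun k) (auto simp: complex_eq_iff)
  have "(\<lambda>y. Complex (1 / 2 + real k * real j) y) = (\<lambda>y. of_real (1 / 2 + real k * real j) + \<i> * of_real y)"
    by (auto simp: fun_eq_iff complex_eq_iff)
  thus "continuous_on A (Complex (1 / 2 + real k * real j))"
    by (simp only:) (intro continuous_intros)
qed auto

lemma line_int_holomorphic:
  assumes k: "k > 0"
  shows "line_int k c (1 / 2) m holomorphic_on UNIV"
proof -
  have ne: "Complex (1 / 2) y \<noteq> 0" for y by (simp add: complex_eq_iff)
  have pk: "continuous_on A (\<lambda>y. per_kernel k c (Complex (1 / 2) y))" for A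
  proof (rule continuous_on_compose2[of "{z. Re z = 1 / 2}" "per_kernel k c"])
    show "continuous_on {z. Re z = 1 / 2} (per_kernel k c)"
      using half_not_int[of k 0] half_not_int[of k 0, symmetric] by (intro holomorphic_on_imp_continuous_on per_kernel_holomorphic k) (auto simp: complex_eq_iff)
    have "(\<lambda>y. Complex (1 / 2) y) = (\<lambda>y. of_real (1 / 2) + \<i> * of_real y)"
      by (auto simp: fun_eq_iff complex_eq_iff)
    thus "continuous_on A (Complex (1 / 2))"
      by (simp only:) (intro continuous_intros)
  qed auto
  have cx: "continuous_on A (\<lambda>y. Ln (Complex (1 / 2) y))" for A
  proof -
    have "(\<lambda>y. Complex (1 / 2) y) = (\<lambda>y. of_real (1 / 2) + \<i> * of_real y)"
      by (auto simp: fun_eq_iff complex_eq_iff)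
    thus ?thesis by (simp only:) (intro continuous_intros, auto simp: complex_nonpos_Reals_iff)
  qed
  have "(\<lambda>s. integral (cbox (- real m) (real m)) (\<lambda>y. line_fun k c s (Complex (1 / 2) y))) holomorphic_on UNIV"
  proof (rule leibniz_rule_holomorphic[where fx = "\<lambda>s y. - Ln (Complex (1 / 2) y) * line_fun k c s (Complex (1 / 2) y)"])
    fix s y
    have "((\<lambda>s. exp (- s * Ln (Complex (1 / 2) y)) * per_kernel k c (Complex (1 / 2) y)) has_field_derivative
       - Ln (Complex (1 / 2) y) * (exp (- s * Ln (Complex (1 / 2) y)) * per_kernel k c (Complex (1 / 2) y))) (at s)"
      by (auto intro!: derivative_eq_intros)
    thus "((\<lambda>s. line_fun k c s (Complex (1 / 2) y)) has_field_derivative - Ln (Complex (1 / 2) y) * line_fun k c s (Complex (1 / 2) y)) (at s)"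
      using ne by (simp add: line_fun_def powr_def)
    show "(\<lambda>y. line_fun k c s (Complex (1 / 2) y)) integrable_on cbox (- real m) (real m)"
      using continuous_on_line_fun[OF k, of _ c s 0] by (intro integrable_continuous) auto
  next
    have "continuous_on (UNIV \<times> cbox (- real m) (real m)) (\<lambda>p. - Ln (Complex (1 / 2) (snd p)) * (exp (- fst p * Ln (Complex (1 / 2) (snd p))) * per_kernel k c (Complex (1 / 2) (snd p))))"
      by (intro continuous_intros continuous_on_compose2[OF cx continuous_on_snd] continuous_on_compose2[OF pk continuous_on_snd]) auto
    thus "continuous_on (UNIV \<times> cbox (- real m) (real m)) (\<lambda>(s, y). - Ln (Complex (1 / 2) y) * line_fun k c s (Complex (1 / 2) y))"
      using ne by (simp add: line_fun_def powr_def case_prod_unfold)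
  qed auto
  thus ?thesis by (simp add: line_int_def[abs_def])
qed

text \<open>Half of the decay rate \<open>2 * pi / k\<close> of the kernel is spent on absorbing the
  power of \<open>norm z\<close>.\<close>

lemma norm_line_fun_half:
  assumes k: "k > 0" and c: "(\<Sum>a=1..k. c a) = 0" and R: "R \<ge> 0"
  obtains K where "K > 0" "\<And>s y. \<bar>Re s\<bar> \<le> R \<Longrightarrow> norm (line_fun k c s (Complex (1 / 2) y)) \<le> K * exp (pi / 2 * \<bar>Im s\<bar>) * exp (- (pi / k * \<bar>y\<bar>))"
proof -
  obtain C where C: "C > 0" "\<And>z. \<bar>Im z\<bar> \<ge> 1 \<or> (\<exists>j::nat. Re z = 1 / 2 + real k * real j) \<Longrightarrow> norm (per_kernel k c z) \<le> C * exp (- (2 * pi / k * \<bar>Im z\<bar>))"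
    using per_kernel_bound[OF k c] by blast
  obtain K1 where K1: "K1 > 0" "\<And>y. y \<ge> 0 \<Longrightarrow> (1 + y) powr R \<le> K1 * exp (pi / k * y)"
    using powr_le_exp[of R "pi / k"] R k by auto
  show thesis
  proof (rule that[of "2 powr R * K1 * C"])
    show "2 powr R * K1 * C > 0" using K1 C by simp
    fix s y assume s: "\<bar>Re s\<bar> \<le> R"
    define z where "z = Complex (1 / 2) y"
    have z: "Re z = 1 / 2" "Im z = y" "z \<noteq> 0" by (auto simp: z_def complex_eq_iff)
    have z1: "1 / 2 \<le> norm z" using abs_Re_le_cmod[of z] z by simp
    have z2: "norm z \<le> 1 + \<bar>y\<bar>" using cmod_le[of z] z by simp
    have "norm z powr (- Re s) \<le> 2 powr R * (1 + \<bar>y\<bar>) powr R"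
    proof (cases "Re s \<ge> 0")
      case True
      have "norm z powr (- Re s) \<le> (1 / 2) powr (- Re s)" using z1 True by (intro powr_mono2') auto
      also have "\<dots> = 2 powr (Re s) * 1 powr R" by (simp add: powr_minus powr_divide)
      also have "\<dots> \<le> 2 powr R * (1 + \<bar>y\<bar>) powr R" using s R by (intro mult_mono powr_mono powr_mono2) auto
      finally show ?thesis .
    next
      case False
      have "norm z powr (- Re s) \<le> (1 + \<bar>y\<bar>) powr (- Re s)" using z1 z2 False by (intro powr_mono2) auto
      also have "\<dots> \<le> 1 * (1 + \<bar>y\<bar>) powr R" using s by (simp, intro powr_mono) auto
      also have "\<dots> \<le> 2 powr R * (1 + \<bar>y\<bar>) powr R" using R by (intro mult_right_mono) (auto simp: ge_one_powr_ge_zero)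
      finally show ?thesis .
    qed
    also have "\<dots> \<le> 2 powr R * (K1 * exp (pi / k * \<bar>y\<bar>))" by (intro mult_left_mono K1) auto
    finally have "norm (z powr (- s)) \<le> (2 powr R * (K1 * exp (pi / k * \<bar>y\<bar>))) * exp (pi / 2 * \<bar>Im s\<bar>)"
      using z by (intro order_trans[OF norm_powr_minus_le] mult_right_mono) auto
    moreover have "norm (per_kernel k c z) \<le> C * exp (- (2 * pi / k * \<bar>y\<bar>))" using C(2)[of z] z by (auto intro: exI[of _ 0])
    ultimately have "norm (line_fun k c s z) \<le> (2 powr R * (K1 * exp (pi / k * \<bar>y\<bar>))) * exp (pi / 2 * \<bar>Im s\<bar>) * (C * exp (- (2 * pi / k * \<bar>y\<bar>)))"
      unfolding line_fun_def norm_mult using K1 by (intro mult_mono) auto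
    also have "\<dots> = 2 powr R * K1 * C * exp (pi / 2 * \<bar>Im s\<bar>) * (exp (pi / k * \<bar>y\<bar>) * exp (- (2 * pi / k * \<bar>y\<bar>)))" by simp
    also have "exp (pi / k * \<bar>y\<bar>) * exp (- (2 * pi / k * \<bar>y\<bar>)) = exp (- (pi / k * \<bar>y\<bar>))"
      unfolding exp_add[symmetric] by (rule arg_cong[of _ _ exp]) simp
    finally show "norm (line_fun k c s (Complex (1 / 2) y)) \<le> 2 powr R * K1 * C * exp (pi / 2 * \<bar>Im s\<bar>) * exp (- (pi / k * \<bar>y\<bar>))"
      by (simp add: z_def)
  qed
qed

text \<open>The differences of successive truncations are bounded by a geometric series of ratio
  \<open>exp (- (pi / k))\<close>, locally uniformly in \<open>s\<close>. This gives an entire limit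
  and at the same time the exponential growth bound in vertical strips.\<close>

lemma line_int_entire:
  assumes k: "k > 0" and c: "(\<Sum>a=1..k. c a) = 0"
  obtains l where "l holomorphic_on UNIV" "\<And>s. (\<lambda>m. line_int k c (1 / 2) m s) \<longlonglongrightarrow> l s"
    "\<And>R. R \<ge> 0 \<Longrightarrow> \<exists>K. \<forall>s. \<bar>Re s\<bar> \<le> R \<longrightarrow> norm (l s) \<le> K * exp (pi / 2 * \<bar>Im s\<bar>)"
proof -
  define f where "f = line_int k c (1 / 2)"
  define g where "g = (\<lambda>j s. f (Suc j) s - f j s)"
  have fg: "f m s = (\<Sum>j<m. g j s)" for m s
    by (induction m) (auto simp: g_def f_def line_int_def)
  define r where "r = exp (- (pi / k))"
  have r: "0 < r" "r < 1" using k by (auto simp: r_def)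
  have int: "(\<lambda>y. line_fun k c s (Complex (1 / 2) y)) integrable_on {a..b}" for s a b
    using continuous_on_line_fun[OF k, of "{a..b}" c s 0] by (intro integrable_continuous_interval) auto
  have bound: "\<exists>K>0. \<forall>j s. \<bar>Re s\<bar> \<le> R \<longrightarrow> norm (g j s) \<le> K * exp (pi / 2 * \<bar>Im s\<bar>) * r ^ j" if R: "R \<ge> 0" for R
  proof -
    obtain K where K: "K > 0" "\<And>s y. \<bar>Re s\<bar> \<le> R \<Longrightarrow> norm (line_fun k c s (Complex (1 / 2) y)) \<le> K * exp (pi / 2 * \<bar>Im s\<bar>) * exp (- (pi / k * \<bar>y\<bar>))"
      using norm_line_fun_half[OF k c R] by blast
    have "norm (g j s) \<le> (2 * K) * exp (pi / 2 * \<bar>Im s\<bar>) * r ^ j" if s: "\<bar>Re s\<bar> \<le> R" for j s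
    proof -
      let ?h = "\<lambda>y. line_fun k c s (Complex (1 / 2) y)"
      have b: "norm (?h y) \<le> K * exp (pi / 2 * \<bar>Im s\<bar>) * r ^ j" if "\<bar>y\<bar> \<ge> real j" for y
      proof -
        have "exp (- (pi / k * \<bar>y\<bar>)) \<le> exp (- (pi / k * real j))" using that k by (auto intro!: mult_left_mono divide_right_mono)
        also have "\<dots> = r ^ j" by (simp add: r_def exp_of_nat_mult[symmetric] mult.commute)
        finally have "K * exp (pi / 2 * \<bar>Im s\<bar>) * exp (- (pi / k * \<bar>y\<bar>)) \<le> K * exp (pi / 2 * \<bar>Im s\<bar>) * r ^ j" using K by (intro mult_left_mono) auto
        thus ?thesis using K(2)[OF s, of y] by simp
      qed
      have e: "f (Suc j) s = integral {- real (Suc j)..- real j} ?h + f j s + integral {real j..real (Suc j)} ?h"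
        unfolding f_def line_int_def
      proof -
        have h1: "integral {- real (Suc j)..- real j} ?h + integral {- real j..real (Suc j)} ?h = integral {- real (Suc j)..real (Suc j)} ?h"
          by (rule Henstock_Kurzweil_Integration.integral_combine[OF _ _ int]) auto
        have h2: "integral {- real j..real j} ?h + integral {real j..real (Suc j)} ?h = integral {- real j..real (Suc j)} ?h"
          by (rule Henstock_Kurzweil_Integration.integral_combine[OF _ _ int]) auto
        show "integral {- real (Suc j)..real (Suc j)} ?h = integral {- real (Suc j)..- real j} ?h + integral {- real j..real j} ?h + integral {real j..real (Suc j)} ?h"
          by (simp only: add.assoc h2 h1)
      qed
      have i1: "norm (integral {real j..real (Suc j)} ?h) \<le> K * exp (pi / 2 * \<bar>Im s\<bar>) * r ^ j * (real (Suc j) - real j)"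
        by (rule integral_bound) (use continuous_on_line_fun[OF k, of _ c s 0] b in auto)
      have i2: "norm (integral {- real (Suc j)..- real j} ?h) \<le> K * exp (pi / 2 * \<bar>Im s\<bar>) * r ^ j * (- real j - (- real (Suc j)))"
        by (rule integral_bound) (use continuous_on_line_fun[OF k, of _ c s 0] b in auto)
      have "g j s = integral {- real (Suc j)..- real j} ?h + integral {real j..real (Suc j)} ?h" using e by (simp add: g_def)
      thus ?thesis using i1 i2 norm_triangle_ineq[of "integral {- real (Suc j)..- real j} ?h" "integral {real j..real (Suc j)} ?h"] by simp
    qed
    thus ?thesis using K by (intro exI[of _ "2 * K"]) auto
  qed
  define l where "l = (\<lambda>s. \<Sum>j. g j s)"
  have ul: "uniform_limit (cball 0 R) f l sequentially" if R: "R \<ge> 0" for R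
  proof -
    obtain K where K: "K > 0" "\<And>j s. \<bar>Re s\<bar> \<le> R \<Longrightarrow> norm (g j s) \<le> K * exp (pi / 2 * \<bar>Im s\<bar>) * r ^ j" using bound[OF R] by blast
    have "uniform_limit (cball 0 R) (\<lambda>n s. \<Sum>j<n. g j s) (\<lambda>s. \<Sum>j. g j s) sequentially"
    proof (rule Weierstrass_m_test[where M = "\<lambda>j. K * exp (pi / 2 * R) * r ^ j"])
      fix j s assume "s \<in> cball (0::complex) R"
      hence s: "\<bar>Re s\<bar> \<le> R" "\<bar>Im s\<bar> \<le> R" using abs_Re_le_cmod[of s] abs_Im_le_cmod[of s] by auto
      have "norm (g j s) \<le> K * exp (pi / 2 * \<bar>Im s\<bar>) * r ^ j" by (rule K(2)[OF s(1)])
      also have "\<dots> \<le> K * exp (pi / 2 * R) * r ^ j" using K r s by (intro mult_right_mono mult_left_mono) auto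
      finally show "norm (g j s) \<le> K * exp (pi / 2 * R) * r ^ j" .
    qed (use r in \<open>auto intro!: summable_mult summable_geometric\<close>)
    thus ?thesis unfolding fg[abs_def] l_def .
  qed
  show thesis
  proof (rule that[of l])
    show "l holomorphic_on UNIV"
    proof (rule holomorphic_uniform_sequence[of UNIV f l])
      show "f n holomorphic_on UNIV" for n unfolding f_def by (rule line_int_holomorphic[OF k])
      fix x :: complex
      have "uniform_limit (cball x 1) f l sequentially"
        by (rule uniform_limit_on_subset[OF ul[of "norm x + 1"]])
           (auto simp: dist_norm, smt (verit, ccfv_threshold) norm_minus_commute norm_triangle_sub)
      thus "\<exists>d>0. cball x d \<subseteq> UNIV \<and> uniform_limit (cball x d) f l sequentially" by (intro exI[of _ 1]) auto
    qed auto
    show "(\<lambda>m. line_int k c (1 / 2) m s) \<longlonglongrightarrow> l s" for s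
      using tendsto_uniform_limitI[OF ul[of "norm s"], of s] by (simp add: f_def)
    show "\<exists>K. \<forall>s. \<bar>Re s\<bar> \<le> R \<longrightarrow> norm (l s) \<le> K * exp (pi / 2 * \<bar>Im s\<bar>)" if R: "R \<ge> 0" for R
    proof -
      obtain K where K: "K > 0" "\<And>j s. \<bar>Re s\<bar> \<le> R \<Longrightarrow> norm (g j s) \<le> K * exp (pi / 2 * \<bar>Im s\<bar>) * r ^ j" using bound[OF R] by blast
      have "norm (l s) \<le> K / (1 - r) * exp (pi / 2 * \<bar>Im s\<bar>)" if s: "\<bar>Re s\<bar> \<le> R" for s
      proof -
        have sm: "summable (\<lambda>j. K * exp (pi / 2 * \<bar>Im s\<bar>) * r ^ j)" using r by (intro summable_mult summable_geometric) auto
        have "norm (l s) \<le> (\<Sum>j. K * exp (pi / 2 * \<bar>Im s\<bar>) * r ^ j)"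
          unfolding l_def by (rule norm_suminf_le[OF K(2)[OF s] sm])
        also have "\<dots> = K * exp (pi / 2 * \<bar>Im s\<bar>) * (1 / (1 - r))" using r by (subst suminf_mult) (auto simp: suminf_geometric intro!: summable_geometric)
        finally show ?thesis by simp
      qed
      thus ?thesis by blast
    qed
  qed
qed


lemma contour_integral_rectpath:
  assumes f: "continuous_on (path_image (rectpath a1 a3)) f" and le: "Re a1 \<le> Re a3" "Im a1 \<le> Im a3"
  shows "contour_integral (rectpath a1 a3) f =
    contour_integral (linepath a1 (Complex (Re a3) (Im a1))) f
    + contour_integral (linepath (Complex (Re a3) (Im a1)) a3) f
    - contour_integral (linepath (Complex (Re a1) (Im a3)) a3) f
    - contour_integral (linepath a1 (Complex (Re a1) (Im a3))) f"
proof -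
  define a2 a4 where "a2 = Complex (Re a3) (Im a1)" and "a4 = Complex (Re a1) (Im a3)"
  have pi: "path_image (rectpath a1 a3) = closed_segment a1 a2 \<union> closed_segment a2 a3 \<union> closed_segment a3 a4 \<union> closed_segment a4 a1"
    by (simp add: rectpath_def Let_def path_image_join a2_def a4_def Un_assoc)
  have c: "continuous_on (closed_segment a1 a2) f" "continuous_on (closed_segment a2 a3) f" "continuous_on (closed_segment a3 a4) f" "continuous_on (closed_segment a4 a1) f"
    using f unfolding pi by (auto intro: continuous_on_subset)
  have i: "f contour_integrable_on linepath a1 a2" "f contour_integrable_on linepath a2 a3" "f contour_integrable_on linepath a3 a4" "f contour_integrable_on linepath a4 a1"
    using c by (auto intro: contour_integrable_continuous_linepath)
  have "contour_integral (rectpath a1 a3) f = contour_integral (linepath a1 a2) f + (contour_integral (linepath a2 a3) f + (contour_integral (linepath a3 a4) f + contour_integral (linepath a4 a1) f))"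
    unfolding rectpath_def Let_def a2_def[symmetric] a4_def[symmetric]
    using i by (subst contour_integral_join | simp add: contour_integrable_join)+
  also have "contour_integral (linepath a3 a4) f = - contour_integral (linepath a4 a3) f"
    by (rule contour_integral_reverse_linepath[OF c(3)])
  also have "contour_integral (linepath a4 a1) f = - contour_integral (linepath a1 a4) f"
    by (rule contour_integral_reverse_linepath[OF c(4)])
  finally show ?thesis by (simp add: a2_def a4_def)
qed

text \<open>Residue theorem, one residue class at a time: between the two vertical sides the summand
  of index \<open>a\<close> has the single simple pole \<open>k * J + a\<close>.\<close>

lemma line_fun_rectangle:
  assumes k: "k > 0" and m: "m > 0"
  defines "x \<equiv> (\<lambda>j::nat. 1 / 2 + real k * real j)"
  shows "contour_integral (rectpath (Complex (x J) (- m)) (Complex (x (Suc J)) m)) (line_fun k c s)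
     = of_nat k * (\<Sum>a=1..k. c a / of_nat (k * J + a) powr s)"
proof -
  define R where "R = rectpath (Complex (x J) (- m)) (Complex (x (Suc J)) m)"
  define S where "S = {z. x J - 1 / 4 < Re z \<and> Re z < x (Suc J) + 1 / 4}"
  have xx: "x (Suc J) = x J + k" by (simp add: x_def algebra_simps)
  have le: "Re (Complex (x J) (- m)) \<le> Re (Complex (x (Suc J)) m)" "Im (Complex (x J) (- m)) \<le> Im (Complex (x (Suc J)) m)"
    using m by (auto simp: xx)
  have opS: "open S" unfolding S_def by (simp add: open_halfspace_Re_gt open_halfspace_Re_lt open_Collect_conj)
  have "convex S"
  proof -
    have "S = {z. Re z > x J - 1 / 4} \<inter> {z. Re z < x (Suc J) + 1 / 4}" by (auto simp: S_def)
    thus ?thesis by (simp add: convex_Int convex_halfspace_Re_gt convex_halfspace_Re_lt)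
  qed
  hence conS: "connected S" by (rule convex_connected)
  have x0: "x J \<ge> 1 / 2" by (simp add: x_def)
  define E where "E = (\<lambda>a z. exp (2 * of_real pi * \<i> * (z - of_nat a) / of_nat k) - 1 :: complex)"
  have holE: "E a holomorphic_on A" for a A unfolding E_def using k by (intro holomorphic_intros) auto
  have holp: "(\<lambda>z. z powr (- s)) holomorphic_on S"
    using x0 by (intro holomorphic_intros) (auto simp: S_def complex_nonpos_Reals_iff)
  have piR: "path_image R = {z. Re z \<in> {x J, x (Suc J)} \<and> Im z \<in> {- m..m}} \<union> {z. Im z \<in> {- m, m} \<and> Re z \<in> {x J..x (Suc J)}}"
    unfolding R_def using path_image_rectpath[OF le] by simp
  have pS: "path_image R \<subseteq> S" unfolding piR using xx by (auto simp: S_def)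
  have trm: "contour_integral R (\<lambda>z. z powr (- s) / E a z) = of_nat k / of_nat (k * J + a) powr s
      \<and> (\<lambda>z. z powr (- s) / E a z) contour_integrable_on R" if a: "a \<in> {1..k}" for a
  proof -
    define p :: complex where "p = of_nat (k * J + a)"
    have Ez: "z = p" if "z \<in> S" "E a z = 0" for z
    proof -
      from that obtain n :: int where n: "z = of_nat a + of_nat k * of_int n"
        using exp_unit_eq_1D[OF k, of z a] by (auto simp: E_def)
      hence "Re z = real_of_int (int a + int k * n)" by simp
      moreover have "x J - 1 / 4 < Re z" "Re z < x J + k + 1 / 4" using that by (auto simp: S_def xx)
      ultimately have "real_of_int (int k * int J) < real_of_int (int a + int k * n)" "real_of_int (int a + int k * n) < real_of_int (int k * int J + int k + 1)"
        by (simp_all add: x_def)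
      hence "int k * int J < int a + int k * n" "int a + int k * n < int k * int J + int k + 1" by (simp_all only: of_int_less_iff)
      hence "int k * (int J - n) < int k * 1" "int k * (n - int J) < int k * 1" using a by (simp_all add: algebra_simps)
      hence "int J - n < 1" "n - int J < 1" using k by (simp_all only: mult_less_cancel_left_pos of_nat_0_less_iff)
      hence "n = int J" by simp
      thus ?thesis by (simp add: n p_def)
    qed
    have Ep: "E a p = 0"
    proof -
      have "2 * of_real pi * \<i> * (p - of_nat a) / of_nat k = of_nat J * (2 * of_real pi * \<i>)" using k by (simp add: p_def)
      thus ?thesis unfolding E_def by (simp add: exp_of_nat_mult exp_two_pi_i)
    qed
    have pbox: "x J < Re p" "Re p < x (Suc J)" using a by (auto simp: p_def x_def algebra_simps)
    have "p \<in> S" using pbox by (auto simp: S_def)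
    have "p \<noteq> 0" using pbox x0 by auto
    have Ed: "(E a has_field_derivative 2 * of_real pi * \<i> / of_nat k) (at p)"
    proof -
      have "(E a has_field_derivative exp (2 * of_real pi * \<i> * (p - of_nat a) / of_nat k) * (2 * of_real pi * \<i> / of_nat k)) (at p)"
        unfolding E_def using k by (auto intro!: derivative_eq_intros)
      thus ?thesis using Ep by (simp add: E_def)
    qed
    have holf: "(\<lambda>z. z powr (- s) / E a z) holomorphic_on S - {p}"
      using Ez by (intro holomorphic_intros holE holomorphic_on_subset[OF holp]) auto
    have pRp: "path_image R \<subseteq> S - {p}"
      using pS pbox unfolding piR using m by (auto simp: p_def)
    have "residue (\<lambda>z. z powr (- s) / E a z) p = p powr (- s) / (2 * of_real pi * \<i> / of_nat k)"
      by (rule residue_simple_pole_deriv[OF holp holE opS conS \<open>p \<in> S\<close> Ed]) (use \<open>p \<noteq> 0\<close> Ep k in auto)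
    moreover have "contour_integral R (\<lambda>z. z powr (- s) / E a z) = 2 * pi * \<i> * (\<Sum>q\<in>{p}. winding_number R q * residue (\<lambda>z. z powr (- s) / E a z) q)"
    proof (rule Residue_theorem[OF opS conS _ holf _ _ pRp])
      show "\<forall>z. z \<notin> S \<longrightarrow> winding_number R z = 0"
      proof (intro allI impI)
        fix z assume "z \<notin> S"
        thus "winding_number R z = 0" unfolding R_def
          by (intro winding_number_rectpath_outside le) (auto simp: S_def in_cbox_complex_iff)
      qed
    qed (auto simp: R_def)
    moreover have "winding_number R p = 1" unfolding R_def using pbox m
      by (intro winding_number_rectpath) (auto simp: in_box_complex_iff p_def)
    ultimately have "contour_integral R (\<lambda>z. z powr (- s) / E a z) = of_nat k * p powr (- s)" using k by simp
    moreover have "(\<lambda>z. z powr (- s) / E a z) contour_integrable_on R"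
      by (rule contour_integrable_holomorphic_simple[OF holf _ _ pRp]) (auto simp: R_def opS intro!: open_Diff)
    ultimately show ?thesis by (simp add: powr_minus p_def divide_inverse)
  qed
  have "contour_integral R (line_fun k c s) = contour_integral R (\<lambda>z. \<Sum>a=1..k. c a * (z powr (- s) / E a z))"
    by (rule arg_cong[of _ _ "contour_integral R"]) (auto simp: fun_eq_iff line_fun_def per_kernel_def E_def sum_distrib_left mult_ac)
  also have "\<dots> = (\<Sum>a=1..k. contour_integral R (\<lambda>z. c a * (z powr (- s) / E a z)))"
    using trm by (intro contour_integral_sum contour_integrable_lmul) auto
  also have "\<dots> = (\<Sum>a=1..k. c a * (of_nat k / of_nat (k * J + a) powr s))"
    using trm by (intro sum.cong refl, subst contour_integral_lmul) auto
  finally show ?thesis by (simp add: R_def sum_distrib_left mult_ac)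
qed

lemma line_fun_horizontal:
  assumes k: "k > 0" and c: "(\<Sum>a=1..k. c a) = 0" and x: "0 \<le> x0" "x0 \<le> x1"
  obtains K where "\<And>m y. m \<ge> (1::nat) \<Longrightarrow> \<bar>y\<bar> = real m \<Longrightarrow> norm (contour_integral (linepath (Complex x0 y) (Complex x1 y)) (line_fun k c s)) \<le> K * exp (- (pi / k * real m))"
proof -
  obtain C where C: "C > 0" "\<And>z. \<bar>Im z\<bar> \<ge> 1 \<or> (\<exists>j::nat. Re z = 1 / 2 + real k * real j) \<Longrightarrow> norm (per_kernel k c z) \<le> C * exp (- (2 * pi / k * \<bar>Im z\<bar>))"
    using per_kernel_bound[OF k c] by blast
  obtain K1 where K1: "K1 > 0" "\<And>y. y \<ge> 0 \<Longrightarrow> (1 + y) powr \<bar>Re s\<bar> \<le> K1 * exp (pi / k * y)"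
    using powr_le_exp[of "\<bar>Re s\<bar>" "pi / k"] k by auto
  define K where "K = K1 * exp (pi / k * x1) * exp (pi / 2 * \<bar>Im s\<bar>) * C * (x1 - x0)"
  show thesis
  proof (rule that[of K])
    fix m :: nat and y :: real assume m: "m \<ge> 1" "\<bar>y\<bar> = real m"
    let ?B = "(K1 * exp (pi / k * (x1 + m))) * exp (pi / 2 * \<bar>Im s\<bar>) * (C * exp (- (2 * pi / k * m)))"
    have seg: "z \<in> closed_segment (Complex x0 y) (Complex x1 y) \<longleftrightarrow> Im z = y \<and> x0 \<le> Re z \<and> Re z \<le> x1" for z
      using x by (subst closed_segment_same_Im) (auto simp: closed_segment_eq_real_ivl)
    have y0: "y \<noteq> 0" using m by auto
    have b: "norm (line_fun k c s z) \<le> ?B" if z: "Im z = y" "x0 \<le> Re z" "Re z \<le> x1" for z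
    proof -
      have z0: "z \<noteq> 0" using z y0 by auto
      have n1: "1 \<le> norm z" using abs_Im_le_cmod[of z] z m by simp
      have n2: "norm z \<le> 1 + (x1 + m)" using cmod_le[of z] z m x by simp
      have "norm z powr (- Re s) \<le> norm z powr \<bar>Re s\<bar>" using n1 by (intro powr_mono) auto
      also have "\<dots> \<le> (1 + (x1 + m)) powr \<bar>Re s\<bar>" using n2 by (intro powr_mono2) auto
      also have "\<dots> \<le> K1 * exp (pi / k * (x1 + m))" using x by (intro K1) auto
      finally have "norm (z powr (- s)) \<le> (K1 * exp (pi / k * (x1 + m))) * exp (pi / 2 * \<bar>Im s\<bar>)"
        using z z0 x by (intro order_trans[OF norm_powr_minus_le] mult_right_mono) auto
      moreover have "norm (per_kernel k c z) \<le> C * exp (- (2 * pi / k * m))" using C(2)[of z] z m by auto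
      ultimately show ?thesis unfolding line_fun_def norm_mult using K1 by (intro mult_mono) auto
    qed
    have hol: "line_fun k c s holomorphic_on {z. Im z \<noteq> 0}"
      unfolding line_fun_def[abs_def] by (intro holomorphic_intros per_kernel_holomorphic k) (auto simp: complex_nonpos_Reals_iff)
    have "norm (contour_integral (linepath (Complex x0 y) (Complex x1 y)) (line_fun k c s)) \<le> ?B * norm (Complex x1 y - Complex x0 y)"
    proof (rule contour_integral_bound_linepath)
      show "line_fun k c s contour_integrable_on linepath (Complex x0 y) (Complex x1 y)"
        using y0 by (intro contour_integrable_continuous_linepath holomorphic_on_imp_continuous_on holomorphic_on_subset[OF hol]) (auto simp: seg)
    qed (use b seg K1 C in auto)
    also have "norm (Complex x1 y - Complex x0 y) = x1 - x0" using x by (simp add: cmod_def)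
    also have "?B * (x1 - x0) = K1 * exp (pi / 2 * \<bar>Im s\<bar>) * C * (x1 - x0) * (exp (pi / k * (x1 + m)) * exp (- (2 * pi / k * m)))" by simp
    also have "exp (pi / k * (x1 + m)) * exp (- (2 * pi / k * m)) = exp (pi / k * x1) * exp (- (pi / k * m))"
      unfolding exp_add[symmetric] by (rule arg_cong[of _ _ exp]) (simp add: add_divide_distrib distrib_left)
    finally show "norm (contour_integral (linepath (Complex x0 y) (Complex x1 y)) (line_fun k c s)) \<le> K * exp (- (pi / k * real m))"
      by (simp add: K_def mult_ac)
  qed
qed

lemma line_fun_horizontal_tendsto:
  assumes k: "k > 0" and c: "(\<Sum>a=1..k. c a) = 0" and x: "0 \<le> x0" "x0 \<le> x1"
  shows "(\<lambda>m. contour_integral (linepath (Complex x0 (- real m)) (Complex x1 (- real m))) (line_fun k c s)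
           - contour_integral (linepath (Complex x0 (real m)) (Complex x1 (real m))) (line_fun k c s)) \<longlonglongrightarrow> 0"
proof -
  obtain K where K: "\<And>m y. m \<ge> (1::nat) \<Longrightarrow> \<bar>y\<bar> = real m \<Longrightarrow> norm (contour_integral (linepath (Complex x0 y) (Complex x1 y)) (line_fun k c s)) \<le> K * exp (- (pi / k * real m))"
    using line_fun_horizontal[OF k c x] by blast
  have lim: "(\<lambda>m. 2 * K * exp (- (pi / k * real m))) \<longlonglongrightarrow> 0"
  proof -
    have "(\<lambda>m. exp (- (a * real m))) \<longlonglongrightarrow> 0" if "a > 0" for a :: real
      using that by real_asymp
    from this[of "pi / k"] have "(\<lambda>m. exp (- (pi / k * real m))) \<longlonglongrightarrow> 0" using k by simp
    from tendsto_mult_right_zero[OF this, of "2 * K"] show ?thesis by simp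
  qed
  show ?thesis
  proof (rule Lim_null_comparison[OF _ lim], rule eventually_sequentiallyI[of 1])
    fix m :: nat assume m: "m \<ge> 1"
    show "norm (contour_integral (linepath (Complex x0 (- real m)) (Complex x1 (- real m))) (line_fun k c s)
           - contour_integral (linepath (Complex x0 (real m)) (Complex x1 (real m))) (line_fun k c s)) \<le> 2 * K * exp (- (pi / k * real m))"
      using K[of m "- real m"] K[of m "real m"] m by (intro order_trans[OF norm_triangle_ineq4]) auto
  qed
qed

text \<open>As \<open>m\<close> grows the horizontal sides vanish, so moving the line by one period
  collects one block of \<open>k\<close> terms of the Dirichlet series.\<close>

lemma line_int_step:
  assumes k: "k > 0" and c: "(\<Sum>a=1..k. c a) = 0"
  defines "x \<equiv> (\<lambda>j::nat. 1 / 2 + real k * real j)"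
  shows "(\<lambda>m. \<i> * (line_int k c (x (Suc J)) m s - line_int k c (x J) m s)) \<longlonglongrightarrow> of_nat k * (\<Sum>a=1..k. c a / of_nat (k * J + a) powr s)"
proof -
  define S where "S = of_nat k * (\<Sum>a=1..k. c a / of_nat (k * J + a) powr s)"
  define h where "h = (\<lambda>m::nat. contour_integral (linepath (Complex (x J) (- real m)) (Complex (x (Suc J)) (- real m))) (line_fun k c s)
           - contour_integral (linepath (Complex (x J) (real m)) (Complex (x (Suc J)) (real m))) (line_fun k c s))"
  have xs: "0 \<le> x J" "x J \<le> x (Suc J)" by (auto simp: x_def algebra_simps)
  have xpos: "x J > 0" by (simp add: x_def add_pos_nonneg)
  have h: "h \<longlonglongrightarrow> 0" unfolding h_def by (rule line_fun_horizontal_tendsto[OF k c xs])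
  have eq: "\<i> * (line_int k c (x (Suc J)) m s - line_int k c (x J) m s) = S - h m" if m: "m \<ge> 1" for m :: nat
  proof -
    have le: "Re (Complex (x J) (- real m)) \<le> Re (Complex (x (Suc J)) (real m))" "Im (Complex (x J) (- real m)) \<le> Im (Complex (x (Suc J)) (real m))"
      using xs by auto
    have pi: "path_image (rectpath (Complex (x J) (- real m)) (Complex (x (Suc J)) (real m))) \<subseteq> {z. Re z > 0 \<and> (Im z \<noteq> 0 \<or> Re z = x J \<or> Re z = x (Suc J))}"
      using path_image_rectpath[OF le] xs xpos m by auto
    have hol: "line_fun k c s holomorphic_on {z. Re z > 0 \<and> (Im z \<noteq> 0 \<or> Re z = x J \<or> Re z = x (Suc J))}"
    proof (rule holomorphic_line_fun[OF k])
      fix z n assume "z \<in> {z. Re z > 0 \<and> (Im z \<noteq> 0 \<or> Re z = x J \<or> Re z = x (Suc J))}" "z = of_int n"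
      thus False using half_not_int[of k J n] half_not_int[of k "Suc J" n] by (auto simp: x_def)
    qed auto
    have ci: "contour_integral (linepath (Complex X (- real m)) (Complex X (real m))) (line_fun k c s) = \<i> * line_int k c X m s" for X
      unfolding line_int_def using m by (intro contour_integral_linepath_same_Re) auto
    have "S = contour_integral (rectpath (Complex (x J) (- real m)) (Complex (x (Suc J)) (real m))) (line_fun k c s)"
      unfolding S_def x_def using m by (intro line_fun_rectangle[symmetric] k) auto
    also have "\<dots> = h m + \<i> * line_int k c (x (Suc J)) m s - \<i> * line_int k c (x J) m s"
      using contour_integral_rectpath[OF continuous_on_subset[OF holomorphic_on_imp_continuous_on[OF hol] pi] le]
      by (simp add: h_def ci)
    finally show ?thesis by (simp add: algebra_simps)
  qed
  have "(\<lambda>m. S - h m) \<longlonglongrightarrow> S - 0" by (intro tendsto_intros h)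
  hence "(\<lambda>m. S - h m) \<longlonglongrightarrow> S" by simp
  thus ?thesis unfolding S_def[symmetric]
    by (rule Lim_transform_eventually) (use eq in \<open>auto intro!: eventually_sequentiallyI[of 1] simp: eq\<close>)
qed

lemma exp_abs_integral_le:
  assumes "\<mu> > (0::real)" "m \<ge> 0"
  shows "(\<lambda>y. exp (- (\<mu> * \<bar>y\<bar>))) integrable_on {- m..m}" "integral {- m..m} (\<lambda>y. exp (- (\<mu> * \<bar>y\<bar>))) \<le> 2 / \<mu>"
proof -
  show int: "(\<lambda>y. exp (- (\<mu> * \<bar>y\<bar>))) integrable_on {- m..m}" for m
    by (intro integrable_continuous_interval continuous_intros)
  have 1: "((\<lambda>y. exp (- (\<mu> * y))) has_integral (- exp (- (\<mu> * m)) / \<mu> - (- exp (- (\<mu> * 0)) / \<mu>))) {0..m}"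
    using assms by (intro fundamental_theorem_of_calculus)
      (auto intro!: derivative_eq_intros simp flip: has_real_derivative_iff_has_vector_derivative)
  have 2: "((\<lambda>y. exp (\<mu> * y)) has_integral (exp (\<mu> * 0) / \<mu> - exp (\<mu> * (- m)) / \<mu>)) {- m..0}"
    using assms by (intro fundamental_theorem_of_calculus)
      (auto intro!: derivative_eq_intros simp flip: has_real_derivative_iff_has_vector_derivative)
  have 3: "((\<lambda>y. exp (- (\<mu> * \<bar>y\<bar>))) has_integral (- exp (- (\<mu> * m)) / \<mu> - (- exp (- (\<mu> * 0)) / \<mu>))) {0..m}"
    by (rule has_integral_eq[OF _ 1]) auto
  have 4: "((\<lambda>y. exp (- (\<mu> * \<bar>y\<bar>))) has_integral (exp (\<mu> * 0) / \<mu> - exp (\<mu> * (- m)) / \<mu>)) {- m..0}"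
    by (rule has_integral_eq[OF _ 2]) auto
  have "((\<lambda>y. exp (- (\<mu> * \<bar>y\<bar>))) has_integral ((exp (\<mu> * 0) / \<mu> - exp (\<mu> * (- m)) / \<mu>) + (- exp (- (\<mu> * m)) / \<mu> - (- exp (- (\<mu> * 0)) / \<mu>)))) {- m..m}"
    using assms by (intro has_integral_combine[OF _ _ 4 3]) auto
  hence "integral {- m..m} (\<lambda>y. exp (- (\<mu> * \<bar>y\<bar>))) = 2 / \<mu> - 2 * exp (- (\<mu> * m)) / \<mu>"
    by (simp add: has_integral_integrable_integral)
  thus "integral {- m..m} (\<lambda>y. exp (- (\<mu> * \<bar>y\<bar>))) \<le> 2 / \<mu>" using assms by simp
qed

text \<open>Adding up the steps expresses the line integral at \<open>x J\<close> by the one at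
  \<open>1 / 2\<close> and the first \<open>k * J\<close> terms of the series. For
  \<open>Re s > 1\<close>, in fact by a factor \<open>x J powr (- Re s)\<close>, the integral at
  \<open>x J\<close> tends to 0.\<close>

theorem periodic_series_line_int:
  assumes k: "k > 0" and c: "(\<Sum>a=1..k. c a) = 0" and per: "\<And>n. c (n + k) = c n" and s: "Re s > 1"
    and l: "(\<lambda>m. line_int k c (1 / 2) m s) \<longlonglongrightarrow> l"
  shows "(\<lambda>n. c (Suc n) / of_nat (Suc n) powr s) sums (- \<i> / of_nat k * l)"
proof -
  define x where "x = (\<lambda>j::nat. 1 / 2 + real k * real j)"
  define t where "t = (\<lambda>n. c (Suc n) / of_nat (Suc n) powr s)"
  have percm: "c (k * J + a) = c a" for J a
  proof (induction J)
    case (Suc J)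
    have "c (k * Suc J + a) = c (k * J + a + k)" by (simp add: algebra_simps)
    thus ?case using Suc per by simp
  qed simp
  have blk: "(\<Sum>a=1..k. c a / of_nat (k * J + a) powr s) = (\<Sum>n=k * J..<k * Suc J. t n)" for J
  proof -
    have e: "t (n + k * J) = c (Suc n) / of_nat (k * J + Suc n) powr s" for n
      using percm[of J "Suc n"] by (simp add: t_def add_ac)
    have "(\<Sum>a=1..k. c a / of_nat (k * J + a) powr s) = (\<Sum>n\<in>{0..<k}. t (n + k * J))"
      unfolding e One_nat_def sum.atLeast1_atMost_eq lessThan_atLeast0 ..
    also have "\<dots> = (\<Sum>n=0 + k * J..<k + k * J. t n)" by (rule sum.shift_bounds_nat_ivl[symmetric])
    finally show ?thesis by (simp add: add_ac)
  qed
  have lim: "(\<lambda>m. \<i> * line_int k c (x J) m s) \<longlonglongrightarrow> \<i> * l + of_nat k * (\<Sum>n<k * J. t n)" for J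
  proof (induction J)
    case 0
    show ?case using tendsto_mult_left[OF l, of \<i>] by (simp add: x_def)
  next
    case (Suc J)
    have "(\<lambda>m. \<i> * (line_int k c (x (Suc J)) m s - line_int k c (x J) m s) + \<i> * line_int k c (x J) m s) \<longlonglongrightarrow>
        of_nat k * (\<Sum>a=1..k. c a / of_nat (k * J + a) powr s) + (\<i> * l + of_nat k * (\<Sum>n<k * J. t n))"
      unfolding x_def by (intro tendsto_add line_int_step[OF k c] Suc[unfolded x_def])
    also have "(\<lambda>m. \<i> * (line_int k c (x (Suc J)) m s - line_int k c (x J) m s) + \<i> * line_int k c (x J) m s) = (\<lambda>m. \<i> * line_int k c (x (Suc J)) m s)"
      by (simp add: algebra_simps)
    also have "of_nat k * (\<Sum>a=1..k. c a / of_nat (k * J + a) powr s) + (\<i> * l + of_nat k * (\<Sum>n<k * J. t n)) = \<i> * l + of_nat k * (\<Sum>n<k * Suc J. t n)"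
    proof -
      have "(\<Sum>n<k * Suc J. t n) = (\<Sum>n<k * J. t n) + (\<Sum>n=k * J..<k * Suc J. t n)"
        by (simp add: lessThan_atLeast0 sum.atLeastLessThan_concat)
      thus ?thesis unfolding blk by (simp add: algebra_simps)
    qed
    finally show ?case .
  qed
  obtain C where C: "C > 0" "\<And>z. \<bar>Im z\<bar> \<ge> 1 \<or> (\<exists>j::nat. Re z = 1 / 2 + real k * real j) \<Longrightarrow> norm (per_kernel k c z) \<le> C * exp (- (2 * pi / k * \<bar>Im z\<bar>))"
    using per_kernel_bound[OF k c] by blast
  define B where "B = exp (pi / 2 * \<bar>Im s\<bar>) * C * (2 / (2 * pi / k))"
  have bd: "norm (line_int k c (x J) m s) \<le> x J powr (- Re s) * B" for J m
  proof -
    have xJ: "x J > 0" by (simp add: x_def add_pos_nonneg)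
    have \<mu>: "2 * pi / k > 0" using k by simp
    have "norm (line_int k c (x J) m s) \<le> integral {- real m..real m} (\<lambda>y. x J powr (- Re s) * (exp (pi / 2 * \<bar>Im s\<bar>) * C) * exp (- (2 * pi / k * \<bar>y\<bar>)))"
      unfolding line_int_def
    proof (rule integral_norm_bound_integral)
      show "(\<lambda>y. line_fun k c s (Complex (x J) y)) integrable_on {- real m..real m}"
        unfolding x_def by (intro integrable_continuous_interval continuous_on_line_fun k)
      show "(\<lambda>y. x J powr (- Re s) * (exp (pi / 2 * \<bar>Im s\<bar>) * C) * exp (- (2 * pi / k * \<bar>y\<bar>))) integrable_on {- real m..real m}"
        by (intro integrable_continuous_interval continuous_intros)
      fix y
      define z where "z = Complex (x J) y"
      have z: "Re z = x J" "Im z = y" "z \<noteq> 0" using xJ by (auto simp: z_def complex_eq_iff)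
      have "norm z powr (- Re s) \<le> x J powr (- Re s)" using xJ s abs_Re_le_cmod[of z] z by (intro powr_mono2') auto
      hence "norm (z powr (- s)) \<le> x J powr (- Re s) * exp (pi / 2 * \<bar>Im s\<bar>)"
        using z xJ by (intro order_trans[OF norm_powr_minus_le] mult_right_mono) auto
      moreover have "norm (per_kernel k c z) \<le> C * exp (- (2 * pi / k * \<bar>y\<bar>))" using C(2)[of z] z by (auto simp: x_def)
      ultimately have "norm (line_fun k c s z) \<le> (x J powr (- Re s) * exp (pi / 2 * \<bar>Im s\<bar>)) * (C * exp (- (2 * pi / k * \<bar>y\<bar>)))"
        unfolding line_fun_def norm_mult by (intro mult_mono) auto
      thus "norm (line_fun k c s (Complex (x J) y)) \<le> x J powr (- Re s) * (exp (pi / 2 * \<bar>Im s\<bar>) * C) * exp (- (2 * pi / k * \<bar>y\<bar>))"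
        by (simp add: z_def mult_ac)
    qed
    also have "\<dots> = x J powr (- Re s) * (exp (pi / 2 * \<bar>Im s\<bar>) * C) * integral {- real m..real m} (\<lambda>y. exp (- (2 * pi / k * \<bar>y\<bar>)))"
      by (rule integral_mult_right)
    also have "\<dots> \<le> x J powr (- Re s) * (exp (pi / 2 * \<bar>Im s\<bar>) * C) * (2 / (2 * pi / k))"
      using C by (intro mult_left_mono exp_abs_integral_le \<mu>) auto
    finally show ?thesis by (simp add: B_def mult_ac)
  qed
  have le: "norm (\<i> * l + of_nat k * (\<Sum>n<k * J. t n)) \<le> x J powr (- Re s) * B" for J
    by (rule Lim_norm_ubound[OF _ lim[of J]]) (use bd in \<open>auto simp: norm_mult\<close>)
  have "(\<lambda>J. x J powr (- Re s) * B) \<longlonglongrightarrow> 0"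
  proof -
    have "(\<lambda>J. x J powr (- Re s)) \<longlonglongrightarrow> 0"
    proof (rule tendsto_neg_powr)
      show "filterlim x at_top sequentially" unfolding x_def using k by real_asymp
    qed (use s in auto)
    thus ?thesis by (rule tendsto_mult_left_zero)
  qed
  hence z: "(\<lambda>J. \<i> * l + of_nat k * (\<Sum>n<k * J. t n)) \<longlonglongrightarrow> 0"
    by (rule Lim_null_comparison[rotated]) (use le in auto)
  have part: "(\<lambda>J. (\<Sum>n<k * J. t n)) \<longlonglongrightarrow> - \<i> / of_nat k * l"
  proof -
    have "(\<lambda>J. ((\<i> * l + of_nat k * (\<Sum>n<k * J. t n)) - \<i> * l) / of_nat k) \<longlonglongrightarrow> (0 - \<i> * l) / of_nat k"
      using k by (intro tendsto_intros z) auto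
    thus ?thesis using k by simp
  qed
  \<comment> \<open>So far the partial sums converge only along multiples of \<open>k\<close>;
    absolute convergence settles the rest.\<close>
  have "summable t"
  proof (rule summable_comparison_test)
    define M where "M = (\<Sum>a=1..k. norm (c a))"
    have cM: "norm (c n) \<le> M" if "n > 0" for n
    proof -
      define a where "a = (n - 1) mod k + 1"
      have a: "a \<in> {1..k}" using k by (auto simp: a_def Suc_leI)
      have "n = k * ((n - 1) div k) + a" unfolding a_def using that by (metis Suc_diff_1 Suc_eq_plus1 add.assoc div_mult_mod_eq mult.commute)
      hence "c n = c a" using percm by metis
      also have "norm (c a) \<le> M" unfolding M_def using a by (intro member_le_sum) auto
      finally show ?thesis .
    qed
    show "summable (\<lambda>n. M * (1 / real (Suc n) powr Re s))"
    proof (rule summable_mult)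
      have "summable (\<lambda>n. 1 / real n powr Re s)" using summable_real_powr_iff[of "- Re s"] s by (simp add: powr_minus divide_inverse)
      thus "summable (\<lambda>n. 1 / real (Suc n) powr Re s)" by (subst summable_Suc_iff)
    qed
    have "norm (t n) \<le> M * (1 / real (Suc n) powr Re s)" for n
      unfolding t_def norm_divide using cM[of "Suc n"] by (subst norm_powr_real_powr) (auto intro!: divide_right_mono)
    thus "\<exists>N. \<forall>n\<ge>N. norm (t n) \<le> M * (1 / real (Suc n) powr Re s)" by blast
  qed
  hence "(\<lambda>N. \<Sum>n<N. t n) \<longlonglongrightarrow> suminf t" by (rule summable_LIMSEQ)
  hence "(\<lambda>J. \<Sum>n<k * J. t n) \<longlonglongrightarrow> suminf t"
    by (rule filterlim_compose) (use k in \<open>auto intro!: filterlim_subseq strict_monoI\<close>)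
  hence "suminf t = - \<i> / of_nat k * l" using part LIMSEQ_unique by blast
  thus ?thesis using \<open>summable t\<close> unfolding t_def by (metis summable_sums)
qed

text \<open>Any periodic coefficients with vanishing sum are allowed, so that both
  \<open>chi\<close> and the alternating series in \<open>eta_entire\<close> are covered. The growth
  bound is what later permits Phragmen--Lindelof in the strip.\<close>

theorem periodic_dirichlet_entire:
  assumes k: "k > 0" and c: "(\<Sum>a=1..k. c a) = 0" and per: "\<And>n. c (n + k) = c n"
  obtains f where "f holomorphic_on UNIV"
    "\<And>s. Re s > 1 \<Longrightarrow> (\<lambda>n. c (Suc n) / of_nat (Suc n) powr s) sums f s"
    "\<And>s. (\<lambda>m. - \<i> / of_nat k * line_int k c (1 / 2) m s) \<longlonglongrightarrow> f s"
    "\<And>R. R \<ge> 0 \<Longrightarrow> \<exists>K. \<forall>s. \<bar>Re s\<bar> \<le> R \<longrightarrow> norm (f s) \<le> K * exp (pi / 2 * \<bar>Im s\<bar>)"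
proof -
  obtain l where l: "l holomorphic_on UNIV" "\<And>s. (\<lambda>m. line_int k c (1 / 2) m s) \<longlonglongrightarrow> l s"
    "\<And>R. R \<ge> 0 \<Longrightarrow> \<exists>K. \<forall>s. \<bar>Re s\<bar> \<le> R \<longrightarrow> norm (l s) \<le> K * exp (pi / 2 * \<bar>Im s\<bar>)"
    using line_int_entire[OF k c] by blast
  show thesis
  proof (rule that[of "\<lambda>s. - \<i> / of_nat k * l s"])
    show "(\<lambda>s. - \<i> / of_nat k * l s) holomorphic_on UNIV" using k by (intro holomorphic_intros l)
    show "(\<lambda>n. c (Suc n) / of_nat (Suc n) powr s) sums (- \<i> / of_nat k * l s)" if "Re s > 1" for s
      by (rule periodic_series_line_int[OF k c per that l(2)])
    show "(\<lambda>m. - \<i> / of_nat k * line_int k c (1 / 2) m s) \<longlonglongrightarrow> - \<i> / of_nat k * l s" for s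
      by (intro tendsto_mult_left l)
    show "\<exists>K. \<forall>s. \<bar>Re s\<bar> \<le> R \<longrightarrow> norm (- \<i> / of_nat k * l s) \<le> K * exp (pi / 2 * \<bar>Im s\<bar>)" if R: "R \<ge> 0" for R
    proof -
      obtain K where K: "\<forall>s. \<bar>Re s\<bar> \<le> R \<longrightarrow> norm (l s) \<le> K * exp (pi / 2 * \<bar>Im s\<bar>)" using l(3)[OF R] ..
      have "norm (- \<i> / of_nat k * l s) \<le> (1 / k * K) * exp (pi / 2 * \<bar>Im s\<bar>)" if "\<bar>Re s\<bar> \<le> R" for s
      proof -
        have "norm (- \<i> / of_nat k * l s) = 1 / k * norm (l s)" by (simp add: norm_mult norm_divide)
        also have "\<dots> \<le> 1 / k * (K * exp (pi / 2 * \<bar>Im s\<bar>))" using K that by (intro mult_left_mono) auto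
        finally show ?thesis by simp
      qed
      thus ?thesis by blast
    qed
  qed
qed

section \<open>Functional equation of periodic series by a Mellin transform on the imaginary
  axis\<close>

definition gamma_kernel :: "complex \<Rightarrow> real \<Rightarrow> real \<Rightarrow> complex" where
  "gamma_kernel w a y = indicator {0<..} y *\<^sub>R (of_real y powr (w - 1) * of_real (exp (- (a * y))))"

text \<open>Euler's integral at \<open>a = 1\<close>, followed by a linear substitution. The
  indicator in \<open>gamma_kernel\<close> puts the integrand on the whole line with Lebesgue
  measure, where series can be integrated termwise.\<close>

lemma gamma_kernel_integral:
  assumes w: "Re w > 0" and a: "a > 0"
  shows "integrable lborel (gamma_kernel w a)" "integral\<^sup>L lborel (gamma_kernel w a) = Gamma w * of_real a powr (- w)"
proof -
  have meas: "gamma_kernel w a \<in> borel_measurable borel" for a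
    unfolding gamma_kernel_def[abs_def]
    by (intro borel_measurable_continuous_on_indicator continuous_intros) auto
  have int: "integrable lborel (gamma_kernel w a)" if a: "a > 0" for a
  proof -
    have "(\<lambda>t. complex_of_real t powr (w - 1) / of_real (exp (a * t))) absolutely_integrable_on {0<..}"
      by (rule absolutely_integrable_Gamma_integral[OF w a])
    hence "integrable lebesgue (gamma_kernel w a)"
      unfolding set_integrable_def gamma_kernel_def[abs_def] by (simp add: exp_minus divide_inverse)
    thus ?thesis using integrable_completion[of "gamma_kernel w a" lborel] meas by simp
  qed
  show "integrable lborel (gamma_kernel w a)" by (rule int[OF a])
  have one: "integral\<^sup>L lborel (gamma_kernel w 1) = Gamma w"
  proof -
    have "set_integrable lborel {0<..} (\<lambda>t. of_real t powr (w - 1) / of_real (exp t))"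
      using int[of 1] unfolding set_integrable_def gamma_kernel_def[abs_def] by (simp add: exp_minus divide_inverse)
    from set_borel_integral_eq_integral(2)[OF this]
    have "(LINT t:{0<..}|lborel. of_real t powr (w - 1) / of_real (exp t)) = Gamma w"
      using Gamma_integral_complex'[OF w] by (simp add: integral_unique)
    thus ?thesis unfolding set_lebesgue_integral_def gamma_kernel_def[abs_def] by (simp add: exp_minus divide_inverse)
  qed
  have sc: "gamma_kernel w 1 (a * x) = of_real a powr (w - 1) * gamma_kernel w a x" for x
  proof (cases "x > 0")
    case True
    have "complex_of_real (a * x) powr (w - 1) = of_real a powr (w - 1) * of_real x powr (w - 1)"
      unfolding of_real_mult using a by (intro powr_times_real_left) auto
    thus ?thesis using True a by (simp add: gamma_kernel_def)
  next
    case False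
    thus ?thesis using a by (simp add: gamma_kernel_def zero_less_mult_iff)
  qed
  have "Gamma w = of_real a * (of_real a powr (w - 1) * integral\<^sup>L lborel (gamma_kernel w a))"
    using lborel_integral_real_affine[of a "gamma_kernel w 1" 0] a by (simp add: one sc scaleR_conv_of_real)
  also have "\<dots> = of_real a powr w * integral\<^sup>L lborel (gamma_kernel w a)"
    using a by (simp add: powr_diff)
  finally show "integral\<^sup>L lborel (gamma_kernel w a) = Gamma w * of_real a powr (- w)"
    using a by (simp add: powr_minus field_simps)
qed

lemma gamma_kernel_norm_integral:
  assumes w: "Re w > 0" and a: "a > 0"
  shows "(\<integral>y. norm (gamma_kernel w a y) \<partial>lborel) = norm (Gamma (complex_of_real (Re w))) * a powr (- Re w)"
proof -
  have e: "gamma_kernel (of_real (Re w)) a y = of_real (norm (gamma_kernel w a y))" for y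
  proof (cases "y > 0")
    case True
    have "complex_of_real y powr (of_real (Re w) - 1) = of_real (y powr (Re w - 1))"
      using True by (simp add: powr_of_real[symmetric])
    moreover have "norm (complex_of_real y powr (w - 1)) = y powr (Re w - 1)"
      using True by (subst norm_powr_real_powr) auto
    ultimately show ?thesis using True by (simp add: gamma_kernel_def norm_mult)
  qed (simp add: gamma_kernel_def)
  have "complex_of_real (\<integral>y. norm (gamma_kernel w a y) \<partial>lborel) = integral\<^sup>L lborel (gamma_kernel (of_real (Re w)) a)"
    unfolding e[abs_def] by (simp add: e)
  also have "\<dots> = Gamma (of_real (Re w)) * of_real a powr (- of_real (Re w))"
    using w a by (intro gamma_kernel_integral) auto
  finally have "norm (complex_of_real (\<integral>y. norm (gamma_kernel w a y) \<partial>lborel)) = norm (Gamma (complex_of_real (Re w))) * norm (complex_of_real a powr (- of_real (Re w)))"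
    by (simp only: norm_mult)
  moreover have "norm (complex_of_real a powr (- of_real (Re w))) = a powr (- Re w)"
    using a by (subst norm_powr_real_powr) auto
  moreover have "(\<integral>y. norm (gamma_kernel w a y) \<partial>lborel) \<ge> 0" by simp
  ultimately show ?thesis by simp
qed

lemma summable_Suc_powr: "r > 1 \<Longrightarrow> summable (\<lambda>n. real (Suc n) powr (- r))"
  using summable_real_powr_iff[of "- r"] by (subst summable_Suc_iff) simp

text \<open>For \<open>Re w > 1\<close> the integrals of the norms are summable, which permits
  termwise integration. The limit is taken over integrals from 0 to \<open>m\<close> because that is
  the form in which \<open>line_int\<close> produces them.\<close>

lemma mellin_power_series:
  fixes b :: "nat \<Rightarrow> complex"
  assumes w: "Re w > 1" and \<mu>: "\<mu> > 0" and b: "\<And>n. norm (b n) \<le> M"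
    and H: "\<And>y. y > 0 \<Longrightarrow> (\<lambda>n. b n * of_real (exp (- (\<mu> * real (Suc n) * y)))) sums H y"
  shows "(\<lambda>m::nat. integral {0..real m} (\<lambda>y. of_real y powr (w - 1) * H y)) \<longlonglongrightarrow>
           Gamma w * of_real \<mu> powr (- w) * (\<Sum>n. b n * of_nat (Suc n) powr (- w))"
proof -
  have M: "M \<ge> 0" using b[of 0] norm_ge_zero order_trans by blast
  define F where "F = (\<lambda>n y. b n * gamma_kernel w (\<mu> * real (Suc n)) y)"
  have pos: "\<mu> * real (Suc n) > 0" for n using \<mu> by simp
  have w0: "Re w > 0" using w by simp
  have Fi: "integrable lborel (F n)" for n
    unfolding F_def by (intro integrable_mult_right gamma_kernel_integral w0 pos)
  have Fs: "(\<lambda>n. F n y) sums (indicator {0<..} y *\<^sub>R (of_real y powr (w - 1) * H y))" for y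
  proof (cases "y > 0")
    case True
    from sums_mult[OF H[OF True], of "of_real y powr (w - 1)"] show ?thesis
      using True by (simp add: F_def gamma_kernel_def mult_ac)
  qed (simp add: F_def gamma_kernel_def)
  have Fn: "(\<integral>y. norm (F n y) \<partial>lborel) \<le> (M * (norm (Gamma (complex_of_real (Re w))) * \<mu> powr (- Re w))) * real (Suc n) powr (- Re w)" for n
  proof -
    have "(\<integral>y. norm (F n y) \<partial>lborel) = norm (b n) * (norm (Gamma (complex_of_real (Re w))) * (\<mu> * real (Suc n)) powr (- Re w))"
      unfolding F_def norm_mult using gamma_kernel_norm_integral[OF w0 pos, of n] by simp
    also have "\<dots> \<le> M * (norm (Gamma (complex_of_real (Re w))) * (\<mu> * real (Suc n)) powr (- Re w))"
      by (intro mult_right_mono b) auto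
    also have "(\<mu> * real (Suc n)) powr (- Re w) = \<mu> powr (- Re w) * real (Suc n) powr (- Re w)"
      using \<mu> by (subst powr_mult) auto
    finally show ?thesis by (simp only: mult_ac)
  qed
  have sm1: "summable (\<lambda>n. \<integral>y. norm (F n y) \<partial>lborel)"
    by (rule summable_comparison_test[OF _ summable_mult[OF summable_Suc_powr[OF w]]])
       (use Fn in \<open>auto intro!: exI[of _ 0]\<close>)
  have sm2: "AE y in lborel. summable (\<lambda>n. norm (F n y))"
  proof (rule AE_I2)
    fix y :: real
    show "summable (\<lambda>n. norm (F n y))"
    proof (cases "y > 0")
      case True
      define q where "q = exp (- (\<mu> * y))"
      have q: "0 < q" "q < 1" using True \<mu> by (auto simp: q_def)
      have "summable (\<lambda>n. (M * y powr (Re w - 1)) * q ^ Suc n)"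
        using q by (intro summable_mult summable_Suc_iff[THEN iffD2] summable_geometric) auto
      moreover have "norm (norm (F n y)) \<le> (M * y powr (Re w - 1)) * q ^ Suc n" for n
      proof -
        have "exp (- (\<mu> * real (Suc n) * y)) = q ^ Suc n"
          unfolding q_def exp_of_nat_mult[symmetric] by (rule arg_cong[of _ _ exp]) (simp add: algebra_simps)
        hence "norm (F n y) = norm (b n) * (y powr (Re w - 1) * q ^ Suc n)"
          using True q by (simp add: F_def gamma_kernel_def norm_mult norm_power norm_powr_real_powr del: power_Suc)
        also have "\<dots> \<le> M * (y powr (Re w - 1) * q ^ Suc n)" using q by (intro mult_right_mono b) auto
        finally show ?thesis by (simp only: mult_ac real_norm_def abs_norm_cancel)
      qed
      ultimately show ?thesis by (intro summable_comparison_test[of "\<lambda>n. norm (F n y)" "\<lambda>n. (M * y powr (Re w - 1)) * q ^ Suc n"]) blast+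
    qed (simp add: F_def gamma_kernel_def)
  qed
  have sI: "(\<lambda>n. integral\<^sup>L lborel (F n)) sums (\<integral>y. (\<Sum>n. F n y) \<partial>lborel)"
    by (rule sums_integral[OF Fi sm2 sm1])
  have iI: "integrable lborel (\<lambda>y. \<Sum>n. F n y)" by (rule integrable_suminf[OF Fi sm2 sm1])
  have Fsum: "(\<Sum>n. F n y) = indicator {0<..} y *\<^sub>R (of_real y powr (w - 1) * H y)" for y
    using Fs[of y] by (rule sums_unique[symmetric])
  have val: "integral\<^sup>L lborel (F n) = Gamma w * of_real \<mu> powr (- w) * (b n * of_nat (Suc n) powr (- w))" for n
  proof -
    have "integral\<^sup>L lborel (F n) = b n * (Gamma w * of_real (\<mu> * real (Suc n)) powr (- w))"
      unfolding F_def using gamma_kernel_integral(2)[OF w0 pos, of n] by simp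
    also have "complex_of_real (\<mu> * real (Suc n)) powr (- w) = of_real \<mu> powr (- w) * of_nat (Suc n) powr (- w)"
      unfolding of_real_mult using \<mu> by (subst powr_times_real_left) auto
    finally show ?thesis by (simp only: mult_ac)
  qed
  have tot: "(\<integral>y. (\<Sum>n. F n y) \<partial>lborel) = Gamma w * of_real \<mu> powr (- w) * (\<Sum>n. b n * of_nat (Suc n) powr (- w))"
  proof -
    have nz: "Gamma w * of_real \<mu> powr (- w) \<noteq> 0"
      using w0 \<mu> by (auto simp: Gamma_eq_zero_iff nonpos_Ints_def)
    have "summable (\<lambda>n. Gamma w * of_real \<mu> powr (- w) * (b n * of_nat (Suc n) powr (- w)))"
      using sI unfolding val by (rule sums_summable)
    hence "summable (\<lambda>n. b n * of_nat (Suc n) powr (- w))" using nz by (subst (asm) summable_cmult_iff) auto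
    from sums_mult[OF summable_sums[OF this], of "Gamma w * of_real \<mu> powr (- w)"] sI show ?thesis
      unfolding val using sums_unique2 by blast
  qed
  define h where "h = (\<lambda>y. \<Sum>n. F n y)"
  have hI: "integrable lborel h" using iI by (simp add: h_def)
  have si: "set_integrable lborel A h" if "A \<in> sets borel" for A
    unfolding set_integrable_def using integrable_mult_indicator[OF _ hI, of A] that by simp
  have "((\<lambda>b. set_lebesgue_integral lborel {0..b} h) \<longlongrightarrow> set_lebesgue_integral lborel {0..} h) at_top"
    by (rule tendsto_set_lebesgue_integral_at_top) (auto intro: si)
  also have "set_lebesgue_integral lborel {0..} h = integral\<^sup>L lborel h"
    unfolding set_lebesgue_integral_def by (rule Bochner_Integration.integral_cong) (auto simp: h_def Fsum indicator_def)
  finally have "((\<lambda>b. set_lebesgue_integral lborel {0..b} h) \<longlongrightarrow> integral\<^sup>L lborel h) at_top" .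
  hence "(\<lambda>m. set_lebesgue_integral lborel {0..real m} h) \<longlonglongrightarrow> integral\<^sup>L lborel h"
    by (rule filterlim_compose[OF _ filterlim_real_sequentially])
  moreover have "set_lebesgue_integral lborel {0..real m} h = integral {0..real m} (\<lambda>y. of_real y powr (w - 1) * H y)" for m
  proof -
    have "set_lebesgue_integral lborel {0..real m} h = integral {0..real m} h"
      by (rule set_borel_integral_eq_integral) (auto intro: si)
    also have "\<dots> = integral {0..real m} (\<lambda>y. of_real y powr (w - 1) * H y)"
      by (rule integral_spike[of "{0}"]) (auto simp: h_def Fsum)
    finally show ?thesis .
  qed
  ultimately show ?thesis using tot by (simp add: h_def)
qed

text \<open>In this strip only the summand \<open>a = k\<close> has a pole, namely at 0.\<close>

lemma per_kernel_holomorphic_strip: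
  assumes k: "k > 0" and ck: "c k = 0"
  shows "per_kernel k c holomorphic_on {z. \<bar>Re z\<bar> < 1}"
proof -
  have nz: "exp (2 * of_real pi * \<i> * (z - of_nat a) / of_nat k) - 1 \<noteq> 0" if z: "\<bar>Re z\<bar> < 1" and a: "a \<in> {1..<k}" for z a
  proof
    assume "exp (2 * of_real pi * \<i> * (z - of_nat a) / of_nat k) - 1 = 0"
    hence "exp (2 * of_real pi * \<i> * (z - of_nat a) / of_nat k) = 1" by simp
    then obtain n where n: "z = of_nat a + of_nat k * of_int n" by (rule exp_unit_eq_1D[OF k])
    hence "Re z = real_of_int (int a + int k * n)" by simp
    hence "\<bar>real_of_int (int a + int k * n)\<bar> < 1" using z by simp
    hence "int a + int k * n = 0" by linarith
    hence "int k dvd int a" by (metis add_eq_0_iff dvd_minus_iff dvd_triv_left)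
    thus False using a by (auto dest: dvd_imp_le)
  qed
  have split: "{1..k} = insert k {1..<k}" using k by auto
  have "per_kernel k c = (\<lambda>z. \<Sum>a\<in>{1..<k}. c a / (exp (2 * of_real pi * \<i> * (z - of_nat a) / of_nat k) - 1))"
    unfolding per_kernel_def split by (rule ext, subst sum.insert) (auto simp: ck)
  moreover have "(\<lambda>z. \<Sum>a\<in>{1..<k}. c a / (exp (2 * of_real pi * \<i> * (z - of_nat a) / of_nat k) - 1)) holomorphic_on {z. \<bar>Re z\<bar> < 1}"
    using k nz by (intro holomorphic_intros) auto
  ultimately show ?thesis by simp
qed

text \<open>For \<open>Re s < 0\<close> the power \<open>z powr (- s)\<close> is continuous at 0,
  and Cauchy's theorem asks for no more than continuity on the closed rectangle and
  differentiability inside.\<close>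

lemma line_int_shift_zero:
  assumes k: "k > 0" and c: "(\<Sum>a=1..k. c a) = 0" and ck: "c k = 0" and s: "Re s < 0"
  shows "(\<lambda>m. \<i> * (line_int k c (1 / 2) m s - line_int k c 0 m s)) \<longlonglongrightarrow> 0"
proof -
  define h where "h = (\<lambda>m::nat. contour_integral (linepath (Complex 0 (- real m)) (Complex (1 / 2) (- real m))) (line_fun k c s)
           - contour_integral (linepath (Complex 0 (real m)) (Complex (1 / 2) (real m))) (line_fun k c s))"
  have h: "h \<longlonglongrightarrow> 0" unfolding h_def by (rule line_fun_horizontal_tendsto[OF k c]) auto
  have eq: "\<i> * (line_int k c (1 / 2) m s - line_int k c 0 m s) = - h m" if m: "m \<ge> 1" for m :: nat
  proof -
    define S where "S = cbox (Complex 0 (- real m)) (Complex (1 / 2) (real m))"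
    have le: "Re (Complex 0 (- real m)) \<le> Re (Complex (1 / 2) (real m))" "Im (Complex 0 (- real m)) \<le> Im (Complex (1 / 2) (real m))"
      by auto
    have cont: "continuous_on S (line_fun k c s)"
      unfolding line_fun_def[abs_def]
    proof (intro continuous_on_mult continuous_on_powr_complex continuous_on_id continuous_on_const)
      show "continuous_on S (per_kernel k c)"
        by (intro holomorphic_on_imp_continuous_on holomorphic_on_subset[OF per_kernel_holomorphic_strip[where c = c, OF k ck]])
           (auto simp: S_def in_cbox_complex_iff)
    qed (use s in \<open>auto simp: S_def in_cbox_complex_iff\<close>)
    have pS: "path_image (rectpath (Complex 0 (- real m)) (Complex (1 / 2) (real m))) \<subseteq> S"
      unfolding S_def by (rule path_image_rectpath_subset_cbox[OF le])
    have "(line_fun k c s has_contour_integral 0) (rectpath (Complex 0 (- real m)) (Complex (1 / 2) (real m)))"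
    proof (rule Cauchy_theorem_convex[OF cont _ finite.emptyI _ _ pS])
      show "convex S" by (simp add: S_def)
      fix z assume "z \<in> interior S - {}"
      hence z: "0 < Re z" "Re z < 1 / 2" by (auto simp: S_def interior_cbox in_box_complex_iff)
      have "line_fun k c s holomorphic_on {z. 0 < Re z \<and> Re z < 1 / 2}"
        unfolding line_fun_def[abs_def]
        by (intro holomorphic_intros holomorphic_on_subset[OF per_kernel_holomorphic_strip[where c = c, OF k ck]]) (auto simp: complex_nonpos_Reals_iff)
      moreover have "open {z::complex. 0 < Re z \<and> Re z < 1 / 2}"
        by (intro open_Collect_conj open_Collect_less continuous_intros)
      ultimately show "line_fun k c s field_differentiable at z" using z by (auto simp: holomorphic_on_open field_differentiable_def)
    qed auto
    hence "0 = contour_integral (rectpath (Complex 0 (- real m)) (Complex (1 / 2) (real m))) (line_fun k c s)"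
      by (simp add: contour_integral_unique)
    moreover have ci: "contour_integral (linepath (Complex X (- real m)) (Complex X (real m))) (line_fun k c s) = \<i> * line_int k c X m s" for X
      unfolding line_int_def using m by (intro contour_integral_linepath_same_Re) auto
    ultimately have "h m + (\<i> * line_int k c (1 / 2) m s - \<i> * line_int k c 0 m s) = 0"
      using contour_integral_rectpath[OF continuous_on_subset[OF cont pS] le] by (simp add: h_def ci algebra_simps)
    thus ?thesis by (simp only: right_diff_distrib eq_neg_iff_add_eq_0 add.commute)
  qed
  have "(\<lambda>m. - h m) \<longlonglongrightarrow> - 0" by (intro tendsto_intros h)
  hence "(\<lambda>m. - h m) \<longlonglongrightarrow> 0" by simp
  thus ?thesis
    by (rule Lim_transform_eventually) (auto intro!: eventually_sequentiallyI[of 1] simp: eq)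
qed

definition dft_neg :: "nat \<Rightarrow> (nat \<Rightarrow> complex) \<Rightarrow> nat \<Rightarrow> complex" where
  "dft_neg k c n = (\<Sum>a=1..k. c a * exp (- (2 * of_real pi * \<i> * of_nat a * of_nat n / of_nat k)))"

definition dft_pos :: "nat \<Rightarrow> (nat \<Rightarrow> complex) \<Rightarrow> nat \<Rightarrow> complex" where
  "dft_pos k c n = (\<Sum>a=1..k. c a * exp (2 * of_real pi * \<i> * of_nat a * of_nat n / of_nat k))"

text \<open>Geometric series in \<open>q a\<close>, which has modulus below 1 above the axis. The
  constant term is the sum of the coefficients and drops out.\<close>

lemma per_kernel_upper:
  assumes k: "k > 0" and c: "(\<Sum>a=1..k. c a) = 0" and y: "y > 0"
  shows "(\<lambda>n. dft_neg k c (Suc n) * of_real (exp (- (2 * pi / k * real (Suc n) * y)))) sums (- per_kernel k c (\<i> * of_real y))"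
proof -
  define q where "q = (\<lambda>a::nat. exp (2 * of_real pi * \<i> * (\<i> * of_real y - of_nat a) / of_nat k))"
  have nq: "norm (q a) < 1" for a using k y by (simp add: q_def Re_divide_of_nat)
  have qn: "q a ^ Suc n = exp (- (2 * of_real pi * \<i> * of_nat a * of_nat (Suc n) / of_nat k)) * of_real (exp (- (2 * pi / k * real (Suc n) * y)))" for a n
    unfolding q_def exp_of_nat_mult[symmetric] exp_of_real[symmetric] exp_add[symmetric]
    by (rule arg_cong[of _ _ exp]) (use k in \<open>simp add: field_simps\<close>)
  have "(\<lambda>n. \<Sum>a=1..k. c a * q a ^ Suc n) sums (\<Sum>a=1..k. c a * (q a / (1 - q a)))"
  proof (intro sums_sum sums_mult)
    fix a
    from sums_mult[OF geometric_sums[OF nq[of a]], of "q a"] show "(\<lambda>n. q a ^ Suc n) sums (q a / (1 - q a))" by simp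
  qed
  also have "(\<Sum>a=1..k. c a * (q a / (1 - q a))) = - per_kernel k c (\<i> * of_real y)"
  proof -
    have "q a \<noteq> 1" for a using nq[of a] by auto
    hence "c a * (q a / (1 - q a)) = - (c a / (q a - 1)) - c a" for a by (simp add: field_simps)
    thus ?thesis using c by (simp add: per_kernel_def q_def sum_subtractf sum_negf)
  qed
  also have "(\<lambda>n. \<Sum>a=1..k. c a * q a ^ Suc n) = (\<lambda>n. dft_neg k c (Suc n) * of_real (exp (- (2 * pi / k * real (Suc n) * y))))"
    unfolding qn dft_neg_def sum_distrib_right by (simp only: mult.assoc)
  finally show ?thesis .
qed

text \<open>Below the axis the inverse exponential is the small one, and the expansion has no
  constant term from the start.\<close>

lemma per_kernel_lower:
  assumes k: "k > 0" and y: "y > 0"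
  shows "(\<lambda>n. dft_pos k c (Suc n) * of_real (exp (- (2 * pi / k * real (Suc n) * y)))) sums per_kernel k c (- (\<i> * of_real y))"
proof -
  define q where "q = (\<lambda>a::nat. exp (- (2 * of_real pi * \<i> * (- (\<i> * of_real y) - of_nat a) / of_nat k)))"
  have nq: "norm (q a) < 1" for a using k y by (simp add: q_def Re_divide_of_nat)
  have qn: "q a ^ Suc n = exp (2 * of_real pi * \<i> * of_nat a * of_nat (Suc n) / of_nat k) * of_real (exp (- (2 * pi / k * real (Suc n) * y)))" for a n
    unfolding q_def exp_of_nat_mult[symmetric] exp_of_real[symmetric] exp_add[symmetric]
    by (rule arg_cong[of _ _ exp]) (use k in \<open>simp add: field_simps\<close>)
  have "(\<lambda>n. \<Sum>a=1..k. c a * q a ^ Suc n) sums (\<Sum>a=1..k. c a * (q a / (1 - q a)))"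
  proof (intro sums_sum sums_mult)
    fix a
    from sums_mult[OF geometric_sums[OF nq[of a]], of "q a"] show "(\<lambda>n. q a ^ Suc n) sums (q a / (1 - q a))" by simp
  qed
  also have "(\<Sum>a=1..k. c a * (q a / (1 - q a))) = per_kernel k c (- (\<i> * of_real y))"
    unfolding per_kernel_def
  proof (rule sum.cong[OF refl])
    fix a
    have q1: "q a \<noteq> 1" using nq[of a] by (metis norm_one order_less_irrefl)
    have q0: "q a \<noteq> 0" by (simp add: q_def)
    have "exp (2 * of_real pi * \<i> * (- (\<i> * of_real y) - of_nat a) / of_nat k) = inverse (q a)"
      unfolding q_def exp_minus by simp
    moreover have "1 / (inverse (q a) - 1) = q a / (1 - q a)"
      using q1 q0 by (simp add: field_simps)
    ultimately show "c a * (q a / (1 - q a)) = c a / (exp (2 * of_real pi * \<i> * (- (\<i> * of_real y) - of_nat a) / of_nat k) - 1)"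
      by (metis mult.right_neutral times_divide_eq_right)
  qed
  also have "(\<lambda>n. \<Sum>a=1..k. c a * q a ^ Suc n) = (\<lambda>n. dft_pos k c (Suc n) * of_real (exp (- (2 * pi / k * real (Suc n) * y))))"
    unfolding qn dft_pos_def sum_distrib_right by (simp only: mult.assoc)
  finally show ?thesis .
qed

lemma ii_times_real_powr:
  assumes "y > 0"
  shows "(\<i> * of_real y) powr z = of_real y powr z * exp (\<i> * of_real pi * z / 2)"
    "(- (\<i> * of_real y)) powr z = of_real y powr z * exp (- (\<i> * of_real pi * z / 2))"
proof -
  have "(\<i> * of_real y) powr z = (of_real y * \<i>) powr z" by (simp add: mult.commute)
  also have "\<dots> = of_real y powr z * \<i> powr z" using assms by (intro powr_times_real_left) auto
  finally show "(\<i> * of_real y) powr z = of_real y powr z * exp (\<i> * of_real pi * z / 2)" by (simp add: powr_def mult_ac)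
  have "(- (\<i> * of_real y)) powr z = (of_real y * (- \<i>)) powr z" by (simp add: mult.commute)
  also have "\<dots> = of_real y powr z * (- \<i>) powr z" using assms by (intro powr_times_real_left) auto
  finally show "(- (\<i> * of_real y)) powr z = of_real y powr z * exp (- (\<i> * of_real pi * z / 2))" by (simp add: powr_def mult_ac)
qed

text \<open>Once the line is moved to the imaginary axis, each half of it is a Mellin transform of
  an exponential series whose coefficients are finite Fourier transforms of \<open>c\<close>. The
  factors \<open>exp (\<plusminus> i * pi * w / 2)\<close> come from powers of
  \<open>\<plusminus> i * y\<close>.\<close>

theorem periodic_functional_equation:
  assumes k: "k > 0" and c: "(\<Sum>a=1..k. c a) = 0" and ck: "c k = 0" and w: "Re w > 1"
    and f: "(\<lambda>m. - \<i> / of_nat k * line_int k c (1 / 2) m (1 - w)) \<longlonglongrightarrow> f"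
  shows "f = Gamma w * of_real (2 * pi / k) powr (- w) / of_nat k *
     (exp (\<i> * of_real pi * w / 2) * (\<Sum>n. dft_neg k c (Suc n) * of_nat (Suc n) powr (- w))
      + exp (- (\<i> * of_real pi * w / 2)) * (\<Sum>n. dft_pos k c (Suc n) * of_nat (Suc n) powr (- w)))"
proof -
  define \<mu> where "\<mu> = 2 * pi / k"
  have \<mu>: "\<mu> > 0" using k by (simp add: \<mu>_def)
  define Sn Sp where "Sn = (\<Sum>n. dft_neg k c (Suc n) * of_nat (Suc n) powr (- w))" and "Sp = (\<Sum>n. dft_pos k c (Suc n) * of_nat (Suc n) powr (- w))"
  define M where "M = (\<Sum>a=1..k. norm (c a))"
  have b1: "norm (dft_neg k c n) \<le> M" for n unfolding dft_neg_def M_def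
    by (intro sum_norm_le) (simp add: norm_mult Re_divide_of_nat)
  have b2: "norm (dft_pos k c n) \<le> M" for n unfolding dft_pos_def M_def
    by (intro sum_norm_le) (simp add: norm_mult Re_divide_of_nat)
  have half: "exp (\<i> * pi / 2) = \<i>" "exp (- (\<i> * pi / 2)) = - \<i>"
    using cis_pi_half[unfolded cis_conv_exp] by (simp_all add: exp_minus)
  have eu: "exp (\<i> * of_real pi * (w - 1) / 2) = - \<i> * exp (\<i> * of_real pi * w / 2)"
    "exp (- (\<i> * of_real pi * (w - 1) / 2)) = \<i> * exp (- (\<i> * of_real pi * w / 2))"
  proof -
    have "\<i> * of_real pi * (w - 1) / 2 = - (\<i> * pi / 2) + \<i> * of_real pi * w / 2" by (simp add: algebra_simps diff_divide_distrib)
    thus "exp (\<i> * of_real pi * (w - 1) / 2) = - \<i> * exp (\<i> * of_real pi * w / 2)" by (simp only: exp_add half)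
    have "- (\<i> * of_real pi * (w - 1) / 2) = \<i> * pi / 2 + - (\<i> * of_real pi * w / 2)" by (simp add: algebra_simps diff_divide_distrib)
    thus "exp (- (\<i> * of_real pi * (w - 1) / 2)) = \<i> * exp (- (\<i> * of_real pi * w / 2))" by (simp only: exp_add half)
  qed
  define U L where "U = (\<lambda>m::nat. integral {0..real m} (\<lambda>y. of_real y powr (w - 1) * (- per_kernel k c (\<i> * of_real y))))"
    and "L = (\<lambda>m::nat. integral {0..real m} (\<lambda>y. of_real y powr (w - 1) * per_kernel k c (- (\<i> * of_real y))))"
  have U: "U \<longlonglongrightarrow> Gamma w * of_real \<mu> powr (- w) * Sn"
    unfolding U_def Sn_def by (rule mellin_power_series[OF w \<mu> b1]) (unfold \<mu>_def, rule per_kernel_upper[OF k c])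
  have L: "L \<longlonglongrightarrow> Gamma w * of_real \<mu> powr (- w) * Sp"
    unfolding L_def Sp_def by (rule mellin_power_series[OF w \<mu> b2]) (unfold \<mu>_def, rule per_kernel_lower[OF k])
  have cont: "continuous_on A (\<lambda>y. line_fun k c (1 - w) (Complex 0 y))" for A
  proof -
    have C: "(\<lambda>y. Complex 0 y) = (\<lambda>y. \<i> * of_real y)" by (auto simp: fun_eq_iff complex_eq_iff)
    have "continuous_on {z. Re z = 0} (line_fun k c (1 - w))"
      unfolding line_fun_def[abs_def]
    proof (intro continuous_on_mult continuous_on_powr_complex continuous_on_id continuous_on_const)
      show "continuous_on {z. Re z = 0} (per_kernel k c)"
        by (intro holomorphic_on_imp_continuous_on holomorphic_on_subset[OF per_kernel_holomorphic_strip[where c = c, OF k ck]]) auto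
    qed (use w in auto)
    thus ?thesis
      by (rule continuous_on_compose2) (simp only: C, intro continuous_intros, auto)
  qed
  have li: "line_int k c 0 m (1 - w) = \<i> * exp (\<i> * of_real pi * w / 2) * U m + \<i> * exp (- (\<i> * of_real pi * w / 2)) * L m" for m
  proof -
    have 0: "Complex 0 y = \<i> * of_real y" "Complex 0 (- y) = - (\<i> * of_real y)" for y by (simp_all add: complex_eq_iff)
    have "line_int k c 0 m (1 - w) = integral {- real m..0} (\<lambda>y. line_fun k c (1 - w) (Complex 0 y)) + integral {0..real m} (\<lambda>y. line_fun k c (1 - w) (Complex 0 y))"
      unfolding line_int_def
      by (rule Henstock_Kurzweil_Integration.integral_combine[symmetric]) (auto intro!: integrable_continuous_interval cont)
    also have "integral {- real m..0} (\<lambda>y. line_fun k c (1 - w) (Complex 0 y)) = integral {0..real m} (\<lambda>y. line_fun k c (1 - w) (Complex 0 (- y)))"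
      using Henstock_Kurzweil_Integration.integral_reflect_real[of "real m" 0 "\<lambda>y. line_fun k c (1 - w) (Complex 0 (- y))"] by simp
    also have "\<dots> = integral {0..real m} (\<lambda>y. \<i> * exp (- (\<i> * of_real pi * w / 2)) * (of_real y powr (w - 1) * per_kernel k c (- (\<i> * of_real y))))"
    proof (rule integral_spike[of "{0}"])
      fix y assume "y \<in> {0..real m} - {0}"
      hence y: "y > 0" by auto
      show "\<i> * exp (- (\<i> * of_real pi * w / 2)) * (of_real y powr (w - 1) * per_kernel k c (- (\<i> * of_real y))) = line_fun k c (1 - w) (Complex 0 (- y))"
        unfolding line_fun_def 0(2) minus_diff_eq ii_times_real_powr(2)[OF y] eu by (simp only: mult_ac)
    qed simp
    also have "\<dots> = \<i> * exp (- (\<i> * of_real pi * w / 2)) * L m" unfolding L_def by (rule integral_mult_right)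
    also have "integral {0..real m} (\<lambda>y. line_fun k c (1 - w) (Complex 0 y)) = integral {0..real m} (\<lambda>y. \<i> * exp (\<i> * of_real pi * w / 2) * (of_real y powr (w - 1) * (- per_kernel k c (\<i> * of_real y))))"
    proof (rule integral_spike[of "{0}"])
      fix y assume "y \<in> {0..real m} - {0}"
      hence y: "y > 0" by auto
      show "\<i> * exp (\<i> * of_real pi * w / 2) * (of_real y powr (w - 1) * (- per_kernel k c (\<i> * of_real y))) = line_fun k c (1 - w) (Complex 0 y)"
        unfolding line_fun_def 0(1) minus_diff_eq ii_times_real_powr(1)[OF y] eu by simp
    qed simp
    also have "\<dots> = \<i> * exp (\<i> * of_real pi * w / 2) * U m" unfolding U_def by (rule integral_mult_right)
    finally show ?thesis by simp
  qed
  define V where "V = \<i> * exp (\<i> * of_real pi * w / 2) * (Gamma w * of_real \<mu> powr (- w) * Sn) + \<i> * exp (- (\<i> * of_real pi * w / 2)) * (Gamma w * of_real \<mu> powr (- w) * Sp)"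
  have "(\<lambda>m. line_int k c 0 m (1 - w)) \<longlonglongrightarrow> V" unfolding li V_def by (intro tendsto_intros U L)
  moreover have "(\<lambda>m. - \<i> * (\<i> * (line_int k c (1 / 2) m (1 - w) - line_int k c 0 m (1 - w)))) \<longlonglongrightarrow> - \<i> * 0"
    using w by (intro tendsto_mult_left line_int_shift_zero[OF k c ck]) auto
  ultimately have "(\<lambda>m. line_int k c 0 m (1 - w) + - \<i> * (\<i> * (line_int k c (1 / 2) m (1 - w) - line_int k c 0 m (1 - w)))) \<longlonglongrightarrow> V + - \<i> * 0"
    by (rule tendsto_add)
  hence "(\<lambda>m. line_int k c (1 / 2) m (1 - w)) \<longlonglongrightarrow> V" by (simp flip: mult.assoc)
  hence "(\<lambda>m. - \<i> / of_nat k * line_int k c (1 / 2) m (1 - w)) \<longlonglongrightarrow> - \<i> / of_nat k * V" by (rule tendsto_mult_left)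
  hence "f = - \<i> / of_nat k * V" using f LIMSEQ_unique by blast
  also have "\<dots> = Gamma w * of_real \<mu> powr (- w) / of_nat k * (exp (\<i> * of_real pi * w / 2) * Sn + exp (- (\<i> * of_real pi * w / 2)) * Sp)"
    unfolding V_def using k by (simp add: field_simps)
  finally show ?thesis by (simp only: \<mu>_def Sn_def Sp_def)
qed

section \<open>Gauss sums and the functional equation\<close>

definition rootk :: "nat \<Rightarrow> nat \<Rightarrow> complex" where
  "rootk k m = exp (2 * of_real pi * \<i> * of_nat m / of_nat k)"

lemma rootk_add: "rootk k (m + n) = rootk k m * rootk k n"
  by (simp add: rootk_def algebra_simps add_divide_distrib exp_add)

lemma rootk_mult: "rootk k (m * n) = rootk k m ^ n"
  by (simp add: rootk_def exp_of_nat_mult[symmetric] mult_ac)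

lemma rootk_self [simp]: "k > 0 \<Longrightarrow> rootk k k = 1"
  by (simp add: rootk_def exp_two_pi_i)

lemma rootk_multiple [simp]: "k > 0 \<Longrightarrow> rootk k (k * n) = 1"
  by (simp add: rootk_mult)

lemma rootk_mod: "k > 0 \<Longrightarrow> rootk k (m mod k) = rootk k m"
proof -
  assume k: "k > 0"
  have "rootk k m = rootk k (k * (m div k) + m mod k)" by simp
  thus ?thesis using k by (simp only: rootk_add rootk_multiple mult_1_left)
qed

lemma norm_rootk [simp]: "norm (rootk k m) = 1"
  by (simp add: rootk_def Re_divide_of_nat)

lemma cnj_rootk: "cnj (rootk k m) = inverse (rootk k m)"
  by (simp add: rootk_def exp_cnj exp_minus[symmetric])

lemma rootk_eqD:
  assumes k: "k > 0" and "rootk k a = rootk k b" "a < k" "b < k"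
  shows "a = b"
proof -
  have "exp (2 * of_real pi * \<i> * (of_nat a - of_nat b) / of_nat k) = rootk k a / rootk k b"
    by (simp add: rootk_def exp_diff[symmetric] diff_divide_distrib algebra_simps)
  also have "\<dots> = 1" using assms by (simp add: rootk_def)
  finally obtain n :: int where "complex_of_nat a = of_nat b + of_nat k * of_int n" by (rule exp_unit_eq_1D[OF k])
  hence "complex_of_int (int a) = of_int (int b + int k * n)" by simp
  hence e: "int a = int b + int k * n" by (simp only: of_int_eq_iff)
  have "n < 1"
  proof (rule ccontr)
    assume "\<not> n < 1"
    hence "int k * 1 \<le> int k * n" by (intro mult_left_mono) auto
    thus False using e assms by linarith
  qed
  moreover have "n > - 1"
  proof (rule ccontr)
    assume "\<not> n > - 1"
    hence "int k * n \<le> int k * (- 1)" by (intro mult_left_mono) auto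
    thus False using e assms by linarith
  qed
  ultimately have "n = 0" by simp
  thus ?thesis using e by simp
qed

lemma sum_rootk_powers:
  assumes k: "k > 0" and "a < k" "b < k"
  shows "(\<Sum>n<k. (rootk k a * cnj (rootk k b)) ^ n) = (if a = b then of_nat k else 0)"
proof (cases "a = b")
  case True
  have "rootk k b * cnj (rootk k b) = 1" by (simp add: complex_norm_square[symmetric] flip: of_real_power)
  thus ?thesis using True by simp
next
  case False
  define z where "z = rootk k a * cnj (rootk k b)"
  have "z \<noteq> 1"
  proof
    assume "z = 1"
    hence "rootk k a * inverse (rootk k b) = 1" by (simp add: z_def cnj_rootk)
    moreover have "rootk k b \<noteq> 0" by (simp add: rootk_def)
    ultimately have "rootk k a = rootk k b" by (simp add: field_simps)
    thus False using rootk_eqD[OF k] assms False by blast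
  qed
  moreover have "z ^ k = 1"
  proof -
    have "rootk k a ^ k = 1" for a using k by (simp flip: rootk_mult add: mult.commute[of a])
    thus ?thesis by (simp add: z_def power_mult_distrib flip: complex_cnj_power)
  qed
  ultimately show ?thesis using False by (simp add: z_def[symmetric] sum_gp_strict)
qed

locale prim_char =
  fixes k :: nat and chi :: "nat \<Rightarrow> complex"
  assumes prim: "primitive_char k chi" and nonprinc: "\<not> principal_char k chi"
begin

lemma k_pos: "k > 0" and chi_mult: "chi (m * n) = chi m * chi n" and chi_periodic: "chi (n + k) = chi n"
  and chi_nz: "chi n \<noteq> 0 \<longleftrightarrow> coprime n k"
  using prim by (auto simp: primitive_char_def dirichlet_char_def)

lemma chi_1 [simp]: "chi (Suc 0) = 1"
proof -
  have "chi (Suc 0) * chi (Suc 0) = chi (Suc 0) * 1" using chi_mult[of "Suc 0" "Suc 0"] by simp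
  moreover have "chi (Suc 0) \<noteq> 0" by (simp add: chi_nz)
  ultimately show ?thesis by (simp only: mult_cancel_left simp_thms)
qed

lemma chi_add_mult: "chi (n + k * m) = chi n"
proof (induction m)
  case (Suc m)
  have "chi (n + k * Suc m) = chi (n + k * m + k)" by (simp add: algebra_simps)
  thus ?case using Suc chi_periodic by simp
qed simp

lemma chi_mod: "chi (n mod k) = chi n"
  using chi_add_mult[of "n mod k" "n div k"] by (simp add: add.commute)

lemma chi_power: "chi (n ^ m) = chi n ^ m"
  by (induction m) (auto simp: chi_mult)

lemma norm_chi: "norm (chi n) = (if coprime n k then 1 else 0)"
proof (cases "coprime n k")
  case True
  have "[n ^ totient k = 1] (mod k)" by (rule euler_theorem[OF True])
  hence "chi (n ^ totient k) = chi 1" by (metis chi_mod cong_def)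
  hence "chi n ^ totient k = 1" by (simp add: chi_power)
  hence "norm (chi n) ^ totient k = 1" by (metis norm_power norm_one)
  moreover have "totient k > 0" using k_pos by simp
  ultimately have "norm (chi n) = 1" using power_eq_imp_eq_base[of "norm (chi n)" "totient k" 1] by simp
  thus ?thesis using True by simp
qed (use chi_nz in auto)

lemma norm_chi_le: "norm (chi n) \<le> 1"
  by (simp add: norm_chi)

text \<open>The moduli 1 and 2 carry only the principal character. The numerical part uses this
  through \<open>ln (k * T) \<ge> ln (3 * T0)\<close>.\<close>

lemma k_ge_3: "k \<ge> 3"
proof (rule ccontr)
  assume "\<not> k \<ge> 3"
  hence k: "k = 1 \<or> k = 2" using k_pos by auto
  have "principal_char k chi"
    unfolding principal_char_def
  proof (intro allI impI)
    fix n assume n: "coprime n k"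
    have "n mod k = 1 mod k"
      using k
    proof
      assume "k = 2"
      hence "odd n" using n by (simp add: coprime_right_2_iff_odd)
      thus ?thesis using \<open>k = 2\<close> by (simp add: odd_iff_mod_2_eq_one)
    qed auto
    hence "chi n = chi 1" using chi_mod[of n] chi_mod[of 1] by metis
    thus "chi n = 1" by simp
  qed
  thus False using nonprinc by simp
qed

lemma chi_0 [simp]: "chi 0 = 0" using chi_nz[of 0] k_ge_3 by auto
lemma chi_k [simp]: "chi k = 0" using chi_periodic[of 0] by simp

lemma sum_shift_residues:
  assumes "f k = f 0" shows "(\<Sum>a=1..k. f a) = (\<Sum>a<k. f a :: complex)"
proof -
  have "(\<Sum>a=1..k. f a) = (\<Sum>a<k. f (Suc a))" by (simp add: sum.atLeast1_atMost_eq)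
  also have "\<dots> = (\<Sum>a<k. f a) + f k - f 0"
    by (induction k) auto
  finally show ?thesis using assms by simp
qed

lemma sum_permute_residues:
  assumes b: "coprime b k" and per: "\<And>n. f (n mod k) = f n"
  shows "(\<Sum>a<k. f (b * a)) = (\<Sum>a<k. f a :: complex)"
proof -
  have inj: "inj_on (\<lambda>a. (b * a) mod k) {..<k}"
  proof (rule inj_onI)
    fix x y assume xy: "x \<in> {..<k}" "y \<in> {..<k}" "(b * x) mod k = (b * y) mod k"
    hence "[b * x = b * y] (mod k)" by (simp add: cong_def)
    hence "[x = y] (mod k)" using b by (simp add: cong_mult_lcancel_nat)
    thus "x = y" using xy by (simp add: cong_def)
  qed
  have "(\<lambda>a. (b * a) mod k) ` {..<k} = {..<k}"
    by (rule card_subset_eq) (use k_pos in \<open>auto simp: card_image[OF inj]\<close>)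
  hence "bij_betw (\<lambda>a. (b * a) mod k) {..<k} {..<k}" using inj by (simp add: bij_betw_def)
  hence "(\<Sum>a<k. f ((b * a) mod k)) = (\<Sum>a<k. f a)" by (rule sum.reindex_bij_betw)
  thus ?thesis by (simp add: per)
qed

lemma sum_chi: "(\<Sum>a=1..k. chi a) = 0"
proof -
  obtain b where b: "coprime b k" "chi b \<noteq> 1" using nonprinc by (auto simp: principal_char_def)
  have "(\<Sum>a<k. chi a) = (\<Sum>a<k. chi (b * a))" by (rule sum_permute_residues[of b chi, OF b(1) chi_mod, symmetric])
  also have "\<dots> = chi b * (\<Sum>a<k. chi a)" by (simp add: chi_mult sum_distrib_left)
  finally have "(\<Sum>a<k. chi a) = 0" using b by simp
  thus ?thesis by (subst sum_shift_residues) auto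
qed

definition gauss :: "nat \<Rightarrow> complex" where
  "gauss n = (\<Sum>a<k. chi a * rootk k (a * n))"

text \<open>This is where primitivity enters. If \<open>g = gcd n k > 1\<close>, the root of unity
  depends on \<open>a\<close> only modulo \<open>d = k div g\<close>. Since \<open>d\<close> is no
  induced modulus, some \<open>m\<close> congruent to 1 modulo \<open>d\<close> has
  \<open>chi m \<noteq> 1\<close>; multiplying the summation index by \<open>m\<close> shows that
  the sum vanishes.\<close>

lemma gauss_eq: "gauss n = cnj (chi n) * gauss 1"
proof (cases "coprime n k")
  case True
  have "gauss 1 = (\<Sum>a<k. chi (n * a) * rootk k (n * a))"
    using sum_permute_residues[OF True, of "\<lambda>a. chi a * rootk k a"] k_pos by (simp add: gauss_def chi_mod rootk_mod)
  also have "\<dots> = chi n * gauss n" by (simp add: gauss_def chi_mult sum_distrib_left mult_ac)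
  finally have "cnj (chi n) * gauss 1 = (cnj (chi n) * chi n) * gauss n" by simp
  also have "cnj (chi n) * chi n = of_real ((norm (chi n))\<^sup>2)" by (simp only: complex_norm_square mult.commute)
  also have "\<dots> = 1" using True by (simp add: norm_chi)
  finally show ?thesis by simp
next
  case False
  define g where "g = gcd n k"
  have g: "g > 1" using False k_pos by (metis g_def coprime_iff_gcd_eq_1 gcd_pos_nat less_one linorder_neqE_nat nat_less_le neq0_conv)
  define d n' where "d = k div g" and "n' = n div g"
  have dk: "k = g * d" "n = g * n'" by (simp_all add: d_def n'_def g_def)
  have d: "d > 0" "d < k" using dk k_pos g by (auto intro: Nat.gr0I)
  have "\<not> induced_modulus k chi d" using prim d by (auto simp: primitive_char_def)
  then obtain m where m: "coprime m k" "m mod d = 1 mod d" "chi m \<noteq> 1" using dk by (auto simp: induced_modulus_def)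
  have red: "rootk k (x * n) = rootk d (x * n')" for x
    unfolding rootk_def using g d by (simp add: dk mult_ac)
  have md: "rootk d (m * x) = rootk d x" for x
  proof -
    have "(m * x) mod d = x mod d" using m(2) by (metis mod_mult_left_eq mult_1)
    thus ?thesis using rootk_mod[of d "m * x"] rootk_mod[of d x] d by simp
  qed
  have "gauss n = (\<Sum>a<k. chi (m * a) * rootk k (m * a * n))"
    using sum_permute_residues[OF m(1), of "\<lambda>a. chi a * rootk k (a * n)"] k_pos
    by (simp add: gauss_def chi_mod rootk_mult rootk_mod)
  also have "\<dots> = chi m * gauss n"
    unfolding gauss_def red sum_distrib_left using md by (simp add: chi_mult mult.assoc)
  finally have "gauss n = 0" using m by simp
  thus ?thesis using False chi_nz[of n] by simp
qed

text \<open>Parseval's identity: the sum of the squared moduli of \<open>gauss n\<close> is computed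
  once from \<open>gauss_eq\<close> and once from the orthogonality of the roots of unity.\<close>

lemma norm_gauss_1: "norm (gauss 1) = sqrt k"
proof -
  define P where "P = (\<Sum>n<k. (norm (chi n))\<^sup>2)"
  have P: "P > 0"
  proof -
    have "(norm (chi 1))\<^sup>2 \<le> P" unfolding P_def using k_ge_3 by (intro member_le_sum) auto
    thus ?thesis by simp
  qed
  have "complex_of_real ((norm (gauss 1))\<^sup>2 * P) = (\<Sum>n<k. gauss n * cnj (gauss n))"
  proof -
    have "gauss n * cnj (gauss n) = of_real ((norm (gauss 1))\<^sup>2 * (norm (chi n))\<^sup>2)" for n
    proof -
      have "norm (gauss n) = norm (gauss 1) * norm (chi n)" by (subst gauss_eq) (simp add: norm_mult)
      thus ?thesis unfolding complex_norm_square[symmetric] by (simp only: power_mult_distrib)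
    qed
    hence "(\<Sum>n<k. gauss n * cnj (gauss n)) = (\<Sum>n<k. complex_of_real ((norm (gauss 1))\<^sup>2 * (norm (chi n))\<^sup>2))" by (simp only:)
    also have "\<dots> = complex_of_real ((norm (gauss 1))\<^sup>2 * P)" unfolding P_def sum_distrib_left of_real_sum ..
    finally show ?thesis ..
  qed
  also have "\<dots> = (\<Sum>n<k. \<Sum>a<k. \<Sum>b<k. chi a * cnj (chi b) * (rootk k a * cnj (rootk k b)) ^ n)"
  proof -
    have "gauss n * cnj (gauss n) = (\<Sum>a<k. \<Sum>b<k. chi a * cnj (chi b) * (rootk k a * cnj (rootk k b)) ^ n)" for n
      unfolding gauss_def cnj_sum sum_product rootk_mult complex_cnj_mult complex_cnj_power power_mult_distrib
      by (intro sum.cong refl) (simp only: mult_ac)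
    thus ?thesis by simp
  qed
  also have "\<dots> = (\<Sum>a<k. \<Sum>n<k. \<Sum>b<k. chi a * cnj (chi b) * (rootk k a * cnj (rootk k b)) ^ n)"
    by (rule sum.swap)
  also have "\<dots> = (\<Sum>a<k. \<Sum>b<k. \<Sum>n<k. chi a * cnj (chi b) * (rootk k a * cnj (rootk k b)) ^ n)"
    by (rule sum.cong[OF refl], rule sum.swap)
  also have "\<dots> = (\<Sum>a<k. of_nat k * (chi a * cnj (chi a)))"
  proof (rule sum.cong[OF refl])
    fix a assume a: "a \<in> {..<k}"
    have "(\<Sum>b<k. \<Sum>n<k. chi a * cnj (chi b) * (rootk k a * cnj (rootk k b)) ^ n) = (\<Sum>b<k. if a = b then of_nat k * (chi a * cnj (chi a)) else 0)"
    proof (rule sum.cong[OF refl])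
      fix b assume b: "b \<in> {..<k}"
      have "(\<Sum>n<k. chi a * cnj (chi b) * (rootk k a * cnj (rootk k b)) ^ n) = chi a * cnj (chi b) * (\<Sum>n<k. (rootk k a * cnj (rootk k b)) ^ n)"
        by (rule sum_distrib_left[symmetric])
      also have "(\<Sum>n<k. (rootk k a * cnj (rootk k b)) ^ n) = (if a = b then of_nat k else 0)"
        using a b by (intro sum_rootk_powers k_pos) auto
      finally show "(\<Sum>n<k. chi a * cnj (chi b) * (rootk k a * cnj (rootk k b)) ^ n) = (if a = b then of_nat k * (chi a * cnj (chi a)) else 0)"
        by simp
    qed
    also have "\<dots> = of_nat k * (chi a * cnj (chi a))" using a by (subst sum.delta') auto
    finally show "(\<Sum>b<k. \<Sum>n<k. chi a * cnj (chi b) * (rootk k a * cnj (rootk k b)) ^ n) = of_nat k * (chi a * cnj (chi a))" .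
  qed
  also have "\<dots> = of_nat k * (\<Sum>a<k. chi a * cnj (chi a))"
    by (rule sum_distrib_left[symmetric])
  also have "(\<Sum>a<k. chi a * cnj (chi a)) = of_real P" unfolding P_def of_real_sum complex_norm_square ..
  also have "of_nat k * complex_of_real P = of_real (k * P)" by simp
  finally have "(norm (gauss 1))\<^sup>2 * P = k * P" by (simp only: of_real_eq_iff)
  hence "(norm (gauss 1))\<^sup>2 = k" using P by simp
  thus ?thesis by (metis norm_ge_zero real_sqrt_unique)
qed

text \<open>The value at -1, written with \<open>k - 1\<close> because arguments are natural
  numbers. It decides between cosine and sine in \<open>gcos\<close>.\<close>

definition sgn_chi :: complex where "sgn_chi = chi (k - 1)"

lemma sgn_chi: "sgn_chi = 1 \<or> sgn_chi = - 1"
proof -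
  obtain m where m: "k = m + 3" using k_ge_3 le_iff_add[of 3 k] by (auto simp: add.commute)
  have "(k - 1) * (k - 1) = 1 + k * (k - 2)" unfolding m by (simp add: algebra_simps)
  hence "sgn_chi * sgn_chi = 1" using chi_add_mult[of 1 "k - 2"] by (simp add: sgn_chi_def chi_mult[symmetric])
  thus ?thesis by (simp only: square_eq_1_iff)
qed

lemma dft_pos_chi: "dft_pos k chi n = cnj (chi n) * gauss 1"
proof -
  have "dft_pos k chi n = (\<Sum>a=1..k. chi a * rootk k (a * n))" by (simp add: dft_pos_def rootk_def mult.assoc)
  also have "\<dots> = gauss n" unfolding gauss_def by (rule sum_shift_residues) simp
  also have "\<dots> = cnj (chi n) * gauss 1" by (rule gauss_eq)
  finally show ?thesis .
qed

lemma dft_neg_chi: "dft_neg k chi n = sgn_chi * cnj (chi n) * gauss 1"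
proof -
  have e: "exp (- (2 * of_real pi * \<i> * of_nat a * of_nat n / of_nat k)) = rootk k (a * ((k - 1) * n))" for a
  proof -
    have "a * ((k - 1) * n) + a * n = k * (a * n)" using k_pos by (cases k) (auto simp: algebra_simps)
    hence "rootk k (a * ((k - 1) * n)) * rootk k (a * n) = 1" using k_pos by (simp flip: rootk_add)
    hence "inverse (rootk k (a * n)) = rootk k (a * ((k - 1) * n))" by (intro inverse_unique) (simp only: mult.commute)
    moreover have "exp (- (2 * of_real pi * \<i> * of_nat a * of_nat n / of_nat k)) = inverse (rootk k (a * n))"
      unfolding rootk_def exp_minus of_nat_mult by (simp only: mult.assoc)
    ultimately show ?thesis by (simp only:)
  qed
  have "dft_neg k chi n = (\<Sum>a=1..k. chi a * rootk k (a * ((k - 1) * n)))" unfolding dft_neg_def e ..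
  also have "\<dots> = gauss ((k - 1) * n)" unfolding gauss_def by (rule sum_shift_residues) simp
  also have "\<dots> = cnj sgn_chi * cnj (chi n) * gauss 1" using gauss_eq[of "(k - 1) * n"] by (simp add: sgn_chi_def chi_mult)
  also have "cnj sgn_chi = sgn_chi" using sgn_chi by auto
  finally show ?thesis .
qed

definition chi_bar :: "nat \<Rightarrow> complex" where "chi_bar n = cnj (chi n)"

text \<open>Makes all results of the locale available for the conjugate character, which appears on
  the other side of the functional equation and, later, for the horizontal side at height
  \<open>- T\<close>.\<close>

lemma prim_char_bar: "prim_char k chi_bar"
proof
  have ii: "induced_modulus k chi_bar d \<longleftrightarrow> induced_modulus k chi d" for d
    by (simp add: induced_modulus_def chi_bar_def)
  show "primitive_char k chi_bar"
  proof -
    have "dirichlet_char k chi_bar"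
      unfolding dirichlet_char_def chi_bar_def by (simp add: k_pos chi_mult chi_periodic chi_nz)
    thus ?thesis using prim unfolding primitive_char_def ii by blast
  qed
  show "\<not> principal_char k chi_bar" using nonprinc by (simp add: principal_char_def chi_bar_def)
qed

end

lemma powr_of_nat_cnj: "n > 0 \<Longrightarrow> cnj (of_nat n powr s) = of_nat n powr cnj s"
  by (simp add: powr_def exp_cnj)

lemma holomorphic_eq_on_halfplane:
  fixes f g :: "complex \<Rightarrow> complex"
  assumes "f holomorphic_on {s. Re s > a}" "g holomorphic_on {s. Re s > a}" "\<And>s. Re s > b \<Longrightarrow> f s = g s" "Re s > a" "a \<le> b"
  shows "f s = g s"
proof -
  have "f s - g s = 0"
  proof (rule analytic_continuation_open[of "{s. Re s > b}" "{s. Re s > a}" "\<lambda>s. f s - g s" "\<lambda>_. 0"])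
    show "{s. Re s > b} \<noteq> {}" by (auto intro: exI[of _ "of_real (b + 1)"])
    show "connected {s. Re s > a}" by (intro convex_connected convex_halfspace_Re_gt)
  qed (use assms in \<open>auto intro!: holomorphic_intros simp: open_halfspace_Re_gt\<close>)
  thus ?thesis by simp
qed

text \<open>Entire functions with the same series agree for \<open>Re s > 1\<close>, hence
  everywhere, so the choice operator can return nothing but \<open>f\<close>.\<close>

lemma dirichlet_L_eqI:
  assumes "f holomorphic_on UNIV" "\<And>s. Re s > 1 \<Longrightarrow> (\<lambda>n. chi (Suc n) / of_nat (Suc n) powr s) sums f s"
  shows "dirichlet_L chi = f"
proof -
  define P where "P = (\<lambda>f. f holomorphic_on UNIV \<and> (\<forall>s. Re s > 1 \<longrightarrow> (\<lambda>n. chi (Suc n) / of_nat (Suc n) powr s) sums f s))"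
  have "P f" using assms by (simp add: P_def)
  hence "P (Eps P)" by (rule someI[of P])
  moreover have "dirichlet_L chi = Eps P" by (simp add: dirichlet_L_def P_def[abs_def])
  ultimately have "P (dirichlet_L chi)" by simp
  show ?thesis
  proof
    fix s
    show "dirichlet_L chi s = f s"
    proof (rule holomorphic_eq_on_halfplane[where a = "min 0 (Re s - 1)" and b = 1 and f = "dirichlet_L chi" and g = f])
      show "dirichlet_L chi z = f z" if "Re z > 1" for z
        using \<open>P f\<close> \<open>P (dirichlet_L chi)\<close> that sums_unique2 unfolding P_def by blast
    qed (use \<open>P f\<close> \<open>P (dirichlet_L chi)\<close> in \<open>auto simp: P_def intro: holomorphic_on_subset\<close>)
  qed
qed

section \<open>The functional equation of \<open>L\<close>\<close>

context prim_char
begin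

abbreviation L :: "complex \<Rightarrow> complex" where "L \<equiv> dirichlet_L chi"
abbreviation Lb :: "complex \<Rightarrow> complex" where "Lb \<equiv> dirichlet_L chi_bar"

lemma L_props:
  shows L_holomorphic_UNIV: "L holomorphic_on UNIV"
    and L_sums: "Re s > 1 \<Longrightarrow> (\<lambda>n. chi (Suc n) / of_nat (Suc n) powr s) sums L s"
    and L_line_int: "(\<lambda>m. - \<i> / of_nat k * line_int k chi (1 / 2) m s) \<longlonglongrightarrow> L s"
    and L_growth: "R \<ge> 0 \<Longrightarrow> \<exists>K. \<forall>s. \<bar>Re s\<bar> \<le> R \<longrightarrow> norm (L s) \<le> K * exp (pi / 2 * \<bar>Im s\<bar>)"
proof -
  obtain f where f: "f holomorphic_on UNIV"
    "\<And>s. Re s > 1 \<Longrightarrow> (\<lambda>n. chi (Suc n) / of_nat (Suc n) powr s) sums f s"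
    "\<And>s. (\<lambda>m. - \<i> / of_nat k * line_int k chi (1 / 2) m s) \<longlonglongrightarrow> f s"
    "\<And>R. R \<ge> 0 \<Longrightarrow> \<exists>K. \<forall>s. \<bar>Re s\<bar> \<le> R \<longrightarrow> norm (f s) \<le> K * exp (pi / 2 * \<bar>Im s\<bar>)"
    using periodic_dirichlet_entire[OF k_pos sum_chi chi_periodic] by blast
  have "L = f" by (rule dirichlet_L_eqI[OF f(1,2)])
  thus "L holomorphic_on UNIV"
    "Re s > 1 \<Longrightarrow> (\<lambda>n. chi (Suc n) / of_nat (Suc n) powr s) sums L s"
    "(\<lambda>m. - \<i> / of_nat k * line_int k chi (1 / 2) m s) \<longlonglongrightarrow> L s"
    "R \<ge> 0 \<Longrightarrow> \<exists>K. \<forall>s. \<bar>Re s\<bar> \<le> R \<longrightarrow> norm (L s) \<le> K * exp (pi / 2 * \<bar>Im s\<bar>)"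
    using f by auto
qed

lemma L_holomorphic [holomorphic_intros]: "L holomorphic_on A"
  using L_holomorphic_UNIV by (rule holomorphic_on_subset) auto

lemma Lb_eq: "Lb s = cnj (L (cnj s))"
proof -
  have "dirichlet_L chi_bar = (\<lambda>s. cnj (L (cnj s)))"
  proof (rule dirichlet_L_eqI)
    have "cnj \<circ> L \<circ> cnj holomorphic_on UNIV"
      by (intro holomorphic_on_compose_cnj_cnj L_holomorphic) auto
    thus "(\<lambda>s. cnj (L (cnj s))) holomorphic_on UNIV" by (simp add: o_def)
    fix s :: complex assume s: "Re s > 1"
    have "(\<lambda>n. cnj (chi (Suc n) / of_nat (Suc n) powr cnj s)) sums cnj (L (cnj s))"
      using L_sums[of "cnj s"] s by (subst sums_cnj) auto
    thus "(\<lambda>n. chi_bar (Suc n) / of_nat (Suc n) powr s) sums cnj (L (cnj s))"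
      by (simp only: complex_cnj_divide powr_of_nat_cnj zero_less_Suc complex_cnj_cnj chi_bar_def)
  qed
  thus ?thesis by simp
qed

definition Phi :: "complex \<Rightarrow> complex" where
  "Phi s = Gamma s * of_real (2 * pi / k) powr (- s) * (gauss 1 / of_nat k) * gcos sgn_chi s"

text \<open>For \<open>Re s > 1\<close> the Mellin computation applies, the Fourier coefficients of
  \<open>chi\<close> being Gauss sums times conjugate values. Both sides are holomorphic for
  \<open>Re s > 0\<close>, so the identity extends across the critical strip.\<close>

theorem functional_equation:
  assumes "Re s > 0"
  shows "L (1 - s) = Phi s * Lb s"
proof (rule holomorphic_eq_on_halfplane[where a = 0 and b = 1 and f = "\<lambda>s. L (1 - s)" and g = "\<lambda>s. Phi s * Lb s"])
  interpret bar: prim_char k chi_bar by (rule prim_char_bar)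
  have "z \<notin> \<int>\<^sub>\<le>\<^sub>0" if "Re z > 0" for z :: complex using that by (auto simp: nonpos_Ints_def)
  thus "(\<lambda>s. Phi s * Lb s) holomorphic_on {s. Re s > 0}"
    unfolding Phi_def gcos_def using k_pos by (intro holomorphic_intros bar.L_holomorphic) auto
  show "(\<lambda>s. L (1 - s)) holomorphic_on {s. Re s > 0}"
  proof -
    have "(L \<circ> (\<lambda>s. 1 - s)) holomorphic_on {s. Re s > 0}" by (intro holomorphic_on_compose holomorphic_intros)
    thus ?thesis by (simp add: o_def)
  qed
  fix s :: complex assume s: "Re s > 1"
  have su: "(\<Sum>n. x * (chi_bar (Suc n) * of_nat (Suc n) powr (- s))) = x * Lb s" for x
    using sums_mult[OF bar.L_sums[OF s], of x] by (simp add: sums_iff powr_minus divide_inverse)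
  have "L (1 - s) = Gamma s * of_real (2 * pi / k) powr (- s) / of_nat k *
     (exp (\<i> * of_real pi * s / 2) * (\<Sum>n. dft_neg k chi (Suc n) * of_nat (Suc n) powr (- s))
      + exp (- (\<i> * of_real pi * s / 2)) * (\<Sum>n. dft_pos k chi (Suc n) * of_nat (Suc n) powr (- s)))"
    by (rule periodic_functional_equation[OF k_pos sum_chi chi_k s L_line_int])
  also have "(\<Sum>n. dft_neg k chi (Suc n) * of_nat (Suc n) powr (- s)) = sgn_chi * gauss 1 * Lb s"
    using su[of "sgn_chi * gauss 1"] by (simp only: dft_neg_chi chi_bar_def mult_ac)
  also have "(\<Sum>n. dft_pos k chi (Suc n) * of_nat (Suc n) powr (- s)) = gauss 1 * Lb s"
    using su[of "gauss 1"] by (simp only: dft_pos_chi chi_bar_def mult_ac)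
  finally show "L (1 - s) = Phi s * Lb s"
    by (simp add: Phi_def gcos_def algebra_simps add_divide_distrib)
qed (use assms in auto)

lemma functional_equation_cnj:
  assumes "Re s > 0"
  shows "L (1 - s) = Phi s * cnj (L (cnj s))"
  using functional_equation[OF assms] by (simp add: Lb_eq)

end

section \<open>Euler products\<close>

text \<open>Termwise comparison of the power series at \<open>w\<close> with the one at
  \<open>norm w\<close>, whose terms all have the same sign.\<close>

lemma norm_Ln_one_minus_le:
  fixes w :: complex
  assumes "norm w < 1"
  shows "norm (Ln (1 - w)) \<le> - ln (1 - norm w)"
proof -
  define r where "r = norm w"
  have r: "0 \<le> r" "r < 1" using assms by (auto simp: r_def)
  have s1: "(\<lambda>n. (- 1) ^ Suc n / of_nat n * (- w) ^ n) sums Ln (1 + (- w))"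
    by (rule Ln_series) (use assms in simp)
  have e1: "(- 1) ^ Suc n / of_nat n * (- w) ^ n = - (w ^ n / of_nat n)" for n
    by (cases "even n") (auto simp: power_minus_odd)
  have s2: "(\<lambda>n. - (w ^ n / of_nat n)) sums Ln (1 - w)" using s1 unfolding e1 by simp
  have s0: "(\<lambda>n. (- 1) ^ Suc n / of_nat n * (- complex_of_real r) ^ n) sums Ln (1 + (- complex_of_real r))"
    by (rule Ln_series) (use r in simp)
  have e2: "(- 1) ^ Suc n / of_nat n * (- complex_of_real r) ^ n = of_real (- (r ^ n / real n))" for n
    by (cases "even n") (auto simp: power_minus_odd)
  have e3: "Ln (1 + (- complex_of_real r)) = of_real (ln (1 - r))"
    using r Ln_of_real[of "1 - r"] by simp
  have "(\<lambda>n. complex_of_real (- (r ^ n / real n))) sums of_real (ln (1 - r))" using s0 unfolding e2 e3 .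
  hence "(\<lambda>n. - (r ^ n / real n)) sums ln (1 - r)" by (simp only: sums_of_real_iff)
  hence s3: "(\<lambda>n. r ^ n / real n) sums (- ln (1 - r))" using sums_minus by fastforce
  have "norm (\<Sum>n. - (w ^ n / of_nat n)) \<le> (\<Sum>n. r ^ n / real n)"
    by (rule norm_suminf_le) (use s3 in \<open>auto simp: r_def norm_divide norm_power sums_iff\<close>)
  thus ?thesis using s2 s3 by (simp add: sums_iff r_def)
qed

text \<open>One setting for the constant 1, for \<open>chi\<close> and for its conjugate; the
  nonvanishing argument multiplies all three Dirichlet series.\<close>

locale cmult_fun =
  fixes chi :: "nat \<Rightarrow> complex"
  assumes cm_mult: "chi (m * n) = chi m * chi n" and cm_1: "chi (Suc 0) = 1" and cm_le: "norm (chi n) \<le> 1"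
begin

definition dterm :: "complex \<Rightarrow> nat \<Rightarrow> complex" where
  "dterm s n = chi n * of_nat n powr (- s)"

definition rough :: "nat \<Rightarrow> nat set" where
  "rough P = {n. n > 0 \<and> (\<forall>p<P. prime p \<longrightarrow> \<not> p dvd n)}"

lemma dterm_0 [simp]: "dterm s 0 = 0"
  and dterm_1 [simp]: "dterm s (Suc 0) = 1"
  by (simp_all add: dterm_def cm_1)

lemma dterm_mult: "dterm s (m * n) = dterm s m * dterm s n"
proof -
  have "complex_of_nat (m * n) powr (- s) = of_nat m powr (- s) * of_nat n powr (- s)"
    unfolding of_nat_mult by (rule powr_times_real_left) auto
  thus ?thesis by (simp add: dterm_def cm_mult mult_ac)
qed

lemma norm_dterm_le: "norm (dterm s n) \<le> real n powr (- Re s)"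
proof -
  have "norm (complex_of_nat n powr (- s)) = real n powr (- Re s)" by (subst norm_powr_real_powr) auto
  thus ?thesis using cm_le[of n] mult_right_mono[of "norm (chi n)" 1 "real n powr (- Re s)"] by (simp add: dterm_def norm_mult)
qed

lemma norm_dterm_prime:
  assumes "prime p" "Re s > 1" shows "norm (dterm s p) < 1"
proof -
  have "real p powr (- Re s) < 1" using assms prime_gt_1_nat[of p] powr_less_one[of "real p" "- Re s"] by simp
  thus ?thesis using norm_dterm_le[of s p] by linarith
qed

lemma dterm_summable:
  assumes "Re s > 1" shows "summable (\<lambda>n. norm (dterm s n))" "dterm s summable_on A"
proof -
  have "summable (\<lambda>n. real n powr (- Re s))" using assms by (simp add: summable_real_powr_iff)
  thus *: "summable (\<lambda>n. norm (dterm s n))"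
    by (rule summable_comparison_test[rotated]) (use norm_dterm_le in \<open>auto intro!: exI[of _ 0]\<close>)
  show "dterm s summable_on A"
    using norm_summable_imp_summable_on[OF *] summable_on_subset_banach by blast
qed

text \<open>A sieve in place of an infinite product: the value at \<open>P = 0\<close> is the full
  series, each prime removes its Euler factor, and the limit in \<open>P\<close> is 1.\<close>

definition dser :: "nat \<Rightarrow> complex \<Rightarrow> complex" where
  "dser P s = infsum (dterm s) (rough P)"

lemma dser_Suc:
  assumes s: "Re s > 1"
  shows "dser (Suc P) s = dser P s * (if prime P then 1 - dterm s P else 1)"
proof (cases "prime P")
  case False
  hence "rough (Suc P) = rough P" by (auto simp: rough_def less_Suc_eq)
  thus ?thesis using False by (simp add: dser_def)
next
  case True
  have P0: "P > 0" using True prime_gt_0_nat by blast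
  have sub: "(*) P ` rough P \<subseteq> rough P"
  proof
    fix m assume "m \<in> (*) P ` rough P"
    then obtain n where n: "n \<in> rough P" "m = P * n" by auto
    have "\<not> p dvd m" if p: "p < P" "prime p" for p
    proof
      assume "p dvd m"
      hence "p dvd P \<or> p dvd n" using p n prime_dvd_mult_iff by blast
      thus False using n p True primes_dvd_imp_eq[of p P] by (auto simp: rough_def)
    qed
    thus "m \<in> rough P" using n P0 by (auto simp: rough_def)
  qed
  have diff: "rough (Suc P) = rough P - (*) P ` rough P"
  proof (intro equalityI subsetI)
    fix n assume "n \<in> rough (Suc P)"
    thus "n \<in> rough P - (*) P ` rough P" using True by (auto simp: rough_def less_Suc_eq)
  next
    fix n assume n: "n \<in> rough P - (*) P ` rough P"
    have "\<not> P dvd n"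
    proof
      assume "P dvd n"
      then obtain m where m: "n = P * m" by (auto elim: dvdE)
      hence "m \<in> rough P" using n by (auto simp: rough_def)
      thus False using n m by auto
    qed
    thus "n \<in> rough (Suc P)" using n by (auto simp: rough_def less_Suc_eq)
  qed
  have "dser (Suc P) s = dser P s - infsum (dterm s) ((*) P ` rough P)"
    unfolding dser_def diff by (rule infsum_Diff) (use s sub in \<open>auto intro: dterm_summable\<close>)
  also have "infsum (dterm s) ((*) P ` rough P) = infsum (dterm s \<circ> (*) P) (rough P)"
    by (rule infsum_reindex) (use P0 in \<open>auto simp: inj_on_def\<close>)
  also have "dterm s \<circ> (*) P = (\<lambda>n. dterm s P * dterm s n)" by (auto simp: dterm_mult fun_eq_iff)
  also have "infsum (\<lambda>n. dterm s P * dterm s n) (rough P) = dterm s P * dser P s"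
    unfolding dser_def by (rule infsum_cmult_right) (use s in \<open>auto intro: dterm_summable\<close>)
  finally show ?thesis using True by (simp add: algebra_simps)
qed

lemma dser_prod:
  assumes s: "Re s > 1"
  shows "dser P s = dser 0 s * (\<Prod>p\<in>{p. prime p \<and> p < P}. 1 - dterm s p)"
proof (induction P)
  case (Suc P)
  have "{p. prime p \<and> p < Suc P} = (if prime P then insert P {p. prime p \<and> p < P} else {p. prime p \<and> p < P})"
    by (auto simp: less_Suc_eq)
  thus ?case using Suc by (simp add: dser_Suc[OF s])
qed simp

lemma dser_sums:
  assumes s: "Re s > 1"
  shows "(\<lambda>n. chi (Suc n) / of_nat (Suc n) powr s) sums dser 0 s"
proof -
  have "rough 0 = UNIV - {0}" by (auto simp: rough_def)
  hence "dser 0 s = infsum (dterm s) UNIV"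
    unfolding dser_def by (intro infsum_cong_neutral) auto
  moreover have "(dterm s has_sum infsum (dterm s) UNIV) UNIV" using dterm_summable(2)[OF s] by simp
  ultimately have "dterm s sums dser 0 s" using has_sum_imp_sums by metis
  hence "(\<lambda>n. dterm s (Suc n)) sums dser 0 s" by (subst sums_Suc_iff) simp
  thus ?thesis by (simp add: dterm_def powr_minus divide_inverse)
qed

text \<open>Apart from 1, an integer without prime factors below \<open>P\<close> is at least
  \<open>P\<close>, so the tail of the zeta series dominates the difference.\<close>

lemma dser_near_1:
  assumes s: "Re s \<ge> r" and r: "r > 1"
  shows "norm (dser P s - 1) \<le> (\<Sum>n. real n powr (- r)) - (\<Sum>n<P. real n powr (- r))"
proof -
  have s1: "Re s > 1" using s r by simp
  have sm: "summable (\<lambda>n. real n powr (- r))" using r by (simp add: summable_real_powr_iff)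
  have smo: "(\<lambda>n. real n powr (- r)) summable_on A" for A
    by (rule summable_on_subset_banach[of _ UNIV]) (use norm_summable_imp_summable_on[of "\<lambda>n. real n powr (- r)"] sm in auto)
  have 1: "1 \<in> rough P" by (auto simp: rough_def dest: prime_gt_1_nat)
  have ge: "n \<ge> P" if "n \<in> rough P - {1}" for n
  proof -
    have "n \<noteq> 1" "n > 0" using that by (auto simp: rough_def)
    then obtain p where p: "prime p" "p dvd n" using prime_factor_nat by blast
    hence "p \<ge> P" using that by (auto simp: rough_def not_less[symmetric])
    thus ?thesis using p \<open>n > 0\<close> dvd_imp_le[of p n] by linarith
  qed
  have "dser P s = dterm s 1 + infsum (dterm s) (rough P - {1})"
    unfolding dser_def using infsum_insert[OF dterm_summable(2)[OF s1], of 1 "rough P - {1}"] 1 by (simp add: insert_absorb)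
  hence "norm (dser P s - 1) = norm (infsum (dterm s) (rough P - {1}))" by simp
  also have "\<dots> \<le> infsum (\<lambda>n. real n powr (- r)) (rough P - {1})"
  proof (rule norm_infsum_le)
    show "(dterm s has_sum infsum (dterm s) (rough P - {1})) (rough P - {1})" using dterm_summable(2)[OF s1] by simp
    show "((\<lambda>n. real n powr (- r)) has_sum infsum (\<lambda>n. real n powr (- r)) (rough P - {1})) (rough P - {1})" using smo by simp
    show "norm (dterm s n) \<le> real n powr (- r)" if "n \<in> rough P - {1}" for n
    proof -
      have "real n powr (- Re s) \<le> real n powr (- r)" using s that by (intro powr_mono) (auto simp: rough_def)
      thus ?thesis using norm_dterm_le[of s n] by linarith
    qed
  qed
  also have "\<dots> \<le> infsum (\<lambda>n. real n powr (- r)) (UNIV - {..<P})"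
    by (rule infsum_mono_neutral) (use ge in \<open>auto intro: smo simp: not_less\<close>)
  also have "\<dots> = infsum (\<lambda>n. real n powr (- r)) UNIV - infsum (\<lambda>n. real n powr (- r)) {..<P}"
    by (rule infsum_Diff) (auto intro: smo)
  also have "infsum (\<lambda>n. real n powr (- r)) UNIV = (\<Sum>n. real n powr (- r))"
  proof -
    have "((\<lambda>n. real n powr (- r)) has_sum infsum (\<lambda>n. real n powr (- r)) UNIV) UNIV" using smo by simp
    from has_sum_imp_sums[OF this] show ?thesis by (rule sums_unique)
  qed
  finally show ?thesis by simp
qed

lemma dser_tendsto_1:
  assumes s: "Re s > 1" shows "(\<lambda>P. dser P s) \<longlonglongrightarrow> 1"
proof -
  have sm: "summable (\<lambda>n. real n powr (- Re s))" using s by (simp add: summable_real_powr_iff)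
  have "(\<lambda>P. (\<Sum>n. real n powr (- Re s)) - (\<Sum>n<P. real n powr (- Re s))) \<longlonglongrightarrow> (\<Sum>n. real n powr (- Re s)) - (\<Sum>n. real n powr (- Re s))"
    by (intro tendsto_diff tendsto_const summable_LIMSEQ sm)
  hence lim: "(\<lambda>P. (\<Sum>n. real n powr (- Re s)) - (\<Sum>n<P. real n powr (- Re s))) \<longlonglongrightarrow> 0" by simp
  have "(\<lambda>P. dser P s - 1) \<longlonglongrightarrow> 0"
    by (rule Lim_null_comparison[OF always_eventually lim]) (intro allI dser_near_1[OF order.refl s])
  thus ?thesis by (rule LIM_zero_cancel)
qed

end

section \<open>Zeta to the right of 1 and logarithms of Euler products\<close>

global_interpretation one: cmult_fun "\<lambda>_. 1"
  defines zterm = one.dterm and zser = one.dser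
  by standard auto

lemma zterm_real: "zterm (of_real r) n = of_real (real n powr (- r))"
proof -
  have "zterm (of_real r) n = of_real (real n) powr (of_real (- r))" by (simp add: one.dterm_def)
  also have "\<dots> = of_real (real n powr (- r))" by (rule powr_of_real) simp
  finally show ?thesis .
qed

text \<open>Comparison with the integral of \<open>x powr (- r)\<close>, carried out through the
  mean value theorem. This is the only numerical upper bound for zeta that enters the final
  constants.\<close>

lemma suminf_powr_le:
  assumes r: "r > 1" shows "(\<Sum>n. real n powr (- r)) \<le> r / (r - 1)"
proof (rule suminf_le_const)
  show "summable (\<lambda>n. real n powr (- r))" using r by (simp add: summable_real_powr_iff)
  have tel: "(\<Sum>n<Suc (Suc N). real n powr (- r)) \<le> r / (r - 1) - real (Suc N) powr (1 - r) / (r - 1)" for N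
  proof (induction N)
    case 0
    have "r / (r - 1) - 1 / (r - 1) = 1" using r by (simp add: diff_divide_distrib[symmetric])
    thus ?case by simp
  next
    case (Suc N)
    define x where "x = real (Suc N)"
    have x: "x > 0" by (simp add: x_def)
    have D: "((\<lambda>x. x powr (1 - r)) has_real_derivative (1 - r) * u powr (1 - r - 1)) (at u)" if "u > 0" for u
      by (rule has_real_derivative_powr[OF that])
    have "\<exists>z>x. z < x + 1 \<and> (x + 1) powr (1 - r) - x powr (1 - r) = (x + 1 - x) * ((1 - r) * z powr (1 - r - 1))"
      by (rule MVT2[of x "x + 1" "\<lambda>x. x powr (1 - r)" "\<lambda>z. (1 - r) * z powr (1 - r - 1)"]) (use x D in \<open>simp, metis less_le_trans\<close>)
    then obtain z where z: "z > x" "z < x + 1" "(x + 1) powr (1 - r) - x powr (1 - r) = (1 - r) * z powr (- r)" by auto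
    have "(x + 1) powr (- r) \<le> z powr (- r)" using z x r by (intro powr_mono2') auto
    hence "(r - 1) * (x + 1) powr (- r) \<le> (r - 1) * z powr (- r)" using r by (intro mult_left_mono) auto
    also have "\<dots> = x powr (1 - r) - (x + 1) powr (1 - r)" using z by (simp add: algebra_simps)
    finally have "(x + 1) powr (- r) \<le> (x powr (1 - r) - (x + 1) powr (1 - r)) / (r - 1)"
      using r by (simp add: pos_le_divide_eq mult.commute)
    hence "(x + 1) powr (- r) \<le> x powr (1 - r) / (r - 1) - (x + 1) powr (1 - r) / (r - 1)"
      by (simp add: diff_divide_distrib)
    moreover have e: "real (Suc (Suc N)) = x + 1" by (simp add: x_def)
    moreover have "(\<Sum>n<Suc (Suc (Suc N)). real n powr (- r)) = (\<Sum>n<Suc (Suc N). real n powr (- r)) + real (Suc (Suc N)) powr (- r)"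
      by (rule sum.lessThan_Suc)
    ultimately show ?case using Suc.IH unfolding x_def[symmetric] e by linarith
  qed
  fix N
  have "(\<Sum>n<N. real n powr (- r)) \<le> (\<Sum>n<Suc (Suc N). real n powr (- r))" by (intro sum_mono2) auto
  also have "\<dots> \<le> r / (r - 1)" using tel[of N] r by (smt (verit) divide_nonneg_pos powr_ge_zero)
  finally show "(\<Sum>n<N. real n powr (- r)) \<le> r / (r - 1)" .
qed

definition zeta_real :: "real \<Rightarrow> real" where "zeta_real r = (\<Sum>n. real n powr (- r))"

lemma zeta_real_ge_1: assumes "r > 1" shows "zeta_real r \<ge> 1"
proof -
  have "(\<Sum>n<2. real n powr (- r)) \<le> zeta_real r"
    unfolding zeta_real_def by (rule sum_le_suminf) (use assms in \<open>auto simp: summable_real_powr_iff\<close>)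
  thus ?thesis by (simp add: numeral_2_eq_2)
qed

lemma zser_0_real:
  assumes r: "r > 1" shows "zser 0 (of_real r) = of_real (zeta_real r)"
proof -
  have "(\<lambda>n. complex_of_real (real (Suc n) powr (- r))) sums zser 0 (of_real r)"
  proof -
    have e: "1 / of_nat (Suc n) powr complex_of_real r = complex_of_real (real (Suc n) powr (- r))" for n
      using zterm_real[of r "Suc n"] by (simp add: one.dterm_def powr_minus divide_inverse)
    show ?thesis using one.dser_sums[of "of_real r"] r unfolding e by simp
  qed
  moreover have "(\<lambda>n. real (Suc n) powr (- r)) sums zeta_real r"
    unfolding zeta_real_def using r by (subst sums_Suc_iff) (auto simp: summable_real_powr_iff intro: summable_sums)
  hence "(\<lambda>n. complex_of_real (real (Suc n) powr (- r))) sums of_real (zeta_real r)" by (simp only: sums_of_real_iff)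
  ultimately show ?thesis by (rule sums_unique2)
qed

text \<open>Zeta times the finite product over \<open>p < P\<close> is the sum over integers without
  prime factor below \<open>P\<close>, and this is at least its term for 1.\<close>

lemma prime_log_sum_le:
  assumes r: "r > 1"
  shows "(\<Sum>n<P. if prime n then - ln (1 - real n powr (- r)) else 0) \<le> ln (zeta_real r)"
proof -
  define S where "S = {p. prime p \<and> p < P}"
  have fin: "finite S" by (auto simp: S_def)
  have x: "0 < 1 - real p powr (- r)" if "p \<in> S" for p
    using that one.norm_dterm_prime[of p "of_real r"] r by (simp add: S_def zterm_real)
  define Q where "Q = (\<Prod>p\<in>S. 1 - real p powr (- r))"
  have Q: "Q > 0" unfolding Q_def by (intro prod_pos) (use x in auto)
  have "zser P (of_real r) = of_real (zeta_real r * Q)"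
    using one.dser_prod[of "of_real r" P] r by (simp add: zser_0_real zterm_real Q_def S_def)
  moreover have "Re (zser P (of_real r)) \<ge> 1"
  proof -
    have sm: "zterm (of_real r) summable_on A" for A using one.dterm_summable(2)[of "of_real r"] r by simp
    have "Re (zser P (of_real r)) = infsum (\<lambda>n. Re (zterm (of_real r) n)) (one.rough P)"
      unfolding one.dser_def by (rule infsum_Re[OF sm, symmetric])
    also have "\<dots> \<ge> infsum (\<lambda>n. Re (zterm (of_real r) n)) {1}"
      by (rule infsum_mono_neutral) (auto simp: zterm_real intro: summable_on_Re[OF sm, simplified zterm_real Re_complex_of_real] , auto simp: one.rough_def dest: prime_gt_1_nat)
    finally show ?thesis by (simp add: zterm_real)
  qed
  ultimately have "zeta_real r * Q \<ge> 1" by simp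
  hence "0 \<le> ln (zeta_real r * Q)" by simp
  also have "\<dots> = ln (zeta_real r) + ln Q" using Q zeta_real_ge_1[OF r] by (intro ln_mult_pos) auto
  also have "ln Q = (\<Sum>p\<in>S. ln (1 - real p powr (- r)))" unfolding Q_def by (rule ln_prod[OF fin]) (frule x, linarith)
  finally have "(\<Sum>p\<in>S. - ln (1 - real p powr (- r))) \<le> ln (zeta_real r)" by (simp add: sum_negf)
  moreover have "(\<Sum>p\<in>S. - ln (1 - real p powr (- r))) = (\<Sum>n<P. if prime n then - ln (1 - real n powr (- r)) else 0)"
    by (rule sum.mono_neutral_cong_left) (auto simp: S_def)
  ultimately show ?thesis by simp
qed

context cmult_fun
begin

definition log_term :: "nat \<Rightarrow> complex \<Rightarrow> complex" where
  "log_term n s = (if prime n then - Ln (1 - dterm s n) else 0)"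

definition log_ser :: "complex \<Rightarrow> complex" where "log_ser s = (\<Sum>n. log_term n s)"

lemma norm_log_term:
  assumes "r > 1" "Re s \<ge> r"
  shows "norm (log_term n s) \<le> (if prime n then - ln (1 - real n powr (- r)) else 0)"
proof (cases "prime n")
  case True
  have w: "norm (dterm s n) < 1" using True assms by (intro norm_dterm_prime) auto
  have "norm (dterm s n) \<le> real n powr (- Re s)" by (rule norm_dterm_le)
  also have "\<dots> \<le> real n powr (- r)" using assms True prime_ge_1_nat[of n] by (intro powr_mono) auto
  finally have le: "norm (dterm s n) \<le> real n powr (- r)" .
  have lt: "real n powr (- r) < 1" using True assms prime_gt_1_nat[of n] powr_less_one[of "real n" "- r"] by simp
  have "norm (Ln (1 - dterm s n)) \<le> - ln (1 - norm (dterm s n))" by (rule norm_Ln_one_minus_le[OF w])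
  also have "\<dots> \<le> - ln (1 - real n powr (- r))" using le lt by simp
  finally show ?thesis using True by (simp add: log_term_def)
qed (simp add: log_term_def)

lemma summable_prime_log:
  assumes r: "r > 1"
  shows "summable (\<lambda>n. if prime n then - ln (1 - real n powr (- r)) else 0)"
    "(\<Sum>n. if prime n then - ln (1 - real n powr (- r)) else 0) \<le> ln (zeta_real r)"
proof -
  let ?f = "\<lambda>n::nat. if prime n then - ln (1 - real n powr (- r)) else 0"
  have nn: "?f n \<ge> 0" for n
  proof (cases "prime n")
    case True
    have "real n powr (- r) < 1" using True r prime_gt_1_nat[of n] powr_less_one[of "real n" "- r"] by simp
    thus ?thesis using True by simp
  qed simp
  show "summable ?f"
    by (rule bounded_imp_summable[where B = "ln (zeta_real r)"])
       (use nn prime_log_sum_le[OF r, of "Suc _"] in \<open>auto simp: lessThan_Suc_atMost\<close>)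
  thus "(\<Sum>n. ?f n) \<le> ln (zeta_real r)" by (intro suminf_le_const prime_log_sum_le[OF r])
qed

text \<open>It matters that the modulus is bounded, and not only the real and imaginary parts
  separately: the Cauchy--Schwarz step of the final estimate relies on it.\<close>

lemma norm_log_ser:
  assumes "Re s > 1" shows "norm (log_ser s) \<le> ln (zeta_real (Re s))"
proof -
  have "norm (log_ser s) \<le> (\<Sum>n. if prime n then - ln (1 - real n powr (- Re s)) else 0)"
    unfolding log_ser_def by (rule norm_suminf_le) (use norm_log_term[OF assms order.refl] summable_prime_log[OF assms] in auto)
  thus ?thesis using summable_prime_log[OF assms] by linarith
qed

lemma log_ser_sums:
  assumes "Re s > 1" shows "(\<lambda>n. log_term n s) sums log_ser s"
proof -
  have "summable (\<lambda>n. log_term n s)"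
    by (rule summable_comparison_test[OF _ summable_prime_log(1)[OF assms]])
       (use norm_log_term[OF assms order.refl] in \<open>auto intro!: exI[of _ 0]\<close>)
  thus ?thesis unfolding log_ser_def by (rule summable_sums)
qed

text \<open>The quotient of \<open>dser P s\<close> by the finite Euler product is
  \<open>dser 0 s\<close> for every \<open>P\<close>; its limit is \<open>exp (log_ser s)\<close>
  since \<open>dser P s\<close> tends to 1.\<close>

lemma exp_log_ser:
  assumes s: "Re s > 1" shows "exp (log_ser s) = dser 0 s"
proof -
  define S where "S = (\<lambda>P. {p::nat. prime p \<and> p < P})"
  have nz: "1 - dterm s p \<noteq> 0" if "prime p" for p using norm_dterm_prime[OF that s] by auto
  have "(\<lambda>P. exp (\<Sum>n<P. log_term n s)) \<longlonglongrightarrow> exp (log_ser s)"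
    using log_ser_sums[OF s] unfolding sums_def by (intro tendsto_exp)
  moreover have "exp (\<Sum>n<P. log_term n s) = inverse (\<Prod>p\<in>S P. 1 - dterm s p)" for P
  proof -
    have "(\<Sum>n<P. log_term n s) = (\<Sum>p\<in>S P. - Ln (1 - dterm s p))"
      by (rule sum.mono_neutral_cong_right) (auto simp: S_def log_term_def)
    hence "exp (\<Sum>n<P. log_term n s) = (\<Prod>p\<in>S P. exp (- Ln (1 - dterm s p)))"
      by (simp add: exp_sum S_def)
    also have "\<dots> = (\<Prod>p\<in>S P. inverse (1 - dterm s p))"
      by (intro prod.cong refl) (use nz in \<open>auto simp: S_def exp_minus\<close>)
    also have "\<dots> = inverse (\<Prod>p\<in>S P. 1 - dterm s p)"
      using prod_inversef[of "\<lambda>p. 1 - dterm s p" "S P"] by (simp add: o_def)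
    finally show ?thesis .
  qed
  ultimately have l1: "(\<lambda>P. inverse (\<Prod>p\<in>S P. 1 - dterm s p)) \<longlonglongrightarrow> exp (log_ser s)" by simp
  have "(\<lambda>P. dser P s * inverse (\<Prod>p\<in>S P. 1 - dterm s p)) \<longlonglongrightarrow> 1 * exp (log_ser s)"
    by (intro tendsto_mult dser_tendsto_1 s l1)
  moreover have "dser P s * inverse (\<Prod>p\<in>S P. 1 - dterm s p) = dser 0 s" for P
  proof -
    have "(\<Prod>p\<in>S P. 1 - dterm s p) \<noteq> 0" using nz by (auto simp: S_def)
    thus ?thesis unfolding dser_prod[OF s, of P] S_def by simp
  qed
  ultimately show ?thesis by (simp add: LIMSEQ_const_iff)
qed

lemma log_ser_holomorphic: "log_ser holomorphic_on {s. Re s > 1}"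
proof (rule holomorphic_uniform_sequence[where f = "\<lambda>N s. \<Sum>n<N. log_term n s"])
  show "open {s. Re s > 1}" by (simp add: open_halfspace_Re_gt)
  show "(\<lambda>s. \<Sum>n<N. log_term n s) holomorphic_on {s. Re s > 1}" for N
  proof (intro holomorphic_intros)
    fix n
    show "log_term n holomorphic_on {s. Re s > 1}"
    proof (cases "prime n")
      case True
      have "1 - dterm s n \<notin> \<real>\<^sub>\<le>\<^sub>0" if "Re s > 1" for s
        using norm_dterm_prime[OF True that] abs_Re_le_cmod[of "dterm s n"] by (auto simp: complex_nonpos_Reals_iff)
      moreover have "n > 0" using True prime_gt_0_nat by blast
      ultimately have "(\<lambda>s. - Ln (1 - dterm s n)) holomorphic_on {s. Re s > 1}"
        unfolding dterm_def by (intro holomorphic_intros) auto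
      thus ?thesis using True by (simp add: log_term_def[abs_def])
    qed (simp add: log_term_def[abs_def])
  qed
  fix x :: complex assume "x \<in> {s. Re s > 1}"
  hence x: "Re x > 1" by simp
  define d where "d = (Re x - 1) / 2"
  have d: "d > 0" using x by (simp add: d_def)
  have re: "Re s \<ge> 1 + d" if "s \<in> cball x d" for s
  proof -
    have "norm (x - s) \<le> d" using that by (simp add: dist_norm)
    moreover have "\<bar>Re x - Re s\<bar> \<le> norm (x - s)" using abs_Re_le_cmod[of "x - s"] by simp
    moreover have "Re x = 1 + 2 * d" by (simp add: d_def field_simps)
    ultimately show ?thesis by linarith
  qed
  have "uniform_limit (cball x d) (\<lambda>N s. \<Sum>n<N. log_term n s) (\<lambda>s. \<Sum>n. log_term n s) sequentially"
  proof (rule Weierstrass_m_test)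
    show "summable (\<lambda>n. if prime n then - ln (1 - real n powr (- (1 + d))) else 0)" using d by (intro summable_prime_log) auto
    show "norm (log_term n s) \<le> (if prime n then - ln (1 - real n powr (- (1 + d))) else 0)" if "s \<in> cball x d" for n s
      using re[OF that] d by (intro norm_log_term) auto
  qed
  hence "uniform_limit (cball x d) (\<lambda>N s. \<Sum>n<N. log_term n s) log_ser sequentially" by (simp add: log_ser_def[abs_def])
  moreover have "cball x d \<subseteq> {s. Re s > 1}" using re d by fastforce
  ultimately show "\<exists>d>0. cball x d \<subseteq> {s. Re s > 1} \<and> uniform_limit (cball x d) (\<lambda>N s. \<Sum>n<N. log_term n s) log_ser sequentially"
    using d by blast
qed

end

section \<open>Non-vanishing on the line of real part one\<close>

text \<open>The variable is \<open>u = 2 - s\<close>. The radius 1/2 keeps \<open>Re s\<close> above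
  \<open>3 / 2\<close>, well inside the region of the Euler products.\<close>

definition nn_taylor :: "(complex \<Rightarrow> complex) \<Rightarrow> bool" where
  "nn_taylor h \<longleftrightarrow> h holomorphic_on ball 0 (1 / 2) \<and> (\<forall>n. (deriv ^^ n) h 0 \<in> \<real>\<^sub>\<ge>\<^sub>0)"

lemma nn_taylorI:
  "h holomorphic_on ball 0 (1 / 2) \<Longrightarrow> (\<And>n. (deriv ^^ n) h 0 \<in> \<real>\<^sub>\<ge>\<^sub>0) \<Longrightarrow> nn_taylor h"
  by (simp add: nn_taylor_def)

lemma sum_in_nonneg_Reals:
  "(\<And>x. x \<in> A \<Longrightarrow> f x \<in> \<real>\<^sub>\<ge>\<^sub>0) \<Longrightarrow> sum f A \<in> (\<real>\<^sub>\<ge>\<^sub>0 :: complex set)"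
  by (induction A rule: infinite_finite_induct) auto

lemma nn_taylor_cong:
  assumes "nn_taylor f" "\<And>u. u \<in> ball 0 (1 / 2) \<Longrightarrow> f u = g u"
  shows "nn_taylor g"
proof -
  have g: "g holomorphic_on ball 0 (1 / 2)" by (rule holomorphic_transform[of f]) (use assms in \<open>auto simp: nn_taylor_def\<close>)
  have "(deriv ^^ n) f 0 = (deriv ^^ n) g 0" for n
    by (rule higher_deriv_transform_within_open[of f "ball 0 (1 / 2)"]) (use assms g in \<open>auto simp: nn_taylor_def\<close>)
  thus ?thesis using assms g by (simp add: nn_taylor_def)
qed

lemma nn_taylor_mult:
  assumes "nn_taylor f" "nn_taylor g"
  shows "nn_taylor (\<lambda>u. f u * g u)"
proof (rule nn_taylorI)
  show "(\<lambda>u. f u * g u) holomorphic_on ball 0 (1 / 2)" using assms by (auto simp: nn_taylor_def intro!: holomorphic_intros)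
  fix n
  have "(deriv ^^ n) (\<lambda>u. f u * g u) 0 = (\<Sum>i = 0..n. of_nat (n choose i) * (deriv ^^ i) f 0 * (deriv ^^ (n - i)) g 0)"
    by (rule higher_deriv_mult[of f "ball 0 (1 / 2)"]) (use assms in \<open>auto simp: nn_taylor_def\<close>)
  also have "\<dots> \<in> \<real>\<^sub>\<ge>\<^sub>0" using assms by (auto simp: nn_taylor_def intro!: sum_in_nonneg_Reals nonneg_Reals_mult_I)
  finally show "(deriv ^^ n) (\<lambda>u. f u * g u) 0 \<in> \<real>\<^sub>\<ge>\<^sub>0" .
qed

lemma nn_taylor_add:
  assumes "nn_taylor f" "nn_taylor g"
  shows "nn_taylor (\<lambda>u. f u + g u)"
proof (rule nn_taylorI)
  show "(\<lambda>u. f u + g u) holomorphic_on ball 0 (1 / 2)" using assms by (auto simp: nn_taylor_def intro!: holomorphic_intros)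
  fix n
  have "(deriv ^^ n) (\<lambda>u. f u + g u) 0 = (deriv ^^ n) f 0 + (deriv ^^ n) g 0"
    by (rule higher_deriv_add[of f "ball 0 (1 / 2)"]) (use assms in \<open>auto simp: nn_taylor_def\<close>)
  thus "(deriv ^^ n) (\<lambda>u. f u + g u) 0 \<in> \<real>\<^sub>\<ge>\<^sub>0" using assms by (auto simp: nn_taylor_def)
qed

lemma nn_taylor_const: "c \<in> \<real>\<^sub>\<ge>\<^sub>0 \<Longrightarrow> nn_taylor (\<lambda>_. c)"
  by (rule nn_taylorI) auto

lemma nn_taylor_sum: "(\<And>i. i \<in> A \<Longrightarrow> nn_taylor (f i)) \<Longrightarrow> nn_taylor (\<lambda>u. \<Sum>i\<in>A. f i u)"
  by (induction A rule: infinite_finite_induct) (auto intro: nn_taylor_add nn_taylor_const)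

text \<open>Strong induction with the Leibniz rule applied to the derivative
  \<open>deriv h u * exp (h u)\<close>. Subtracting 1 changes only the constant coefficient, which
  stays nonnegative because \<open>h 0 \<ge> 0\<close>.\<close>

lemma nn_taylor_exp:
  assumes h: "nn_taylor h"
  shows "nn_taylor (\<lambda>u. exp (h u))" "nn_taylor (\<lambda>u. exp (h u) - 1)"
proof -
  let ?B = "ball (0 :: complex) (1 / 2)"
  have hol: "h holomorphic_on ?B" using h by (simp add: nn_taylor_def)
  have h0: "h 0 \<in> \<real>\<^sub>\<ge>\<^sub>0" using h by (metis nn_taylor_def funpow_0)
  then obtain x where x: "h 0 = of_real x" "x \<ge> 0" by (auto elim: nonneg_Reals_cases)
  define e where "e = (\<lambda>u. exp (h u))"
  have e: "e holomorphic_on ?B" unfolding e_def by (intro holomorphic_intros hol)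
  have de: "deriv e u = deriv h u * e u" if "u \<in> ?B" for u
  proof -
    have "(h has_field_derivative deriv h u) (at u)" using hol that holomorphic_derivI[of h ?B u] by auto
    hence "(e has_field_derivative exp (h u) * deriv h u) (at u)" unfolding e_def by (rule DERIV_fun_exp)
    thus ?thesis by (simp add: DERIV_imp_deriv e_def mult.commute)
  qed
  have "(deriv ^^ n) e 0 \<in> \<real>\<^sub>\<ge>\<^sub>0" for n
  proof (induction n rule: less_induct)
    case (less n)
    show ?case
    proof (cases n)
      case 0
      thus ?thesis using x by (simp add: e_def exp_of_real)
    next
      case (Suc m)
      have "(deriv ^^ n) e 0 = (deriv ^^ m) (deriv e) 0" by (simp add: Suc funpow_swap1)
      also have "\<dots> = (deriv ^^ m) (\<lambda>u. deriv h u * e u) 0"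
        by (rule higher_deriv_transform_within_open[of _ ?B]) (use hol e de in \<open>auto intro!: holomorphic_intros\<close>)
      also have "\<dots> = (\<Sum>i = 0..m. of_nat (m choose i) * (deriv ^^ i) (deriv h) 0 * (deriv ^^ (m - i)) e 0)"
        by (rule higher_deriv_mult[of _ ?B]) (use hol e in \<open>auto intro!: holomorphic_intros\<close>)
      also have "\<dots> \<in> \<real>\<^sub>\<ge>\<^sub>0"
      proof (rule sum_in_nonneg_Reals)
        fix i assume "i \<in> {0..m}"
        have "(deriv ^^ i) (deriv h) 0 = (deriv ^^ Suc i) h 0" by (simp add: funpow_swap1)
        also have "\<dots> \<in> \<real>\<^sub>\<ge>\<^sub>0" using h unfolding nn_taylor_def by blast
        finally show "of_nat (m choose i) * (deriv ^^ i) (deriv h) 0 * (deriv ^^ (m - i)) e 0 \<in> \<real>\<^sub>\<ge>\<^sub>0"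
          using less[of "m - i"] Suc by (intro nonneg_Reals_mult_I) auto
      qed
      finally show ?thesis .
    qed
  qed
  with e show n: "nn_taylor (\<lambda>u. exp (h u))" by (simp add: nn_taylor_def e_def)
  show "nn_taylor (\<lambda>u. exp (h u) - 1)"
  proof (rule nn_taylorI)
    show "(\<lambda>u. exp (h u) - 1) holomorphic_on ?B" by (intro holomorphic_intros hol)
    fix n
    have "(deriv ^^ n) (\<lambda>u. exp (h u) - 1) 0 = (deriv ^^ n) (\<lambda>u. exp (h u)) 0 - (deriv ^^ n) (\<lambda>_. 1) 0"
      by (rule higher_deriv_diff[of _ ?B]) (use n in \<open>auto simp: nn_taylor_def\<close>)
    moreover have "exp (of_real x) - 1 \<in> (\<real>\<^sub>\<ge>\<^sub>0 :: complex set)"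
    proof -
      have "exp (of_real x) - 1 = complex_of_real (exp x - 1)" by (simp add: exp_of_real)
      thus ?thesis using x by (simp only: nonneg_Reals_of_real_iff) simp
    qed
    moreover have "(deriv ^^ n) (\<lambda>u. exp (h u)) 0 \<in> \<real>\<^sub>\<ge>\<^sub>0" using n by (simp add: nn_taylor_def)
    ultimately show "(deriv ^^ n) (\<lambda>u. exp (h u) - 1) 0 \<in> \<real>\<^sub>\<ge>\<^sub>0" using x by (cases "n = 0") auto
  qed
qed

lemma nn_taylor_exp_linear:
  fixes a b :: real assumes b: "b \<ge> 0"
  shows "nn_taylor (\<lambda>u. exp (of_real a + of_real b * u))"
proof -
  have d: "(deriv ^^ n) (\<lambda>u :: complex. exp (of_real a + of_real b * u)) = (\<lambda>u. of_real b ^ n * exp (of_real a + of_real b * u))" for n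
  proof (induction n)
    case (Suc n)
    have "deriv (\<lambda>u. of_real b ^ n * exp (of_real a + of_real b * u)) u = of_real b ^ Suc n * exp (of_real a + of_real b * u)" for u :: complex
      by (rule DERIV_imp_deriv) (auto intro!: derivative_eq_intros)
    thus ?case using Suc by auto
  qed auto
  show ?thesis
  proof (rule nn_taylorI)
    show "(\<lambda>u. exp (of_real a + of_real b * u)) holomorphic_on ball 0 (1 / 2)" by (intro holomorphic_intros)
    show "(deriv ^^ n) (\<lambda>u :: complex. exp (of_real a + of_real b * u)) 0 \<in> \<real>\<^sub>\<ge>\<^sub>0" for n
    proof -
      have "(deriv ^^ n) (\<lambda>u :: complex. exp (of_real a + of_real b * u)) 0 = complex_of_real (b ^ n * exp a)"
        by (simp add: d exp_of_real)
      thus ?thesis using b by (simp only: nonneg_Reals_of_real_iff) simp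
    qed
  qed
qed

lemma nn_taylor_limit:
  assumes lim: "uniform_limit (ball 0 (1 / 2)) f g sequentially" and f: "\<And>n :: nat. nn_taylor (f n)"
  shows "nn_taylor g"
proof (rule nn_taylorI)
  show "g holomorphic_on ball 0 (1 / 2)"
  proof (rule holomorphic_uniform_sequence[where f = f])
    fix x :: complex assume "x \<in> ball 0 (1 / 2)"
    then obtain d where "d > 0" "cball x d \<subseteq> ball 0 (1 / 2)" using open_contains_cball by (metis open_ball)
    thus "\<exists>d>0. cball x d \<subseteq> ball 0 (1 / 2) \<and> uniform_limit (cball x d) f g sequentially"
      using uniform_limit_on_subset[OF lim] by blast
  qed (use f in \<open>auto simp: nn_taylor_def\<close>)
  fix n
  have "(\<lambda>m. (deriv ^^ n) (f m) 0) \<longlonglongrightarrow> (deriv ^^ n) g 0"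
    by (rule higher_deriv_complex_uniform_limit[OF lim]) (use f in \<open>auto simp: nn_taylor_def\<close>)
  moreover have "(deriv ^^ n) (f m) 0 \<in> \<real>\<^sub>\<ge>\<^sub>0" for m using f by (simp add: nn_taylor_def)
  ultimately show "(deriv ^^ n) g 0 \<in> \<real>\<^sub>\<ge>\<^sub>0"
    using Lim_in_closed_set[OF closed_nonneg_Reals_complex] by (metis always_eventually trivial_limit_sequentially)
qed

text \<open>\<open>R\<close> may exceed the radius 1/2 of \<open>nn_taylor\<close>: the Taylor
  series converges on the larger disc, and this is how nonnegativity reaches
  \<open>s = 1 / 2\<close>.\<close>

lemma nn_taylor_value:
  assumes nn: "nn_taylor h" and h: "h holomorphic_on ball 0 R" and x: "0 \<le> x" "x < R"
  shows "h (of_real x) \<in> \<real>\<^sub>\<ge>\<^sub>0"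
proof -
  have "(\<lambda>n. (deriv ^^ n) h 0 / fact n * (of_real x - 0) ^ n) sums h (of_real x)"
    by (rule holomorphic_power_series[OF h]) (use x in \<open>simp add: dist_norm\<close>)
  hence "(\<lambda>N. \<Sum>n<N. (deriv ^^ n) h 0 / fact n * of_real x ^ n) \<longlonglongrightarrow> h (of_real x)" by (simp add: sums_def)
  moreover have "(\<Sum>n<N. (deriv ^^ n) h 0 / fact n * of_real x ^ n) \<in> \<real>\<^sub>\<ge>\<^sub>0" for N
  proof (rule sum_in_nonneg_Reals)
    fix n
    have "(deriv ^^ n) h 0 / fact n * of_real x ^ n = (deriv ^^ n) h 0 * of_real (x ^ n / fact n)" by (simp add: divide_inverse)
    moreover have "complex_of_real (x ^ n / fact n) \<in> \<real>\<^sub>\<ge>\<^sub>0" using x by (simp only: nonneg_Reals_of_real_iff) simp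
    moreover have "(deriv ^^ n) h 0 \<in> \<real>\<^sub>\<ge>\<^sub>0" using nn by (simp add: nn_taylor_def)
    ultimately show "(deriv ^^ n) h 0 / fact n * of_real x ^ n \<in> \<real>\<^sub>\<ge>\<^sub>0" using nonneg_Reals_mult_I by metis
  qed
  ultimately show ?thesis
    using Lim_in_closed_set[OF closed_nonneg_Reals_complex] by (metis (no_types, lifting) always_eventually trivial_limit_sequentially)
qed

lemma neg_Ln_one_minus_uniform:
  fixes q :: "complex \<Rightarrow> complex"
  assumes q: "\<And>u. u \<in> A \<Longrightarrow> norm (q u) \<le> 1 / 2" and w: "norm w \<le> 1"
  shows "uniform_limit A (\<lambda>N u. \<Sum>m<N. w ^ m * q u ^ m / of_nat m) (\<lambda>u. - Ln (1 - w * q u)) sequentially"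
proof -
  have wq: "norm (w * q u) \<le> 1 / 2" if "u \<in> A" for u
    using q[OF that] w mult_mono[of "norm w" 1 "norm (q u)" "1 / 2"] by (simp add: norm_mult)
  have "uniform_limit A (\<lambda>N u. \<Sum>m<N. w ^ m * q u ^ m / of_nat m) (\<lambda>u. \<Sum>m. w ^ m * q u ^ m / of_nat m) sequentially"
  proof (rule Weierstrass_m_test)
    show "summable (\<lambda>m. (1 / 2 :: real) ^ m)" by (rule summable_geometric) simp
    fix m u assume u: "u \<in> A"
    have "norm (w ^ m * q u ^ m / of_nat m) = norm (w * q u) ^ m / real m"
      by (simp add: norm_mult norm_divide norm_power power_mult_distrib)
    also have "\<dots> \<le> norm (w * q u) ^ m" by (cases "m = 0") (auto simp: divide_le_eq mult_le_cancel_left1)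
    also have "\<dots> \<le> (1 / 2) ^ m" using wq[OF u] by (intro power_mono) auto
    finally show "norm (w ^ m * q u ^ m / of_nat m) \<le> (1 / 2) ^ m" .
  qed
  moreover have "(\<Sum>m. w ^ m * q u ^ m / of_nat m) = - Ln (1 - w * q u)" if "u \<in> A" for u
  proof -
    define z where "z = w * q u"
    have z: "norm z < 1" using wq[OF that] by (simp add: z_def)
    have s1: "(\<lambda>n. (- 1) ^ Suc n / of_nat n * (- z) ^ n) sums Ln (1 + (- z))"
      by (rule Ln_series) (use z in simp)
    have e: "(- 1) ^ Suc n / of_nat n * (- z) ^ n = - (z ^ n / of_nat n)" for n
      by (cases "even n") (auto simp: power_minus_odd)
    have "(\<lambda>n. - (z ^ n / of_nat n)) sums Ln (1 - z)" using s1 unfolding e by simp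
    hence "(\<lambda>n. z ^ n / of_nat n) sums (- Ln (1 - z))" using sums_minus by fastforce
    thus ?thesis by (simp add: sums_iff z_def power_mult_distrib)
  qed
  ultimately show ?thesis using uniform_limit_cong'[of A] by (metis (no_types, lifting))
qed

section \<open>Landau's product: zeta squared times two conjugate shifted Dirichlet series\<close>

context cmult_fun
begin

lemma cmult_fun_cnj: "cmult_fun (\<lambda>n. cnj (chi n))"
  by standard (use cm_le in \<open>auto simp: cm_mult cm_1\<close>)

text \<open>The contribution of the prime \<open>n\<close> to the logarithm of the product of zeta
  squared at \<open>s\<close>, the series of \<open>chi\<close> at \<open>s + i * t\<close> and the
  conjugate series at \<open>s - i * t\<close>, where \<open>s = 2 - u\<close>.\<close>

definition landau_term :: "real \<Rightarrow> nat \<Rightarrow> complex \<Rightarrow> complex" where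
  "landau_term t n u = 2 * one.log_term n (2 - u) + log_term n (2 - u + \<i> * t)
     + cmult_fun.log_term (\<lambda>n. cnj (chi n)) n (2 - u - \<i> * t)"

definition landau_w :: "real \<Rightarrow> nat \<Rightarrow> complex" where
  "landau_w t n = chi n * of_nat n powr (- (\<i> * t))"

definition landau_q :: "nat \<Rightarrow> complex \<Rightarrow> complex" where
  "landau_q n u = of_nat n powr (u - 2)"

lemma landau_w_le: "norm (landau_w t n) \<le> 1"
proof -
  have "norm (of_nat n powr (- (\<i> * t))) \<le> 1" by (cases "n = 0") (auto simp: norm_powr_real_powr)
  thus ?thesis using cm_le[of n] mult_mono[of "norm (chi n)" 1 "norm (of_nat n powr (- (\<i> * t)))" 1] by (simp add: landau_w_def norm_mult)
qed

lemma landau_q_exp: "n > 0 \<Longrightarrow> landau_q n u = exp (of_real (- 2 * ln n) + of_real (ln n) * u)"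
  by (simp add: landau_q_def powr_def Ln_of_nat algebra_simps)

lemma dterm_landau:
  assumes "n > 0"
  shows "zterm (2 - u) n = landau_q n u" "dterm (2 - u + \<i> * t) n = landau_w t n * landau_q n u"
    "cmult_fun.dterm (\<lambda>n. cnj (chi n)) (2 - u - \<i> * t) n = cnj (landau_w t n) * landau_q n u"
proof -
  interpret bar: cmult_fun "\<lambda>n. cnj (chi n)" by (rule cmult_fun_cnj)
  show "zterm (2 - u) n = landau_q n u" by (simp add: one.dterm_def landau_q_def)
  show "dterm (2 - u + \<i> * t) n = landau_w t n * landau_q n u"
    by (simp add: dterm_def landau_q_def landau_w_def mult.assoc algebra_simps flip: powr_add)
  have "cnj (of_nat n powr (- (\<i> * t))) = of_nat n powr (\<i> * t)" using assms by (simp add: powr_of_nat_cnj)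
  thus "bar.dterm (2 - u - \<i> * t) n = cnj (landau_w t n) * landau_q n u"
    by (simp add: bar.dterm_def landau_q_def landau_w_def mult.assoc algebra_simps flip: powr_add)
qed

text \<open>In powers of \<open>landau_q n u\<close> the coefficient of order \<open>m\<close> is
  \<open>(2 + 2 * Re (w ^ m)) / m\<close>, which is nonnegative since \<open>norm w \<le> 1\<close>;
  this is why zeta is squared. The powers themselves are exponentials in \<open>u\<close> with
  nonnegative rate.\<close>

lemma nn_taylor_landau_term: "nn_taylor (landau_term t n)"
proof (cases "prime n")
  case False
  interpret bar: cmult_fun "\<lambda>n. cnj (chi n)" by (rule cmult_fun_cnj)
  have "landau_term t n = (\<lambda>_. 0)"
    using False by (simp add: landau_term_def fun_eq_iff log_term_def bar.log_term_def one.log_term_def)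
  thus ?thesis by (simp add: nn_taylor_const)
next
  case True
  interpret bar: cmult_fun "\<lambda>n. cnj (chi n)" by (rule cmult_fun_cnj)
  define w where "w = landau_w t n"
  have n0: "n > 0" using True prime_gt_0_nat by blast
  have qle: "norm (landau_q n u) \<le> 1 / 2" if "u \<in> ball 0 (1 / 2)" for u
  proof -
    have "\<bar>Re u\<bar> < 1 / 2" using that abs_Re_le_cmod[of u] by simp
    hence "real n powr (Re u - 2) \<le> real n powr (- 1)" using prime_ge_1_nat[OF True] by (intro powr_mono) auto
    hence "norm (landau_q n u) \<le> real n powr (- 1)"
      unfolding landau_q_def using n0 by (subst norm_powr_real_powr) auto
    also have "\<dots> \<le> 1 / 2" using prime_ge_2_nat[OF True] by (simp add: powr_minus divide_simps)
    finally show ?thesis .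
  qed
  have w: "norm w \<le> 1" "norm (cnj w) \<le> 1" using landau_w_le by (auto simp: w_def)
  let ?B = "ball (0 :: complex) (1 / 2)"
  have "uniform_limit ?B (\<lambda>N u. (2 * (\<Sum>m<N. 1 ^ m * landau_q n u ^ m / of_nat m)
       + (\<Sum>m<N. w ^ m * landau_q n u ^ m / of_nat m)) + (\<Sum>m<N. cnj w ^ m * landau_q n u ^ m / of_nat m))
     (\<lambda>u. (2 * (- Ln (1 - 1 * landau_q n u)) + (- Ln (1 - w * landau_q n u))) + (- Ln (1 - cnj w * landau_q n u))) sequentially"
    by (intro uniform_limit_add bounded_linear.uniform_limit[OF bounded_linear_mult_right] neg_Ln_one_minus_uniform qle w) auto
  moreover have "(2 * (- Ln (1 - 1 * landau_q n u)) + (- Ln (1 - w * landau_q n u))) + (- Ln (1 - cnj w * landau_q n u)) = landau_term t n u" for u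
    using True dterm_landau[OF n0] by (simp add: landau_term_def log_term_def bar.log_term_def one.log_term_def w_def)
  ultimately have lim: "uniform_limit ?B (\<lambda>N u. (2 * (\<Sum>m<N. 1 ^ m * landau_q n u ^ m / of_nat m)
       + (\<Sum>m<N. w ^ m * landau_q n u ^ m / of_nat m)) + (\<Sum>m<N. cnj w ^ m * landau_q n u ^ m / of_nat m)) (landau_term t n) sequentially"
    by simp
  show ?thesis
  proof (rule nn_taylor_limit[OF lim])
    fix N
    have "nn_taylor (\<lambda>u. \<Sum>m<N. of_real ((2 + 2 * Re (w ^ m)) / m) * exp (of_real (m * (- 2 * ln n)) + of_real (m * ln n) * u))"
    proof (intro nn_taylor_sum nn_taylor_mult nn_taylor_const nn_taylor_exp_linear)
      fix m
      have "\<bar>Re (w ^ m)\<bar> \<le> norm (w ^ m)" by (rule abs_Re_le_cmod)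
      also have "\<dots> \<le> 1" using w by (simp add: norm_power power_le_one)
      finally show "complex_of_real ((2 + 2 * Re (w ^ m)) / m) \<in> \<real>\<^sub>\<ge>\<^sub>0" by (simp only: nonneg_Reals_of_real_iff) simp
      show "0 \<le> m * ln n" using n0 by simp
    qed
    moreover have "(\<Sum>m<N. of_real ((2 + 2 * Re (w ^ m)) / m) * exp (of_real (m * (- 2 * ln n)) + of_real (m * ln n) * u))
       = (2 * (\<Sum>m<N. 1 ^ m * landau_q n u ^ m / of_nat m)
       + (\<Sum>m<N. w ^ m * landau_q n u ^ m / of_nat m)) + (\<Sum>m<N. cnj w ^ m * landau_q n u ^ m / of_nat m)" for u
    proof -
      have "of_real ((2 + 2 * Re (w ^ m)) / m) * exp (of_real (m * (- 2 * ln n)) + of_real (m * ln n) * u)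
        = (2 * (1 ^ m * landau_q n u ^ m / of_nat m) + w ^ m * landau_q n u ^ m / of_nat m) + cnj w ^ m * landau_q n u ^ m / of_nat m" for m
      proof -
        have e: "landau_q n u ^ m = exp (of_real (m * (- 2 * ln n)) + of_real (m * ln n) * u)"
          unfolding landau_q_exp[OF n0] by (simp add: exp_of_nat_mult[symmetric] algebra_simps)
        have "complex_of_real (2 + 2 * Re (w ^ m)) = 2 + w ^ m + cnj w ^ m"
          by (simp add: complex_eq_iff flip: complex_cnj_power)
        thus ?thesis unfolding e[symmetric] by (simp add: add_divide_distrib algebra_simps)
      qed
      thus ?thesis by (simp only: sum.distrib sum_distrib_left)
    qed
    ultimately show "nn_taylor (\<lambda>u. (2 * (\<Sum>m<N. 1 ^ m * landau_q n u ^ m / of_nat m)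
       + (\<Sum>m<N. w ^ m * landau_q n u ^ m / of_nat m)) + (\<Sum>m<N. cnj w ^ m * landau_q n u ^ m / of_nat m))" by (simp only:)
  qed
qed


lemma uniform_landau_log:
  shows "uniform_limit (ball 0 (1 / 2)) (\<lambda>N u. \<Sum>n<N. landau_term t (n + P) u)
    (\<lambda>u. \<Sum>n. landau_term t (n + P) u) sequentially" (is ?A)
   and "u \<in> ball 0 (1 / 2) \<Longrightarrow> exp ((\<Sum>n<P. landau_term t n u) + (\<Sum>n. landau_term t (n + P) u))
     = (zser 0 (2 - u))\<^sup>2 * dser 0 (2 - u + \<i> * t) * cmult_fun.dser (\<lambda>n. cnj (chi n)) 0 (2 - u - \<i> * t)" (is "_ \<Longrightarrow> ?B")
proof -
  interpret bar: cmult_fun "\<lambda>n. cnj (chi n)" by (rule cmult_fun_cnj)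
  define M where "M = (\<lambda>n :: nat. 4 * (if prime n then - ln (1 - real n powr (- (3 / 2))) else 0))"
  have M: "summable M" unfolding M_def by (intro summable_mult summable_prime_log) simp
  have re: "Re u \<le> 1 / 2" if "u \<in> ball 0 (1 / 2)" for u
    using that abs_Re_le_cmod[of u] by simp
  have le: "norm (landau_term t n u) \<le> M n" if u: "u \<in> ball 0 (1 / 2)" for n u
  proof -
    have "norm (landau_term t n u) \<le> (norm (2 * one.log_term n (2 - u)) + norm (log_term n (2 - u + \<i> * t))) + norm (bar.log_term n (2 - u - \<i> * t))"
      unfolding landau_term_def by (meson norm_triangle_ineq add_right_mono order.trans)
    moreover have "norm (one.log_term n (2 - u)) \<le> M n / 4" "norm (log_term n (2 - u + \<i> * t)) \<le> M n / 4"
      "norm (bar.log_term n (2 - u - \<i> * t)) \<le> M n / 4"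
      using norm_log_term[of "3 / 2" "2 - u + \<i> * t" n] one.norm_log_term[of "3 / 2" "2 - u" n] bar.norm_log_term[of "3 / 2" "2 - u - \<i> * t" n] re[OF u]
      unfolding M_def by auto
    ultimately show ?thesis by (simp add: norm_mult)
  qed
  show ?A
  proof (rule Weierstrass_m_test)
    show "summable (\<lambda>n. M (n + P))" using M by (rule summable_ignore_initial_segment)
  qed (rule le)
  assume u: "u \<in> ball 0 (1 / 2)"
  have s: "Re (2 - u) > 1" "Re (2 - u + \<i> * t) > 1" "Re (2 - u - \<i> * t) > 1" using re[OF u] by auto
  have "(\<lambda>n. landau_term t n u) sums (2 * one.log_ser (2 - u) + log_ser (2 - u + \<i> * t) + bar.log_ser (2 - u - \<i> * t))"
    unfolding landau_term_def by (intro sums_add sums_mult one.log_ser_sums log_ser_sums bar.log_ser_sums s)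
  hence "(\<Sum>n<P. landau_term t n u) + (\<Sum>n. landau_term t (n + P) u) = 2 * one.log_ser (2 - u) + log_ser (2 - u + \<i> * t) + bar.log_ser (2 - u - \<i> * t)"
    using suminf_split_initial_segment[of "\<lambda>n. landau_term t n u" P] by (simp add: sums_iff add.commute)
  thus ?B using s by (simp add: exp_add exp_double one.exp_log_ser exp_log_ser bar.exp_log_ser)
qed

definition landau_prod :: "real \<Rightarrow> nat \<Rightarrow> complex \<Rightarrow> complex" where
  "landau_prod t P u = (\<Prod>p | prime p \<and> p < P. inverse ((1 - landau_q p u)\<^sup>2 * (1 - landau_w t p * landau_q p u) * (1 - cnj (landau_w t p) * landau_q p u)))"

lemma norm_landau_q: "n > 0 \<Longrightarrow> norm (landau_q n u) = real n powr (Re u - 2)"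
  by (simp add: landau_q_def norm_powr_real_powr)

lemma landau_factor_nz:
  assumes p: "prime p" and u: "Re u < 2" and w: "norm w \<le> 1"
  shows "1 - w * landau_q p u \<noteq> 0"
proof -
  have "norm (landau_q p u) < 1"
    using prime_gt_1_nat[OF p] u by (subst norm_landau_q) (auto simp: powr_less_one)
  hence "norm (w * landau_q p u) < 1" using w mult_mono[of "norm w" 1 "norm (landau_q p u)" "norm (landau_q p u)"] by (simp add: norm_mult)
  thus ?thesis by auto
qed

lemma landau_prod_holomorphic: "landau_prod t P holomorphic_on {u. Re u < 2}"
proof -
  have "landau_q p holomorphic_on A" if "prime p" for p A
    unfolding landau_q_def using prime_gt_0_nat[OF that] by (intro holomorphic_intros) auto
  thus ?thesis unfolding landau_prod_def
    using landau_factor_nz[of _ _ 1] landau_factor_nz[OF _ _ landau_w_le]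
      landau_factor_nz[of _ _ "cnj (landau_w t _)"] landau_w_le
    by (intro holomorphic_intros) auto
qed

lemma landau_prod_exp:
  assumes u: "u \<in> ball 0 (1 / 2)"
  shows "exp (\<Sum>n<P. landau_term t n u) = landau_prod t P u"
proof -
  interpret bar: cmult_fun "\<lambda>n. cnj (chi n)" by (rule cmult_fun_cnj)
  have re: "Re u < 2" using u abs_Re_le_cmod[of u] by simp
  have "exp (landau_term t p u) = inverse ((1 - landau_q p u)\<^sup>2 * (1 - landau_w t p * landau_q p u) * (1 - cnj (landau_w t p) * landau_q p u))" if p: "prime p" for p
  proof -
    have "1 - landau_q p u \<noteq> 0" "1 - landau_w t p * landau_q p u \<noteq> 0" "1 - cnj (landau_w t p) * landau_q p u \<noteq> 0"
      using landau_factor_nz[OF p re, of 1] landau_factor_nz[OF p re landau_w_le[of t p]] landau_factor_nz[OF p re, of "cnj (landau_w t p)"] landau_w_le[of t p] by auto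
    thus ?thesis using p dterm_landau[OF prime_gt_0_nat[OF p]]
      by (simp add: landau_term_def log_term_def bar.log_term_def one.log_term_def exp_diff exp_double exp_minus divide_inverse)
  qed
  hence "(\<Prod>p | prime p \<and> p < P. exp (landau_term t p u)) = landau_prod t P u"
    unfolding landau_prod_def by (intro prod.cong) auto
  moreover have "(\<Prod>p | prime p \<and> p < P. exp (landau_term t p u)) = (\<Prod>p<P. exp (landau_term t p u))"
    by (rule prod.mono_neutral_left) (auto simp: landau_term_def log_term_def bar.log_term_def one.log_term_def)
  ultimately show ?thesis by (simp add: exp_sum)
qed

text \<open>At \<open>s = 1 / 2\<close> put \<open>x = p powr (- 1 / 2)\<close>. Each inverse factor
  is at most the square of \<open>(1 - x) * (1 + x) = 1 - 1 / p\<close>, whatever the argument of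
  \<open>landau_w\<close>.\<close>

lemma norm_landau_prod_ge:
  "norm (landau_prod t P (of_real (3 / 2))) \<ge> (\<Prod>p | prime p \<and> p < P. inverse (1 - 1 / real p)) ^ 2"
proof -
  have "(\<Prod>p | prime p \<and> p < P. inverse (1 - 1 / real p)) ^ 2 = (\<Prod>p | prime p \<and> p < P. inverse ((1 - 1 / real p)\<^sup>2))"
    unfolding prod_power_distrib power_inverse ..
  also have "\<dots> \<le> (\<Prod>p | prime p \<and> p < P. norm (inverse ((1 - landau_q p (of_real (3 / 2)))\<^sup>2 * (1 - landau_w t p * landau_q p (of_real (3 / 2))) * (1 - cnj (landau_w t p) * landau_q p (of_real (3 / 2))))))"
  proof (rule prod_mono, safe)
    fix p :: nat assume p: "prime p"
    show "0 \<le> inverse ((1 - 1 / real p)\<^sup>2)" by simp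
    define x where "x = real p powr (- (1 / 2))"
    have p0: "p > 1" using p prime_gt_1_nat by blast
    have q: "landau_q p (of_real (3 / 2)) = of_real x"
    proof -
      have "landau_q p (of_real (3 / 2)) = of_real (real p) powr (of_real (- (1 / 2)))" by (simp add: landau_q_def)
      also have "\<dots> = of_real x" unfolding x_def by (rule powr_of_real) simp
      finally show ?thesis .
    qed
    have x: "0 < x" "x < 1" using p0 by (auto simp: x_def powr_less_one)
    have "x * x = real p powr (- 1)" unfolding x_def powr_add[symmetric] by simp
    hence xx: "x * x = 1 / real p" using p0 by (simp add: powr_minus divide_inverse)
    have w: "norm (1 - w * of_real x) \<le> 1 + x" if "norm w \<le> 1" for w :: complex
    proof -
      have "norm (1 - w * of_real x) \<le> norm (1 :: complex) + norm (w * of_real x)" by (rule norm_triangle_ineq4)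
      also have "norm (w * of_real x) \<le> 1 * x" unfolding norm_mult using that x by (intro mult_mono) auto
      finally show ?thesis by simp
    qed
    have nz: "1 - w * of_real x \<noteq> 0" if "norm w \<le> 1" for w :: complex
      using landau_factor_nz[OF p, of "of_real (3 / 2)" w] that q by simp
    have "norm ((1 - of_real x)\<^sup>2 * (1 - landau_w t p * of_real x) * (1 - cnj (landau_w t p) * of_real x))
       = (1 - x)\<^sup>2 * norm (1 - landau_w t p * of_real x) * norm (1 - cnj (landau_w t p) * of_real x)"
    proof -
      have "norm (1 - complex_of_real x) = 1 - x" using x norm_of_real[of "1 - x"] by simp
      thus ?thesis by (simp add: norm_mult norm_power)
    qed
    also have "\<dots> \<le> (1 - x)\<^sup>2 * (1 + x) * (1 + x)" using w landau_w_le x by (intro mult_mono) auto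
    also have "\<dots> = (1 - x * x)\<^sup>2" by (simp add: power2_eq_square algebra_simps)
    finally have le: "norm ((1 - of_real x)\<^sup>2 * (1 - landau_w t p * of_real x) * (1 - cnj (landau_w t p) * of_real x)) \<le> (1 - 1 / p)\<^sup>2" by (simp only: xx)
    moreover have "norm ((1 - of_real x)\<^sup>2 * (1 - landau_w t p * of_real x) * (1 - cnj (landau_w t p) * of_real x)) > 0"
      using nz[of 1] nz[of "landau_w t p"] nz[of "cnj (landau_w t p)"] landau_w_le by simp
    ultimately show "inverse ((1 - 1 / real p)\<^sup>2) \<le> norm (inverse ((1 - landau_q p (of_real (3 / 2)))\<^sup>2 * (1 - landau_w t p * landau_q p (of_real (3 / 2))) * (1 - cnj (landau_w t p) * landau_q p (of_real (3 / 2)))))"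
      unfolding q norm_inverse by (intro le_imp_inverse_le)
  qed
  also have "\<dots> = norm (landau_prod t P (of_real (3 / 2)))" unfolding landau_prod_def by (simp only: prod_norm)
  finally show ?thesis .
qed

text \<open>Landau's argument: \<open>h\<close> has nonnegative Taylor coefficients at \<open>u = 0\<close> which dominate those of every
  finite part of its Euler product, and at \<open>s = 1 / 2\<close> these finite products are unbounded.\<close>
lemma landau_product_bounded:
  fixes t :: real
  assumes h: "h holomorphic_on ball 0 2"
    "\<And>u. u \<in> ball 0 (1 / 2) \<Longrightarrow> h u = (zser 0 (2 - u))\<^sup>2 * dser 0 (2 - u + \<i> * t) * cmult_fun.dser (\<lambda>n. cnj (chi n)) 0 (2 - u - \<i> * t)"
  shows "(\<Prod>p | prime p \<and> p < P. inverse (1 - 1 / real p)) ^ 2 \<le> norm (h (of_real (3 / 2)))"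
proof -
  define S where "S = (\<lambda>u. \<Sum>n<P. landau_term t n u)"
  define R where "R = (\<lambda>u. \<Sum>n. landau_term t (n + P) u)"
  have S: "nn_taylor S" unfolding S_def by (intro nn_taylor_sum nn_taylor_landau_term)
  have R: "nn_taylor R" unfolding R_def
    by (rule nn_taylor_limit[OF uniform_landau_log(1)]) (intro nn_taylor_sum nn_taylor_landau_term)
  have F: "nn_taylor (landau_prod t P)"
    by (rule nn_taylor_cong[OF nn_taylor_exp(1)[OF S]]) (simp only: S_def landau_prod_exp)
  \<comment> \<open>\<open>S\<close> collects the primes below \<open>P\<close> and \<open>R\<close>
    the others. The difference \<open>exp (S + R) - exp S\<close> is a product of two functions with
    nonnegative coefficients.\<close>
  have D: "nn_taylor (\<lambda>u. h u - landau_prod t P u)"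
  proof (rule nn_taylor_cong)
    show "nn_taylor (\<lambda>u. exp (S u) * (exp (R u) - 1))" by (intro nn_taylor_mult nn_taylor_exp S R)
    fix u :: complex assume u: "u \<in> ball 0 (1 / 2)"
    have "exp (S u) * (exp (R u) - 1) = exp (S u + R u) - exp (S u)" by (simp add: exp_add algebra_simps)
    also have "\<dots> = h u - landau_prod t P u"
      unfolding h(2)[OF u] uniform_landau_log(2)[OF u, symmetric, where P = P] landau_prod_exp[OF u, symmetric] S_def R_def ..
    finally show "exp (S u) * (exp (R u) - 1) = h u - landau_prod t P u" .
  qed
  have "ball 0 2 \<subseteq> {u :: complex. Re u < 2}" using complex_Re_le_cmod le_less_trans by fastforce
  hence Fh: "landau_prod t P holomorphic_on ball 0 2" using landau_prod_holomorphic holomorphic_on_subset by blast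
  have "h (of_real (3 / 2)) - landau_prod t P (of_real (3 / 2)) \<in> \<real>\<^sub>\<ge>\<^sub>0"
    by (rule nn_taylor_value[OF D, where R = 2]) (use h Fh in \<open>auto intro!: holomorphic_intros\<close>)
  then obtain a where a: "a \<ge> 0" "h (of_real (3 / 2)) - landau_prod t P (of_real (3 / 2)) = of_real a"
    by (auto elim: nonneg_Reals_cases)
  have "landau_prod t P (of_real (3 / 2)) \<in> \<real>\<^sub>\<ge>\<^sub>0"
    by (rule nn_taylor_value[OF F Fh]) auto
  then obtain b where b: "b \<ge> 0" "landau_prod t P (of_real (3 / 2)) = of_real b"
    by (auto elim: nonneg_Reals_cases)
  have "h (of_real (3 / 2)) = of_real (a + b)" using a b by (simp add: algebra_simps)
  hence "norm (h (of_real (3 / 2))) = a + b" using a b norm_of_real[of "a + b", where 'a = complex] by simp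
  thus ?thesis using norm_landau_prod_ge[where t = t and P = P] a b by simp
qed

end

text \<open>If the products were bounded, zeta at every \<open>r > 1\<close> would be at most
  \<open>K\<close>, because the sieve leaves a remainder tending to 1; as \<open>r\<close> tends to
  1, the harmonic sums would be bounded too.\<close>

lemma prime_product_unbounded:
  assumes "\<And>P. (\<Prod>p | prime p \<and> p < P. inverse (1 - 1 / real p)) ^ 2 \<le> M"
  shows False
proof -
  define K where "K = sqrt M"
  have K: "(\<Prod>p | prime p \<and> p < P. inverse (1 - 1 / real p)) \<le> K" for P
    unfolding K_def by (rule real_le_rsqrt[OF assms])
  have zb: "zeta_real r \<le> K" if r: "r > 1" for r
  proof -
    have ge: "zeta_real r \<le> K * Re (zser P (of_real r))" for P
    proof -
      have fac: "0 < 1 - 1 / real p \<and> 1 - 1 / real p \<le> 1 - real p powr (- r)" if "prime p" for p :: nat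
      proof -
        have "p > 1" using that prime_gt_1_nat by blast
        moreover from this have "real p powr (- r) \<le> real p powr (- 1)" using r by (intro powr_mono) auto
        moreover have "1 / real p < 1" using \<open>p > 1\<close> by simp
        ultimately show ?thesis by (simp add: powr_minus divide_inverse)
      qed
      define A B where "A = (\<Prod>p | prime p \<and> p < P. 1 - 1 / real p)" and "B = (\<Prod>p | prime p \<and> p < P. 1 - real p powr (- r))"
      have A: "A > 0" unfolding A_def using fac by (intro prod_pos) auto
      have AB: "A \<le> B" unfolding A_def B_def using fac by (intro prod_mono) (auto intro: less_imp_le)
      have "inverse A = (\<Prod>p | prime p \<and> p < P. inverse (1 - 1 / real p))" 
        unfolding A_def using prod_inversef[of "\<lambda>p. 1 - 1 / real p" "{p. prime p \<and> p < P}"] by (simp add: o_def)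
      hence "1 / A \<le> K" using K[of P] by (simp add: divide_inverse)
      hence "1 \<le> K * A" using A by (simp add: divide_le_eq)
      also have "\<dots> \<le> K * B" using AB order.trans[OF less_imp_le[OF divide_pos_pos[OF zero_less_one A]] \<open>1 / A \<le> K\<close>] by (intro mult_left_mono)
      finally have "1 * zeta_real r \<le> (K * B) * zeta_real r" using zeta_real_ge_1[OF r] by (intro mult_right_mono) auto
      moreover have "zser P (of_real r) = of_real (zeta_real r * B)"
        using one.dser_prod[of "of_real r" P] r by (simp add: zser_0_real zterm_real B_def)
      ultimately show ?thesis by (simp add: mult_ac)
    qed
    have "(\<lambda>P. K * Re (zser P (of_real r))) \<longlonglongrightarrow> K * Re 1"
      by (intro tendsto_mult tendsto_const tendsto_Re one.dser_tendsto_1) (use r in simp)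
    thus ?thesis using LIMSEQ_le_const[of _ "K * Re 1" "zeta_real r"] ge by auto
  qed
  have "(\<Sum>n<N. inverse (real n)) \<le> K" for N
  proof -
    have cont: "((\<lambda>r. \<Sum>n<N. real n powr (- r)) \<longlongrightarrow> (\<Sum>n<N. real n powr (- 1))) (at_right 1)"
    proof (rule tendsto_sum)
      fix n
      show "((\<lambda>r. real n powr (- r)) \<longlongrightarrow> real n powr (- 1)) (at_right 1)"
        by (cases "n = 0") (simp, intro tendsto_powr tendsto_minus tendsto_const tendsto_ident_at, simp)
    qed
    have "\<forall>\<^sub>F r in at_right 1. (\<Sum>n<N. real n powr (- r)) \<le> K"
    proof (rule eventually_at_right_less[THEN eventually_mono])
      fix r :: real assume r: "1 < r"
      have "(\<Sum>n<N. real n powr (- r)) \<le> zeta_real r"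
        unfolding zeta_real_def by (rule sum_le_suminf) (use r in \<open>auto simp: summable_real_powr_iff\<close>)
      thus "(\<Sum>n<N. real n powr (- r)) \<le> K" using zb[OF r] by simp
    qed
    from tendsto_upperbound[OF cont this] have "(\<Sum>n<N. real n powr (- 1)) \<le> K" by simp
    thus ?thesis by (simp add: powr_minus)
  qed
  hence "summable (\<lambda>n. inverse (real n))" by (intro bounded_imp_summable[where B = K]) (simp_all only: lessThan_Suc_atMost[symmetric] inverse_nonnegative_iff_nonnegative of_nat_0_le_iff)
  thus False using not_summable_harmonic[where 'a = real] by simp
qed


text \<open>The alternating series has period 2 and coefficient sum 0, so the continuation theorem
  applies to it and removes the pole of zeta in one stroke.\<close>

lemma eta_entire:
  obtains f where "f holomorphic_on UNIV" "\<And>s. Re s > 1 \<Longrightarrow> f s = (1 - 2 powr (1 - s)) * zser 0 s"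
proof -
  define c :: "nat \<Rightarrow> complex" where "c = (\<lambda>n. if odd n then 1 else - 1)"
  obtain f where f: "f holomorphic_on UNIV" "\<And>s. Re s > 1 \<Longrightarrow> (\<lambda>n. c (Suc n) / of_nat (Suc n) powr s) sums f s"
  proof (rule periodic_dirichlet_entire[of 2 c])
    show "(\<Sum>a = 1..2. c a) = 0" by (simp add: c_def numeral_2_eq_2)
    show "c (n + 2) = c n" for n by (simp add: c_def)
  qed auto
  have "f s = (1 - 2 powr (1 - s)) * zser 0 s" if s: "Re s > 1" for s
  proof -
    \<comment> \<open>The alternating series is twice its odd part minus the full series, and the
      sieve at 3 removes exactly the factor of the prime 2.\<close>
    have rough3: "one.rough 3 = {n. odd n}"
    proof (intro equalityI subsetI)
      fix n assume "n \<in> one.rough 3" thus "n \<in> {n. odd n}" unfolding one.rough_def using two_is_prime_nat by auto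
    next
      fix n :: nat assume n: "n \<in> {n. odd n}"
      have "p = 2" if "prime p" "p < 3" for p :: nat using that prime_ge_2_nat[of p] by simp
      thus "n \<in> one.rough 3" using n unfolding one.rough_def by (auto intro: Nat.gr0I)
    qed
    have "(zterm s has_sum zser 3 s) {n. odd n}"
      using one.dterm_summable(2)[OF s, of "{n. odd n}"] by (simp add: one.dser_def rough3)
    hence "((\<lambda>n. if odd n then zterm s n else 0) has_sum zser 3 s) UNIV"
      by (subst has_sum_cong_neutral[where T = "{n. odd n}" and g = "zterm s"]) auto
    from has_sum_imp_sums[OF this] have s1: "(\<lambda>n. if odd n then zterm s n else 0) sums zser 3 s" .
    have "(\<lambda>n. zterm s (Suc n)) sums zser 0 s"
      using one.dser_sums[OF s] by (simp add: one.dterm_def powr_minus divide_inverse)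
    hence s2: "zterm s sums zser 0 s" unfolding sums_Suc_iff by simp
    have "(\<lambda>n. 2 * (if odd n then zterm s n else 0) - zterm s n) sums (2 * zser 3 s - zser 0 s)"
      by (intro sums_diff sums_mult s1 s2)
    also have "(\<lambda>n. 2 * (if odd n then zterm s n else 0) - zterm s n) = (\<lambda>n. c n * zterm s n)"
      by (auto simp: c_def fun_eq_iff)
    finally have "(\<lambda>n. c (Suc n) * zterm s (Suc n)) sums (2 * zser 3 s - zser 0 s)" by (subst sums_Suc_iff) simp
    hence "(\<lambda>n. c (Suc n) / of_nat (Suc n) powr s) sums (2 * zser 3 s - zser 0 s)"
      by (simp add: one.dterm_def powr_minus divide_inverse)
    hence "f s = 2 * zser 3 s - zser 0 s" using f(2)[OF s] sums_unique2 by blast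
    also have "zser 3 s = zser 0 s * (1 - zterm s 2)"
    proof -
      have "zser (Suc 0) s = zser 0 s" using one.dser_Suc[OF s, of 0] by simp
      moreover have "zser (Suc (Suc 0)) s = zser (Suc 0) s" using one.dser_Suc[OF s, of "Suc 0"] by simp
      moreover have "zser (Suc (Suc (Suc 0))) s = zser (Suc (Suc 0)) s * (1 - zterm s (Suc (Suc 0)))"
        using one.dser_Suc[OF s, of "Suc (Suc 0)"] two_is_prime_nat[unfolded numeral_2_eq_2] by simp
      ultimately show ?thesis unfolding numeral_3_eq_3 numeral_2_eq_2 by simp
    qed
    also have "zterm s 2 = 2 powr (1 - s) / 2"
    proof -
      have "(2 :: complex) powr (1 + - s) = 2 powr 1 * 2 powr (- s)" by (rule powr_add)
      thus ?thesis by (simp add: one.dterm_def)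
    qed
    finally show ?thesis by (simp add: algebra_simps)
  qed
  thus ?thesis using that f(1) by blast
qed

text \<open>The remaining solutions differ from 1 by nonzero multiples of
  \<open>2 * pi * i / ln 2\<close> and lie too far away for this disc.\<close>

lemma two_powr_eq_1:
  assumes "2 powr (1 - z) = (1 :: complex)" "norm (2 - z) < 2"
  shows "z = 1"
proof -
  have L: "Ln 2 = complex_of_real (ln 2)" by (rule Ln_of_real[of 2, unfolded of_real_numeral]) (rule zero_less_numeral)
  have "exp ((1 - z) * of_real (ln 2)) = exp 0" using assms(1) unfolding powr_def L by (simp split: if_splits)
  then obtain n :: int where n: "(1 - z) * of_real (ln 2) = of_int (2 * n) * pi * \<i>"
    unfolding exp_eq by (auto simp only: add_0_left)
  have "norm ((1 - z) * of_real (ln 2)) = norm (complex_of_real (real_of_int (2 * n) * pi) * \<i>)" unfolding n ..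
  hence e: "norm (1 - z) * ln 2 = 2 * \<bar>real_of_int n\<bar> * pi" unfolding norm_mult norm_of_real norm_ii by (simp add: abs_mult)
  have "norm ((2 - z) - 1) \<le> norm (2 - z) + norm (1 :: complex)" by (rule norm_triangle_ineq4)
  moreover have "(2 - z) - 1 = 1 - z" by (simp add: algebra_simps)
  ultimately have "norm (1 - z) < 3" using assms by simp
  hence "norm (1 - z) * ln 2 < 3 * 1" using ln_2_less_1 by (intro mult_strict_mono) auto
  moreover have "2 * \<bar>real_of_int n\<bar> * 3 \<le> 2 * \<bar>real_of_int n\<bar> * pi" using pi_gt3 by (intro mult_left_mono) auto
  ultimately have "n = 0" using e by linarith
  hence "(1 - z) * complex_of_real (ln 2) = 0" using n by simp
  thus ?thesis by simp
qed

sublocale prim_char \<subseteq> cm: cmult_fun chi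
  by standard (auto simp: chi_mult norm_chi_le)

context prim_char
begin

lemma L_eq_dser: "Re s > 1 \<Longrightarrow> L s = cm.dser 0 s"
  using L_sums cm.dser_sums sums_unique2 by blast

lemma L_eq_exp: "Re s > 1 \<Longrightarrow> L s = exp (cm.log_ser s)"
  by (simp add: L_eq_dser cm.exp_log_ser)

text \<open>A zero of \<open>L\<close> at \<open>1 + i * t\<close> and the conjugate zero of
  \<open>Lb\<close> would cancel the double pole of the squared zeta function. The product would
  then be holomorphic in the disc of radius 2 around \<open>s = 2\<close>, which contains
  \<open>1 / 2\<close>, and Landau's bound would contradict the divergence of the prime product.
  Real zeros, \<open>t = 0\<close>, need no separate treatment.\<close>

lemma L_Re_1_nonzero:
  assumes "Re s = 1" shows "L s \<noteq> 0"
proof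
  assume "L s = 0"
  define t where "t = Im s"
  have L0: "L (1 + \<i> * t) = 0" using assms \<open>L s = 0\<close> by (metis complex_eq mult.commute of_real_1 t_def)
  interpret bar: prim_char k chi_bar by (rule prim_char_bar)
  obtain E where E: "E holomorphic_on UNIV" "\<And>s. Re s > 1 \<Longrightarrow> E s = (1 - 2 powr (1 - s)) * zser 0 s"
    using eta_entire by blast
  let ?V = "ball (2 :: complex) 2"
  \<comment> \<open>In this disc \<open>S\<close> has a single zero, simple and at 1.
    \<open>E\<close> is \<open>S\<close> times zeta, so the two copies of \<open>S\<close> in
    \<open>E\<close> squared are balanced by dividing \<open>S\<close> out of each L-factor.\<close>
  define S where "S = (\<lambda>z :: complex. 1 - 2 powr (1 - z))"
  have S: "S holomorphic_on ?V" "S 1 = 0" unfolding S_def by (auto intro!: holomorphic_intros)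
  have "((\<lambda>z :: complex. 2 powr (1 - z)) has_field_derivative (Ln 2 * 2 powr (1 - 1)) * (0 - 1)) (at 1)"
    by (rule DERIV_chain2[where f = "\<lambda>z. 2 powr z", OF has_field_derivative_powr_right]) (auto intro!: derivative_eq_intros)
  hence "(S has_field_derivative 0 - (Ln 2 * 2 powr (1 - 1)) * (0 - 1)) (at 1)" unfolding S_def by (intro DERIV_diff DERIV_const)
  hence dS: "deriv S 1 \<noteq> 0" by (simp add: DERIV_imp_deriv)
  have nz: "S z \<noteq> 0" if "z \<in> ?V" "z \<noteq> 1" for z
    using two_powr_eq_1[of z] that by (auto simp: S_def dist_norm)
  have one: "1 \<in> ?V" by (simp add: dist_norm)
  have lc: "(\<lambda>z. f (z + a)) holomorphic_on A" if "f holomorphic_on UNIV" for f :: "complex \<Rightarrow> complex" and a A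
  proof -
    have "f \<circ> (\<lambda>z. z + a) holomorphic_on A"
      by (rule holomorphic_on_compose_gen[OF _ that]) (auto intro!: holomorphic_intros)
    thus ?thesis by (simp add: o_def)
  qed
  obtain G1 where G1: "G1 holomorphic_on ?V" "\<And>z. z \<in> ?V \<Longrightarrow> L (z + \<i> * t) = S z * G1 z"
    by (rule holomorphic_factor_simple_zero[of ?V "\<lambda>z. L (z + \<i> * t)" S 1])
       (use S dS nz one L0 in \<open>auto intro!: lc L_holomorphic\<close>)
  have Lb0: "Lb (1 + - (\<i> * t)) = 0" using L0 by (simp add: Lb_eq)
  obtain G2 where G2: "G2 holomorphic_on ?V" "\<And>z. z \<in> ?V \<Longrightarrow> Lb (z + - (\<i> * t)) = S z * G2 z"
    by (rule holomorphic_factor_simple_zero[of ?V "\<lambda>z. Lb (z + - (\<i> * t))" S 1])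
       (use S dS nz one Lb0 in \<open>auto intro!: lc[of Lb] bar.L_holomorphic simp del: add_uminus_conv_diff\<close>)
  define h where "h = (\<lambda>u. (E (2 - u))\<^sup>2 * G1 (2 - u) * G2 (2 - u))"
  have refl: "(\<lambda>u. f (2 - u)) holomorphic_on ball 0 2" if "f holomorphic_on ?V" for f :: "complex \<Rightarrow> complex"
  proof -
    have "f \<circ> (\<lambda>u. 2 - u) holomorphic_on ball 0 2"
      by (rule holomorphic_on_compose_gen[OF _ that]) (auto simp: dist_norm intro!: holomorphic_intros)
    thus ?thesis by (simp add: o_def)
  qed
  have h: "h holomorphic_on ball 0 2"
    unfolding h_def by (intro holomorphic_intros refl G1 G2 holomorphic_on_subset[OF E(1)]) auto
  have "h u = (zser 0 (2 - u))\<^sup>2 * cm.dser 0 (2 - u + \<i> * t) * bar.cm.dser 0 (2 - u - \<i> * t)" if "u \<in> ball 0 (1 / 2)" for u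
  proof -
    have re: "Re u < 1" using that abs_Re_le_cmod[of u] by simp
    have v: "2 - u \<in> ?V" using that by (simp add: dist_norm)
    have "h u = (S (2 - u) * zser 0 (2 - u))\<^sup>2 * G1 (2 - u) * G2 (2 - u)"
      using E(2)[of "2 - u"] re by (simp add: h_def S_def)
    also have "\<dots> = (zser 0 (2 - u))\<^sup>2 * (S (2 - u) * G1 (2 - u)) * (S (2 - u) * G2 (2 - u))"
      by (simp add: power2_eq_square mult_ac)
    also have "\<dots> = (zser 0 (2 - u))\<^sup>2 * L (2 - u + \<i> * t) * Lb (2 - u - \<i> * t)"
      using G1(2)[OF v] G2(2)[OF v] by simp
    also have "L (2 - u + \<i> * t) = cm.dser 0 (2 - u + \<i> * t)" using re by (intro L_eq_dser) simp
    also have "Lb (2 - u - \<i> * t) = bar.cm.dser 0 (2 - u - \<i> * t)" using re by (intro bar.L_eq_dser) simp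
    finally show ?thesis .
  qed
  moreover have "chi_bar = (\<lambda>n. cnj (chi n))" by (simp add: chi_bar_def fun_eq_iff)
  ultimately have hb: "h u = (zser 0 (2 - u))\<^sup>2 * cm.dser 0 (2 - u + \<i> * t) * cmult_fun.dser (\<lambda>n. cnj (chi n)) 0 (2 - u - \<i> * t)" if "u \<in> ball 0 (1 / 2)" for u
    using that by metis
  show False using prime_product_unbounded[OF cm.landau_product_bounded[OF h hb]] .
qed

lemma L_nonzero:
  assumes "Re s \<ge> 1" shows "L s \<noteq> 0"
  using L_Re_1_nonzero[of s] L_eq_exp[of s] assms by (cases "Re s = 1") auto

end

section \<open>Counting zeros by argument variation\<close>

lemma finite_zeros_compact:
  assumes f: "f holomorphic_on UNIV" and K: "compact K" and nz: "f w \<noteq> 0"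
  shows "finite {z \<in> K. f z = 0}"
proof (rule ccontr)
  assume "infinite {z \<in> K. f z = 0}"
  then obtain x where x: "x \<in> K" "x islimpt {z \<in> K. f z = 0}"
    using K unfolding compact_eq_Bolzano_Weierstrass by (metis (no_types, lifting) mem_Collect_eq subsetI)
  have "f w = 0"
    by (rule analytic_continuation[OF f _ _ _ _ x(2)]) auto
  thus False using nz by simp
qed

text \<open>A neighbourhood of constant width around a convex set is again convex, and a zero-free
  function on it has a holomorphic logarithm.\<close>

lemma holomorphic_log_near:
  assumes f: "f holomorphic_on UNIV" and K: "compact K" "convex K" and nz: "\<And>z. z \<in> K \<Longrightarrow> f z \<noteq> 0"
  obtains U g where "open U" "K \<subseteq> U" "g holomorphic_on U" "\<And>z. z \<in> U \<Longrightarrow> f z = exp (g z)"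
proof -
  have "closed (f -` {0})"
    using holomorphic_on_imp_continuous_on[OF f] by (intro closed_vimage) auto
  then obtain d where d: "d > 0" "\<And>x y. x \<in> K \<Longrightarrow> y \<in> f -` {0} \<Longrightarrow> d \<le> dist x y"
    using separate_compact_closed[OF K(1), of "f -` {0}"] nz by force
  define U where "U = (\<Union>x\<in>K. \<Union>y\<in>ball 0 d. {x + y})"
  have ball: "U = (\<Union>x\<in>K. ball x d)"
  proof -
    have "(\<Union>y\<in>ball 0 d. {x + y}) = ball x d" for x :: complex
    proof (intro equalityI subsetI)
      fix z assume "z \<in> ball x d"
      hence "z - x \<in> ball 0 d" "z = x + (z - x)" by (auto simp: dist_norm norm_minus_commute)
      thus "z \<in> (\<Union>y\<in>ball 0 d. {x + y})" by blast
    qed (auto simp: dist_norm)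
    thus ?thesis by (simp add: U_def)
  qed
  have oU: "open U" unfolding ball by blast
  have cU: "convex U" unfolding U_def by (rule convex_sums) (use K in auto)
  have KU: "K \<subseteq> U" unfolding ball using d by auto
  have fU: "f z \<noteq> 0" if "z \<in> U" for z using that d unfolding ball by fastforce
  obtain g where "g holomorphic_on U" "\<And>z. z \<in> U \<Longrightarrow> f z = exp (g z)"
    using contractible_imp_holomorphic_log[of f U] holomorphic_on_subset[OF f] convex_imp_contractible[OF cU] fU by blast
  thus ?thesis using that oU KU by blast
qed

text \<open>The change of a logarithm of \<open>f\<close> along a segment; the imaginary part is the
  variation of the argument.\<close>

definition logint :: "(complex \<Rightarrow> complex) \<Rightarrow> complex \<Rightarrow> complex \<Rightarrow> complex" where
  "logint f a b = contour_integral (linepath a b) (\<lambda>z. deriv f z / f z)"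

lemma logint_eq:
  assumes U: "open U" and g: "g holomorphic_on U" and f: "\<And>z. z \<in> U \<Longrightarrow> f z = exp (g z)" and s: "closed_segment a b \<subseteq> U"
  shows "logint f a b = g b - g a"
proof -
  have "(g has_field_derivative deriv f z / f z) (at z within U)" if z: "z \<in> U" for z
  proof -
    have dg: "(g has_field_derivative deriv g z) (at z)" by (rule holomorphic_derivI[OF g U z])
    hence "((\<lambda>z. exp (g z)) has_field_derivative exp (g z) * deriv g z) (at z)" by (rule DERIV_fun_exp)
    hence "(f has_field_derivative exp (g z) * deriv g z) (at z)"
      by (rule has_field_derivative_transform_within_open[OF _ U z]) (simp add: f)
    hence "deriv f z / f z = deriv g z" using f[OF z] by (simp add: DERIV_imp_deriv)
    thus ?thesis using dg by (simp add: has_field_derivative_at_within)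
  qed
  hence "((\<lambda>z. deriv f z / f z) has_contour_integral (g (pathfinish (linepath a b)) - g (pathstart (linepath a b)))) (linepath a b)"
    by (rule contour_integral_primitive) (use s in auto)
  thus ?thesis unfolding logint_def by (simp add: contour_integral_unique)
qed

lemma logint_combine:
  assumes f: "f holomorphic_on UNIV" and nz: "\<And>z. z \<in> closed_segment a c \<Longrightarrow> f z \<noteq> 0" and b: "b \<in> closed_segment a c"
  shows "logint f a c = logint f a b + logint f b c"
proof -
  obtain U g where U: "open U" "closed_segment a c \<subseteq> U" "g holomorphic_on U" "\<And>z. z \<in> U \<Longrightarrow> f z = exp (g z)"
    using holomorphic_log_near[OF f compact_segment(1) convex_closed_segment nz] by metis
  have "closed_segment a b \<subseteq> U" "closed_segment b c \<subseteq> U" using U b subset_closed_segment by fastforce+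
  thus ?thesis using logint_eq[OF U(1,3,4)] U(2) by simp
qed

text \<open>If \<open>g\<close> is a logarithm of \<open>f\<close> near the reflected segment, then
  \<open>cnj (g (1 - cnj z)) - p z\<close> is one near the original segment. Both sides are then
  differences of end values, and no integral has to be transformed.\<close>

lemma logint_reflect:
  assumes f: "f holomorphic_on UNIV" and nz: "\<And>z. z \<in> closed_segment a b \<Longrightarrow> f (1 - cnj z) \<noteq> 0"
    and V: "open V" "closed_segment a b \<subseteq> V" and p: "p holomorphic_on V"
    and fe: "\<And>z. z \<in> V \<Longrightarrow> cnj (f (1 - cnj z)) = exp (p z) * f z"
  shows "logint f (1 - cnj a) (1 - cnj b) = cnj (logint f a b + (p b - p a))"
proof -
  let ?r = "\<lambda>z. 1 - cnj z"
  have seg: "closed_segment (?r a) (?r b) = ?r ` closed_segment a b"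
  proof (intro equalityI subsetI)
    fix z assume "z \<in> closed_segment (?r a) (?r b)"
    then obtain u where u: "0 \<le> u" "u \<le> 1" "z = (1 - u) *\<^sub>R ?r a + u *\<^sub>R ?r b" by (auto simp: closed_segment_def)
    have "z = ?r ((1 - u) *\<^sub>R a + u *\<^sub>R b)" by (simp add: u scaleR_conv_of_real algebra_simps)
    thus "z \<in> ?r ` closed_segment a b" using u unfolding closed_segment_def by blast
  next
    fix z assume "z \<in> ?r ` closed_segment a b"
    then obtain u where u: "0 \<le> u" "u \<le> 1" "z = ?r ((1 - u) *\<^sub>R a + u *\<^sub>R b)" by (auto simp: closed_segment_def)
    have "z = (1 - u) *\<^sub>R ?r a + u *\<^sub>R ?r b" by (simp add: u scaleR_conv_of_real algebra_simps)
    thus "z \<in> closed_segment (?r a) (?r b)" using u unfolding closed_segment_def by blast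
  qed
  have nz': "f z \<noteq> 0" if "z \<in> closed_segment (?r a) (?r b)" for z using that nz unfolding seg by auto
  obtain U g where U: "open U" "closed_segment (?r a) (?r b) \<subseteq> U" "g holomorphic_on U" "\<And>z. z \<in> U \<Longrightarrow> f z = exp (g z)"
    using holomorphic_log_near[OF f compact_segment(1) convex_closed_segment nz'] by metis
  define W where "W = ?r -` U \<inter> V"
  have oU: "open (?r -` U)" by (rule open_vimage[OF U(1)]) (intro continuous_intros)
  have oW: "open W" unfolding W_def using oU V by blast
  have "(cnj \<circ> (\<lambda>s. g (1 - s)) \<circ> cnj) holomorphic_on ?r -` U"
  proof (rule holomorphic_on_compose_cnj_cnj[OF _ oU])
    have "g \<circ> (\<lambda>s. 1 - s) holomorphic_on cnj ` (?r -` U)"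
      by (rule holomorphic_on_compose_gen[OF _ U(3)]) (auto intro!: holomorphic_intros)
    thus "(\<lambda>s. g (1 - s)) holomorphic_on cnj ` (?r -` U)" by (simp add: o_def)
  qed
  hence "(\<lambda>z. cnj (g (1 - cnj z))) holomorphic_on W" unfolding W_def o_def by (rule holomorphic_on_subset) auto
  hence h: "(\<lambda>z. cnj (g (1 - cnj z)) - p z) holomorphic_on W"
    by (intro holomorphic_intros holomorphic_on_subset[OF p]) (auto simp: W_def)
  have "f z = exp (cnj (g (1 - cnj z)) - p z)" if "z \<in> W" for z
  proof -
    have "exp (p z) * f z = exp (cnj (g (1 - cnj z)))" using that fe[of z] U(4)[of "1 - cnj z"] by (simp add: W_def exp_cnj)
    thus ?thesis by (simp add: exp_diff field_simps)
  qed
  moreover have "closed_segment a b \<subseteq> W" using U(2) V(2) unfolding W_def seg by auto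
  ultimately have "logint f a b = (cnj (g (1 - cnj b)) - p b) - (cnj (g (1 - cnj a)) - p a)"
    by (rule logint_eq[OF oW h])
  moreover have "logint f (?r a) (?r b) = g (?r b) - g (?r a)" by (rule logint_eq[OF U(1,3,4,2)])
  ultimately show ?thesis by simp
qed

lemma logint_cnj:
  assumes f: "f holomorphic_on UNIV" and nz: "\<And>z. z \<in> closed_segment a b \<Longrightarrow> f z \<noteq> 0"
  shows "logint (\<lambda>z. cnj (f (cnj z))) (cnj a) (cnj b) = cnj (logint f a b)"
proof -
  obtain U g where U: "open U" "closed_segment a b \<subseteq> U" "g holomorphic_on U" "\<And>z. z \<in> U \<Longrightarrow> f z = exp (g z)"
    using holomorphic_log_near[OF f compact_segment(1) convex_closed_segment nz] by metis
  have oU: "open (cnj -` U)" by (rule open_vimage[OF U(1)]) (intro continuous_intros)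
  have "(cnj \<circ> g \<circ> cnj) holomorphic_on cnj -` U"
    by (rule holomorphic_on_compose_cnj_cnj[OF _ oU]) (auto intro: holomorphic_on_subset[OF U(3)])
  hence h: "(\<lambda>z. cnj (g (cnj z))) holomorphic_on cnj -` U" by (simp add: o_def)
  have seg: "closed_segment (cnj a) (cnj b) \<subseteq> cnj -` U"
  proof
    fix z assume "z \<in> closed_segment (cnj a) (cnj b)"
    then obtain u where u: "0 \<le> u" "u \<le> 1" "z = (1 - u) *\<^sub>R cnj a + u *\<^sub>R cnj b" by (auto simp: closed_segment_def)
    have "cnj z = (1 - u) *\<^sub>R a + u *\<^sub>R b" by (simp add: u)
    thus "z \<in> cnj -` U" using u U(2) by (auto simp: closed_segment_def)
  qed
  have "logint (\<lambda>z. cnj (f (cnj z))) (cnj a) (cnj b) = cnj (g (cnj (cnj b))) - cnj (g (cnj (cnj a)))"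
    by (rule logint_eq[OF oU h _ seg]) (simp add: U(4) exp_cnj)
  thus ?thesis using logint_eq[OF U(1,3,4,2)] by simp
qed

lemma ln_Gamma_cnj:
  assumes "Re z > 0" shows "ln_Gamma (cnj z) = cnj (ln_Gamma z)"
proof -
  have pos: "w \<notin> \<real>\<^sub>\<le>\<^sub>0" if "Re w > 0" for w :: complex using that by (auto simp: complex_nonpos_Reals_iff)
  have nz: "z \<notin> \<int>\<^sub>\<le>\<^sub>0" "cnj z \<notin> \<int>\<^sub>\<le>\<^sub>0" using assms by (auto simp: nonpos_Ints_def complex_eq_iff)
  have ser: "ln_Gamma_series (cnj z) (Suc n) = cnj (ln_Gamma_series z (Suc n))" for n
  proof -
    have "cnj (ln (z / of_nat k + 1)) = ln (cnj z / of_nat k + 1)" for k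
    proof -
      have "Re (z / of_nat k + 1) > 0" using assms by (simp add: Re_divide_of_nat add_nonneg_pos)
      hence "cnj (ln (z / of_nat k + 1)) = ln (cnj (z / of_nat k + 1))" by (intro cnj_Ln pos)
      thus ?thesis by simp
    qed
    moreover have "cnj (ln z) = ln (cnj z)" using assms by (intro cnj_Ln pos)
    moreover have "cnj (ln (of_nat (Suc n) :: complex)) = ln (of_nat (Suc n))" by (subst (1 2) Ln_of_nat) (simp_all del: of_nat_Suc)
    ultimately show ?thesis unfolding ln_Gamma_series_def by (simp del: of_nat_Suc)
  qed
  have "(\<lambda>n. cnj (ln_Gamma_series z (Suc n))) \<longlonglongrightarrow> cnj (ln_Gamma z)"
    by (intro tendsto_cnj LIMSEQ_Suc ln_Gamma_complex_LIMSEQ nz)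
  moreover have "(\<lambda>n. ln_Gamma_series (cnj z) (Suc n)) \<longlonglongrightarrow> ln_Gamma (cnj z)"
    by (intro LIMSEQ_Suc ln_Gamma_complex_LIMSEQ nz)
  ultimately show ?thesis unfolding ser by (metis LIMSEQ_unique)
qed

text \<open>Inside the strip both \<open>cos (pi * s / 2)\<close> and
  \<open>sin (pi * s / 2)\<close> have positive real part, so the principal logarithm serves. On the
  critical line the imaginary part is at most the real part, whence the angle
  \<open>pi / 4\<close>.\<close>

lemma gcos_log:
  assumes e: "e = 1 \<or> e = - 1"
  obtains g c where "g holomorphic_on {s. 0 < Re s \<and> Re s < 1}" "c \<noteq> 0"
    "\<And>s. 0 < Re s \<Longrightarrow> Re s < 1 \<Longrightarrow> gcos e s = c * exp (g s)"
    "\<And>T. \<bar>Im (g (Complex (1 / 2) T))\<bar> \<le> pi / 4"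
proof -
  define C where "C = (\<lambda>s :: complex. if e = 1 then cos (of_real pi * s / 2) else sin (of_real pi * s / 2))"
  define c where "c = (if e = 1 then 2 else - 2 * \<i>)"
  have gC: "gcos e s = c * C s" for s
    using e by (auto simp: gcos_def C_def c_def cos_exp_eq sin_exp_eq mult.assoc diff_divide_distrib)
  have h: "C holomorphic_on UNIV" unfolding C_def by (cases "e = 1") (auto intro!: holomorphic_intros)
  have pos: "Re (C s) > 0" if "0 < Re s" "Re s < 1" for s
  proof -
    have "0 < pi * Re s / 2" "pi * Re s / 2 < pi / 2" using that by (auto simp: field_simps)
    moreover from this have "pi * Re s / 2 < pi" "- (pi / 2) < pi * Re s / 2" using pi_gt_zero by linarith+
    ultimately have "cos (pi * Re s / 2) > 0" "sin (pi * Re s / 2) > 0" using cos_gt_zero_pi sin_gt_zero by blast+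
    thus ?thesis by (auto simp: C_def Re_cos Re_sin intro!: mult_pos_pos add_pos_pos)
  qed
  show ?thesis
  proof (rule that[of "\<lambda>s. Ln (C s)" c])
    show "(\<lambda>s. Ln (C s)) holomorphic_on {s. 0 < Re s \<and> Re s < 1}"
      using pos by (intro holomorphic_intros holomorphic_on_subset[OF h]) (auto simp: complex_nonpos_Reals_iff not_le)
    show "c \<noteq> 0" by (simp add: c_def)
    show "gcos e s = c * exp (Ln (C s))" if "0 < Re s" "Re s < 1" for s
      using pos[OF that] gC[of s] by (subst exp_Ln) auto
    fix T
    define w where "w = C (Complex (1 / 2) T)"
    have p: "Re w > 0" using pos by (simp add: w_def)
    have le: "\<bar>Im w\<bar> \<le> Re w"
    proof -
      have eq: "cos (pi / 4) = sin (pi / 4)" by (simp add: cos_45 sin_45)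
      have s: "sin (pi / 4) > 0" by (simp add: sin_45)
      have ex: "0 \<le> exp (x :: real)" for x by simp
      have "\<bar>exp a - exp (- a)\<bar> \<le> exp a + exp (- a)" for a :: real using ex[of a] ex[of "- a"] by linarith
      from mult_left_mono[OF this less_imp_le[OF s]] show ?thesis
        by (auto simp: w_def C_def Re_cos Re_sin Im_cos Im_sin eq abs_mult abs_minus_commute abs_of_pos[OF s])
    qed
    have "w \<noteq> 0" using p by auto
    hence Im: "Im (Ln w) = arctan (Im w / Re w)" using arg_conv_arctan[OF p] by (simp add: Arg_eq_Im_Ln)
    have "Im w / Re w \<le> 1" "- 1 \<le> Im w / Re w" using p le by (auto simp: divide_le_eq le_divide_eq)
    hence "arctan (Im w / Re w) \<le> arctan 1" "arctan (- 1) \<le> arctan (Im w / Re w)" unfolding arctan_le_iff by auto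
    thus "\<bar>Im (Ln (C (Complex (1 / 2) T)))\<bar> \<le> pi / 4" unfolding w_def[symmetric] Im by (simp add: arctan_one arctan_minus)
  qed
qed

section \<open>Logarithm of the functional equation factor, and the zero count\<close>

context prim_char
begin

lemma cnj_gcos: "cnj (gcos sgn_chi (cnj s)) = sgn_chi * gcos sgn_chi s"
  using sgn_chi by (auto simp: gcos_def exp_cnj)

lemma cnj_Phi:
  assumes "Re s > 0"
  shows "cnj (L (1 - cnj s)) = (cnj (gauss 1) / of_nat k * sgn_chi) * exp (ln_Gamma s - s * of_real (ln (2 * pi / k))) * gcos sgn_chi s * L s"
proof -
  have np: "s \<notin> \<int>\<^sub>\<le>\<^sub>0" "cnj s \<notin> \<int>\<^sub>\<le>\<^sub>0" using assms by (auto simp: nonpos_Ints_def complex_eq_iff)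
  have G: "Gamma s = exp (ln_Gamma s)" using np by (simp add: Gamma_complex_altdef)
  have G': "cnj (Gamma (cnj s)) = exp (ln_Gamma s)"
    using np assms by (simp add: Gamma_complex_altdef ln_Gamma_cnj exp_cnj)
  have pos: "2 * pi / real k > 0" using k_pos by simp
  have "cnj (of_real (2 * pi / k) powr (- cnj s)) = exp (- s * of_real (ln (2 * pi / k)))"
    using pos k_pos by (simp add: powr_def exp_cnj Ln_of_real del: of_real_divide of_real_mult)
  hence "cnj (Phi (cnj s)) = exp (ln_Gamma s) * exp (- s * of_real (ln (2 * pi / k))) * (cnj (gauss 1) / of_nat k) * (sgn_chi * gcos sgn_chi s)"
    unfolding Phi_def by (simp add: G' cnj_gcos)
  moreover have "cnj (L (1 - cnj s)) = cnj (Phi (cnj s)) * L s"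
    using functional_equation_cnj[of "cnj s"] assms by simp
  ultimately show ?thesis by (simp add: exp_diff exp_minus field_simps)
qed

lemma gauss_1_nz: "gauss 1 \<noteq> 0" using norm_gauss_1 k_pos by auto

lemma sgn_chi_nz: "sgn_chi \<noteq> 0" using sgn_chi by auto

text \<open>Reflection of the nonvanishing for \<open>Re s \<ge> 1\<close>. Off the real axis the
  two exponentials in \<open>gcos\<close> have different moduli and cannot cancel.\<close>

lemma L_zero_left:
  assumes z: "Im z \<noteq> 0" "Re z \<le> 0"
  shows "L z \<noteq> 0"
proof -
  define s where "s = 1 - cnj z"
  have s: "Re s \<ge> 1" "Im s = Im z" using z by (auto simp: s_def)
  have "gcos sgn_chi s \<noteq> 0"
  proof
    assume "gcos sgn_chi s = 0"
    hence "exp (- (\<i> * pi * s / 2)) = - sgn_chi * exp (\<i> * pi * s / 2)" by (simp add: gcos_def eq_neg_iff_add_eq_0)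
    hence "norm (exp (- (\<i> * pi * s / 2))) = norm (exp (\<i> * pi * s / 2))" using sgn_chi by (auto simp: norm_mult)
    thus False using s z by simp
  qed
  moreover have "L s \<noteq> 0" using s by (intro L_nonzero)
  moreover have "cnj (L (1 - cnj s)) = cnj (L z)" by (simp add: s_def)
  ultimately have "cnj (L z) \<noteq> 0" using cnj_Phi[of s] s gauss_1_nz sgn_chi_nz k_pos by auto
  thus ?thesis by simp
qed

text \<open>One branch \<open>p\<close> on the whole strip is needed, as its variation is taken from
  height \<open>- T\<close> to \<open>T\<close>. Stirling's formula yields the main term and the
  error \<open>1 / (4 * T)\<close>, the two ends of \<open>gcos\<close> the error
  \<open>pi / 2\<close>.\<close>

lemma strip_log:
  fixes T :: real
  assumes T: "T > 0"
  obtains p where "p holomorphic_on {s. 0 < Re s \<and> Re s < 1}"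
    "\<And>s. 0 < Re s \<Longrightarrow> Re s < 1 \<Longrightarrow> cnj (L (1 - cnj s)) = exp (p s) * L s"
    "\<bar>Im (p (Complex (1 / 2) T) - p (Complex (1 / 2) (- T))) - 2 * T * ln (k * T / (2 * pi * exp 1))\<bar> \<le> pi / 2 + 1 / (4 * T)"
proof (rule gcos_log[OF sgn_chi])
  fix g c assume g: "g holomorphic_on {s. 0 < Re s \<and> Re s < 1}" "c \<noteq> 0"
    "\<And>s. 0 < Re s \<Longrightarrow> Re s < 1 \<Longrightarrow> gcos sgn_chi s = c * exp (g s)"
    "\<And>T. \<bar>Im (g (Complex (1 / 2) T))\<bar> \<le> pi / 4"
  define c' where "c' = cnj (gauss 1) / of_nat k * sgn_chi * c"
  have c': "c' \<noteq> 0" using gauss_1_nz sgn_chi_nz g(2) k_pos by (simp add: c'_def)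
  define p where "p = (\<lambda>s :: complex. Ln c' + (ln_Gamma s - s * of_real (ln (2 * pi / k)) + g s))"
  show ?thesis
  proof (rule that[of p])
    show "p holomorphic_on {s. 0 < Re s \<and> Re s < 1}"
      unfolding p_def by (intro holomorphic_intros g) (auto simp: complex_nonpos_Reals_iff)
    show "cnj (L (1 - cnj s)) = exp (p s) * L s" if "0 < Re s" "Re s < 1" for s
    proof -
      have "exp (p s) = c' * (exp (ln_Gamma s - s * of_real (ln (2 * pi / k))) * exp (g s))"
        unfolding p_def exp_add exp_Ln[OF c'] ..
      thus ?thesis unfolding cnj_Phi[OF that(1)] g(3)[OF that] c'_def by (simp only: mult_ac)
    qed
    define l where "l = Im (ln_Gamma (Complex (1 / 2) T))"
    have l: "T * ln T - T \<le> l" "l \<le> T * ln T - T + 1 / (8 * T)" using Im_ln_Gamma_half[OF T] by (auto simp: l_def)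
    have l': "Im (ln_Gamma (Complex (1 / 2) (- T))) = - l"
      using ln_Gamma_cnj[of "Complex (1 / 2) T"] by (simp add: l_def complex_cnj)
    have Imp: "Im (p (Complex (1 / 2) T) - p (Complex (1 / 2) (- T))) = 2 * l - 2 * T * ln (2 * pi / k) + (Im (g (Complex (1 / 2) T)) - Im (g (Complex (1 / 2) (- T))))"
      by (simp add: p_def l' l_def[symmetric])
    have lneq: "ln (k * T / (2 * pi * exp 1)) = ln T - 1 - ln (2 * pi / k)"
      using T k_pos by (simp add: ln_div ln_mult)
    have "Im (p (Complex (1 / 2) T) - p (Complex (1 / 2) (- T))) - 2 * T * ln (k * T / (2 * pi * exp 1))
       = 2 * (l - (T * ln T - T)) + (Im (g (Complex (1 / 2) T)) - Im (g (Complex (1 / 2) (- T))))"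
      unfolding Imp lneq by (simp add: algebra_simps)
    moreover have "\<bar>2 * (l - (T * ln T - T)) + (Im (g (Complex (1 / 2) T)) - Im (g (Complex (1 / 2) (- T))))\<bar> \<le> pi / 2 + 2 * (1 / (8 * T))"
    proof -
      have "\<bar>2 * a + (x - y)\<bar> \<le> pi / 2 + 2 * e" if "0 \<le> a" "a \<le> e" "\<bar>x\<bar> \<le> pi / 4" "\<bar>y\<bar> \<le> pi / 4" for a e x y :: real
      proof (rule abs_leI)
        have xy: "x \<le> pi / 4" "- x \<le> pi / 4" "y \<le> pi / 4" "- y \<le> pi / 4" using that by auto
        show "2 * a + (x - y) \<le> pi / 2 + 2 * e" using that(1,2) xy by simp
        show "- (2 * a + (x - y)) \<le> pi / 2 + 2 * e" using that(1,2) xy by simp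
      qed
      thus ?thesis using l g(4)[of T] g(4)[of "- T"] by (simp add: algebra_simps)
    qed
    ultimately show "\<bar>Im (p (Complex (1 / 2) T) - p (Complex (1 / 2) (- T))) - 2 * T * ln (k * T / (2 * pi * exp 1))\<bar> \<le> pi / 2 + 1 / (4 * T)"
      by simp
  qed
qed

end

lemma logint_reverse:
  assumes f: "f holomorphic_on UNIV" and nz: "\<And>z. z \<in> closed_segment a b \<Longrightarrow> f z \<noteq> 0"
  shows "logint f b a = - logint f a b"
proof -
  obtain U g where U: "open U" "closed_segment a b \<subseteq> U" "g holomorphic_on U" "\<And>z. z \<in> U \<Longrightarrow> f z = exp (g z)"
    using holomorphic_log_near[OF f compact_segment(1) convex_closed_segment nz] by metis
  have "closed_segment b a \<subseteq> U" using U(2) by (simp add: closed_segment_commute)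
  thus ?thesis using logint_eq[OF U(1,3,4)] U(2) by simp
qed

context prim_char
begin

lemma zeros_finite:
  "finite {z. L z = 0 \<and> 0 < Re z \<and> Re z < 1 \<and> \<bar>Im z\<bar> \<le> T}" (is "finite ?Z")
proof (rule finite_subset)
  show "?Z \<subseteq> {z \<in> cbox (Complex 0 (- T)) (Complex 1 T). L z = 0}" by (auto simp: in_cbox_complex_iff)
  show "finite {z \<in> cbox (Complex 0 (- T)) (Complex 1 T). L z = 0}"
    by (rule finite_zeros_compact[OF L_holomorphic_UNIV compact_cbox, of 2]) (simp add: L_nonzero)
qed

lemma logint_cauchy:
  assumes "a \<le> b" "u \<le> v" and nz: "\<And>z. Re z \<in> {a..b} \<Longrightarrow> Im z \<in> {u..v} \<Longrightarrow> L z \<noteq> 0"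
  shows "logint L (Complex a u) (Complex a v) = logint L (Complex a u) (Complex b u) + logint L (Complex b u) (Complex b v) - logint L (Complex a v) (Complex b v)"
proof -
  obtain U g where U: "open U" "cbox (Complex a u) (Complex b v) \<subseteq> U" "g holomorphic_on U" "\<And>z. z \<in> U \<Longrightarrow> L z = exp (g z)"
    using holomorphic_log_near[OF L_holomorphic_UNIV compact_cbox convex_box(1), of "Complex a u" "Complex b v"] nz
    unfolding in_cbox_complex_iff complex.sel by metis
  have "closed_segment (Complex a u) (Complex a v) \<subseteq> U" "closed_segment (Complex a u) (Complex b u) \<subseteq> U"
    "closed_segment (Complex b u) (Complex b v) \<subseteq> U" "closed_segment (Complex a v) (Complex b v) \<subseteq> U"
    using assms(1,2) by (intro order.trans[OF closed_segment_subset U(2)] convex_box; simp add: in_cbox_complex_iff)+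
  thus ?thesis by (simp add: logint_eq[OF U(1,3,4)])
qed

theorem zero_count:
  fixes T c :: real
  assumes T: "T > 0" and gen: "\<And>s. 0 < Re s \<Longrightarrow> Re s < 1 \<Longrightarrow> \<bar>Im s\<bar> = T \<Longrightarrow> L s \<noteq> 0" and c: "c > 1"
  shows "\<bar>N_zeros T chi - T / pi * ln (k * T / (2 * pi * exp 1))\<bar> \<le>
     (\<bar>Im (logint L (Complex (1 / 2) T) (Complex c T))\<bar> + \<bar>Im (logint L (Complex (1 / 2) (- T)) (Complex c (- T)))\<bar>
      + \<bar>Im (cm.log_ser (Complex c T))\<bar> + \<bar>Im (cm.log_ser (Complex c (- T)))\<bar>) / pi + 1 / 4 + 1 / (8 * pi * T)"
proof -
  define Z where "Z = {z. L z = 0 \<and> 0 < Re z \<and> Re z < 1 \<and> \<bar>Im z\<bar> \<le> T}"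
  have finZ: "finite Z" unfolding Z_def by (rule zeros_finite)
  \<comment> \<open>Supplies an abscissa \<open>c' < 1\<close> to the right of all zeros and of
    their mirror images. The rectangle from \<open>1 - c'\<close> to \<open>c'\<close> then encloses
    all zeros, while its sides stay in the open strip where \<open>p\<close> is defined.\<close>
  define X where "X = insert (1 / 2) (Re ` Z \<union> (\<lambda>z. 1 - Re z) ` Z)"
  have finX: "finite X" "X \<noteq> {}" using finZ by (auto simp: X_def)
  have "Max X < 1" using finX by (subst Max_less_iff) (auto simp: X_def Z_def)
  define c' where "c' = (1 + Max X) / 2"
  have X: "x < c'" if "x \<in> X" for x using Max_ge[OF finX(1) that] \<open>Max X < 1\<close> by (simp add: c'_def)
  have c': "1 / 2 < c'" "c' < 1" using X[of "1 / 2"] \<open>Max X < 1\<close> by (auto simp: c'_def X_def)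
  have Zc: "Re z < c'" "1 - c' < Re z" if "z \<in> Z" for z
    using X[of "Re z"] X[of "1 - Re z"] that by (auto simp: X_def)
  have nz_line: "L z \<noteq> 0" if "\<bar>Im z\<bar> = T" for z
    using L_nonzero[of z] L_zero_left[of z] gen[of z] that T by (cases "Re z \<ge> 1"; cases "Re z \<le> 0") auto
  have nz_right: "L z \<noteq> 0" if "Re z \<ge> c'" "\<bar>Im z\<bar> \<le> T" for z
    using L_nonzero[of z] Zc(1)[of z] that c' by (cases "Re z \<ge> 1") (auto simp: Z_def)
  have nz_left: "L z \<noteq> 0" if "Re z \<le> 1 - c'" "0 < Re z" "\<bar>Im z\<bar> \<le> T" for z
    using Zc(2)[of z] that c' by (auto simp: Z_def)
  note hol = L_holomorphic_UNIV
  define a1 a2 a3 a4 m1 m3 e2 e3 where "a1 = Complex (1 - c') (- T)" and "a2 = Complex c' (- T)" and "a3 = Complex c' T"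
    and "a4 = Complex (1 - c') T" and "m1 = Complex (1 / 2) (- T)" and "m3 = Complex (1 / 2) T" and "e2 = Complex c (- T)" and "e3 = Complex c T"
  note defs = a1_def a2_def a3_def a4_def m1_def m3_def e2_def e3_def
  define r where "r = rectpath a1 a3"
  have rle: "Re a1 \<le> Re a3" "Im a1 \<le> Im a3" using c' T by (auto simp: defs)
  have nz_path: "L z \<noteq> 0" if "z \<in> path_image r" for z
    using that nz_line[of z] nz_right[of z] nz_left[of z] c' T unfolding r_def path_image_rectpath[OF rle] by (auto simp: defs abs_le_iff)
  define S where "S = box (Complex 0 (- T - 1)) (Complex 1 (T + 1))"
  have sub: "cbox a1 a3 \<subseteq> S" using c' T by (auto simp: S_def defs in_cbox_complex_iff in_box_complex_iff)
  \<comment> \<open>The argument principle asks for all zeros in the open set \<open>S\<close>,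
    which reaches one unit beyond height \<open>T\<close>; those outside the rectangle have winding
    number 0.\<close>
  define pz where "pz = {w \<in> S. L w = 0 \<or> w \<in> {}}"
  have finpz: "finite pz"
  proof (rule finite_subset)
    show "pz \<subseteq> {z. L z = 0 \<and> 0 < Re z \<and> Re z < 1 \<and> \<bar>Im z\<bar> \<le> T + 1}" by (auto simp: pz_def S_def in_box_complex_iff)
  qed (rule zeros_finite)
  have wn0: "winding_number r z = 0" if "z \<notin> cbox a1 a3" for z
    unfolding r_def by (rule winding_number_rectpath_outside[OF rle that])
  have "contour_integral r (\<lambda>z. deriv L z * 1 / L z) = 2 * pi * \<i> * (\<Sum>p\<in>pz. winding_number r p * 1 * zorder L p)"
    unfolding pz_def
  proof (rule argument_principle[where S = S and f = L and poles = "{}" and h = "\<lambda>_. 1" and g = r])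
    show "open S" "connected S" unfolding S_def by (auto intro: convex_connected)
    show "L holomorphic_on S - {}" "(\<lambda>_. 1) holomorphic_on S" by (auto intro: holomorphic_intros)
    show "valid_path r" "pathfinish r = pathstart r" by (auto simp: r_def)
    show "path_image r \<subseteq> S - {w \<in> S. L w = 0 \<or> w \<in> {}}"
    proof -
      have "path_image r \<subseteq> S" using sub path_image_rectpath_subset_cbox[OF rle] unfolding r_def by (rule order.trans[rotated])
      thus ?thesis using nz_path by blast
    qed
    show "\<forall>z. z \<notin> S \<longrightarrow> winding_number r z = 0" using wn0 sub by blast
    show "finite {w \<in> S. L w = 0 \<or> w \<in> {}}" using finpz by (simp add: pz_def)
  qed auto
  also have "(\<Sum>p\<in>pz. winding_number r p * 1 * zorder L p) = (\<Sum>p\<in>Z. of_int (zorder L p))"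
  proof (rule sum.mono_neutral_cong_right[OF finpz])
    show "Z \<subseteq> pz" by (auto simp: Z_def pz_def S_def in_box_complex_iff)
    have "p \<notin> cbox a1 a3" if "p \<in> pz - Z" for p
      using that c' by (auto simp: pz_def Z_def S_def in_cbox_complex_iff in_box_complex_iff defs)
    thus "\<forall>p\<in>pz - Z. winding_number r p * 1 * of_int (zorder L p) = 0" using wn0 by simp
    fix p assume p: "p \<in> Z"
    have "\<bar>Im p\<bar> \<noteq> T" using nz_line[of p] p by (auto simp: Z_def)
    hence "p \<in> box a1 a3" using p Zc[OF p] by (auto simp: in_box_complex_iff defs Z_def)
    thus "winding_number r p * 1 * of_int (zorder L p) = of_int (zorder L p)"
      unfolding r_def by (simp add: winding_number_rectpath)
  qed
  also have "\<dots> = of_real (N_zeros T chi)" by (simp add: N_zeros_def Z_def)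
  finally have ci: "contour_integral r (\<lambda>z. deriv L z / L z) = 2 * pi * \<i> * of_real (N_zeros T chi)" by simp
  have cont: "continuous_on (path_image r) (\<lambda>z. deriv L z / L z)"
  proof (intro continuous_on_divide)
    have "deriv L holomorphic_on UNIV" by (rule holomorphic_deriv[OF hol open_UNIV])
    thus "continuous_on (path_image r) (deriv L)" using continuous_on_subset holomorphic_on_imp_continuous_on by blast
    show "continuous_on (path_image r) L" by (intro holomorphic_on_imp_continuous_on L_holomorphic)
  qed (use nz_path in auto)
  have "contour_integral r (\<lambda>z. deriv L z / L z) = logint L a1 a2 + logint L a2 a3 - logint L a4 a3 - logint L a1 a4"
    using contour_integral_rectpath[OF cont[unfolded r_def] rle] unfolding r_def logint_def by (simp add: defs)
  hence I: "2 * pi * N_zeros T chi = Im (logint L a1 a2) + Im (logint L a2 a3) - Im (logint L a4 a3) - Im (logint L a1 a4)"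
  proof -
    assume e: "contour_integral r (\<lambda>z. deriv L z / L z) = logint L a1 a2 + logint L a2 a3 - logint L a4 a3 - logint L a1 a4"
    have "Im (2 * pi * \<i> * of_real (N_zeros T chi)) = Im (logint L a1 a2 + logint L a2 a3 - logint L a4 a3 - logint L a1 a4)"
      unfolding ci[symmetric] e ..
    thus ?thesis by simp
  qed
  obtain p where p: "p holomorphic_on {s. 0 < Re s \<and> Re s < 1}"
    "\<And>s. 0 < Re s \<Longrightarrow> Re s < 1 \<Longrightarrow> cnj (L (1 - cnj s)) = exp (p s) * L s"
    "\<bar>Im (p (Complex (1 / 2) T) - p (Complex (1 / 2) (- T))) - 2 * T * ln (k * T / (2 * pi * exp 1))\<bar> \<le> pi / 2 + 1 / (4 * T)"
    by (rule strip_log[OF T]) (rule that)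
  have refl: "logint L (1 - cnj a) (1 - cnj b) = cnj (logint L a b + (p b - p a))"
    if "\<And>z. z \<in> closed_segment a b \<Longrightarrow> L (1 - cnj z) \<noteq> 0" "closed_segment a b \<subseteq> {s. 0 < Re s \<and> Re s < 1}" for a b
    by (rule logint_reflect[OF hol that(1) _ that(2) p(1)])
       (use p(2) in \<open>auto intro!: open_Int[of "{s. 0 < Re s}" "{s. Re s < 1}", unfolded Collect_conj_eq[symmetric]] open_halfspace_Re_gt open_halfspace_Re_lt simp: Int_def\<close>)
  have seg_h: "closed_segment (Complex x y) (Complex x' y) = {z. Im z = y \<and> Re z \<in> closed_segment x x'}" for x x' y
    by (subst closed_segment_same_Im) auto
  have seg_v: "closed_segment (Complex x y) (Complex x y') = {z. Re z = x \<and> Im z \<in> closed_segment y y'}" for x y y'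
    by (subst closed_segment_same_Re) auto
  \<comment> \<open>The left half of the contour is expressed by the right half: here the bottom
    side, then in \<open>r3\<close> the top side and in \<open>r2\<close> the vertical side.\<close>
  have r1: "logint L a1 m1 = cnj (- logint L m1 a2 + (p m1 - p a2))"
  proof -
    have "logint L (1 - cnj a2) (1 - cnj m1) = cnj (logint L a2 m1 + (p m1 - p a2))"
      by (rule refl) (use c' T in \<open>auto simp: defs seg_h closed_segment_eq_real_ivl intro!: nz_line\<close>)
    moreover have "logint L a2 m1 = - logint L m1 a2"
      by (rule logint_reverse[OF hol nz_line]) (use T in \<open>auto simp: defs seg_h\<close>)
    moreover have "1 - cnj a2 = a1" "1 - cnj m1 = m1" by (auto simp: defs complex_eq_iff)
    ultimately show ?thesis by simp
  qed
  have r3: "logint L a4 m3 = cnj (- logint L m3 a3 + (p m3 - p a3))"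
  proof -
    have "logint L (1 - cnj a3) (1 - cnj m3) = cnj (logint L a3 m3 + (p m3 - p a3))"
      by (rule refl) (use c' T in \<open>auto simp: defs seg_h closed_segment_eq_real_ivl intro!: nz_line\<close>)
    moreover have "logint L a3 m3 = - logint L m3 a3"
      by (rule logint_reverse[OF hol nz_line]) (use T in \<open>auto simp: defs seg_h\<close>)
    moreover have "1 - cnj a3 = a4" "1 - cnj m3 = m3" by (auto simp: defs complex_eq_iff)
    ultimately show ?thesis by simp
  qed
  have r2: "logint L a1 a4 = cnj (logint L a2 a3 + (p a3 - p a2))"
  proof -
    have "logint L (1 - cnj a2) (1 - cnj a3) = cnj (logint L a2 a3 + (p a3 - p a2))"
    proof (rule refl)
      fix z assume "z \<in> closed_segment a2 a3"
      hence "Re z = c'" "\<bar>Im z\<bar> \<le> T" using T by (auto simp: defs seg_v closed_segment_eq_real_ivl)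
      thus "L (1 - cnj z) \<noteq> 0" using c' by (intro nz_left) auto
    qed (use c' in \<open>auto simp: defs seg_v\<close>)
    moreover have "1 - cnj a2 = a1" "1 - cnj a3 = a4" by (auto simp: defs complex_eq_iff)
    ultimately show ?thesis by simp
  qed
  have comb: "logint L x z = logint L x y + logint L y z"
    if "Im x = Im y" "Im y = Im z" "\<bar>Im y\<bar> = T" "Re x \<le> Re y" "Re y \<le> Re z" for x y z
  proof (rule logint_combine[OF hol])
    have e: "closed_segment x z = {w. Im w = Im x \<and> Re w \<in> closed_segment (Re x) (Re z)}" by (rule closed_segment_same_Im) (use that in simp)
    show "L w \<noteq> 0" if "w \<in> closed_segment x z" for w using that nz_line[of w] \<open>Im x = Im y\<close> \<open>\<bar>Im y\<bar> = T\<close> unfolding e by auto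
    show "y \<in> closed_segment x z" using that unfolding e by (auto simp: closed_segment_eq_real_ivl)
  qed
  have s: "logint L a1 a2 = logint L a1 m1 + logint L m1 a2" "logint L a4 a3 = logint L a4 m3 + logint L m3 a3"
    "logint L m1 e2 = logint L m1 a2 + logint L a2 e2" "logint L m3 e3 = logint L m3 a3 + logint L a3 e3"
    by (rule comb; use c' c T in \<open>simp add: defs\<close>)+
  have cau: "logint L a2 a3 = logint L a2 e2 + logint L e2 e3 - logint L a3 e3"
    unfolding defs
  proof (rule logint_cauchy)
    show "L z \<noteq> 0" if "Re z \<in> {c'..c}" "Im z \<in> {- T..T}" for z
      using that by (intro nz_right) auto
  qed (use c' c T in auto)
  have ls: "logint L e2 e3 = cm.log_ser e3 - cm.log_ser e2"
    by (rule logint_eq[OF open_halfspace_Re_gt cm.log_ser_holomorphic]) (use c in \<open>auto simp: L_eq_exp defs seg_v\<close>)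
  \<comment> \<open>Conjugation changes the sign of imaginary parts, so the reflected half doubles
    the right half; the values of \<open>p\<close> off the critical line cancel.\<close>
  have tot: "2 * pi * N_zeros T chi = 2 * (Im (logint L m1 e2) - Im (logint L m3 e3) + Im (cm.log_ser e3) - Im (cm.log_ser e2)) + Im (p m3 - p m1)"
    using arg_cong[OF r1, of Im] arg_cong[OF r2, of Im] arg_cong[OF r3, of Im] arg_cong[OF s(1), of Im] arg_cong[OF s(2), of Im]
      arg_cong[OF s(3), of Im] arg_cong[OF s(4), of Im] arg_cong[OF cau, of Im] arg_cong[OF ls, of Im]
    unfolding I by simp
  define W where "W = \<bar>Im (logint L m3 e3)\<bar> + \<bar>Im (logint L m1 e2)\<bar> + \<bar>Im (cm.log_ser e3)\<bar> + \<bar>Im (cm.log_ser e2)\<bar>"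
  have "\<bar>Im (logint L m1 e2) - Im (logint L m3 e3) + Im (cm.log_ser e3) - Im (cm.log_ser e2)\<bar> \<le> W" 
    unfolding W_def by linarith
  moreover have "\<bar>2 * a + b - m\<bar> \<le> 2 * w + e" if "\<bar>a\<bar> \<le> w" "\<bar>b - m\<bar> \<le> e" for a b m w e :: real
    using that by linarith
  ultimately have "\<bar>2 * pi * N_zeros T chi - 2 * T * ln (k * T / (2 * pi * exp 1))\<bar> \<le> 2 * W + (pi / 2 + 1 / (4 * T))"
    unfolding tot using p(3)[folded m1_def m3_def] by blast
  hence "\<bar>2 * pi * N_zeros T chi - 2 * T * ln (k * T / (2 * pi * exp 1))\<bar> / (2 * pi) \<le> (2 * W + (pi / 2 + 1 / (4 * T))) / (2 * pi)"
    by (intro divide_right_mono) auto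
  moreover have "\<bar>2 * pi * N_zeros T chi - 2 * T * ln (k * T / (2 * pi * exp 1))\<bar> / (2 * pi) = \<bar>N_zeros T chi - T / pi * ln (k * T / (2 * pi * exp 1))\<bar>"
  proof -
    have "N_zeros T chi - T / pi * ln (k * T / (2 * pi * exp 1)) = (2 * pi * N_zeros T chi - 2 * T * ln (k * T / (2 * pi * exp 1))) / (2 * pi)"
      by (simp add: field_simps)
    thus ?thesis by (simp only: abs_divide) simp
  qed
  moreover have "(2 * W + (pi / 2 + 1 / (4 * T))) / (2 * pi) = W / pi + 1 / 4 + 1 / (8 * pi * T)"
    using T by (simp add: field_simps)
  ultimately show ?thesis unfolding W_def defs by simp
qed

end

section \<open>Backlund bound for the argument\<close>

text \<open>The exponential has modulus \<open>exp (- (pi * T)) \<le> 1 / (21 * T)\<close>, because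
  \<open>exp (31 / 10) \<ge> 21\<close>, which follows from the 16th power of a quadratic Taylor
  bound. Then \<open>norm w / (1 - norm w)\<close> bounds the logarithm of
  \<open>1 - w\<close>.\<close>

lemma norm_Ln_one_plus_exp_le:
  assumes e: "e = 1 \<or> e = - 1" and s: "Im s = T" and T: "T \<ge> 1"
  shows "norm (e * exp (\<i> * pi * s)) < 1" "\<bar>Im (Ln (1 + e * exp (\<i> * pi * s)))\<bar> \<le> 1 / (20 * T)"
proof -
  define w where "w = - (e * exp (\<i> * pi * s))"
  have nw: "norm w = exp (- (pi * T))" using e s by (auto simp: w_def norm_mult)
  have "exp (31 / 10 :: real) \<ge> 21"
  proof -
    have "1 + 31 / 160 + (31 / 160)\<^sup>2 / 2 \<le> exp (31 / 160 :: real)" by (rule exp_lower_Taylor_quadratic) simp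
    hence "(1 + 31 / 160 + (31 / 160)\<^sup>2 / 2) ^ 16 \<le> exp (31 / 160 :: real) ^ 16" by (rule power_mono) (simp add: power2_eq_square)
    also have "exp (31 / 160 :: real) ^ 16 = exp (31 / 10)" by (simp flip: exp_of_nat_mult)
    finally show ?thesis by (rule order.trans[rotated]) (simp add: power2_eq_square power_divide)
  qed
  also have "exp (31 / 10 :: real) \<le> exp pi" using pi_approx by simp
  finally have "21 * T \<le> exp pi * (1 + pi * (T - 1))"
  proof (rule mult_mono)
    have "1 * (T - 1) \<le> pi * (T - 1)" using T pi_gt3 by (intro mult_right_mono) auto
    thus "T \<le> 1 + pi * (T - 1)" by simp
  qed (use T in auto)
  also have "\<dots> \<le> exp pi * exp (pi * (T - 1))" by (intro mult_left_mono exp_ge_add_one_self) auto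
  also have "\<dots> = exp (pi * T)" unfolding exp_add[symmetric] by (simp add: algebra_simps)
  finally have "norm w \<le> 1 / (21 * T)" unfolding nw exp_minus inverse_eq_divide using T by (intro divide_left_mono) auto
  moreover have "norm w / (1 - norm w) \<le> (1 / (21 * T)) / (1 - 1 / (21 * T))" if "norm w \<le> 1 / (21 * T)"
    using that T by (intro frac_le diff_left_mono) (auto simp: field_simps)
  moreover have "(1 / (21 * T)) / (1 - 1 / (21 * T)) \<le> 1 / (20 * T)" using T by (simp add: divide_simps)
  ultimately have le: "norm w / (1 - norm w) \<le> 1 / (20 * T)" by linarith
  have lt: "norm w < 1" using nw T by simp
  thus "norm (e * exp (\<i> * pi * s)) < 1" by (simp add: w_def)
  have "\<bar>Im (Ln (1 - w))\<bar> \<le> norm (Ln (1 - w))" by (rule abs_Im_le_cmod)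
  also have "\<dots> \<le> - ln (1 - norm w)" by (rule norm_Ln_one_minus_le[OF lt])
  also have "\<dots> = ln (1 / (1 - norm w))" using lt by (simp add: ln_div)
  also have "\<dots> \<le> 1 / (1 - norm w) - 1" using lt by (intro ln_le_minus_one) simp
  also have "\<dots> = norm w / (1 - norm w)" using lt by (simp add: field_simps)
  finally show "\<bar>Im (Ln (1 + e * exp (\<i> * pi * s)))\<bar> \<le> 1 / (20 * T)" using le by (simp add: w_def)
qed

context prim_char
begin

text \<open>The branch of \<open>strip_log\<close> ends at real part 1, whereas the horizontal
  segments run to \<open>c > 1\<close>. In the quadrant the dominant exponential of
  \<open>gcos\<close> is split off; its argument cancels the growth \<open>pi / 2 * x\<close> of the
  argument of Gamma, and \<open>1 + sgn_chi * exp (i * pi * s)\<close> stays near 1.\<close>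

lemma quadrant_log:
  obtains p where "p holomorphic_on {s. 0 < Re s \<and> 0 < Im s}"
    "\<And>s. s \<in> {s. 0 < Re s \<and> 0 < Im s} \<Longrightarrow> cnj (L (1 - cnj s)) = exp (p s) * L s"
    "\<And>x T. T \<ge> 1 \<Longrightarrow> 1 / 2 \<le> x \<Longrightarrow> x \<le> 3 / 2 \<Longrightarrow> \<bar>Im (p (Complex x T) - p (Complex (1 / 2) T))\<bar> \<le> (x\<^sup>2 / 2 + 1 / 10) / T"
proof -
  define c' where "c' = cnj (gauss 1) / of_nat k * sgn_chi"
  have c': "c' \<noteq> 0" using gauss_1_nz sgn_chi_nz k_pos by (simp add: c'_def)
  define p where "p = (\<lambda>s. Ln c' + (ln_Gamma s - s * of_real (ln (2 * pi / k)) + (- (\<i> * pi * s / 2) + Ln (1 + sgn_chi * exp (\<i> * pi * s)))))"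
  have lt: "norm (sgn_chi * exp (\<i> * pi * s)) < 1" if "0 < Im s" for s
    using sgn_chi that by (auto simp: norm_mult)
  have np: "1 + sgn_chi * exp (\<i> * pi * s) \<notin> \<real>\<^sub>\<le>\<^sub>0" if "0 < Im s" for s
    using lt[OF that] abs_Re_le_cmod[of "sgn_chi * exp (\<i> * pi * s)"] by (auto simp: complex_nonpos_Reals_iff)
  show ?thesis
  proof (rule that[of p])
    show "p holomorphic_on {s. 0 < Re s \<and> 0 < Im s}"
      unfolding p_def using np by (intro holomorphic_intros) (auto simp: complex_nonpos_Reals_iff)
    show "cnj (L (1 - cnj s)) = exp (p s) * L s" if s: "s \<in> {s. 0 < Re s \<and> 0 < Im s}" for s
    proof -
      have nz: "1 + sgn_chi * exp (\<i> * pi * s) \<noteq> 0" using np[of s] s by auto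
      have g: "gcos sgn_chi s = exp (- (\<i> * pi * s / 2)) * (1 + sgn_chi * exp (\<i> * pi * s))"
      proof -
        have "- (\<i> * pi * s / 2) + \<i> * pi * s = \<i> * pi * s / 2" by (simp add: field_simps)
        hence "exp (- (\<i> * pi * s / 2)) * exp (\<i> * pi * s) = exp (\<i> * pi * s / 2)" unfolding exp_add[symmetric] by (rule arg_cong)
        thus ?thesis unfolding gcos_def by (simp only: distrib_left mult_1_right mult.left_commute)
      qed
      have "exp (p s) = c' * (exp (ln_Gamma s - s * of_real (ln (2 * pi / k))) * (exp (- (\<i> * pi * s / 2)) * (1 + sgn_chi * exp (\<i> * pi * s))))"
        unfolding p_def exp_add exp_Ln[OF c'] exp_Ln[OF nz] ..
      moreover have "0 < Re s" using s by simp
      ultimately show ?thesis unfolding cnj_Phi[OF \<open>0 < Re s\<close>] g c'_def by (simp only: mult_ac)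
    qed
    fix x T :: real assume T: "T \<ge> 1" and x: "1 / 2 \<le> x" "x \<le> 3 / 2"
    define D where "D = Im (ln_Gamma (Complex x T)) - Im (ln_Gamma (Complex (1 / 2) T)) - pi / 2 * (x - 1 / 2)"
    have D: "- ((x - 1 / 2)\<^sup>2 + 1 / 8) / T \<le> D" "D \<le> x\<^sup>2 / (2 * T)"
      using Im_ln_Gamma_horizontal[of T x] T x by (auto simp: D_def)
    have "(x - 1 / 2)\<^sup>2 + 1 / 8 \<le> x\<^sup>2 / 2"
    proof -
      have "0 \<le> (x - 1 / 2) * (3 / 2 - x)" using x by (intro mult_nonneg_nonneg) auto
      thus ?thesis by (simp add: power2_eq_square field_simps)
    qed
    hence "((x - 1 / 2)\<^sup>2 + 1 / 8) / T \<le> x\<^sup>2 / 2 / T" using T by (intro divide_right_mono) auto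
    moreover have "- ((x - 1 / 2)\<^sup>2 + 1 / 8) / T = - (((x - 1 / 2)\<^sup>2 + 1 / 8) / T)" by (rule minus_divide_left[symmetric])
    moreover have "x\<^sup>2 / (2 * T) = x\<^sup>2 / 2 / T" by simp
    ultimately have absD: "\<bar>D\<bar> \<le> x\<^sup>2 / 2 / T" using D unfolding abs_le_iff by linarith
    define e where "e = (\<lambda>x. Im (Ln (1 + sgn_chi * exp (\<i> * pi * Complex x T))))"
    have e: "\<bar>e x\<bar> \<le> 1 / (20 * T)" for x
      unfolding e_def by (rule norm_Ln_one_plus_exp_le[OF sgn_chi _ T]) simp
    have "Im (p (Complex x T) - p (Complex (1 / 2) T)) = D + (e x - e (1 / 2))"
      by (simp add: p_def D_def e_def Im_divide_numeral field_simps)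
    also have "\<bar>\<dots>\<bar> \<le> \<bar>D\<bar> + (\<bar>e x\<bar> + \<bar>e (1 / 2)\<bar>)" by linarith
    also have "\<dots> \<le> x\<^sup>2 / 2 / T + (1 / (20 * T) + 1 / (20 * T))" by (intro add_mono absD e)
    also have "\<dots> = (x\<^sup>2 / 2 + 1 / 10) / T" using T by (simp add: field_simps)
    finally show "\<bar>Im (p (Complex x T) - p (Complex (1 / 2) T))\<bar> \<le> (x\<^sup>2 / 2 + 1 / 10) / T" .
  qed
qed

lemma norm_L_le: "Re s > 1 \<Longrightarrow> norm (L s) \<le> exp (ln (zeta_real (Re s)))"
  using cm.norm_log_ser[of s] complex_Re_le_cmod[of "cm.log_ser s"] by (simp add: L_eq_exp)

text \<open>Functional equation at real part \<open>- d\<close>: the Gauss sum gives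
  \<open>k powr (- 1 / 2)\<close>, the power gives \<open>(k / (2 * pi)) powr (1 + d)\<close>, and
  \<open>norm_gfac_le\<close> supplies the power of \<open>T\<close>. Together they produce
  \<open>k * T / (2 * pi)\<close> to the exponent \<open>1 / 2 + d\<close>.\<close>

lemma norm_L_left:
  fixes T lam d :: real
  assumes T: "T > 0" and lam: "lam > 0" and d: "0 < d" "d \<le> 1 / 2" and w: "Re w = - d"
  shows "norm (L w) \<le> exp ((1 / 2 + d) * (ln (k * T / (2 * pi)) + (1 / (8 * T) + lam / 2) / T)
      + (1 / 4 - d\<^sup>2) / (2 * lam * T) + ln (zeta_real (1 + d)) + 1 / (2 * lam * T) * (Im w - T)\<^sup>2)"
proof -
  define s where "s = 1 - cnj w"
  have s: "Re s = 1 + d" "Im s = Im w" using w by (auto simp: s_def)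
  have np: "s \<notin> \<int>\<^sub>\<le>\<^sub>0" using s d by (auto simp: nonpos_Ints_def complex_eq_iff)
  have "norm (L w) = norm (cnj (L (1 - cnj s)))" by (simp add: s_def)
  also have "\<dots> = norm (cnj (gauss 1) / of_nat k * sgn_chi) * norm (exp (ln_Gamma s - s * of_real (ln (2 * pi / k)))) * norm (gcos sgn_chi s) * norm (L s)"
  proof -
    have "Re s > 0" using s d by simp
    show ?thesis unfolding cnj_Phi[OF \<open>Re s > 0\<close>] norm_mult ..
  qed
  also have "norm (cnj (gauss 1) / of_nat k * sgn_chi) = exp (- (1 / 2) * ln k)"
  proof -
    have "norm (cnj (gauss 1) / of_nat k * sgn_chi) = sqrt k / k" using sgn_chi norm_gauss_1 by (auto simp: norm_mult norm_divide)
    also have "\<dots> = real k powr (1 / 2) / real k powr 1" using k_pos by (simp add: powr_half_sqrt)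
    also have "\<dots> = real k powr (- (1 / 2))" unfolding powr_diff[symmetric] by simp
    finally show ?thesis using k_pos by (simp add: powr_def)
  qed
  also have "norm (exp (ln_Gamma s - s * of_real (ln (2 * pi / k)))) = norm (Gamma s) * exp (- (1 + d) * ln (2 * pi / k))"
  proof -
    have "norm (exp (ln_Gamma s - s * of_real (ln (2 * pi / k)))) = norm (exp (ln_Gamma s)) * exp (Re (- (s * of_real (ln (2 * pi / k)))))"
      unfolding norm_exp_eq_Re exp_add[symmetric] by simp
    moreover have "Re (- (s * of_real (ln (2 * pi / k)))) = - (1 + d) * ln (2 * pi / k)" by (simp add: s(1) algebra_simps)
    ultimately show ?thesis using np by (simp only: Gamma_complex_altdef if_False)
  qed
  also have "exp (- (1 / 2) * ln k) * (norm (Gamma s) * exp (- (1 + d) * ln (2 * pi / k))) * norm (gcos sgn_chi s) * norm (L s)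
     = exp (- (1 / 2) * ln k - (1 + d) * ln (2 * pi / k) + ln (sqrt (2 * pi))) * norm (gfac sgn_chi s) * norm (L s)"
  proof -
    have "exp (ln (sqrt (2 * pi))) = sqrt (2 * pi)" by simp
    hence "norm (Gamma s) * norm (gcos sgn_chi s) = exp (ln (sqrt (2 * pi))) * norm (gfac sgn_chi s)" by (simp add: gfac_def norm_mult norm_divide)
    moreover have "exp (- (1 / 2) * ln k - (1 + d) * ln (2 * pi / k) + ln (sqrt (2 * pi))) = exp (- (1 / 2) * ln k) * exp (- (1 + d) * ln (2 * pi / k)) * exp (ln (sqrt (2 * pi)))"
      unfolding exp_add[symmetric] by (simp add: algebra_simps)
    moreover have "x * (a * y) * b * l = (x * y * e) * g * l" if "a * b = e * g" for a b e g l x y :: real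
    proof -
      have "x * (a * y) * b * l = x * y * (a * b) * l" by (simp only: mult_ac)
      thus ?thesis unfolding that by (simp only: mult_ac)
    qed
    ultimately show ?thesis by (simp only:)
  qed
  also have "- (1 / 2) * ln k - (1 + d) * ln (2 * pi / k) + ln (sqrt (2 * pi)) = (1 / 2 + d) * (ln k - ln (2 * pi))"
    using k_pos by (simp add: ln_div ln_sqrt algebra_simps)
  also have "exp ((1 / 2 + d) * (ln k - ln (2 * pi))) * norm (gfac sgn_chi s) * norm (L s) \<le>
     exp ((1 / 2 + d) * (ln k - ln (2 * pi))) *
     exp ((Re s - 1 / 2) * (ln T + (1 / (8 * T) + lam / 2) / T) + ((Im s - T)\<^sup>2 + (Re s - 1 / 2) * (3 / 2 - Re s)) / (2 * lam * T)) *
     exp (ln (zeta_real (Re s)))"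
    using norm_gfac_le[OF sgn_chi T lam, of s] norm_L_le[of s] s d by (intro mult_mono) auto
  also have "\<dots> = exp ((1 / 2 + d) * (ln k - ln (2 * pi)) + ((1 / 2 + d) * (ln T + (1 / (8 * T) + lam / 2) / T)
      + ((Im w - T)\<^sup>2 + (1 / 2 + d) * (1 / 2 - d)) / (2 * lam * T)) + ln (zeta_real (1 + d)))"
    unfolding exp_add[symmetric] s by (simp add: algebra_simps)
  also have "(1 / 2 + d) * (ln k - ln (2 * pi)) + ((1 / 2 + d) * (ln T + (1 / (8 * T) + lam / 2) / T)
      + ((Im w - T)\<^sup>2 + (1 / 2 + d) * (1 / 2 - d)) / (2 * lam * T)) + ln (zeta_real (1 + d))
     = (1 / 2 + d) * (ln (k * T / (2 * pi)) + (1 / (8 * T) + lam / 2) / T)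
      + (1 / 4 - d\<^sup>2) / (2 * lam * T) + ln (zeta_real (1 + d)) + 1 / (2 * lam * T) * (Im w - T)\<^sup>2"
  proof -
    have l: "ln (k * T / (2 * pi)) = (ln k - ln (2 * pi)) + ln T" using k_pos T by (simp add: ln_div ln_mult)
    have m: "(1 / 2 + d) * (1 / 2 - d) = 1 / 4 - d\<^sup>2" by (simp add: power2_eq_square algebra_simps)
    show ?thesis unfolding l m add_divide_distrib by (simp add: algebra_simps)
  qed
  finally show ?thesis .
qed

text \<open>Applies \<open>backlund_strip\<close> to \<open>L\<close> shifted by
  \<open>i * T\<close>. The left edge is controlled by \<open>norm_L_left\<close>, the right edge by
  the Euler product, and the defect \<open>E\<close> of the reflection symmetry of the argument by
  \<open>quadrant_log\<close>.\<close>

theorem logint_bound: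
  fixes T B c d lam G :: real
  assumes T: "T \<ge> 1" and nz: "\<And>z. Im z = T \<Longrightarrow> L z \<noteq> 0"
    and lam: "lam > 0" and d: "0 < d" "d \<le> 1 / 2" and c: "1 < c" "c < 1 + d" "c < B"
    and G: "G > 0" "1 - cos (pi / (2 * (B + d)) * (2 * c - 1)) \<le> exp (- G) * (1 - cos (pi / (2 * (B + d)) * (2 * c + 1 + 4 * d)))"
  defines "A \<equiv> (1 / 2 + d) * (ln (k * T / (2 * pi)) + (1 / (8 * T) + lam / 2) / T) + (1 / 4 - d\<^sup>2) / (2 * lam * T) + ln (zeta_real (1 + d))"
  shows "\<bar>Im (logint L (Complex (1 / 2) T) (Complex c T))\<bar> \<le> (c\<^sup>2 / 2 + 1 / 10) / T
     + pi / G * ((A * (B - c) + ln (zeta_real B) * (c + d)) / (B + d) + 1 / (2 * lam * T) * ((c + d) * (B - c)) - ln (norm (L (Complex c T))))"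
proof -
  have seg: "closed_segment (Complex (1 - c) T) (Complex c T) = {z. Im z = T \<and> Re z \<in> {1 - c..c}}"
    using c by (subst closed_segment_same_Im) (auto simp: closed_segment_eq_real_ivl)
  have seg': "closed_segment (Complex x T) (Complex y T) = {z. Im z = T \<and> Re z \<in> closed_segment x y}" for x y
    by (subst closed_segment_same_Im) auto
  obtain U g where U: "open U" "closed_segment (Complex (1 - c) T) (Complex c T) \<subseteq> U" "g holomorphic_on U" "\<And>z. z \<in> U \<Longrightarrow> L z = exp (g z)"
  proof (rule holomorphic_log_near[OF L_holomorphic_UNIV compact_segment(1) convex_closed_segment])
    show "L z \<noteq> 0" if "z \<in> closed_segment (Complex (1 - c) T) (Complex c T)" for z using that nz unfolding seg by simp
  qed (rule that)
  have inU: "Complex x T \<in> U" if "x \<in> {1 - c..c}" for x using that U(2) unfolding seg by auto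
  define b where "b = (\<lambda>x. Im (g (Complex x T)))"
  have li: "logint L (Complex x T) (Complex y T) = g (Complex y T) - g (Complex x T)" if "x \<in> {1 - c..c}" "y \<in> {1 - c..c}" for x y
  proof (rule logint_eq[OF U(1,3,4)])
    show "closed_segment (Complex x T) (Complex y T) \<subseteq> U"
      using U(2) that unfolding seg seg' by (auto simp: closed_segment_eq_real_ivl split: if_splits)
  qed
  define f where "f = (\<lambda>z. L (z + Complex 0 T))"
  have hol: "f holomorphic_on UNIV"
  proof -
    have "L \<circ> (\<lambda>z. z + Complex 0 T) holomorphic_on UNIV" by (intro holomorphic_on_compose holomorphic_intros)
    thus ?thesis by (simp add: f_def o_def)
  qed
  have fr: "f (of_real x) = L (Complex x T)" for x
  proof -
    have "complex_of_real x + Complex 0 T = Complex x T" by (simp add: complex_eq_iff)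
    thus ?thesis by (simp add: f_def)
  qed
  obtain K where K: "\<And>s. \<bar>Re s\<bar> \<le> B + d \<Longrightarrow> norm (L s) \<le> K * exp (pi / 2 * \<bar>Im s\<bar>)"
    using L_growth[of "B + d"] c d by auto
  define C where "C = max (\<bar>K\<bar> * exp (pi / 2 * T)) (pi / 2)"
  have C: "C \<ge> 0" "\<bar>K\<bar> * exp (pi / 2 * T) \<le> C" "pi / 2 \<le> C" by (auto simp: C_def le_max_iff_disj)
  have half: "1 / 2 \<in> {1 - c..c}" "c \<in> {1 - c..c}" using c by auto
  have "\<bar>b (1 / 2) - b c\<bar> \<le> (c\<^sup>2 / 2 + 1 / 10) / T
     + pi / G * ((A * (B - c) + ln (zeta_real B) * (c + d)) / (B + d) + 1 / (2 * lam * T) * ((c + d) * (B - c)) - ln (norm (f (of_real c))))"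
  proof (rule backlund_strip[where C = C and al = "pi / (2 * (B + d))" and W = "B + d" and d = d])
    show "norm (f z) \<le> C * exp (C * \<bar>Im z\<bar>)" if "- d \<le> Re z" "Re z \<le> B" for z
    proof -
      have "norm (f z) \<le> K * exp (pi / 2 * \<bar>Im (z + Complex 0 T)\<bar>)"
        unfolding f_def by (rule K) (use that c d in auto)
      also have "\<dots> \<le> \<bar>K\<bar> * exp (pi / 2 * (T + \<bar>Im z\<bar>))"
        using T by (intro mult_mono) auto
      also have "\<dots> = (\<bar>K\<bar> * exp (pi / 2 * T)) * exp (pi / 2 * \<bar>Im z\<bar>)" by (simp add: exp_add distrib_left)
      also have "\<dots> \<le> C * exp (C * \<bar>Im z\<bar>)" using C mult_right_mono[OF C(3), of "\<bar>Im z\<bar>"] by (intro mult_mono) auto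
      finally show ?thesis .
    qed
    show "norm (f z) \<le> exp (A + 1 / (2 * lam * T) * (Im z)\<^sup>2)" if "Re z = - d" for z
      using norm_L_left[of T lam d "z + Complex 0 T"] T lam d that by (simp add: f_def A_def)
    show "norm (f z) \<le> exp (ln (zeta_real B) + 1 / (2 * lam * T) * (Im z)\<^sup>2)" if "Re z = B" for z
    proof -
      have "norm (f z) \<le> exp (ln (zeta_real B))" using norm_L_le[of "z + Complex 0 T"] that c by (simp add: f_def)
      also have "\<dots> \<le> exp (ln (zeta_real B) + 1 / (2 * lam * T) * (Im z)\<^sup>2)" using lam T by simp
      finally show ?thesis .
    qed
    have cU: "continuous_on U g" using U(3) by (rule holomorphic_on_imp_continuous_on)
    have "continuous_on {1 - c..c} (\<lambda>x. g (Complex x T))"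
    proof (rule continuous_on_compose2[OF cU])
      have "(\<lambda>x. Complex x T) = (\<lambda>x. of_real x + \<i> * of_real T)" by (simp add: complex_eq_iff fun_eq_iff)
      thus "continuous_on {1 - c..c} (\<lambda>x. Complex x T)" by (auto intro!: continuous_intros)
    qed (use inU in auto)
    thus "continuous_on {1 - c..c} b" unfolding b_def by (intro continuous_intros)
    show "f (of_real x) = of_real (norm (f (of_real x))) * cis (b x)" if "x \<in> {1 - c..c}" for x
      using U(4)[OF inU[OF that]] by (simp add: fr b_def exp_eq_polar norm_mult)
    show "\<bar>b (1 - x) + b x - 2 * b (1 / 2)\<bar> \<le> (c\<^sup>2 / 2 + 1 / 10) / T" if x: "x \<in> {1 / 2..c}" for x
    proof -
      obtain p where p: "p holomorphic_on {s. 0 < Re s \<and> 0 < Im s}"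
        "\<And>s. s \<in> {s. 0 < Re s \<and> 0 < Im s} \<Longrightarrow> cnj (L (1 - cnj s)) = exp (p s) * L s"
        "\<And>x T. T \<ge> 1 \<Longrightarrow> 1 / 2 \<le> x \<Longrightarrow> x \<le> 3 / 2 \<Longrightarrow> \<bar>Im (p (Complex x T) - p (Complex (1 / 2) T))\<bar> \<le> (x\<^sup>2 / 2 + 1 / 10) / T"
        by (rule quadrant_log) (rule that)
      have op: "open {s. 0 < Re s \<and> 0 < Im s}"
        unfolding Collect_conj_eq by (intro open_Int open_halfspace_Re_gt open_halfspace_Im_gt)
      have "logint L (1 - cnj (Complex (1 / 2) T)) (1 - cnj (Complex x T)) = cnj (logint L (Complex (1 / 2) T) (Complex x T) + (p (Complex x T) - p (Complex (1 / 2) T)))"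
      proof (rule logint_reflect[OF L_holomorphic_UNIV _ op _ p(1,2)])
        show "L (1 - cnj z) \<noteq> 0" if "z \<in> closed_segment (Complex (1 / 2) T) (Complex x T)" for z
          using that unfolding seg' by (intro nz) auto
        show "closed_segment (Complex (1 / 2) T) (Complex x T) \<subseteq> {s. 0 < Re s \<and> 0 < Im s}"
          unfolding seg' using T x by (auto simp: closed_segment_eq_real_ivl)
      qed
      moreover have "1 - cnj (Complex (1 / 2) T) = Complex (1 / 2) T" "1 - cnj (Complex x T) = Complex (1 - x) T" by (auto simp: complex_eq_iff)
      moreover have "1 - x \<in> {1 - c..c}" "x \<in> {1 - c..c}" using x c by auto
      ultimately have "g (Complex (1 - x) T) - g (Complex (1 / 2) T) = cnj (g (Complex x T) - g (Complex (1 / 2) T) + (p (Complex x T) - p (Complex (1 / 2) T)))"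
        using half by (simp add: li)
      from arg_cong[OF this, of Im] have "b (1 - x) + b x - 2 * b (1 / 2) = - Im (p (Complex x T) - p (Complex (1 / 2) T))"
        by (simp add: b_def)
      also have "\<bar>\<dots>\<bar> \<le> (x\<^sup>2 / 2 + 1 / 10) / T" using p(3)[OF T, of x] x c d by simp
      also have "\<dots> \<le> (c\<^sup>2 / 2 + 1 / 10) / T" using x T by (intro divide_right_mono) (auto intro!: power_mono)
      finally show ?thesis .
    qed
    show "f (of_real c) \<noteq> 0" unfolding fr by (rule nz) simp
  qed (use assms hol in auto)
  moreover have "logint L (Complex (1 / 2) T) (Complex c T) = g (Complex c T) - g (Complex (1 / 2) T)" by (rule li[OF half])
  ultimately show ?thesis by (simp add: fr b_def abs_minus_commute)
qed

end

section \<open>Explicit constants\<close>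

lemma ln_zeta_real_le: "r > 1 \<Longrightarrow> ln (zeta_real r) \<le> ln (r / (r - 1))"
  using suminf_powr_le[of r] zeta_real_ge_1[of r] by (simp add: zeta_real_def)

lemma exp_one_bounds: "2718 / 1000 \<le> exp (1 :: real)" "exp (1 :: real) \<le> 27183 / 10000"
  using e_approx_32 by (simp_all add: abs_if split: if_split_asm)

text \<open>Exponentials and logarithms of rationals are compared through integer powers of
  \<open>exp 1\<close>, so that every numerical condition becomes an inequality between
  rationals.\<close>

lemma exp_quot_power: "q > 0 \<Longrightarrow> exp (real p / real q) ^ q = exp 1 ^ p"
  unfolding exp_of_nat_mult[symmetric] by simp

lemma exp_quot_le:
  assumes "(27183 / 10000) ^ p \<le> x ^ q" "0 \<le> x" "q > 0"
  shows "exp (real p / real q) \<le> x"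
proof -
  have "exp (real p / real q) ^ q \<le> (27183 / 10000) ^ p"
    unfolding exp_quot_power[OF assms(3)] using exp_one_bounds(2) by (intro power_mono) auto
  hence "exp (real p / real q) ^ q \<le> x ^ q" using assms(1) by (rule order.trans)
  thus ?thesis using assms(2,3) power_mono_iff[of "exp (real p / real q)" x q] by simp
qed

lemma le_exp_quot:
  assumes "x ^ q \<le> (2718 / 1000) ^ p" "0 \<le> x" "q > 0"
  shows "x \<le> exp (real p / real q)"
proof -
  have "x ^ q \<le> exp (real p / real q) ^ q"
    unfolding exp_quot_power[OF assms(3)] by (rule order.trans[OF assms(1)]) (intro power_mono exp_one_bounds, simp)
  thus ?thesis using assms(2,3) power_mono_iff[of x "exp (real p / real q)" q] by simp
qed

lemma ln_le_quot:
  assumes "x > 0" "q > 0" "x ^ q \<le> (2718 / 1000) ^ p"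
  shows "ln x \<le> real p / real q"
proof -
  have "x \<le> exp (real p / real q)" by (rule le_exp_quot) (use assms in auto)
  hence "ln x \<le> ln (exp (real p / real q))" using assms(1) by (intro ln_mono) auto
  thus ?thesis by simp
qed

lemma quot_le_ln:
  assumes "x > 0" "q > 0" "(27183 / 10000) ^ p \<le> x ^ q"
  shows "real p / real q \<le> ln x"
proof -
  have "exp (real p / real q) \<le> x" by (rule exp_quot_le) (use assms in auto)
  hence "ln (exp (real p / real q)) \<le> ln x" by (intro ln_mono) auto
  thus ?thesis by simp
qed

lemma cos_ge_Maclaurin: "1 - x\<^sup>2 / 2 + x ^ 4 / 24 - x ^ 6 / 720 \<le> cos (x :: real)"
proof -
  obtain t where "cos x = (\<Sum>m<6. cos_coeff m * x ^ m) + (cos (t + 1 / 2 * real 6 * pi) / fact 6) * x ^ 6"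
    using Maclaurin_cos_expansion[of x 6] by blast
  moreover have "(\<Sum>m<6. cos_coeff m * x ^ m) = 1 - x\<^sup>2 / 2 + x ^ 4 / 24"
  proof -
    have "{..<6} = {0, 1, 2, 3, 4, 5 :: nat}" by auto
    thus ?thesis by (simp add: cos_coeff_def fact_numeral)
  qed
  moreover have "(cos (t + 1 / 2 * real 6 * pi) / fact 6) * x ^ 6 \<ge> (- 1 / 720) * x ^ 6"
    by (intro mult_right_mono) (auto simp: fact_numeral)
  ultimately show ?thesis by linarith
qed

text \<open>Reduces the condition on \<open>G\<close> to rationals. The first angle is bounded by
  \<open>X\<close>; the second, which is close to \<open>pi\<close> for the chosen parameters, is
  written as \<open>pi - y\<close> and \<open>y\<close> bounded by \<open>Y\<close>. The number
  \<open>9 / 5\<close> is \<open>1 + 4 * d\<close> for \<open>d = 1 / 5\<close>.\<close>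

lemma jensen_ratio:
  assumes W: "W > 0" and c: "1 < c"
    and X: "X = 31416 / 10000 * (2 * c - 1) / (2 * W)" "X \<le> 3"
    and Y: "31416 / 10000 * \<bar>1 - (2 * c + 9 / 5) / (2 * W)\<bar> \<le> Y" "Y \<le> 3"
    and G: "exp G \<le> x" "x * (X\<^sup>2 / 2 - X ^ 4 / 24 + X ^ 6 / 720) \<le> 2 - Y\<^sup>2 / 2 + Y ^ 4 / 24 - Y ^ 6 / 720" "0 \<le> x"
  shows "1 - cos (pi / (2 * W) * (2 * c - 1)) \<le> exp (- G) * (1 - cos (pi / (2 * W) * (2 * c + 9 / 5)))"
proof -
  have pi: "pi \<le> 31416 / 10000" using pi_approx by simp
  have "pi * ((2 * c - 1) / (2 * W)) \<le> 31416 / 10000 * ((2 * c - 1) / (2 * W))" using W c by (intro mult_right_mono[OF pi]) auto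
  hence "pi / (2 * W) * (2 * c - 1) \<le> X" unfolding X by simp
  moreover have "0 \<le> pi / (2 * W) * (2 * c - 1)" using W c by simp
  ultimately have "cos X \<le> cos (pi / (2 * W) * (2 * c - 1))" using X(2) pi_gt3 by (intro cos_monotone_0_pi_le) auto
  hence n: "1 - cos (pi / (2 * W) * (2 * c - 1)) \<le> X\<^sup>2 / 2 - X ^ 4 / 24 + X ^ 6 / 720" using cos_ge_Maclaurin[of X] by linarith
  define y where "y = pi * (1 - (2 * c + 9 / 5) / (2 * W))"
  have "\<bar>y\<bar> = pi * \<bar>1 - (2 * c + 9 / 5) / (2 * W)\<bar>" by (simp add: y_def abs_mult)
  also have "\<dots> \<le> 31416 / 10000 * \<bar>1 - (2 * c + 9 / 5) / (2 * W)\<bar>" by (rule mult_right_mono[OF pi]) simp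
  also have "\<dots> \<le> Y" by (rule Y(1))
  finally have "cos Y \<le> cos \<bar>y\<bar>" using Y(2) pi_gt3 by (intro cos_monotone_0_pi_le) auto
  hence "1 - Y\<^sup>2 / 2 + Y ^ 4 / 24 - Y ^ 6 / 720 \<le> cos y" using cos_ge_Maclaurin[of Y] by simp
  moreover have "pi / (2 * W) * (2 * c + 9 / 5) = pi - y" using W by (simp add: y_def field_simps)
  ultimately have m: "2 - Y\<^sup>2 / 2 + Y ^ 4 / 24 - Y ^ 6 / 720 \<le> 1 - cos (pi / (2 * W) * (2 * c + 9 / 5))" by simp
  have "exp G * (1 - cos (pi / (2 * W) * (2 * c - 1))) \<le> x * (X\<^sup>2 / 2 - X ^ 4 / 24 + X ^ 6 / 720)"
    using G n by (intro mult_mono) auto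
  also have "\<dots> \<le> 1 - cos (pi / (2 * W) * (2 * c + 9 / 5))" using G m by linarith
  finally show ?thesis by (simp add: exp_minus field_simps)
qed

text \<open>Cauchy--Schwarz by Lagrange's identity: the square added in the first step completes the
  product of the two norms.\<close>

lemma linear_comb_le_norm:
  fixes z :: complex and u v S :: real
  assumes "u\<^sup>2 + v\<^sup>2 \<le> S\<^sup>2" "S \<ge> 0"
  shows "u * Re z + v * Im z \<le> S * norm z"
proof -
  have "(u * Re z + v * Im z)\<^sup>2 \<le> (u * Re z + v * Im z)\<^sup>2 + (u * Im z - v * Re z)\<^sup>2" by simp
  also have "\<dots> = (u\<^sup>2 + v\<^sup>2) * (norm z)\<^sup>2" 

    unfolding cmod_power2 by (simp add: power2_eq_square algebra_simps)
  also have "\<dots> \<le> S\<^sup>2 * (norm z)\<^sup>2" by (rule mult_right_mono[OF assms(1)]) simp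
  also have "\<dots> = (S * norm z)\<^sup>2" by (rule power_mult_distrib[symmetric])
  finally show ?thesis by (rule power2_le_imp_le) (use assms in simp)
qed

lemma abs_comb_le_norm:
  fixes z :: complex and u v S :: real
  assumes "u\<^sup>2 + v\<^sup>2 \<le> S\<^sup>2" "S \<ge> 0"
  shows "- (u * Re z) + v * \<bar>Im z\<bar> \<le> S * norm z"
proof (cases "Im z \<ge> 0")
  case True
  thus ?thesis using linear_comb_le_norm[of "- u" v S z] assms by simp
next
  case False
  thus ?thesis using linear_comb_le_norm[of "- u" "- v" S z] assms by simp
qed

section \<open>The final estimate for given parameters\<close>

context prim_char
begin

text \<open>The fixed choices are \<open>d = 1 / 5\<close> and \<open>lam = 2\<close>. They give
  \<open>7 / 5 = 2 * (1 / 2 + d)\<close> and \<open>21 / 100 = 1 / 4 - d^2\<close>. The number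
  \<open>31 / 60\<close> is \<open>9 / 5 - 7 / 10 * 11 / 6\<close>, from the bounds 9/5 for
  \<open>ln (zeta_real (6 / 5))\<close> and 11/6 for \<open>ln (2 * pi)\<close>; and
  \<open>203 / 2000\<close> exceeds the square of \<open>1 / pi\<close>.\<close>

lemma main_bound:
  fixes T T0 B c G S zB zc C1 C2 l0 :: real
  defines "w \<equiv> (B - c) / (B + 1 / 5)"
  assumes T: "T \<ge> T0" "T0 \<ge> 1" and gen: "\<And>s. 0 < Re s \<Longrightarrow> Re s < 1 \<Longrightarrow> \<bar>Im s\<bar> = T \<Longrightarrow> L s \<noteq> 0"
    and c: "1 < c" "c < 6 / 5" "c < B"
    and G: "G > 0" "1 - cos (pi / (2 * (B + 1 / 5)) * (2 * c - 1)) \<le> exp (- G) * (1 - cos (pi / (2 * (B + 1 / 5)) * (2 * c + 9 / 5)))"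
    and z: "ln (B / (B - 1)) \<le> zB" "ln (c / (c - 1)) \<le> zc"
    and S: "1 / G\<^sup>2 + 203 / 2000 \<le> S\<^sup>2" "S \<ge> 0"
    and l0: "l0 \<le> ln (k * T)" and C1: "7 / 5 * w / G \<le> C1"
    and C2: "2 / G * (w * (31 / 60 + 7 / 10 * (1 / (8 * T0) + 1) / T0 + 21 / 100 / (4 * T0)) + (c + 1 / 5) / (B + 1 / 5) * zB
        + (c + 1 / 5) * (B - c) / (4 * T0)) + 2 * S * zc + 2 * (c\<^sup>2 / 2 + 1 / 10) / (314 / 100 * T0) + 1 / 4 + 1 / (8 * (314 / 100) * T0)
      \<le> (C1 - 7 / 5 * w / G) * l0 + C2"
  shows "\<bar>N_zeros T chi - T / pi * ln (k * T / (2 * pi * exp 1))\<bar> \<le> C1 * ln (k * T) + C2"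
proof -
  \<comment> \<open>The side at height \<open>- T\<close> is the conjugate of the side at height
    \<open>T\<close> for the conjugate character, which also has the logarithm \<open>lm\<close> at
    its end.\<close>
  interpret bar: prim_char k chi_bar by (rule prim_char_bar)
  have T1: "T \<ge> 1" "T0 > 0" using T by auto
  have nz: "L z \<noteq> 0" if "\<bar>Im z\<bar> = T" for z
    using L_nonzero[of z] L_zero_left[of z] gen[of z] that T1 by (cases "Re z \<ge> 1"; cases "Re z \<le> 0") auto
  have nzb: "Lb z \<noteq> 0" if "Im z = T" for z using nz[of "cnj z"] that T1 by (simp add: Lb_eq)
  define q where "q = (\<lambda>t :: real. 7 / 10 * (1 / (8 * t) + 1) / t + 21 / 100 / (4 * t))"
  define A where "A = (1 / 2 + 1 / 5) * (ln (k * T / (2 * pi)) + (1 / (8 * T) + 2 / 2) / T) + (1 / 4 - (1 / 5)\<^sup>2) / (2 * 2 * T) + ln (zeta_real (1 + 1 / 5))"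
  define M where "M = (A * (B - c) + ln (zeta_real B) * (c + 1 / 5)) / (B + 1 / 5) + 1 / (2 * 2 * T) * ((c + 1 / 5) * (B - c))"
  define E where "E = (c\<^sup>2 / 2 + 1 / 10) / T"
  have "2 * c + 1 + 4 * (1 / 5) = 2 * c + 9 / 5" by simp
  hence G2: "1 - cos (pi / (2 * (B + 1 / 5)) * (2 * c - 1)) \<le> exp (- G) * (1 - cos (pi / (2 * (B + 1 / 5)) * (2 * c + 1 + 4 * (1 / 5))))"
    using G(2) by (simp only:)
  have lb: "\<bar>Im (logint L (Complex (1 / 2) T) (Complex c T))\<bar> \<le> E + pi / G * (M - ln (norm (L (Complex c T))))"
    unfolding E_def M_def A_def by (rule logint_bound[OF _ _ _ _ _ _ _ _ G(1) G2]) (use T1 nz c in auto)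
  have lbb: "\<bar>Im (logint Lb (Complex (1 / 2) T) (Complex c T))\<bar> \<le> E + pi / G * (M - ln (norm (Lb (Complex c T))))"
    unfolding E_def M_def A_def by (rule bar.logint_bound[OF _ _ _ _ _ _ _ _ G(1) G2]) (use T1 nzb c in auto)
  define lp lm :: complex where "lp = cm.log_ser (Complex c T)" and "lm = cm.log_ser (Complex c (- T))"
  have lnL: "ln (norm (L (Complex c T))) = Re lp" using c by (simp add: L_eq_exp lp_def)
  have lnLb: "ln (norm (Lb (Complex c T))) = Re lm"
  proof -
    have "cnj (Complex c T) = Complex c (- T)" by (simp add: complex_eq_iff)
    thus ?thesis using c by (simp add: Lb_eq L_eq_exp lm_def)
  qed
  have neg: "\<bar>Im (logint L (Complex (1 / 2) (- T)) (Complex c (- T)))\<bar> = \<bar>Im (logint Lb (Complex (1 / 2) T) (Complex c T))\<bar>"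
  proof -
    have "(\<lambda>z. cnj (Lb (cnj z))) = L" by (simp add: Lb_eq fun_eq_iff)
    moreover have "logint (\<lambda>z. cnj (Lb (cnj z))) (cnj (Complex (1 / 2) T)) (cnj (Complex c T)) = cnj (logint Lb (Complex (1 / 2) T) (Complex c T))"
    proof (rule logint_cnj[OF bar.L_holomorphic_UNIV])
      fix z assume "z \<in> closed_segment (Complex (1 / 2) T) (Complex c T)"
      hence "Im z = T" by (subst (asm) closed_segment_same_Im) auto
      thus "Lb z \<noteq> 0" by (rule nzb)
    qed
    moreover have "cnj (Complex x T) = Complex x (- T)" for x by (simp add: complex_eq_iff)
    ultimately show ?thesis by simp
  qed
  have zc0: "ln (zeta_real c) \<le> zc" using ln_zeta_real_le[of c] c z by linarith
  have nl: "norm lp \<le> zc" "norm lm \<le> zc"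
    using cm.norm_log_ser[of "Complex c T"] cm.norm_log_ser[of "Complex c (- T)"] c zc0 by (auto simp: lp_def lm_def)
  have Sp: "(1 / G)\<^sup>2 + (1 / pi)\<^sup>2 \<le> S\<^sup>2"
  proof -
    have "(314 / 100)\<^sup>2 \<le> pi\<^sup>2" using pi_approx by (intro power_mono) auto
    hence "1 / pi\<^sup>2 \<le> 1 / (314 / 100)\<^sup>2" by (intro divide_left_mono) auto
    also have "\<dots> \<le> 203 / 2000" by (simp add: power2_eq_square)
    finally show ?thesis using S by (simp add: power_divide)
  qed
  \<comment> \<open>The real part comes from Jensen's inequality at \<open>c\<close>, the imaginary
    part from the vertical side. Both belong to the same logarithm, so they cannot both be as large
    as \<open>zc\<close>; this saves over estimating them separately.\<close>
  have cb: "- (1 / G * Re l) + 1 / pi * \<bar>Im l\<bar> \<le> S * zc" if "norm l \<le> zc" for l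
    using abs_comb_le_norm[OF Sp S(2), of l] mult_left_mono[OF that S(2)] by linarith
  define N where "N = \<bar>N_zeros T chi - T / pi * ln (k * T / (2 * pi * exp 1))\<bar>"
  have "N \<le> (\<bar>Im (logint L (Complex (1 / 2) T) (Complex c T))\<bar> + \<bar>Im (logint L (Complex (1 / 2) (- T)) (Complex c (- T)))\<bar>
      + \<bar>Im lp\<bar> + \<bar>Im lm\<bar>) / pi + 1 / 4 + 1 / (8 * pi * T)"
    unfolding N_def lp_def lm_def by (rule zero_count) (use T1 gen c in auto)
  also have "\<dots> \<le> ((E + pi / G * (M - Re lp)) + (E + pi / G * (M - Re lm)) + \<bar>Im lp\<bar> + \<bar>Im lm\<bar>) / pi + 1 / 4 + 1 / (8 * pi * T)"
    unfolding neg using lb lbb unfolding lnL lnLb by (intro add_right_mono divide_right_mono add_mono) auto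
  also have "\<dots> = 2 * E / pi + 2 / G * M + (- (1 / G * Re lp) + 1 / pi * \<bar>Im lp\<bar>) + (- (1 / G * Re lm) + 1 / pi * \<bar>Im lm\<bar>) + 1 / 4 + 1 / (8 * pi * T)"
    using G by (simp add: field_simps)
  also have "\<dots> \<le> 2 * E / pi + 2 / G * M + S * zc + S * zc + 1 / 4 + 1 / (8 * pi * T)"
    by (intro add_mono cb nl order.refl)
  finally have N1: "N \<le> 2 * E / pi + 2 / G * M + S * zc + S * zc + 1 / 4 + 1 / (8 * pi * T)" .
  have W: "B + 1 / 5 > 0" "w \<ge> 0" using c by (auto simp: w_def)
  have E1: "2 * E / pi \<le> 2 * (c\<^sup>2 / 2 + 1 / 10) / (314 / 100 * T0)"
  proof -
    have "2 * E / pi = 2 * (c\<^sup>2 / 2 + 1 / 10) / (pi * T)" using T1 by (simp add: E_def field_simps)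
    also have "\<dots> \<le> 2 * (c\<^sup>2 / 2 + 1 / 10) / (314 / 100 * T0)"
      using T1 T pi_approx by (intro divide_left_mono mult_mono) auto
    finally show ?thesis .
  qed
  have E2: "1 / (8 * pi * T) \<le> 1 / (8 * (314 / 100) * T0)"
    using T1 T pi_approx by (intro divide_left_mono mult_mono) auto
  have Mb: "M \<le> w * (7 / 10 * ln (k * T) + (31 / 60 + q T0)) + (c + 1 / 5) / (B + 1 / 5) * zB + (c + 1 / 5) * (B - c) / (4 * T0)"
  proof -
    have kT: "real k * T > 0" using k_pos T1 by simp
    have "A = 7 / 10 * ln (k * T / (2 * pi)) + (7 / 10 * ((1 / (8 * T) + 2 / 2) / T) + (1 / 4 - (1 / 5)\<^sup>2) / (2 * 2 * T)) + ln (zeta_real (1 + 1 / 5))"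
      unfolding A_def by (simp add: distrib_left)
    moreover have "ln (k * T / (2 * pi)) = ln (k * T) - ln (2 * pi)" by (rule ln_divide_pos[OF kT]) simp
    moreover have "11 / 6 \<le> ln (2 * pi)"
    proof -
      have "real 11 / real 6 \<le> ln (628 / 100)" by (rule quot_le_ln) (simp_all add: power_divide)
      also have "\<dots> \<le> ln (2 * pi)" using pi_approx by simp
      finally show ?thesis by simp
    qed
    moreover have "ln (zeta_real (1 + 1 / 5)) \<le> 9 / 5"
    proof -
      have "ln (zeta_real (1 + 1 / 5)) \<le> ln 6" using ln_zeta_real_le[of "1 + 1 / 5"] by simp
      also have "ln 6 \<le> real 9 / real 5" by (rule ln_le_quot) (simp_all add: power_divide)
      finally show ?thesis by simp
    qed
    moreover have "7 / 10 * ((1 / (8 * T) + 2 / 2) / T) + (1 / 4 - (1 / 5)\<^sup>2) / (2 * 2 * T) = q T"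
      by (simp add: q_def power2_eq_square)
    moreover have "q T \<le> q T0"
    proof -
      have q: "q t = 7 / 10 * ((1 / 8 * (1 / t) + 1) * (1 / t)) + 21 / 400 * (1 / t)" for t by (simp add: q_def)
      have "1 / T \<le> 1 / T0" using T T1 by (intro divide_left_mono) auto
      thus ?thesis unfolding q using T1 by (intro add_mono mult_mono) auto
    qed
    ultimately have "A \<le> 7 / 10 * ln (k * T) + (31 / 60 + q T0)" by linarith
    hence "w * A \<le> w * (7 / 10 * ln (k * T) + (31 / 60 + q T0))" using W by (intro mult_left_mono) auto
    moreover have "(c + 1 / 5) / (B + 1 / 5) * ln (zeta_real B) \<le> (c + 1 / 5) / (B + 1 / 5) * zB"
      using ln_zeta_real_le[of B] c z by (intro mult_left_mono) auto
    moreover have "(c + 1 / 5) * (B - c) / (4 * T) \<le> (c + 1 / 5) * (B - c) / (4 * T0)"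
      using T T1 c by (intro divide_left_mono) auto
    moreover have "M = w * A + (c + 1 / 5) / (B + 1 / 5) * ln (zeta_real B) + (c + 1 / 5) * (B - c) / (4 * T)"
      unfolding M_def w_def add_divide_distrib[of "A * (B - c)"] by (simp add: mult_ac)
    ultimately show ?thesis by linarith
  qed
  define R where "R = w * (31 / 60 + q T0) + (c + 1 / 5) / (B + 1 / 5) * zB + (c + 1 / 5) * (B - c) / (4 * T0)"
  have "2 / G * M \<le> 2 / G * (7 / 10 * w * ln (k * T) + R)"
    using Mb G by (intro mult_left_mono) (auto simp: R_def algebra_simps)
  also have "\<dots> = 7 / 5 * w / G * ln (k * T) + 2 / G * R"
    unfolding distrib_left by simp
  finally have "N \<le> 7 / 5 * w / G * ln (k * T) + (2 / G * R + 2 * S * zc + 2 * (c\<^sup>2 / 2 + 1 / 10) / (314 / 100 * T0) + 1 / 4 + 1 / (8 * (314 / 100) * T0))"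
    using N1 E1 E2 by linarith
  also have "2 / G * R + 2 * S * zc + 2 * (c\<^sup>2 / 2 + 1 / 10) / (314 / 100 * T0) + 1 / 4 + 1 / (8 * (314 / 100) * T0) \<le> (C1 - 7 / 5 * w / G) * l0 + C2"
    using C2 unfolding R_def q_def by (simp only: add.assoc)
  also have "(C1 - 7 / 5 * w / G) * l0 \<le> (C1 - 7 / 5 * w / G) * ln (k * T)" using l0 C1 by (intro mult_left_mono) auto
  finally show ?thesis unfolding N_def by (simp add: algebra_simps)
qed

text \<open>The zeros up to height \<open>T + 1\<close> are finitely many, so there is a gap
  directly above \<open>T\<close>.\<close>

lemma generic_right:
  fixes T :: real
  obtains \<delta> where "\<delta> > 0"
    "\<And>T' s. T < T' \<Longrightarrow> T' < T + \<delta> \<Longrightarrow> 0 < Re s \<Longrightarrow> Re s < 1 \<Longrightarrow> \<bar>Im s\<bar> = T' \<Longrightarrow> L s \<noteq> 0"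
    "\<And>T'. T < T' \<Longrightarrow> T' < T + \<delta> \<Longrightarrow> N_zeros T' chi = N_zeros T chi"
proof -
  define Z where "Z = {z. L z = 0 \<and> 0 < Re z \<and> Re z < 1 \<and> \<bar>Im z\<bar> \<le> T + 1}"
  have fin: "finite Z" unfolding Z_def by (rule zeros_finite)
  define D where "D = insert 1 ((\<lambda>z. \<bar>Im z\<bar> - T) ` {z \<in> Z. \<bar>Im z\<bar> > T})"
  have D: "finite D" "D \<noteq> {}" using fin by (auto simp: D_def)
  have pos: "Min D > 0" using D by (subst Min_gr_iff) (auto simp: D_def)
  have le1: "Min D \<le> 1" using D by (intro Min_le) (auto simp: D_def)
  have no: "L z \<noteq> 0" if "0 < Re z" "Re z < 1" "T < \<bar>Im z\<bar>" "\<bar>Im z\<bar> < T + Min D" for z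
  proof
    assume "L z = 0"
    hence "\<bar>Im z\<bar> - T \<in> D" using that le1 by (auto simp: D_def Z_def)
    hence "Min D \<le> \<bar>Im z\<bar> - T" using D by (intro Min_le)
    thus False using that by simp
  qed
  show thesis
  proof (rule that[of "Min D"])
    show "L s \<noteq> 0" if "T < T'" "T' < T + Min D" "0 < Re s" "Re s < 1" "\<bar>Im s\<bar> = T'" for T' s
      using no[of s] that by auto
    show "N_zeros T' chi = N_zeros T chi" if "T < T'" "T' < T + Min D" for T'
    proof -
      have "\<bar>Im z\<bar> \<le> T" if "L z = 0" "0 < Re z" "Re z < 1" "\<bar>Im z\<bar> \<le> T'" for z
        using no[of z] that \<open>T' < T + Min D\<close> by (cases "\<bar>Im z\<bar> \<le> T") auto
      hence "{\<rho>. L \<rho> = 0 \<and> 0 < Re \<rho> \<and> Re \<rho> < 1 \<and> \<bar>Im \<rho>\<bar> \<le> T'} = {\<rho>. L \<rho> = 0 \<and> 0 < Re \<rho> \<and> Re \<rho> < 1 \<and> \<bar>Im \<rho>\<bar> \<le> T}"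
        using \<open>T < T'\<close> by (auto intro: order.trans)
      thus ?thesis unfolding N_zeros_def by simp
    qed
  qed (rule pos)
qed

text \<open>The contour argument needs a height without zeros. Heights just above \<open>T\<close>
  qualify and have the same count, and the bound passes to \<open>T\<close> by continuity of all
  other terms.\<close>

lemma explicit_bound:
  fixes T T0 B c S C1 C2 l0 x X Y :: real and p q pB qB pc qc :: nat
  assumes T: "T \<ge> T0" "T0 \<ge> 1"
    and c: "1 < c" "c < 6 / 5" "c < B"
    and X: "X = 31416 / 10000 * (2 * c - 1) / (2 * (B + 1 / 5))" "X \<le> 3"
    and Y: "31416 / 10000 * \<bar>1 - (2 * c + 9 / 5) / (2 * (B + 1 / 5))\<bar> \<le> Y" "Y \<le> 3"
    and x: "(27183 / 10000) ^ p \<le> x ^ q" "x * (X\<^sup>2 / 2 - X ^ 4 / 24 + X ^ 6 / 720) \<le> 2 - Y\<^sup>2 / 2 + Y ^ 4 / 24 - Y ^ 6 / 720" "0 \<le> x" "p > 0" "q > 0"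
    and zB: "(B / (B - 1)) ^ qB \<le> (2718 / 1000) ^ pB" "qB > 0"
    and zc: "(c / (c - 1)) ^ qc \<le> (2718 / 1000) ^ pc" "qc > 0"
    and S: "1 / (p / q)\<^sup>2 + 203 / 2000 \<le> S\<^sup>2" "S \<ge> 0"
    and l0: "l0 \<le> ln (3 * T0)" and C1: "7 / 5 * ((B - c) / (B + 1 / 5)) / (p / q) \<le> C1"
    and C2: "2 / (p / q) * ((B - c) / (B + 1 / 5) * (31 / 60 + 7 / 10 * (1 / (8 * T0) + 1) / T0 + 21 / 100 / (4 * T0)) + (c + 1 / 5) / (B + 1 / 5) * (pB / qB)
        + (c + 1 / 5) * (B - c) / (4 * T0)) + 2 * S * (pc / qc) + 2 * (c\<^sup>2 / 2 + 1 / 10) / (314 / 100 * T0) + 1 / 4 + 1 / (8 * (314 / 100) * T0)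
      \<le> (C1 - 7 / 5 * ((B - c) / (B + 1 / 5)) / (p / q)) * l0 + C2"
  shows "\<bar>N_zeros T chi - T / pi * ln (k * T / (2 * pi * exp 1))\<bar> \<le> C1 * ln (k * T) + C2"
proof -
  have G: "1 - cos (pi / (2 * (B + 1 / 5)) * (2 * c - 1)) \<le> exp (- (p / q)) * (1 - cos (pi / (2 * (B + 1 / 5)) * (2 * c + 9 / 5)))"
    by (rule jensen_ratio[OF _ c(1) X Y exp_quot_le[OF x(1,3,5)] x(2,3)]) (use c in simp)
  have z: "ln (B / (B - 1)) \<le> pB / qB" "ln (c / (c - 1)) \<le> pc / qc"
    by (rule ln_le_quot; use c zB zc in simp)+
  have gen: "\<bar>N_zeros T' chi - T' / pi * ln (k * T' / (2 * pi * exp 1))\<bar> \<le> C1 * ln (k * T') + C2"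
    if T': "T' \<ge> T0" and nz: "\<And>s. 0 < Re s \<Longrightarrow> Re s < 1 \<Longrightarrow> \<bar>Im s\<bar> = T' \<Longrightarrow> L s \<noteq> 0" for T' :: real
  proof (rule main_bound[OF T' T(2) nz c _ G z S _ C1 C2])
    have "3 * T0 \<le> k * T'" using k_ge_3 T' T by (intro mult_mono) auto
    hence "ln (3 * T0) \<le> ln (k * T')" using T by (intro ln_mono) auto
    thus "l0 \<le> ln (k * T')" using l0 by (rule order.trans[rotated])
  qed (use x in auto)
  obtain \<delta> where d: "\<delta> > 0"
    "\<And>T' s. T < T' \<Longrightarrow> T' < T + \<delta> \<Longrightarrow> 0 < Re s \<Longrightarrow> Re s < 1 \<Longrightarrow> \<bar>Im s\<bar> = T' \<Longrightarrow> L s \<noteq> 0"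
    "\<And>T'. T < T' \<Longrightarrow> T' < T + \<delta> \<Longrightarrow> N_zeros T' chi = N_zeros T chi"
    by (rule generic_right) (rule that)
  define F where "F = (\<lambda>T' :: real. C1 * ln (k * T') + C2 - \<bar>N_zeros T chi - T' / pi * ln (k * T' / (2 * pi * exp 1))\<bar>)"
  have kT: "real k * T > 0" "real k * T / (2 * pi * exp 1) > 0" using k_pos T by simp_all
  have "isCont F T"
    unfolding F_def using kT k_pos T by (intro continuous_intros) auto
  hence "(F \<longlongrightarrow> F T) (at_right T)" using isContD tendsto_within_subset[OF _ subset_UNIV] by blast
  moreover have "\<forall>\<^sub>F T' in at_right T. 0 \<le> F T'"
  proof (subst eventually_at_right[of T "T + \<delta>"])
    show "T < T + \<delta>" using d by simp
    show "\<exists>b>T. \<forall>y>T. y < b \<longrightarrow> 0 \<le> F y"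
    proof (intro exI[of _ "T + \<delta>"] conjI allI impI)
      fix y assume y: "T < y" "y < T + \<delta>"
      show "0 \<le> F y" using gen[of y] d(2)[OF y] d(3)[OF y] y T by (simp add: F_def)
    qed (use d in simp)
  qed
  ultimately have "0 \<le> F T" by (rule tendsto_lowerbound) simp
  thus ?thesis by (simp add: F_def)
qed


end

text \<open>The least values of \<open>ln (k * T)\<close> for \<open>k \<ge> 3\<close> and
  \<open>T \<ge> 1\<close> or \<open>T \<ge> 10\<close>. Multiplied by the excess of
  \<open>C1\<close> over the coefficient obtained, they count towards the additive constant.\<close>

lemma ln_3_30: "1 \<le> ln (3 * 1 :: real)" "10 / 3 \<le> ln (3 * 10 :: real)"
proof -
  have "real 1 / real 1 \<le> ln (3 :: real)" by (rule quot_le_ln) simp_all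
  thus "1 \<le> ln (3 * 1 :: real)" by simp
  have "real 10 / real 3 \<le> ln (30 :: real)" by (rule quot_le_ln) (simp_all add: power_divide)
  thus "10 / 3 \<le> ln (3 * 10 :: real)" by simp
qed

text \<open>The part of the bound that is not proportional to \<open>ln (k * T)\<close>, taken at
  the least admissible height \<open>t\<close>. \<open>zB\<close> and \<open>zc\<close> stand for
  the logarithms of the bounds for zeta at \<open>B\<close> and \<open>c\<close>.\<close>

definition bound_const :: "real \<Rightarrow> real \<Rightarrow> real \<Rightarrow> real \<Rightarrow> real \<Rightarrow> real \<Rightarrow> real \<Rightarrow> real" where
  "bound_const B c G zB zc S t = 2 / G * ((B - c) / (B + 1 / 5) * (31 / 60 + 7 / 10 * (1 / (8 * t) + 1) / t + 21 / 100 / (4 * t)) + (c + 1 / 5) / (B + 1 / 5) * zB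
        + (c + 1 / 5) * (B - c) / (4 * t)) + 2 * S * zc + 2 * (c\<^sup>2 / 2 + 1 / 10) / (314 / 100 * t) + 1 / 4 + 1 / (8 * (314 / 100) * t)"

context prim_char
begin

abbreviation zero_bound :: "real \<Rightarrow> real \<Rightarrow> real \<Rightarrow> bool" where
  "zero_bound T C1 C2 \<equiv> \<bar>N_zeros T chi - T / pi * ln (real k * T / (2 * pi * exp 1))\<bar> \<le> C1 * ln (real k * T) + C2"

text \<open>Here \<open>p / q\<close> is the constant \<open>G\<close> of the strip lemma, and \<open>X\<close>, \<open>Y\<close> bound the angles
  \<open>pi * (2 * c - 1) / (2 * (B + 1 / 5))\<close> and \<open>pi - pi * (2 * c + 9 / 5) / (2 * (B + 1 / 5))\<close>.  All conditions are inequalities between rationals.\<close>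
lemma explicit_bounds:
  fixes T B c S C1 C2 C2' x X Y :: real and p q pB qB pc qc :: nat
  assumes c: "1 < c" "c < 6 / 5" "c < B"
    and X: "X = 31416 / 10000 * (2 * c - 1) / (2 * (B + 1 / 5))" "X \<le> 3"
    and Y: "31416 / 10000 * \<bar>1 - (2 * c + 9 / 5) / (2 * (B + 1 / 5))\<bar> \<le> Y" "Y \<le> 3"
    and x: "(27183 / 10000) ^ p \<le> x ^ q" "x * (X\<^sup>2 / 2 - X ^ 4 / 24 + X ^ 6 / 720) \<le> 2 - Y\<^sup>2 / 2 + Y ^ 4 / 24 - Y ^ 6 / 720" "0 \<le> x" "p > 0" "q > 0"
    and zB: "(B / (B - 1)) ^ qB \<le> (2718 / 1000) ^ pB" "qB > 0"
    and zc: "(c / (c - 1)) ^ qc \<le> (2718 / 1000) ^ pc" "qc > 0"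
    and S: "1 / (p / q)\<^sup>2 + 203 / 2000 \<le> S\<^sup>2" "S \<ge> 0"
    and C1: "7 / 5 * ((B - c) / (B + 1 / 5)) / (p / q) \<le> C1"
    and C2: "bound_const B c (p / q) (pB / qB) (pc / qc) S 1 \<le> (C1 - 7 / 5 * ((B - c) / (B + 1 / 5)) / (p / q)) * 1 + C2"
      "bound_const B c (p / q) (pB / qB) (pc / qc) S 10 \<le> (C1 - 7 / 5 * ((B - c) / (B + 1 / 5)) / (p / q)) * (10 / 3) + C2'"
  shows "T \<ge> 1 \<Longrightarrow> zero_bound T C1 C2" "T \<ge> 10 \<Longrightarrow> zero_bound T C1 C2'"
  using explicit_bound[OF _ _ c X Y x zB zc S ln_3_30(1) C1 C2(1)[unfolded bound_const_def], of T]
    explicit_bound[OF _ _ c X Y x zB zc S ln_3_30(2) C1 C2(2)[unfolded bound_const_def], of T] by auto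

text \<open>The parameters come from a numerical search; small exponents keep the rational arithmetic cheap.\<close>
lemma zero_bound_row_1: "T \<ge> 1 \<Longrightarrow> zero_bound T 0.248 9.339" "T \<ge> 10 \<Longrightarrow> zero_bound T 0.248 8.666"
  by (rule explicit_bounds[where ?C2.0 = "9.339" and C2' = "8.666" and B = "341 / 250" and c = "521 / 500" and p = 7 and q = 6 and x = "643 / 200" and X = "62601 / 57500"
        and Y = "19 / 25" and pB = 4 and qB = 3 and pc = 29 and qc = 9 and S = "183 / 200"];
      simp add: power_divide bound_const_def)+

lemma zero_bound_row_2: "T \<ge> 1 \<Longrightarrow> zero_bound T 0.265 8.015" "T \<ge> 10 \<Longrightarrow> zero_bound T 0.265 7.311"
  by (rule explicit_bounds[where ?C2.0 = "8.015" and C2' = "7.311" and B = "293 / 200" and c = "53 / 50" and p = 9 and q = 7 and x = "1817 / 500" and X = "73304 / 69375"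
        and Y = "14 / 25" and pB = 7 and qB = 6 and pc = 23 and qc = 8 and S = "841 / 1000"];
      simp add: power_divide bound_const_def)+

lemma zero_bound_row_3: "T \<ge> 1 \<Longrightarrow> zero_bound T 0.282 7.280" "T \<ge> 10 \<Longrightarrow> zero_bound T 0.282 6.549"
  by (rule explicit_bounds[where ?C2.0 = "7.280" and C2' = "6.549" and B = "157 / 100" and c = "27 / 25" and p = 11 and q = 8 and x = "497 / 125" and X = "37961 / 36875"
        and Y = "19 / 50" and pB = 10 and qB = 9 and pc = 21 and qc = 8 and S = "397 / 500"];
      simp add: power_divide bound_const_def)+

lemma zero_bound_row_4: "T \<ge> 1 \<Longrightarrow> zero_bound T 0.300 6.778" "T \<ge> 10 \<Longrightarrow> zero_bound T 0.300 6.021"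
  by (rule explicit_bounds[where ?C2.0 = "6.778" and C2' = "6.021" and B = "17 / 10" and c = "109 / 100" and p = 3 and q = 2 and x = "4527 / 1000" and X = "231693 / 237500"
        and Y = "3 / 20" and pB = 8 and qB = 9 and pc = 5 and qc = 2 and S = "739 / 1000"];
      simp add: power_divide bound_const_def)+

text \<open>The parameters of row 4 again: their coefficient is just below 0.300, and their constant
  is small enough for this row as well.\<close>

lemma zero_bound_row_5: "T \<ge> 1 \<Longrightarrow> zero_bound T 0.317 6.401" "T \<ge> 10 \<Longrightarrow> zero_bound T 0.317 5.616"
  by (rule explicit_bounds[where ?C2.0 = "6.401" and C2' = "5.616" and B = "17 / 10" and c = "109 / 100" and p = 3 and q = 2 and x = "4527 / 1000" and X = "231693 / 237500"
        and Y = "3 / 20" and pB = 8 and qB = 9 and pc = 5 and qc = 2 and S = "739 / 1000"];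
      simp add: power_divide bound_const_def)+

text \<open>One choice of parameters serves rows 6 to 10. The condition on \<open>C1\<close> is
  tightest here, with a coefficient of about 0.3336; the two conditions on the constants are
  tightest in row 10.\<close>

lemma zero_bound_row_6: "T \<ge> 1 \<Longrightarrow> zero_bound T 0.334 6.101" "T \<ge> 10 \<Longrightarrow> zero_bound T 0.334 5.288"
  by (rule explicit_bounds[where ?C2.0 = "6.101" and C2' = "5.288" and B = "203 / 100" and c = "11 / 10" and p = 7 and q = 4 and x = "5783 / 1000" and X = "23562 / 27875"
        and Y = "33 / 100" and pB = 7 and qB = 10 and pc = 12 and qc = 5 and S = "131 / 200"];
      simp add: power_divide bound_const_def)+

lemma zero_bound_row_7: "T \<ge> 1 \<Longrightarrow> zero_bound T 0.351 5.852" "T \<ge> 10 \<Longrightarrow> zero_bound T 0.351 5.011"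
  by (rule explicit_bounds[where ?C2.0 = "5.852" and C2' = "5.011" and B = "203 / 100" and c = "11 / 10" and p = 7 and q = 4 and x = "5783 / 1000" and X = "23562 / 27875"
        and Y = "33 / 100" and pB = 7 and qB = 10 and pc = 12 and qc = 5 and S = "131 / 200"];
      simp add: power_divide bound_const_def)+

lemma zero_bound_row_8: "T \<ge> 1 \<Longrightarrow> zero_bound T 0.369 5.640" "T \<ge> 10 \<Longrightarrow> zero_bound T 0.369 4.770"
  by (rule explicit_bounds[where ?C2.0 = "5.640" and C2' = "4.770" and B = "203 / 100" and c = "11 / 10" and p = 7 and q = 4 and x = "5783 / 1000" and X = "23562 / 27875"
        and Y = "33 / 100" and pB = 7 and qB = 10 and pc = 12 and qc = 5 and S = "131 / 200"];
      simp add: power_divide bound_const_def)+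

lemma zero_bound_row_9: "T \<ge> 1 \<Longrightarrow> zero_bound T 0.386 5.456" "T \<ge> 10 \<Longrightarrow> zero_bound T 0.386 4.556"
  by (rule explicit_bounds[where ?C2.0 = "5.456" and C2' = "4.556" and B = "203 / 100" and c = "11 / 10" and p = 7 and q = 4 and x = "5783 / 1000" and X = "23562 / 27875"
        and Y = "33 / 100" and pB = 7 and qB = 10 and pc = 12 and qc = 5 and S = "131 / 200"];
      simp add: power_divide bound_const_def)+

lemma zero_bound_row_10: "T \<ge> 1 \<Longrightarrow> zero_bound T 0.403 5.294" "T \<ge> 10 \<Longrightarrow> zero_bound T 0.403 4.363"
  by (rule explicit_bounds[where ?C2.0 = "5.294" and C2' = "4.363" and B = "203 / 100" and c = "11 / 10" and p = 7 and q = 4 and x = "5783 / 1000" and X = "23562 / 27875"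
        and Y = "33 / 100" and pB = 7 and qB = 10 and pc = 12 and qc = 5 and S = "131 / 200"];
      simp add: power_divide bound_const_def)+

end

theorem theorem1:
  fixes k :: nat and chi :: "nat \<Rightarrow> complex"
  assumes "k \<ge> 1"
    and "primitive_char k chi"
    and "\<not> principal_char k chi"
  shows "(\<forall>T::real. T \<ge> 1 \<longrightarrow>
           \<bar>N_zeros T chi - T / pi * ln (real k * T / (2 * pi * exp 1))\<bar>
             \<le> 0.317 * ln (real k * T) + 6.401)
       \<and> (\<forall>(\<eta>, C1, C2, C2') \<in> set zero_count_table.
           (\<forall>T::real. T \<ge> 1 \<longrightarrow>
              \<bar>N_zeros T chi - T / pi * ln (real k * T / (2 * pi * exp 1))\<bar>
                \<le> C1 * ln (real k * T) + C2)
         \<and> (\<forall>T::real. T \<ge> 10 \<longrightarrow>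
              \<bar>N_zeros T chi - T / pi * ln (real k * T / (2 * pi * exp 1))\<bar>
                \<le> C1 * ln (real k * T) + C2'))"
proof -
  interpret prim_char k chi using assms(2,3) by unfold_locales
  show ?thesis
    unfolding zero_count_table_def list.set ball_simps prod.case
    by (intro conjI allI impI TrueI zero_bound_row_1 zero_bound_row_2 zero_bound_row_3 zero_bound_row_4 zero_bound_row_5
          zero_bound_row_6 zero_bound_row_7 zero_bound_row_8 zero_bound_row_9 zero_bound_row_10)
qed

end
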